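(* Let $a>1$ be such that $\mathcal A=\lfloor 1/\ln a\rfloor\ge 8$, and fix $0<\delta<1$. Consider initial data $F_0(x,v)=\tilde\mu(x,v)+f_0(x,v)\ge 0$ on $\Omega\times\mathbb R^3$ such that $$\iint_{\Omega\times\mathbb R^3} f_0(x,v)\,dx\,dv=0,\qquad \big\|e^{\frac12|v|^2+\Phi(x)}f_0\big\|_{L^\infty_{x,v}}<\infty .$$ Then there exists a unique global-in-time solution $F(t,x,v)=\tilde\mu(x,v)+f(t,x,v)\ge 0$ to $$\partial_tF+v\cdot\nabla_xF-\nabla\Phi(x)\cdot\nabla_vF=0\quad\text{in }\mathbb R_+\times\Omega\times\mathbb R^3,$$ $$F(t,x,v)=\mu(x,v)\int_{n(x)\cdot v^1>0}F(t,x,v^1)\{n(x)\cdot v^1\}\,dv^1\quad\text{for }(x,v)\in\gamma_-,$$ with $F|_{t=0}=F_0$ in $\Omega\times\mathbb R^3$, such that $$\iint_{\Omega\times\mathbb R^3}f(t,x,v)\,dx\,dv=0\quad\text{for all }t\ge0.$$ Moreover, for all $t\ge 0$, $$\|f(t)\|_{L^1_{x,v}}\le C\,(\ln\langle t\rangle)^{\mathcal A-6-\frac{\delta}{2}}\,\langle t\rangle^{-(\mathcal A-6)}\;\big\|e^{\frac12|v|^2+\Phi(x)}f_0\big\|_{L^\infty_{x,v}},$$ where (with $a$ and $\delta$ fixed) the constant $C=C(\Omega)$ depends only on the domain $\Omega$; in particular it does not depend on $t$ or $f_0$.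
   Context: $\Omega=\mathbb T^2\times\mathbb R_+=\{x=(x_1,x_2,x_3):(x_1,x_2)\in\mathbb T^2,\ x_3>0\}$, where $\mathbb T^2=\mathbb R^2/\mathbb Z^2$ (so $|\partial\Omega|=1$), $\partial\Omega=\{x_3=0\}$, with outward normal $n(x)=(0,0,-1)$. $\gamma_\pm=\{(x,v)\in\partial\Omega\times\mathbb R^3: n(x)\cdot v\gtrless0\}$; thus $\gamma_-$ corresponds to $v_3>0$. The potential is $\Phi(x)=\log_a(1+x_3)$ and $\lfloor\cdot\rfloor$ is the integer part. The wall Maxwellian is $\mu(x,v)=\frac1{2\pi}e^{-|v|^2/2}$. The stationary solution is $\tilde\mu(x,v)=\frac{c_{\mathfrak m}}{2\pi}e^{-(\frac{|v|^2}{2}+\Phi(x))}$, where $c_{\mathfrak m}>0$ is chosen so that $\iint_{\Omega\times\mathbb R^3}\tilde\mu\,dx\,dv=\mathfrak m$ for a fixed total mass $\mathfrak m>0$. $\|\cdot\|_{L^1_{x,v}}$ is the norm of $L^1(\Omega\times\mathbb R^3)$, $\|\cdot\|_{L^\infty_{x,v}}$ is the norm of $L^\infty(\overline\Omega\times\mathbb R^3)$. Solutions are $L^1$ solutions: the equation holds in the sense of distributions (equivalently, $F$ is constant along the characteristics $\dot X=V$, $\dot V=-\nabla\Phi(X)$ inside $\Omega$) and the boundary condition holds for the traces. $\langle t\rangle:=e+t$. *)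

theory Defs
  imports "HOL-Analysis.Analysis" "HOL-Probability.Essential_Supremum"
begin

(* T^2 = R^2/Z^2 is rendered by its universal cover: a function on T^2 x [0,\<infinity>) is a function of
   x in R^3 that is 1-periodic in x_1 and x_2, and integrals over T^2 are taken over the
   fundamental cell [0,1)^2. *)

definition Omega :: "(real^3) set" where
  "Omega = {x. x $ 3 > 0}"

definition torus_periodic :: "(real^3 \<Rightarrow> real^3 \<Rightarrow> real) \<Rightarrow> bool" where
  "torus_periodic g \<longleftrightarrow>
     (\<forall>x\<in>closure Omega. \<forall>v. g (x + axis 1 1) v = g x v \<and> g (x + axis 2 1) v = g x v)"

definition torus_cell :: "(real^2) set" where
  "torus_cell = {y. 0 \<le> y $ 1 \<and> y $ 1 < 1 \<and> 0 \<le> y $ 2 \<and> y $ 2 < 1}"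

definition Omega_cell :: "(real^3) set" where
  "Omega_cell = {x \<in> Omega. 0 \<le> x $ 1 \<and> x $ 1 < 1 \<and> 0 \<le> x $ 2 \<and> x $ 2 < 1}"

definition phase_measure :: "((real^3) \<times> (real^3)) measure" where
  "phase_measure = lebesgue_on (Omega_cell \<times> UNIV)"

definition wall :: "real^2 \<Rightarrow> real^3" where
  "wall y = vector [y $ 1, y $ 2, 0]"

definition normal :: "real^3 \<Rightarrow> real^3" where
  "normal x = vector [0, 0, -1]"

definition gamma_minus :: "((real^3) \<times> (real^3)) set" where
  "gamma_minus = {(x, v). x \<in> frontier Omega \<and> normal x \<bullet> v < 0}"

definition Phi :: "real \<Rightarrow> real^3 \<Rightarrow> real" where
  "Phi a x = log a (1 + x $ 3)"

definition grad :: "(real^3 \<Rightarrow> real) \<Rightarrow> real^3 \<Rightarrow> real^3" where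
  "grad f x = (THE D. GDERIV f x :> D)"

lemma grad_eqI:
  assumes "GDERIV f x :> D"
  shows "grad f x = D"
  unfolding grad_def
proof (rule the_equality)
  show "GDERIV f x :> D" by (fact assms)
  fix E assume "GDERIV f x :> E"
  then have "(\<lambda>h. h \<bullet> E) = (\<lambda>h. h \<bullet> D)"
    using assms unfolding gderiv_def by (rule has_derivative_unique)
  then have "\<forall>h. h \<bullet> E = h \<bullet> D" by metis
  then show "E = D" by (simp add: vector_eq_ldot)
qed

lemma grad_Phi:
  assumes "a > 1" and "x \<in> closure Omega"
  shows "grad (Phi a) x = axis 3 (1 / ((1 + x $ 3) * ln a))"
proof (rule grad_eqI)
  have "closed {x::real^3. 0 \<le> x $ 3}"
    by (intro closed_Collect_le continuous_intros)
  then have "closure Omega \<subseteq> {x. 0 \<le> x $ 3}"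
    by (intro closure_minimal) (auto simp: Omega_def)
  with assms(2) have x: "0 \<le> x $ 3" by auto
  have "((\<lambda>x::real^3. x $ 3) has_derivative (\<lambda>h. h $ 3)) (at x)"
    by (rule bounded_linear_imp_has_derivative) (rule bounded_linear_vec_nth)
  then show "GDERIV (Phi a) x :> axis 3 (1 / ((1 + x $ 3) * ln a))"
    unfolding gderiv_def Phi_def log_def inner_axis
    using x assms(1)
    by (auto intro!: derivative_eq_intros simp: fun_eq_iff divide_simps)
qed

definition wall_maxwellian :: "real^3 \<Rightarrow> real^3 \<Rightarrow> real" where
  "wall_maxwellian x v = 1 / (2 * pi) * exp (- ((norm v)\<^sup>2) / 2)"

definition stationary :: "real \<Rightarrow> real \<Rightarrow> real^3 \<Rightarrow> real^3 \<Rightarrow> real" where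
  "stationary a c x v = c / (2 * pi) * exp (- ((norm v)\<^sup>2 / 2 + Phi a x))"

definition phase_integral :: "(real^3 \<Rightarrow> real^3 \<Rightarrow> real) \<Rightarrow> real" where
  "phase_integral g = (\<integral>z. g (fst z) (snd z) \<partial>phase_measure)"

definition L1_norm :: "(real^3 \<Rightarrow> real^3 \<Rightarrow> real) \<Rightarrow> real" where
  "L1_norm g = phase_integral (\<lambda>x v. \<bar>g x v\<bar>)"

definition Linf_norm :: "(real^3 \<Rightarrow> real^3 \<Rightarrow> real) \<Rightarrow> ereal" where
  "Linf_norm g = esssup phase_measure (\<lambda>z. ereal \<bar>g (fst z) (snd z)\<bar>)"

definition japanese :: "real \<Rightarrow> real" where
  "japanese t = exp 1 + t"

(* A characteristic on [s,t] stays in the open domain at intermediate times; its end points may lie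
   on the boundary. *)
definition characteristic ::
  "real \<Rightarrow> real \<Rightarrow> real \<Rightarrow> (real \<Rightarrow> real^3) \<Rightarrow> (real \<Rightarrow> real^3) \<Rightarrow> bool" where
  "characteristic a s t X V \<longleftrightarrow>
     s < t \<and>
     (\<forall>\<tau>\<in>{s..t}. (X has_vector_derivative V \<tau>) (at \<tau> within {s..t}) \<and>
                 (V has_vector_derivative - grad (Phi a) (X \<tau>)) (at \<tau> within {s..t})) \<and>
     (\<forall>\<tau>\<in>{s<..<t}. X \<tau> \<in> Omega)"

definition outflux :: "(real \<Rightarrow> real^3 \<Rightarrow> real^3 \<Rightarrow> real) \<Rightarrow> real \<Rightarrow> real^3 \<Rightarrow> real" where
  "outflux F t x = (\<integral>v. F t x v * (normal x \<bullet> v) \<partial>lebesgue_on {v. normal x \<bullet> v > 0})"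

(* F is a pointwise representative on [0,\<infinity>) x closure Omega x R^3.  Constancy along characteristics
   up to their end points forces the values of F on the boundary to be the traces of the
   interior values along characteristics.  Integrability of the outgoing flux is demanded because
   the Bochner integral of a non-integrable function is 0. *)
definition L1_solution ::
  "real \<Rightarrow> (real^3 \<Rightarrow> real^3 \<Rightarrow> real) \<Rightarrow> (real \<Rightarrow> real^3 \<Rightarrow> real^3 \<Rightarrow> real) \<Rightarrow> bool" where
  "L1_solution a F0 F \<longleftrightarrow>
     (\<forall>t\<ge>0. torus_periodic (F t)) \<and>
     (\<forall>t\<ge>0. integrable phase_measure (\<lambda>z. F t (fst z) (snd z))) \<and>
     (\<forall>s\<ge>0. \<forall>t X V. characteristic a s t X V \<longrightarrow> F t (X t) (V t) = F s (X s) (V s)) \<and>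
     (\<lambda>(t, y, v). F t (wall y) v)
       \<in> borel_measurable (lebesgue_on ({0<..} \<times> torus_cell \<times> UNIV)) \<and>
     (AE (t, y) in lebesgue_on ({0<..} \<times> torus_cell).
        integrable (lebesgue_on {v. normal (wall y) \<bullet> v > 0})
          (\<lambda>v. F t (wall y) v * (normal (wall y) \<bullet> v))) \<and>
     (AE (t, y, v) in lebesgue_on ({0<..} \<times> torus_cell \<times> UNIV).
        (wall y, v) \<in> gamma_minus \<longrightarrow>
          F t (wall y) v = wall_maxwellian (wall y) v * outflux F t (wall y)) \<and>
     (AE z in phase_measure. F 0 (fst z) (snd z) = F0 (fst z) (snd z))"

(* The class of nonnegative solutions F = stationary + f whose perturbation f has zero mass. *)
definition admissible_solution ::
  "real \<Rightarrow> real \<Rightarrow> (real^3 \<Rightarrow> real^3 \<Rightarrow> real) \<Rightarrow> (real \<Rightarrow> real^3 \<Rightarrow> real^3 \<Rightarrow> real) \<Rightarrow> bool" where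
  "admissible_solution a c F0 F \<longleftrightarrow>
     L1_solution a F0 F \<and>
     (\<forall>t\<ge>0. AE z in phase_measure. F t (fst z) (snd z) \<ge> 0) \<and>
     (\<forall>t\<ge>0. phase_integral (\<lambda>x v. F t x v - stationary a c x v) = 0)"

end

(* A particle that is emitted with the Maxwellian from the wall returns after a time T whose law has the tail
   P(T > s) <= C s^(-b), where b = 1 / ln a. The flux w of particles that leave the wall therefore solves a
   renewal equation w = q + K w on R x T^2, in which q is the first hitting flux of the initial datum, and the
   least solution of this equation gives the solution F by transport along the orbits. Every other solution has a
   flux that differs from w by some D with |D| <= K |D|, and since mass escapes to later times, D = 0.

   For the decay, split f_0 into its positive and its negative part. Both generate a flux of the same total mass,
   and each flux has a uniform lower bound in terms of the mass that entered a while ago. A fixed fraction of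
   the two fluxes can hence be coupled in every time window of length R + l, and what is not coupled decays
   geometrically in the number n of windows, up to the tail of T. With n ~ ln t and R = t^rho for some rho < 1
   the uncoupled mass is of the order t^(-(A-6)), a rate that even drops the logarithm of the statement. *)

theory Submission
  imports Defs "HOL-Probability.Probability"
begin

section \<open>Lebesgue measure and periodic functions in coordinates\<close>

text \<open>The obstacle is that fast particles stay away for very long: the flight time grows like
  exp(v^2/(2b)) in the vertical emission speed v, and such speeds have probability exp(-v^2/2). What
  survives every restart of the process is a pointwise bound: the returns of the particles in flight
  at time s are dominated by kappa times those of the equilibrium, with the same kappa at all times.
  It keeps the fluxes finite and controls what returns later than a window R by kappa E[(T - R)^+],
  at most of order R^(1-b).

  The rate m = A - 6 leaves the margin b - 1 \<ge> m + 5. This margin permits rho (b - 1) \<ge> m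
  with rho < 1, so that the windows fit into half of [0,t].

  Fluxes take values in the extended nonnegative reals, where least solutions and Fubini need no
  integrability; comparisons of differences are stated additively instead. For uniqueness, a
  competing solution is controlled only almost everywhere on the wall. The exceptional sets are
  followed by transporting their indicators along the orbits and checking that their mass stays
  zero.\<close>

lemma fst_borel [measurable]: "fst \<in> borel_measurable (borel :: ('a::topological_space \<times> 'b::topological_space) measure)"
  by (intro borel_measurable_continuous_onI continuous_intros)

lemma snd_borel [measurable]: "snd \<in> borel_measurable (borel :: ('a::topological_space \<times> 'b::topological_space) measure)"
  by (intro borel_measurable_continuous_onI continuous_intros)

lemma vec_nth_borel [measurable]: "(\<lambda>x. x $ i) \<in> borel_measurable (borel :: (real^'n) measure)"
  by (intro borel_measurable_continuous_onI continuous_intros)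

section \<open>Coordinates of the plane and of space\<close>

definition vec2 :: "real \<times> real \<Rightarrow> real^2" where
  "vec2 z = vector [fst z, snd z]"

definition vec3 :: "(real^2) \<times> real \<Rightarrow> real^3" where
  "vec3 z = vector [fst z $ 1, fst z $ 2, snd z]"

lemma vec2_nth [simp]: "vec2 z $ 1 = fst z" "vec2 z $ 2 = snd z"
  by (simp_all add: vec2_def)

lemma vec3_nth [simp]: "vec3 z $ 1 = fst z $ 1" "vec3 z $ 2 = fst z $ 2" "vec3 z $ 3 = snd z"
  by (simp_all add: vec3_def vector_3)

lemma vec2_eq: "vec2 z = fst z *\<^sub>R axis 1 1 + snd z *\<^sub>R axis 2 1"
  by (auto simp: vec_eq_iff forall_2 axis_def)

lemma vec2_borel [measurable]: "vec2 \<in> borel_measurable borel"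
  unfolding vec2_eq[abs_def] by measurable

lemma vec3_eq: "vec3 z = (fst z $ 1) *\<^sub>R axis 1 1 + (fst z $ 2) *\<^sub>R axis 2 1 + snd z *\<^sub>R axis 3 1"
  by (auto simp: vec_eq_iff forall_3 axis_def)

lemma vec3_borel [measurable]: "vec3 \<in> borel_measurable borel"
  unfolding vec3_eq[abs_def] by measurable

lemma Basis_prod_cart:
  fixes l u :: "real^'n"
  shows "(\<Prod>b\<in>Basis. (u - l) \<bullet> b) = (\<Prod>i\<in>UNIV. u $ i - l $ i)"
proof -
  have B: "(Basis :: (real^'n) set) = range (\<lambda>i. axis i 1)"
    by (auto simp: Basis_vec_def)
  have "inj (\<lambda>i. axis i (1::real) :: real^'n)"
    by (auto simp: inj_on_def axis_eq_axis)
  then show ?thesis unfolding B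
    by (subst prod.reindex) (auto simp: inner_axis)
qed

lemma Basis_le_cart: "(\<forall>b\<in>Basis. l \<bullet> b \<le> u \<bullet> b) \<longleftrightarrow> (\<forall>i. l $ i \<le> (u::real^'n) $ i)"
  by (auto simp: Basis_vec_def inner_axis)

text \<open>Lebesgue measure is determined by its values on boxes, and the preimage of a box is a
  product of two intervals. Together with \<open>lborel_vec3\<close> this turns integrals over
  vectors into iterated integrals over their components.\<close>

lemma lborel_vec2: "distr lborel borel vec2 = lborel"
proof (rule lborel_eqI[symmetric])
  fix l u :: "real^2" assume "\<And>b. b \<in> Basis \<Longrightarrow> l \<bullet> b \<le> u \<bullet> b"
  then have lu: "l $ i \<le> u $ i" for i using Basis_le_cart by blast
  have *: "vec2 -` box l u = box (l$1) (u$1) \<times> box (l$2) (u$2)"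
    by (auto simp: mem_box_cart forall_2)
  have "emeasure (distr lborel borel vec2) (box l u) = emeasure (lborel \<Otimes>\<^sub>M lborel) (box (l$1) (u$1) \<times> box (l$2) (u$2))"
    by (simp add: emeasure_distr * lborel_prod)
  also have "\<dots> = ennreal ((u$1 - l$1) * (u$2 - l$2))"
    using lu by (subst lborel.emeasure_pair_measure_Times) (auto simp: ennreal_mult)
  also have "\<dots> = (\<Prod>b\<in>Basis. (u - l) \<bullet> b)" by (simp add: Basis_prod_cart UNIV_2)
  finally show "emeasure (distr lborel borel vec2) (box l u) = (\<Prod>b\<in>Basis. (u - l) \<bullet> b)" .
qed simp

lemma lborel_vec3: "distr lborel borel vec3 = lborel"
proof (rule lborel_eqI[symmetric])
  fix l u :: "real^3" assume "\<And>b. b \<in> Basis \<Longrightarrow> l \<bullet> b \<le> u \<bullet> b"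
  then have lu: "l $ i \<le> u $ i" for i using Basis_le_cart by blast
  define h :: "real^3 \<Rightarrow> real^2" where "h x = vector [x$1, x$2]" for x
  have *: "vec3 -` box l u = box (h l) (h u) \<times> box (l$3) (u$3)"
    by (auto simp: mem_box_cart forall_2 forall_3 h_def)
  have le: "\<forall>b\<in>Basis. h l \<bullet> b \<le> h u \<bullet> b"
    unfolding Basis_le_cart by (simp add: forall_2 h_def lu)
  have "emeasure (distr lborel borel vec3) (box l u) = emeasure (lborel \<Otimes>\<^sub>M lborel) (box (h l) (h u) \<times> box (l$3) (u$3))"
    by (simp add: emeasure_distr * lborel_prod)
  also have "\<dots> = emeasure lborel (box (h l) (h u)) * emeasure lborel (box (l$3) (u$3))"
    by (rule lborel.emeasure_pair_measure_Times) auto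
  also have "emeasure lborel (box (h l) (h u)) = ennreal (\<Prod>b\<in>Basis. (h u - h l) \<bullet> b)"
    using le by (intro emeasure_lborel_box) blast
  also have "(\<Prod>b\<in>Basis. (h u - h l) \<bullet> b) = (u$1 - l$1) * (u$2 - l$2)"
    by (simp add: Basis_prod_cart UNIV_2 h_def)
  also have "emeasure lborel (box (l$3) (u$3)) = ennreal (u$3 - l$3)"
    using lu[of 3] by simp
  also have "ennreal ((u$1 - l$1) * (u$2 - l$2)) * ennreal (u$3 - l$3) = ennreal ((u$1 - l$1) * (u$2 - l$2) * (u$3 - l$3))"
    using lu[of 3] by (simp add: ennreal_mult'')
  also have "(u$1 - l$1) * (u$2 - l$2) * (u$3 - l$3) = (\<Prod>b\<in>Basis. (u - l) \<bullet> b)"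
    unfolding Basis_prod_cart UNIV_3 by (subst prod.insert; simp)+
  finally show "emeasure (distr lborel borel vec3) (box l u) = (\<Prod>b\<in>Basis. (u - l) \<bullet> b)" .
qed simp

lemma nn_integral_lborel_pair:
  fixes H :: "'a::euclidean_space \<times> 'b::euclidean_space \<Rightarrow> ennreal"
  assumes [measurable]: "H \<in> borel_measurable borel"
  shows "(\<integral>\<^sup>+z. H z \<partial>lborel) = (\<integral>\<^sup>+a. (\<integral>\<^sup>+b. H (a, b) \<partial>lborel) \<partial>lborel)"
  by (subst lborel_prod[symmetric], subst lborel.nn_integral_fst[symmetric])
     (auto simp: lborel_prod)

lemma nn_integral_vec2:
  assumes [measurable]: "H \<in> borel_measurable borel"
  shows "(\<integral>\<^sup>+y. H y \<partial>lborel) = (\<integral>\<^sup>+a. (\<integral>\<^sup>+b. H (vec2 (a, b)) \<partial>lborel) \<partial>lborel)"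
  by (subst lborel_vec2[symmetric]) (simp add: nn_integral_distr nn_integral_lborel_pair)

lemma nn_integral_vec3:
  assumes [measurable]: "H \<in> borel_measurable borel"
  shows "(\<integral>\<^sup>+y. H y \<partial>lborel) = (\<integral>\<^sup>+a. (\<integral>\<^sup>+b. H (vec3 (a, b)) \<partial>lborel) \<partial>lborel)"
  by (subst lborel_vec3[symmetric]) (simp add: nn_integral_distr nn_integral_lborel_pair)

section \<open>Periodic functions and integrals over one period\<close>

lemma periodic_int:
  fixes g :: "real \<Rightarrow> 'a"
  assumes "\<And>x. g (x + 1) = g x"
  shows "g (x + of_int n) = g x"
proof (induction n arbitrary: x rule: int_induct[where k=0])
  case (step1 i)
  have "g (x + of_int (i + 1)) = g ((x + of_int i) + 1)" by (simp add: algebra_simps)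
  then show ?case using step1 assms by metis
next
  case (step2 i)
  have "g (x + of_int (i - 1)) = g (x + of_int (i - 1) + 1)" using assms by metis
  also have "x + of_int (i - 1) + 1 = x + of_int i" by simp
  finally show ?case using step2 by metis
qed simp

text \<open>Only the fractional part r of the shift matters. The shifted window [r, r+1) is cut at
  1, and the overhang [1, 1+r) is moved back by one period.\<close>

lemma nn_integral_periodic_shift:
  fixes g :: "real \<Rightarrow> ennreal"
  assumes [measurable]: "g \<in> borel_measurable borel" and p: "\<And>x. g (x + 1) = g x"
  shows "(\<integral>\<^sup>+y. g (y + z) * indicator {0..<1} y \<partial>lborel) = (\<integral>\<^sup>+y. g y * indicator {0..<1} y \<partial>lborel)"
proof -
  define n where "n = \<lfloor>z\<rfloor>"
  define r where "r = z - of_int n"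
  have r: "0 \<le> r" "r < 1" unfolding r_def n_def by linarith+
  have z: "g (y + z) = g (y + r)" for y
    using periodic_int[of g "y + r" n, OF p] by (simp add: r_def algebra_simps)
  have "(\<integral>\<^sup>+y. g (y + z) * indicator {0..<1} y \<partial>lborel) = (\<integral>\<^sup>+y. g (r + 1 * y) * indicator {r..<r+1} (r + 1 * y) \<partial>lborel)"
    unfolding z by (intro nn_integral_cong) (auto simp: indicator_def add.commute)
  also have "\<dots> = (\<integral>\<^sup>+y. g y * indicator {r..<r+1} y \<partial>lborel)"
    using nn_integral_real_affine[of "\<lambda>y. g y * indicator {r..<r+1} y" 1 r] by simp
  also have "\<dots> = (\<integral>\<^sup>+y. g y * indicator {r..<1} y + g y * indicator {1..<1+r} y \<partial>lborel)"
    using r by (intro nn_integral_cong) (auto simp: indicator_def)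
  also have "\<dots> = (\<integral>\<^sup>+y. g y * indicator {r..<1} y \<partial>lborel) + (\<integral>\<^sup>+y. g y * indicator {1..<1+r} y \<partial>lborel)"
    by (intro nn_integral_add) auto
  also have "(\<integral>\<^sup>+y. g y * indicator {1..<1+r} y \<partial>lborel) = (\<integral>\<^sup>+y. g (1 + 1 * y) * indicator {1..<1+r} (1 + 1 * y) \<partial>lborel)"
    using nn_integral_real_affine[of "\<lambda>y. g y * indicator {1..<1+r} y" 1 1] by simp
  also have "\<dots> = (\<integral>\<^sup>+y. g y * indicator {0..<r} y \<partial>lborel)"
    using p by (intro nn_integral_cong) (auto simp: indicator_def add.commute)
  also have "(\<integral>\<^sup>+y. g y * indicator {r..<1} y \<partial>lborel) + (\<integral>\<^sup>+y. g y * indicator {0..<r} y \<partial>lborel)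
     = (\<integral>\<^sup>+y. g y * indicator {r..<1} y + g y * indicator {0..<r} y \<partial>lborel)"
    by (intro nn_integral_add[symmetric]) auto
  also have "\<dots> = (\<integral>\<^sup>+y. g y * indicator {0..<1} y \<partial>lborel)"
    using r by (intro nn_integral_cong) (auto simp: indicator_def)
  finally show ?thesis .
qed

text \<open>By shift invariance z may be dropped. The substitution 1 - y then maps [0,1) to (0,1],
  which differs from the original window only in two points.\<close>

lemma nn_integral_periodic_reflect:
  fixes g :: "real \<Rightarrow> ennreal"
  assumes [measurable]: "g \<in> borel_measurable borel" and p: "\<And>x. g (x + 1) = g x"
  shows "(\<integral>\<^sup>+y. g (z - y) * indicator {0..<1} y \<partial>lborel) = (\<integral>\<^sup>+y. g y * indicator {0..<1} y \<partial>lborel)"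
proof -
  have p': "g (- (x + 1)) = g (- x)" for x using p[of "-x-1"] by simp
  have "(\<integral>\<^sup>+y. g (z - y) * indicator {0..<1} y \<partial>lborel) = (\<integral>\<^sup>+y. g (- y) * indicator {0..<1} y \<partial>lborel)"
    using nn_integral_periodic_shift[of "\<lambda>y. g (- y)" "-z"] p' by simp
  also have "\<dots> = (\<integral>\<^sup>+y. g (1 + (-1) * y) * indicator {0<..1} (1 + (-1) * y) \<partial>lborel)"
  proof (intro nn_integral_cong)
    fix y
    have "g (1 + (-1) * y) = g (- y)" using p[of "-y"] by (simp add: add.commute)
    moreover have "indicator {0<..1} (1 + (-1) * y) = (indicator {0..<1} y :: ennreal)"
      by (auto simp: indicator_def)
    ultimately show "g (- y) * indicator {0..<1} y = g (1 + (-1) * y) * indicator {0<..1} (1 + (-1) * y)"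
      by metis
  qed
  also have "\<dots> = (\<integral>\<^sup>+y. g y * indicator {0<..1} y \<partial>lborel)"
    using nn_integral_real_affine[of "\<lambda>y. g y * indicator {0<..1} y" "-1" 1] by simp
  also have "\<dots> = (\<integral>\<^sup>+y. g y * indicator {0..<1} y \<partial>lborel)"
  proof (rule nn_integral_cong_AE)
    have "AE y in lborel. y \<noteq> (0::real)" "AE y in lborel. y \<noteq> (1::real)" by (rule AE_lborel_singleton)+
    then show "AE x in lborel. g x * indicator {0<..1} x = g x * indicator {0..<1} x"
      by eventually_elim (auto simp: indicator_def)
  qed
  finally show ?thesis .
qed

text \<open>A density on the whole plane rather than a restriction to the cell: its measurable sets
  are all Borel sets, so that functions on the universal cover can be integrated and shifted as they
  are.\<close>

definition cellm :: "(real^2) measure" where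
  "cellm = density lborel (indicator torus_cell)"

lemma torus_cell_borel [measurable]: "torus_cell \<in> sets borel"
  unfolding torus_cell_def by measurable

lemma sets_cellm [simp, measurable_cong]: "sets cellm = sets borel"
  and space_cellm [simp]: "space cellm = UNIV"
  by (simp_all add: cellm_def)

lemma nn_integral_cellm:
  assumes [measurable]: "H \<in> borel_measurable borel"
  shows "(\<integral>\<^sup>+y. H y \<partial>cellm) = (\<integral>\<^sup>+a. (\<integral>\<^sup>+b. H (vec2 (a, b)) * indicator {0..<1} b \<partial>lborel) * indicator {0..<1} a \<partial>lborel)"
proof -
  have "(\<integral>\<^sup>+y. H y \<partial>cellm) = (\<integral>\<^sup>+y. indicator torus_cell y * H y \<partial>lborel)"
    unfolding cellm_def by (subst nn_integral_density) auto
  also have "\<dots> = (\<integral>\<^sup>+a. (\<integral>\<^sup>+b. (H (vec2 (a, b)) * indicator {0..<1} b) * indicator {0..<1} a \<partial>lborel) \<partial>lborel)"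
    by (subst nn_integral_vec2, measurable, intro nn_integral_cong) (auto simp: indicator_def torus_cell_def)
  also have "\<dots> = (\<integral>\<^sup>+a. (\<integral>\<^sup>+b. H (vec2 (a, b)) * indicator {0..<1} b \<partial>lborel) * indicator {0..<1} a \<partial>lborel)"
    by (subst nn_integral_multc) auto
  finally show ?thesis .
qed

lemma prob_cellm: "prob_space cellm"
proof -
  have "emeasure cellm (space cellm) = (\<integral>\<^sup>+y. 1 \<partial>cellm)" by simp
  also have "\<dots> = 1" by (subst nn_integral_cellm) auto
  finally show ?thesis by (rule prob_spaceI)
qed

definition periodic2 :: "(real^2 \<Rightarrow> 'a) \<Rightarrow> bool" where
  "periodic2 g \<longleftrightarrow> (\<forall>y. g (y + axis 1 1) = g y \<and> g (y + axis 2 1) = g y)"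

lemma vec2_shift: "vec2 (a + 1, b) = vec2 (a, b) + axis 1 1" "vec2 (a, b + 1) = vec2 (a, b) + axis 2 1"
  by (auto simp: vec_eq_iff forall_2 axis_def)

lemma vec2_add: "vec2 (a, b) + z = vec2 (a + z$1, b + z$2)"
  apply (subst vec_eq_iff) apply (subst forall_2) apply (intro conjI)
  by (simp_all only: vector_add_component vec2_nth fst_conv snd_conv)

lemma vec2_diff: "z - vec2 (a, b) = vec2 (z$1 - a, z$2 - b)"
  apply (subst vec_eq_iff) apply (subst forall_2) apply (intro conjI)
  by (simp_all only: vector_minus_component vec2_nth fst_conv snd_conv)

text \<open>The coordinates are shifted one at a time; the inner integral is again a periodic
  function of the outer coordinate.\<close>

lemma nn_integral_cellm_shift:
  assumes [measurable]: "g \<in> borel_measurable borel" and p: "periodic2 g"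
  shows "(\<integral>\<^sup>+y. g (y + z) \<partial>cellm) = (\<integral>\<^sup>+y. g y \<partial>cellm)"
proof -
  note 1 = vec2_add
  have p1: "g (vec2 (a + 1, b)) = g (vec2 (a, b))" and p2: "g (vec2 (a, b + 1)) = g (vec2 (a, b))" for a b
    using p by (auto simp: periodic2_def vec2_shift)
  have 2: "(\<integral>\<^sup>+b. g (vec2 (a, b + z$2)) * indicator {0..<1} b \<partial>lborel) = (\<integral>\<^sup>+b. g (vec2 (a, b)) * indicator {0..<1} b \<partial>lborel)" for a
    by (rule nn_integral_periodic_shift[of "\<lambda>b. g (vec2 (a, b))"]) (auto simp: p2)
  have "(\<integral>\<^sup>+y. g (y + z) \<partial>cellm) = (\<integral>\<^sup>+a. (\<integral>\<^sup>+b. g (vec2 (a + z$1, b)) * indicator {0..<1} b \<partial>lborel) * indicator {0..<1} a \<partial>lborel)"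
    by (subst nn_integral_cellm) (simp_all only: 1 2, measurable)
  also have "\<dots> = (\<integral>\<^sup>+a. (\<integral>\<^sup>+b. g (vec2 (a, b)) * indicator {0..<1} b \<partial>lborel) * indicator {0..<1} a \<partial>lborel)"
    by (rule nn_integral_periodic_shift[of "\<lambda>a. \<integral>\<^sup>+b. g (vec2 (a, b)) * indicator {0..<1} b \<partial>lborel"]) (simp_all only: p1, measurable)
  also have "\<dots> = (\<integral>\<^sup>+y. g y \<partial>cellm)"
    by (rule nn_integral_cellm[symmetric]) fact
  finally show ?thesis .
qed

lemma nn_integral_cellm_reflect:
  assumes [measurable]: "g \<in> borel_measurable borel" and p: "periodic2 g"
  shows "(\<integral>\<^sup>+y. g (z - y) \<partial>cellm) = (\<integral>\<^sup>+y. g y \<partial>cellm)"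
proof -
  note 1 = vec2_diff
  have p1: "g (vec2 (a + 1, b)) = g (vec2 (a, b))" and p2: "g (vec2 (a, b + 1)) = g (vec2 (a, b))" for a b
    using p by (auto simp: periodic2_def vec2_shift)
  have 2: "(\<integral>\<^sup>+b. g (vec2 (a, z$2 - b)) * indicator {0..<1} b \<partial>lborel) = (\<integral>\<^sup>+b. g (vec2 (a, b)) * indicator {0..<1} b \<partial>lborel)" for a
    by (rule nn_integral_periodic_reflect[of "\<lambda>b. g (vec2 (a, b))"]) (auto simp: p2)
  have "(\<integral>\<^sup>+y. g (z - y) \<partial>cellm) = (\<integral>\<^sup>+a. (\<integral>\<^sup>+b. g (vec2 (z$1 - a, b)) * indicator {0..<1} b \<partial>lborel) * indicator {0..<1} a \<partial>lborel)"
    by (subst nn_integral_cellm, measurable) (simp only: 1 2)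
  also have "\<dots> = (\<integral>\<^sup>+a. (\<integral>\<^sup>+b. g (vec2 (a, b)) * indicator {0..<1} b \<partial>lborel) * indicator {0..<1} a \<partial>lborel)"
    by (rule nn_integral_periodic_reflect[of "\<lambda>a. \<integral>\<^sup>+b. g (vec2 (a, b)) * indicator {0..<1} b \<partial>lborel"]) (measurable, simp only: p1)
  also have "\<dots> = (\<integral>\<^sup>+y. g y \<partial>cellm)"
    by (rule nn_integral_cellm[symmetric]) fact
  finally show ?thesis .
qed

section \<open>A renewal equation on the wall\<close>

type_synonym pt = "real \<times> (real^2)"

text \<open>Time runs over the whole line, so that translation by a flight preserves integrals. The
  arrow of time enters through \<open>aft\<close> and \<open>upto\<close>.\<close>

definition wallm :: "pt measure" where
  "wallm = lborel \<Otimes>\<^sub>M cellm"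

lemma sets_wallm [simp, measurable_cong]: "sets wallm = sets borel"
proof -
  have "sets wallm = sets (borel \<Otimes>\<^sub>M (borel :: (real^2) measure))"
    unfolding wallm_def by (intro sets_pair_measure_cong) auto
  then show ?thesis unfolding borel_prod .
qed

lemma space_wallm [simp]: "space wallm = UNIV"
  by (simp add: wallm_def space_pair_measure)

interpretation cellm: prob_space cellm by (rule prob_cellm)

interpretation lc: pair_sigma_finite "lborel :: real measure" cellm
  by unfold_locales

interpretation wallm: sigma_finite_measure wallm
  unfolding wallm_def by (rule lc.P.sigma_finite_measure_axioms)

lemma nn_integral_wallm:
  assumes [measurable]: "H \<in> borel_measurable borel"
  shows "(\<integral>\<^sup>+x. H x \<partial>wallm) = (\<integral>\<^sup>+t. (\<integral>\<^sup>+y. H (t, y) \<partial>cellm) \<partial>lborel)"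
proof -
  have "H \<in> borel_measurable (lborel \<Otimes>\<^sub>M cellm)"
    using assms by (simp add: measurable_cong_sets[OF sets_wallm[unfolded wallm_def] refl])
  then show ?thesis unfolding wallm_def by (rule cellm.nn_integral_fst[symmetric])
qed

text \<open>The class on which the renewal operators act. Periodicity is what makes integrals over
  the cell invariant under the horizontal displacement of a flight.\<close>

definition pm :: "(pt \<Rightarrow> ennreal) \<Rightarrow> bool" where
  "pm q \<longleftrightarrow> q \<in> borel_measurable borel \<and> (\<forall>t. periodic2 (\<lambda>y. q (t, y)))"

lemma pm_measurable: "pm q \<Longrightarrow> q \<in> borel_measurable borel"
  by (simp add: pm_def)

lemma nn_integral_wallm_shift:
  assumes q: "pm q"
  shows "(\<integral>\<^sup>+x. q (x - n) \<partial>wallm) = (\<integral>\<^sup>+x. q x \<partial>wallm)"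
proof -
  have [measurable]: "q \<in> borel_measurable borel" using q by (rule pm_measurable)
  have 1: "(\<integral>\<^sup>+y. q (t, y - snd n) \<partial>cellm) = (\<integral>\<^sup>+y. q (t, y) \<partial>cellm)" for t
    using nn_integral_cellm_shift[of "\<lambda>y. q (t, y)" "- snd n"] q by (simp add: pm_def)
  have m: "(\<lambda>t. \<integral>\<^sup>+y. q (t, y) \<partial>cellm) \<in> borel_measurable borel"
    by (intro cellm.borel_measurable_nn_integral) measurable
  have "(\<integral>\<^sup>+x. q (x - n) \<partial>wallm) = (\<integral>\<^sup>+t. (\<integral>\<^sup>+y. q (t - fst n, y - snd n) \<partial>cellm) \<partial>lborel)"
    by (subst nn_integral_wallm) (auto simp: minus_prod_def)
  also have "\<dots> = (\<integral>\<^sup>+t. (\<integral>\<^sup>+y. q (- fst n + 1 * t, y) \<partial>cellm) \<partial>lborel)"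
    by (simp add: 1)
  also have "\<dots> = (\<integral>\<^sup>+t. (\<integral>\<^sup>+y. q (t, y) \<partial>cellm) \<partial>lborel)"
    using nn_integral_real_affine[OF m, of 1 "- fst n"] by simp
  also have "\<dots> = (\<integral>\<^sup>+x. q x \<partial>wallm)"
    by (rule nn_integral_wallm[symmetric]) fact
  finally show ?thesis .
qed

definition aft :: "real \<Rightarrow> (pt \<Rightarrow> ennreal) \<Rightarrow> pt \<Rightarrow> ennreal" where
  "aft s q x = (if s < fst x then q x else 0)"

definition upto :: "real \<Rightarrow> (pt \<Rightarrow> ennreal) \<Rightarrow> pt \<Rightarrow> ennreal" where
  "upto s q x = (if fst x \<le> s then q x else 0)"

lemma upto_aft: "upto s q x + aft s q x = q x" by (simp add: upto_def aft_def)

lemma pm_aft [simp]: "pm q \<Longrightarrow> pm (aft s q)"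
  unfolding pm_def aft_def[abs_def] periodic2_def by (auto simp: measurable_If)

lemma pm_upto [simp]: "pm q \<Longrightarrow> pm (upto s q)"
  unfolding pm_def upto_def[abs_def] periodic2_def by (auto simp: measurable_If)

lemma pm_time [simp]: "g \<in> borel_measurable borel \<Longrightarrow> pm (\<lambda>x. g (fst x))"
  by (auto simp: pm_def periodic2_def)

lemma pm_const [simp]: "pm (\<lambda>x. c)"
  by (auto simp: pm_def periodic2_def)

lemma pm_add [simp]: "pm q \<Longrightarrow> pm r \<Longrightarrow> pm (\<lambda>x. q x + r x)"
  by (auto simp: pm_def periodic2_def)

lemma pm_diff [simp]: "pm q \<Longrightarrow> pm r \<Longrightarrow> pm (\<lambda>x. q x - r x)"
  by (auto simp: pm_def periodic2_def)

lemma pm_cmult [simp]: "pm q \<Longrightarrow> pm (\<lambda>x. c * q x)"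
  by (auto simp: pm_def periodic2_def)

lemma pm_mult [simp]: "pm q \<Longrightarrow> pm r \<Longrightarrow> pm (\<lambda>x. q x * r x)"
  by (auto simp: pm_def periodic2_def)

text \<open>\<open>N\<close> is the law of the duration and the horizontal displacement of a flight between two visits to the wall.
  \<open>minor\<close> is a Doeblin condition that is uniform in the end point of the flight, and \<open>hazard\<close> says that the hazard
  rate of the duration is at most \<open>B\<close>.\<close>

locale renewal =
  fixes N :: "pt measure" and B :: real
  assumes prob: "prob_space N" and sets_N [measurable_cong]: "sets N = sets borel"
    and pos: "AE n in N. 0 < fst n"
    and B_pos: "0 < B"
    and minor: "\<And>L. 1 < L \<Longrightarrow> \<exists>c>0. \<forall>w t y. pm w \<longrightarrow>
       ennreal c * (\<integral>\<^sup>+x. w x * indicator {t - L..t - 1} (fst x) \<partial>wallm) \<le> (\<integral>\<^sup>+n. w ((t, y) - n) \<partial>N)"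
    and hazard: "\<And>g. g \<in> borel_measurable borel \<Longrightarrow>
       (\<integral>\<^sup>+n. g (fst n) \<partial>N) \<le> ennreal B * (\<integral>\<^sup>+s. g s * emeasure N {n. s \<le> fst n} * indicator {0<..} s \<partial>lborel)"
    and tau_fin: "(\<integral>\<^sup>+s. emeasure N {n. s \<le> fst n} * indicator {0<..} s \<partial>lborel) < \<infinity>"
    and tau_lim: "\<And>e. e > 0 \<Longrightarrow> \<exists>r>0. (\<integral>\<^sup>+s. emeasure N {n. s \<le> fst n} * indicator {r<..} s \<partial>lborel) \<le> ennreal e"
begin

sublocale prob_space N by (rule prob)

lemma space_N [simp]: "space N = UNIV"
  using sets_eq_imp_space_eq[OF sets_N] by simp

sublocale Nw: pair_sigma_finite N wallm ..

section \<open>The flight operator and its dual\<close>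

definition tl :: "real \<Rightarrow> ennreal" where "tl s = emeasure N {n. s \<le> fst n}"

text \<open>This is E[(T - r)^+], the mean excess of a flight over the duration r; in particular
  \<open>tau 0\<close> is the mean flight time.\<close>

definition tau :: "real \<Rightarrow> ennreal" where "tau r = (\<integral>\<^sup>+s. tl s * indicator {r<..} s \<partial>lborel)"

lemma tl_alt: "tl s = (\<integral>\<^sup>+n. indicator {s..} (fst n) \<partial>N)"
proof -
  have "{n. s \<le> fst n} \<in> sets N" by (simp add: sets_N)
  then have "tl s = (\<integral>\<^sup>+n. indicator {n. s \<le> fst n} n \<partial>N)"
    unfolding tl_def by (rule nn_integral_indicator[symmetric])
  then show ?thesis by (simp add: indicator_def)
qed

lemma tl_borel [measurable]: "tl \<in> borel_measurable borel"
  unfolding tl_alt[abs_def] indicator_def atLeast_iff by measurable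

lemma tl_antimono: "s \<le> t \<Longrightarrow> tl t \<le> tl s"
  unfolding tl_def by (rule emeasure_mono) (auto simp: sets_N)

text \<open>Convolution with the law of a flight: the flux of returns that is caused by the emission
  flux q.\<close>

definition K :: "(pt \<Rightarrow> ennreal) \<Rightarrow> pt \<Rightarrow> ennreal" where
  "K q x = (\<integral>\<^sup>+n. q (x - n) \<partial>N)"

lemma pm_K [simp]: "pm q \<Longrightarrow> pm (K q)"
proof -
  assume q: "pm q"
  have "q ((t, y + a) - n) = q ((t, y - snd n + a) - (fst n, 0))" for t y a n
    by (cases n) (simp add: minus_prod_def algebra_simps)
  moreover have "q ((t, y) - n) = q ((t, y - snd n) - (fst n, 0))" for t y n
    by (cases n) (simp add: minus_prod_def)
  ultimately show ?thesis using q
    unfolding pm_def K_def periodic2_def by (auto simp: minus_prod_def)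
qed

lemma K_mono: "(\<And>x. q x \<le> r x) \<Longrightarrow> K q x \<le> K r x"
  unfolding K_def by (intro nn_integral_mono) auto

lemma K_add: "pm q \<Longrightarrow> pm r \<Longrightarrow> K (\<lambda>x. q x + r x) x = K q x + K r x"
  unfolding K_def by (intro nn_integral_add) (auto simp: measurable_cong_sets[OF sets_N refl] dest!: pm_measurable)

lemma K_cmult: "pm q \<Longrightarrow> K (\<lambda>x. c * q x) x = c * K q x"
  unfolding K_def by (intro nn_integral_cmult) (auto simp: measurable_cong_sets[OF sets_N refl] dest!: pm_measurable)

lemma Fubini_Nw:
  assumes "(\<lambda>z. f (fst z) (snd z)) \<in> borel_measurable borel"
  shows "(\<integral>\<^sup>+x. (\<integral>\<^sup>+n. f n x \<partial>N) \<partial>wallm) = (\<integral>\<^sup>+n. (\<integral>\<^sup>+x. f n x \<partial>wallm) \<partial>N)"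
proof (rule Nw.Fubini')
  have "borel_measurable (borel \<Otimes>\<^sub>M (borel :: pt measure)) = (borel_measurable (N \<Otimes>\<^sub>M wallm) :: (_ \<Rightarrow> ennreal) set)"
    by (intro measurable_cong_sets sets_pair_measure_cong) (auto simp: sets_N)
  then show "case_prod f \<in> borel_measurable (N \<Otimes>\<^sub>M wallm)"
    using assms by (simp add: borel_prod case_prod_beta')
qed

text \<open>Translation invariance of \<open>wallm\<close> moves the displacement from q to the
  weight, and a weight that depends on time alone does not disturb periodicity. The constant weight
  gives conservation of mass, the indicator of late times gives the mass in flight.\<close>

lemma K_weight:
  assumes q: "pm q" and g [measurable]: "g \<in> borel_measurable borel"
  shows "(\<integral>\<^sup>+x. g (fst x) * K q x \<partial>wallm) = (\<integral>\<^sup>+x. q x * (\<integral>\<^sup>+n. g (fst x + fst n) \<partial>N) \<partial>wallm)"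
proof -
  have [measurable]: "q \<in> borel_measurable borel" using q by (rule pm_measurable)
  have "(\<integral>\<^sup>+x. g (fst x) * K q x \<partial>wallm) = (\<integral>\<^sup>+x. (\<integral>\<^sup>+n. g (fst x) * q (x - n) \<partial>N) \<partial>wallm)"
    unfolding K_def by (intro nn_integral_cong nn_integral_cmult[symmetric]) (simp add: measurable_cong_sets[OF sets_N refl])
  also have "\<dots> = (\<integral>\<^sup>+n. (\<integral>\<^sup>+x. g (fst x) * q (x - n) \<partial>wallm) \<partial>N)"
    by (rule Fubini_Nw) measurable
  also have "\<dots> = (\<integral>\<^sup>+n. (\<integral>\<^sup>+x. g (fst x + fst n) * q x \<partial>wallm) \<partial>N)"
  proof (rule nn_integral_cong)
    fix n :: pt
    have "pm (\<lambda>x. g (fst x + fst n) * q x)"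
      using q by (intro pm_mult pm_time) auto
    from nn_integral_wallm_shift[OF this, of n]
    show "(\<integral>\<^sup>+x. g (fst x) * q (x - n) \<partial>wallm) = (\<integral>\<^sup>+x. g (fst x + fst n) * q x \<partial>wallm)"
      by (simp add: minus_prod_def)
  qed
  also have "\<dots> = (\<integral>\<^sup>+x. (\<integral>\<^sup>+n. g (fst x + fst n) * q x \<partial>N) \<partial>wallm)"
    by (rule Fubini_Nw[symmetric]) measurable
  also have "\<dots> = (\<integral>\<^sup>+x. q x * (\<integral>\<^sup>+n. g (fst x + fst n) \<partial>N) \<partial>wallm)"
    by (intro nn_integral_cong, subst nn_integral_multc) (auto simp: mult.commute measurable_cong_sets[OF sets_N refl])
  finally show ?thesis .
qed

lemma K_mass: "pm q \<Longrightarrow> (\<integral>\<^sup>+x. K q x \<partial>wallm) = (\<integral>\<^sup>+x. q x \<partial>wallm)"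
  using K_weight[of q "\<lambda>_. 1"] emeasure_space_1 by simp

text \<open>Causality: a flight has positive duration almost surely, so nothing that is emitted
  after s can return at or before s.\<close>

lemma K_aft: "K (aft s q) x = aft s (K (aft s q)) x"
proof (cases "s < fst x")
  case False
  have "AE n in N. aft s q (x - n) = 0"
    using pos by eventually_elim (use False in \<open>auto simp: aft_def\<close>)
  then have "K (aft s q) x = (\<integral>\<^sup>+n. 0 \<partial>N)" unfolding K_def
    by (rule nn_integral_cong_AE)
  then show ?thesis using False by (simp add: aft_def[of _ "K _"])
qed (simp add: aft_def[of _ "K _"])

lemma measurable_N_iff [simp]: "borel_measurable N = borel_measurable borel"
  by (rule measurable_cong_sets) (auto simp: sets_N)

section \<open>The least solution of the renewal equation\<close>

text \<open>The partial Neumann sums: \<open>it q n\<close> adds up the j-th powers of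
  \<open>K\<close> applied to q for j < n, the contributions of fewer than n flights.\<close>

primrec it :: "(pt \<Rightarrow> ennreal) \<Rightarrow> nat \<Rightarrow> pt \<Rightarrow> ennreal" where
  "it q 0 = (\<lambda>_. 0)"
| "it q (Suc n) = (\<lambda>x. q x + K (it q n) x)"

lemma pm_it [simp]: "pm q \<Longrightarrow> pm (it q n)"
  by (induction n) auto

lemma it_mono_n: "it q n x \<le> it q (Suc n) x"
proof (induction n arbitrary: x)
  case (Suc n)
  have "K (it q n) x \<le> K (it q (Suc n)) x" by (rule K_mono) (rule Suc)
  then show ?case by (simp add: add_left_mono)
qed simp

lemma incseq_it: "incseq (\<lambda>n. it q n x)"
  by (rule incseq_SucI) (rule it_mono_n)

text \<open>The least solution of \<open>w = q + K w\<close>.\<close>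

definition U :: "(pt \<Rightarrow> ennreal) \<Rightarrow> pt \<Rightarrow> ennreal" where
  "U q x = (SUP n. it q n x)"

lemma pm_U [simp]: "pm q \<Longrightarrow> pm (U q)"
proof -
  assume "pm q"
  then have p: "pm (it q n)" for n by simp
  then have "it q n \<in> borel_measurable borel" for n by (rule pm_measurable)
  then have "U q \<in> borel_measurable borel" unfolding U_def[abs_def] by measurable
  moreover have "periodic2 (\<lambda>y. U q (t, y))" for t
    using p unfolding pm_def periodic2_def U_def by simp
  ultimately show ?thesis by (simp add: pm_def)
qed

lemma incseq_fun_it: "incseq (\<lambda>n x. it q n (f x))"
  by (rule incseq_SucI) (use it_mono_n in \<open>auto simp: le_fun_def\<close>)

lemma pm_reflect_measurable: "pm q \<Longrightarrow> (\<lambda>n. q (x - n)) \<in> borel_measurable borel"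
  by (rule measurable_compose[OF _ pm_measurable]) measurable

lemma K_U: "pm q \<Longrightarrow> K (U q) x = (SUP n. K (it q n) x)"
  unfolding K_def U_def
  by (rule nn_integral_monotone_convergence_SUP[OF incseq_fun_it])
     (auto intro: pm_reflect_measurable)

lemma U_eq: "pm q \<Longrightarrow> U q x = q x + K (U q) x"
proof -
  assume q: "pm q"
  have "U q x = (SUP n. it q (Suc n) x)"
    unfolding U_def by (rule SUP_eq) (use it_mono_n in blast, blast)
  also have "\<dots> = (SUP n. q x + K (it q n) x)" by simp
  also have "\<dots> = (SUP n::nat. q x) + (SUP n. K (it q n) x)"
  proof (rule ennreal_SUP_add)
    show "incseq (\<lambda>n. K (it q n) x)"
      by (rule incseq_SucI) (intro K_mono it_mono_n)
  qed (simp add: incseq_def)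
  finally show ?thesis using K_U[OF q] by simp
qed

lemma K_U_le: "pm q \<Longrightarrow> K (U q) x \<le> U q x"
  using U_eq[of q x] by (metis add.commute add_increasing2 order_refl zero_le)

lemma le_U: "pm q \<Longrightarrow> q x \<le> U q x"
  using U_eq[of q x] by (metis add_increasing2 order_refl zero_le)

text \<open>A supersolution dominates every partial sum by induction. Pointwise bounds on
  \<open>U\<close> are thereby reduced to the verification of one inequality.\<close>

lemma U_least: assumes "\<And>x. q x + K w x \<le> w x" shows "U q x \<le> w x"
proof -
  have "it q n x \<le> w x" for n
  proof (induction n arbitrary: x)
    case (Suc n)
    have "q x + K (it q n) x \<le> q x + K w x"
      by (intro add_left_mono K_mono Suc)
    also have "\<dots> \<le> w x" by (rule assms)
    finally show ?case by simp
  qed simp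
  then show ?thesis unfolding U_def by (rule SUP_least)
qed

lemma U_mono: assumes "\<And>x. q x \<le> r x" shows "U q x \<le> U r x"
proof -
  have "it q n x \<le> it r n x" for n
  proof (induction n arbitrary: x)
    case (Suc n)
    show ?case unfolding it.simps by (intro add_mono K_mono Suc assms)
  qed simp
  then show ?thesis unfolding U_def by (intro SUP_mono) auto
qed

lemma U_add: assumes "pm q" "pm r" shows "U (\<lambda>x. q x + r x) x = U q x + U r x"
proof -
  have "it (\<lambda>x. q x + r x) n x = it q n x + it r n x" for n
  proof (induction n arbitrary: x)
    case (Suc n)
    have "it (\<lambda>x. q x + r x) n = (\<lambda>x. it q n x + it r n x)" using Suc by auto
    then show ?case using assms by (simp add: K_add ac_simps)
  qed simp
  then show ?thesis
    unfolding U_def by (simp add: ennreal_SUP_add incseq_it)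
qed

lemma U_K: assumes "pm q" shows "U (K q) x = K (U q) x"
proof -
  have "it (K q) n x = K (it q n) x" for n
  proof (induction n arbitrary: x)
    case 0 then show ?case by (simp add: K_def)
  next
    case (Suc n)
    have "it (K q) n = K (it q n)" using Suc by auto
    then show ?case using assms by (simp add: K_add)
  qed
  then show ?thesis using K_U[OF assms] by (simp add: U_def[of "K q"])
qed

text \<open>The remainder w' - \<open>it a n\<close> is the n-th power of \<open>K\<close> applied
  to w', hence at most the same power applied to \<open>U q\<close>, which is \<open>U q\<close> -
  \<open>it q n\<close> and tends to zero because \<open>U q\<close> is finite. The induction
  carries this inequality in additive form, as subtraction of extended reals is truncated.\<close>

lemma U_unique:
  assumes q: "pm a" "pm w'" "pm q" and eq: "\<And>x. w' x = a x + K w' x" and le: "\<And>x. w' x \<le> U q x"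
    and fin: "\<And>x. U q x < \<infinity>"
  shows "w' x = U a x"
proof (rule antisym)
  have "w' x + it q n x \<le> it a n x + U q x" for n
  proof (induction n arbitrary: x)
    case 0 then show ?case using le by simp
  next
    case (Suc n)
    have "w' x + it q (Suc n) x = a x + q x + (K w' x + K (it q n) x)"
      by (subst eq) (simp add: ac_simps)
    also have "K w' x + K (it q n) x = K (\<lambda>x. w' x + it q n x) x"
      using q by (simp add: K_add)
    also have "\<dots> \<le> K (\<lambda>x. it a n x + U q x) x" by (rule K_mono) (rule Suc)
    also have "\<dots> = K (it a n) x + K (U q) x" using q by (simp add: K_add)
    also have "a x + q x + (K (it a n) x + K (U q) x) = it a (Suc n) x + U q x"
      using U_eq[OF q(3), of x] by (simp add: ac_simps)
    finally show ?case by (simp add: add_left_mono)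
  qed
  also have "it a n x + U q x \<le> U a x + U q x" for n
    unfolding U_def[of a] by (intro add_right_mono SUP_upper) simp
  finally have "(SUP n. w' x + it q n x) \<le> U a x + U q x" by (intro SUP_least)
  moreover have "(SUP n. w' x + it q n x) = w' x + U q x"
    unfolding U_def[of q] by (subst ennreal_SUP_add) (auto simp: incseq_it incseq_def)
  ultimately have "w' x + U q x \<le> U a x + U q x" by simp
  then show "w' x \<le> U a x" using fin[of x] by (auto simp: ennreal_add_left_cancel_le add.commute)
  show "U a x \<le> w' x" by (rule U_least) (simp add: eq[symmetric])
qed

section \<open>Conservation of mass and restarting\<close>

definition I :: "(pt \<Rightarrow> ennreal) \<Rightarrow> ennreal" where "I q = (\<integral>\<^sup>+x. q x \<partial>wallm)"

lemma I_add: "pm q \<Longrightarrow> pm r \<Longrightarrow> I (\<lambda>x. q x + r x) = I q + I r"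
  unfolding I_def by (intro nn_integral_add) (auto dest: pm_measurable)

lemma I_mono: "(\<And>x. q x \<le> r x) \<Longrightarrow> I q \<le> I r"
  unfolding I_def by (intro nn_integral_mono) auto

lemma I_cmult: "pm q \<Longrightarrow> I (\<lambda>x. c * q x) = c * I q"
  unfolding I_def by (intro nn_integral_cmult) (auto dest: pm_measurable)

lemma I_time: "g \<in> borel_measurable borel \<Longrightarrow> I (\<lambda>x. g (fst x)) = (\<integral>\<^sup>+t. g t \<partial>lborel)"
  unfolding I_def by (subst nn_integral_wallm) (auto simp: cellm.emeasure_space_1[simplified])

lemma I_split: "pm q \<Longrightarrow> I q = I (upto s q) + I (aft s q)"
  using I_add[of "upto s q" "aft s q"] by (simp add: upto_aft)

lemma I_K: "pm q \<Longrightarrow> I (K q) = I q"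
  unfolding I_def by (rule K_mass)

text \<open>The source that restarts the process at time \<open>s\<close>: first visits after \<open>s\<close> and flights that cross \<open>s\<close>.\<close>

definition A :: "real \<Rightarrow> (pt \<Rightarrow> ennreal) \<Rightarrow> pt \<Rightarrow> ennreal" where
  "A s q = aft s (\<lambda>x. q x + K (upto s (U q)) x)"

lemma pm_A [simp]: "pm q \<Longrightarrow> pm (A s q)"
  unfolding A_def by (intro pm_aft pm_add pm_K pm_upto pm_U)

lemma K_split: "pm q \<Longrightarrow> K q x = K (upto s q) x + K (aft s q) x"
  using K_add[of "upto s q" "aft s q" x] by (simp add: upto_aft)

text \<open>Up to time s the flux consists of the source and of the returns; since \<open>K\<close>
  preserves mass, it also splits into the returns up to s and the flights still under way at s. The
  returns cancel, for which they have to be finite, and what is in flight at s is what the source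
  has fed in.\<close>

lemma conservation:
  assumes q: "pm q" and fin: "I (upto s (U q)) < \<infinity>"
  shows "I (aft s (K (upto s (U q)))) = I (upto s q)"
proof -
  let ?w = "upto s (U q)"
  have "?w x = upto s q x + upto s (K ?w) x" for x
  proof (cases "fst x \<le> s")
    case True
    have "K (aft s (U q)) x = 0" using True by (subst K_aft) (simp add: aft_def[of _ "K _"])
    then show ?thesis using True U_eq[OF q, of x] K_split[OF pm_U[OF q], of x s]
      by (simp add: upto_def[of s "U q" x] upto_def[of s q] upto_def[of s "K _"])
  qed (simp add: upto_def)
  then have "I ?w = I (\<lambda>x. upto s q x + upto s (K ?w) x)" by (metis (no_types, lifting) ext)
  also have "\<dots> = I (upto s q) + I (upto s (K ?w))" using q by (simp add: I_add)
  finally have 1: "I ?w = I (upto s q) + I (upto s (K ?w))" .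
  have 2: "I ?w = I (upto s (K ?w)) + I (aft s (K ?w))"
    using q I_K[of ?w] I_split[of "K ?w" s] by simp
  have "I (upto s (K ?w)) < \<infinity>" using fin 2 by (metis ennreal_add_eq_top infinity_ennreal_def less_top)
  then show ?thesis using 1 2
    by (metis add.commute ennreal_add_left_cancel infinity_ennreal_def less_irrefl)
qed

lemma A_mass:
  assumes q: "pm q" and fin: "I (upto s (U q)) < \<infinity>"
  shows "I (A s q) = I q"
proof -
  have "A s q = (\<lambda>x. aft s q x + aft s (K (upto s (U q))) x)"
    by (auto simp: A_def aft_def)
  then show ?thesis
    using q conservation[OF assms] I_split[OF q, of s] by (simp add: I_add add.commute)
qed

text \<open>The Markov property. The flux after s solves the renewal equation with the restarted
  source and stays below the finite flux \<open>U q\<close>, so that \<open>U_unique\<close>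
  identifies it with the least solution.\<close>

lemma aft_U:
  assumes q: "pm q" and fin: "\<And>x. U q x < \<infinity>"
  shows "aft s (U q) x = U (A s q) x"
proof (rule U_unique[of _ _ q])
  show "aft s (U q) x = A s q x + K (aft s (U q)) x" for x
  proof (cases "s < fst x")
    case True
    then show ?thesis using U_eq[OF q, of x] K_split[OF pm_U[OF q], of x s]
      by (simp add: A_def aft_def[of s "U q" x] aft_def[of s "\<lambda>x. _ x + _ x"] ac_simps)
  next
    case False
    then show ?thesis by (subst K_aft) (simp add: A_def aft_def)
  qed
  show "aft s (U q) x \<le> U q x" for x by (simp add: aft_def)
qed (use q fin in auto)

section \<open>Domination by the equilibrium\<close>

text \<open>The returns after s of the equilibrium with unit wall flux: emission at unit rate at all
  times up to s comes back at time t at the rate P(T \<ge> t - s).\<close>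

definition tail :: "real \<Rightarrow> pt \<Rightarrow> ennreal" where
  "tail s x = (if s < fst x then tl (fst x - s) else 0)"

definition strip :: "real \<Rightarrow> real \<Rightarrow> pt \<Rightarrow> ennreal" where
  "strip s s' x = indicator {s<..s'} (fst x)"

lemma pm_strip [simp]: "pm (strip s s')"
  unfolding strip_def[abs_def] by (rule pm_time) simp

lemma pm_tail [simp]: "pm (tail s)"
  unfolding tail_def[abs_def] by (rule pm_time[of "\<lambda>t. if s < t then tl (t - s) else 0"]) measurable

lemma K_indicator: "S \<in> sets borel \<Longrightarrow> K (\<lambda>x. indicator S (fst x)) x = (\<integral>\<^sup>+n. indicator S (fst x - fst n) \<partial>N)"
  unfolding K_def by (simp add: minus_prod_def)

text \<open>Durations of at least t - s and durations in [t - s', t - s) together exhaust those of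
  at least t - s'.\<close>

lemma tail_strip:
  assumes "s \<le> s'" "s' < fst x"
  shows "tail s x + K (strip s s') x = tail s' x"
proof -
  have [measurable]: "(\<lambda>n. indicator {s<..s'} (fst x - fst n) :: ennreal) \<in> borel_measurable borel"
    by measurable
  have "tail s x + K (strip s s') x = (\<integral>\<^sup>+n. indicator {fst x - s..} (fst n) \<partial>N) + (\<integral>\<^sup>+n. indicator {s<..s'} (fst x - fst n) \<partial>N)"
    using assms by (simp add: tail_def tl_alt strip_def[abs_def] K_indicator)
  also have "\<dots> = (\<integral>\<^sup>+n. indicator {fst x - s..} (fst n) + indicator {s<..s'} (fst x - fst n) \<partial>N)"
    by (intro nn_integral_add[symmetric]) auto
  also have "\<dots> = (\<integral>\<^sup>+n. indicator {fst x - s'..} (fst n) \<partial>N)"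
    using assms by (intro nn_integral_cong) (auto simp: indicator_def)
  finally show ?thesis using assms by (simp add: tail_def tl_alt)
qed

text \<open>A flight that ends at time t began either up to s or after s. Hence the constant flux 1
  after s solves the renewal equation with source \<open>tail s\<close>.\<close>

lemma tail_after:
  assumes "s < fst x"
  shows "tail s x + K (\<lambda>x. indicator {s<..} (fst x)) x = 1"
proof -
  have "tail s x + K (\<lambda>x. indicator {s<..} (fst x)) x = (\<integral>\<^sup>+n. indicator {fst x - s..} (fst n) \<partial>N) + (\<integral>\<^sup>+n. indicator {s<..} (fst x - fst n) \<partial>N)"
    using assms by (simp add: tail_def tl_alt K_indicator)
  also have "\<dots> = (\<integral>\<^sup>+n. indicator {fst x - s..} (fst n) + indicator {s<..} (fst x - fst n) \<partial>N)"
    by (intro nn_integral_add[symmetric]) auto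
  also have "\<dots> = (\<integral>\<^sup>+n. 1 \<partial>N)"
    using assms by (intro nn_integral_cong) (auto simp: indicator_def)
  also have "\<dots> = 1" using emeasure_space_1 by simp
  finally show ?thesis .
qed

text \<open>By \<open>tail_after\<close> the constant \<open>\<kappa>\<close> after s is a
  supersolution, and \<open>U_least\<close> applies. This is the source of all pointwise bounds on
  fluxes.\<close>

lemma U_dominated:
  assumes "\<And>x. q x \<le> \<kappa> * tail s x"
  shows "U q x \<le> \<kappa> * indicator {s<..} (fst x)"
proof (rule U_least)
  fix x
  have i: "pm (\<lambda>x. indicator {s<..} (fst x))" by (rule pm_time) simp
  show "q x + K (\<lambda>x. \<kappa> * indicator {s<..} (fst x)) x \<le> \<kappa> * indicator {s<..} (fst x)"
  proof (cases "s < fst x")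
    case True
    have "q x + K (\<lambda>x. \<kappa> * indicator {s<..} (fst x)) x \<le> \<kappa> * tail s x + \<kappa> * K (\<lambda>x. indicator {s<..} (fst x)) x"
      using assms[of x] by (simp add: K_cmult[OF i] add_right_mono)
    also have "\<dots> = \<kappa> * (tail s x + K (\<lambda>x. indicator {s<..} (fst x)) x)" by (simp add: distrib_left)
    also have "\<dots> = \<kappa>" using tail_after[OF True] by simp
    finally show ?thesis using True by simp
  next
    case False
    have "(\<lambda>x. \<kappa> * indicator {s<..} (fst x)) = aft s (\<lambda>x. \<kappa>)" by (auto simp: aft_def)
    then have "K (\<lambda>x. \<kappa> * indicator {s<..} (fst x)) x = 0"
      using False by (simp only:) (subst K_aft, simp add: aft_def[of _ "K _"])
    then show ?thesis using False assms[of x] by (simp add: tail_def)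
  qed
qed

lemma upto_U_dominated:
  assumes "\<And>x. q x \<le> \<kappa> * tail s x"
  shows "upto s' (U q) x \<le> \<kappa> * strip s s' x"
  using U_dominated[OF assms, of x] by (auto simp: upto_def strip_def indicator_def split: if_splits)

lemma I_strip: "I (strip s s') = ennreal (max 0 (s' - s))"
  unfolding strip_def[abs_def] by (subst I_time) (auto simp: max_def)

lemma I_upto_U_finite:
  assumes "\<And>x. q x \<le> \<kappa> * tail s x" "\<kappa> < \<infinity>"
  shows "I (upto s' (U q)) < \<infinity>"
proof -
  have "I (upto s' (U q)) \<le> I (\<lambda>x. \<kappa> * strip s s' x)"
    by (rule I_mono) (rule upto_U_dominated[OF assms(1)])
  also have "\<dots> < \<infinity>" using assms(2) by (simp add: I_cmult I_strip ennreal_mult_less_top)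
  finally show ?thesis .
qed

text \<open>The domination survives a restart with the same \<open>\<kappa>\<close>: flights from
  before s' are bounded by \<open>tail s\<close> plus the returns of a constant flux on (s, s'],
  which is \<open>tail s'\<close> by \<open>tail_strip\<close>. Coupling can therefore be iterated
  without loss.\<close>

lemma A_dominated:
  assumes q: "\<And>x. q x \<le> \<kappa> * tail s x" and "s \<le> s'"
  shows "A s' q x \<le> \<kappa> * tail s' x"
proof (cases "s' < fst x")
  case True
  have "A s' q x = q x + K (upto s' (U q)) x" using True by (simp add: A_def aft_def)
  also have "\<dots> \<le> \<kappa> * tail s x + K (\<lambda>x. \<kappa> * strip s s' x) x"
    by (intro add_mono q K_mono upto_U_dominated)
  also have "\<dots> = \<kappa> * (tail s x + K (strip s s') x)" by (simp add: K_cmult distrib_left)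
  finally show ?thesis using tail_strip[OF \<open>s \<le> s'\<close> True] by simp
qed (simp add: A_def aft_def)

lemma I_aft_tail: "0 \<le> R \<Longrightarrow> I (aft (s + R) (tail s)) = tau R"
proof -
  assume R: "0 \<le> R"
  have "I (aft (s + R) (tail s)) = I (\<lambda>x. (\<lambda>t. tl (t - s) * indicator {s + R<..} t) (fst x))"
    using R unfolding I_def by (intro nn_integral_cong) (auto simp: aft_def tail_def)
  also have "\<dots> = (\<integral>\<^sup>+t. tl (t - s) * indicator {s + R<..} t \<partial>lborel)"
    by (subst I_time) auto
  also have "\<dots> = (\<integral>\<^sup>+t. tl (s + 1 * t - s) * indicator {s + R<..} (s + 1 * t) \<partial>lborel)"
    by (subst nn_integral_real_affine[where c=1 and t=s]) auto
  also have "\<dots> = tau R" unfolding tau_def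
    by (intro nn_integral_cong) (auto simp: indicator_def)
  finally show ?thesis .
qed

lemma I_tail: "I (tail s) = tau 0"
proof -
  have "aft (s + 0) (tail s) = tail s" by (auto simp: aft_def tail_def)
  then show ?thesis using I_aft_tail[of 0 s] by simp
qed

lemma tau_antimono: "r \<le> s \<Longrightarrow> tau s \<le> tau r"
  unfolding tau_def by (intro nn_integral_mono) (auto simp: indicator_def)

lemma tau_finite: "tau 0 < \<infinity>" using tau_fin by (simp add: tau_def tl_def)

lemma tau_finite': "0 \<le> r \<Longrightarrow> tau r < \<infinity>"
  using tau_antimono[of 0 r] tau_finite by (rule le_less_trans)

lemma tau_small: "e > 0 \<Longrightarrow> \<exists>r>0. tau r \<le> ennreal e"
  using tau_lim by (simp add: tau_def tl_def)

section \<open>Averaging over the torus\<close>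

text \<open>The average is kept as a function on the wall, constant in the horizontal variable, so
  that \<open>K\<close> and \<open>U\<close> still apply to it.\<close>

definition bar :: "(pt \<Rightarrow> ennreal) \<Rightarrow> pt \<Rightarrow> ennreal" where
  "bar q x = (\<integral>\<^sup>+y. q (fst x, y) \<partial>cellm)"

lemma bar_borel:
  fixes q :: "pt \<Rightarrow> ennreal"
  assumes [measurable]: "q \<in> borel_measurable borel"
  shows "(\<lambda>t. \<integral>\<^sup>+y. q (t, y) \<partial>cellm) \<in> borel_measurable borel"
  by (intro cellm.borel_measurable_nn_integral) measurable

lemma bar_K: assumes q: "pm q" shows "bar (K q) x = K (bar q) x"
proof -
  have [measurable]: "q \<in> borel_measurable borel" using q by (rule pm_measurable)
  interpret Nc: pair_sigma_finite N cellm ..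
  have B: "borel_measurable (borel \<Otimes>\<^sub>M (borel :: (real^2) measure)) = (borel_measurable (N \<Otimes>\<^sub>M cellm) :: (_ \<Rightarrow> ennreal) set)"
    by (intro measurable_cong_sets sets_pair_measure_cong) (auto simp: sets_N)
  have "(\<lambda>z. q ((fst x, snd z) - fst z)) \<in> borel_measurable (borel \<Otimes>\<^sub>M (borel :: (real^2) measure))"
    unfolding borel_prod by measurable
  then have m: "case_prod (\<lambda>n y. q ((fst x, y) - n)) \<in> borel_measurable (N \<Otimes>\<^sub>M cellm)"
    unfolding B by (simp add: case_prod_beta')
  have "bar (K q) x = (\<integral>\<^sup>+n. (\<integral>\<^sup>+y. q ((fst x, y) - n) \<partial>cellm) \<partial>N)"
    unfolding bar_def K_def by (rule Nc.Fubini'[OF m])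
  also have "\<dots> = (\<integral>\<^sup>+n. bar q (x - n) \<partial>N)"
  proof (rule nn_integral_cong)
    fix n
    show "(\<integral>\<^sup>+y. q ((fst x, y) - n) \<partial>cellm) = bar q (x - n)"
      using nn_integral_cellm_shift[of "\<lambda>y. q (fst x - fst n, y)" "- snd n"] q
      by (simp add: bar_def pm_def minus_prod_def)
  qed
  finally show ?thesis by (simp add: K_def)
qed

lemma bar_it: assumes q: "pm q" shows "bar (it q n) x = it (bar q) n x"
proof (induction n arbitrary: x)
  case (Suc n)
  have "bar (it q (Suc n)) x = bar q x + bar (K (it q n)) x"
    unfolding it.simps bar_def using q
    by (intro nn_integral_add) (auto intro!: measurable_compose[OF _ pm_measurable])
  also have "bar (K (it q n)) x = K (it (bar q) n) x"
  proof -
    have "bar (it q n) = it (bar q) n" by (rule ext) (rule Suc)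
    then show ?thesis using q by (simp add: bar_K)
  qed
  finally show ?case by simp
qed (simp add: bar_def)

lemma bar_U: assumes q: "pm q" shows "bar (U q) x = U (bar q) x"
proof -
  have "bar (U q) x = (SUP n. bar (it q n) x)"
    unfolding bar_def U_def
    by (rule nn_integral_monotone_convergence_SUP[OF incseq_fun_it])
       (use q in \<open>auto intro!: measurable_compose[OF _ pm_measurable]\<close>)
  then show ?thesis by (simp add: bar_it[OF q] U_def)
qed

lemma I_bar_time:
  assumes p: "pm p" and [measurable]: "f \<in> borel_measurable borel"
  shows "(\<integral>\<^sup>+t. (\<integral>\<^sup>+y. p (t, y) \<partial>cellm) * f t \<partial>lborel) = (\<integral>\<^sup>+z. p z * f (fst z) \<partial>wallm)"
proof -
  have [measurable]: "p \<in> borel_measurable borel" using p by (rule pm_measurable)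
  show ?thesis
    by (simp add: nn_integral_wallm nn_integral_multc)
qed

text \<open>After averaging over the torus only time matters, and there \<open>g\<close> below is a supersolution because a flight
  ends before or after the observation time.\<close>

lemma bar_U_K_bound:
  assumes p: "pm p"
  shows "(\<integral>\<^sup>+y. U (K p) (t, y) \<partial>cellm) \<le> ennreal B * I p"
proof -
  have [measurable]: "p \<in> borel_measurable borel" using p by (rule pm_measurable)
  define G where "G t = (\<integral>\<^sup>+y. p (t, y) \<partial>cellm)" for t
  have [measurable]: "G \<in> borel_measurable borel"
    unfolding G_def[abs_def] by (rule bar_borel) measurable
  \<comment> \<open>The candidate for the supersolution: B times the mass that p has emitted before
    the time of x. It bounds the averaged flux after at least one flight by the mass of p
    alone.\<close>
  define g :: "pt \<Rightarrow> ennreal" where "g x = ennreal B * (\<integral>\<^sup>+z. p z * indicator {..<fst x} (fst z) \<partial>wallm)" for x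
  \<comment> \<open>The hazard bound replaces the law of the duration by its tail.\<close>
  have 1: "K (bar p) x \<le> ennreal B * (\<integral>\<^sup>+z. p z * (tl (fst x - fst z) * indicator {..<fst x} (fst z)) \<partial>wallm)" for x
  proof -
    have "K (bar p) x = (\<integral>\<^sup>+n. G (fst x - fst n) \<partial>N)"
      by (simp add: K_def bar_def G_def)
    also have "\<dots> \<le> ennreal B * (\<integral>\<^sup>+s. G (fst x - s) * tl s * indicator {0<..} s \<partial>lborel)"
      unfolding tl_def by (rule hazard[of "\<lambda>s. G (fst x - s)"]) measurable
    also have "(\<integral>\<^sup>+s. G (fst x - s) * tl s * indicator {0<..} s \<partial>lborel)
       = (\<integral>\<^sup>+r. G (fst x - (fst x + (-1) * r)) * tl (fst x + (-1) * r) * indicator {0<..} (fst x + (-1) * r) \<partial>lborel)"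
      by (subst nn_integral_real_affine[where c="-1" and t="fst x"]) auto
    also have "\<dots> = (\<integral>\<^sup>+r. G r * (tl (fst x - r) * indicator {..<fst x} r) \<partial>lborel)"
      by (intro nn_integral_cong) (auto simp: indicator_def)
    also have "\<dots> = (\<integral>\<^sup>+z. p z * (tl (fst x - fst z) * indicator {..<fst x} (fst z)) \<partial>wallm)"
      unfolding G_def by (subst I_bar_time[OF p]) auto
    finally show ?thesis .
  qed
  have 2: "K g x = ennreal B * (\<integral>\<^sup>+z. p z * (\<integral>\<^sup>+n. indicator {..<fst x - fst n} (fst z) \<partial>N) \<partial>wallm)" for x
  proof -
    have m: "(\<lambda>z. p (snd z) * indicator {..<fst x - fst (fst z)} (fst (snd z))) \<in> borel_measurable (borel :: (pt \<times> pt) measure)"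
      unfolding indicator_def lessThan_iff by measurable
    have "K g x = ennreal B * (\<integral>\<^sup>+n. (\<integral>\<^sup>+z. p z * indicator {..<fst x - fst n} (fst z) \<partial>wallm) \<partial>N)"
      unfolding K_def g_def
    proof (subst nn_integral_cmult)
      have "(\<lambda>z. p z * indicator {..<fst x - fst n} (fst z)) = (\<lambda>z. p z * indicator {..<fst (x - n)} (fst z))" for n by simp
      show "(\<lambda>n. \<integral>\<^sup>+z. p z * indicator {..<fst (x - n)} (fst z) \<partial>wallm) \<in> borel_measurable N"
        unfolding measurable_N_iff
        by (rule wallm.borel_measurable_nn_integral) (use m in \<open>simp add: case_prod_beta' fst_diff measurable_cong_sets[OF sets_pair_measure_cong[OF refl sets_wallm] refl] borel_prod\<close>)
    qed simp
    also have "(\<integral>\<^sup>+n. (\<integral>\<^sup>+z. p z * indicator {..<fst x - fst n} (fst z) \<partial>wallm) \<partial>N)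
      = (\<integral>\<^sup>+z. (\<integral>\<^sup>+n. p z * indicator {..<fst x - fst n} (fst z) \<partial>N) \<partial>wallm)"
      by (rule Fubini_Nw[symmetric]) (rule m)
    also have "\<dots> = (\<integral>\<^sup>+z. p z * (\<integral>\<^sup>+n. indicator {..<fst x - fst n} (fst z) \<partial>N) \<partial>wallm)"
      by (intro nn_integral_cong nn_integral_cmult) (simp add: indicator_def)
    finally show ?thesis .
  qed
  \<comment> \<open>A flight that starts at a lasts at least up to the time of x or ends before it,
    so the two probabilities add up to one.\<close>
  have 3: "tl (fst x - a) * indicator {..<fst x} a + (\<integral>\<^sup>+n. indicator {..<fst x - fst n} a \<partial>N) = indicator {..<fst x} a" for x :: pt and a
  proof (cases "a < fst x")
    case True
    have "tl (fst x - a) + (\<integral>\<^sup>+n. indicator {..<fst x - fst n} a \<partial>N)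
       = (\<integral>\<^sup>+n. indicator {fst x - a..} (fst n) + indicator {..<fst x - fst n} a \<partial>N)"
      unfolding tl_alt by (intro nn_integral_add[symmetric]) (auto simp: indicator_def)
    also have "\<dots> = (\<integral>\<^sup>+n. 1 \<partial>N)" by (intro nn_integral_cong) (auto simp: indicator_def)
    also have "\<dots> = 1" using emeasure_space_1 by simp
    finally show ?thesis using True by simp
  next
    case False
    have "AE n in N. (indicator {..<fst x - fst n} a :: ennreal) = 0"
      using pos by eventually_elim (use False in auto)
    then have "(\<integral>\<^sup>+n. indicator {..<fst x - fst n} a \<partial>N) = (\<integral>\<^sup>+n. 0 \<partial>N)" by (rule nn_integral_cong_AE)
    then show ?thesis using False by simp
  qed
  have "bar (U (K p)) x \<le> g x" for x
  proof -
    have "K (bar p) x + K g x \<le> g x" for x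
    proof -
      have "K (bar p) x + K g x \<le> ennreal B * ((\<integral>\<^sup>+z. p z * (tl (fst x - fst z) * indicator {..<fst x} (fst z)) \<partial>wallm)
         + (\<integral>\<^sup>+z. p z * (\<integral>\<^sup>+n. indicator {..<fst x - fst n} (fst z) \<partial>N) \<partial>wallm))"
        using 1[of x] by (simp add: 2 distrib_left)
      also have "(\<integral>\<^sup>+z. p z * (tl (fst x - fst z) * indicator {..<fst x} (fst z)) \<partial>wallm)
         + (\<integral>\<^sup>+z. p z * (\<integral>\<^sup>+n. indicator {..<fst x - fst n} (fst z) \<partial>N) \<partial>wallm)
        = (\<integral>\<^sup>+z. p z * (tl (fst x - fst z) * indicator {..<fst x} (fst z)) + p z * (\<integral>\<^sup>+n. indicator {..<fst x - fst n} (fst z) \<partial>N) \<partial>wallm)"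
      proof (rule nn_integral_add[symmetric])
        have "(\<lambda>z. \<integral>\<^sup>+n. indicator {..<fst x - fst n} z \<partial>N) \<in> borel_measurable (borel :: real measure)"
          by (rule borel_measurable_nn_integral)
             (simp add: measurable_cong_sets[OF sets_pair_measure_cong[OF refl sets_N] refl] borel_prod case_prod_beta' indicator_def)
        then have "(\<lambda>z. \<integral>\<^sup>+n. indicator {..<fst x - fst n} (fst z) \<partial>N) \<in> borel_measurable (borel :: pt measure)"
          by (rule measurable_compose[OF fst_borel])
        then show "(\<lambda>z. p z * (\<integral>\<^sup>+n. indicator {..<fst x - fst n} (fst z) \<partial>N)) \<in> borel_measurable wallm"
          by measurable
      qed measurable
      also have "\<dots> = (\<integral>\<^sup>+z. p z * indicator {..<fst x} (fst z) \<partial>wallm)"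
        by (simp only: distrib_left[symmetric] 3)
      finally show ?thesis by (simp add: g_def[of x])
    qed
    then have "U (bar (K p)) x \<le> g x"
      by (intro U_least) (simp add: bar_K[OF p])
    then show ?thesis using p by (simp add: bar_U)
  qed
  from this[of "(t, undefined)"] have "(\<integral>\<^sup>+y. U (K p) (t, y) \<partial>cellm) \<le> g (t, undefined)" by (simp add: bar_def)
  also have "\<dots> \<le> ennreal B * I p"
    unfolding g_def I_def by (intro mult_left_mono nn_integral_mono) (auto simp: indicator_def)
  finally show ?thesis .
qed

section \<open>Mass in flight and a uniform lower bound of the flux\<close>

text \<open>\<open>K_weight\<close> with the indicator of the times after t: each emission counts
  with the probability that its flight ends after t.\<close>

lemma I_aft_K:
  assumes p: "pm p"
  shows "I (aft t (K p)) = (\<integral>\<^sup>+x. p x * (\<integral>\<^sup>+n. indicator {t<..} (fst x + fst n) \<partial>N) \<partial>wallm)"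
proof -
  have "I (aft t (K p)) = (\<integral>\<^sup>+x. indicator {t<..} (fst x) * K p x \<partial>wallm)"
    unfolding I_def by (intro nn_integral_cong) (simp add: aft_def)
  then show ?thesis using K_weight[OF p, of "indicator {t<..}"] by simp
qed

lemma escape_le: "r \<le> t - a \<Longrightarrow> (\<integral>\<^sup>+n. indicator {t<..} (a + fst n) \<partial>N) \<le> tl r"
  unfolding tl_alt by (intro nn_integral_mono) (auto simp: indicator_def)

lemma escape_le_1: "(\<integral>\<^sup>+n. indicator {t<..} (a + fst n) \<partial>N) \<le> 1"
proof -
  have "(\<integral>\<^sup>+n. indicator {t<..} (a + fst n) \<partial>N) \<le> (\<integral>\<^sup>+n. 1 \<partial>N)"
    by (intro nn_integral_mono) (auto simp: indicator_def)
  then show ?thesis using emeasure_space_1 by simp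
qed

text \<open>The tail decreases, so its value at r + 1 is at most its mean over (r, r+1].\<close>

lemma tl_le_tau: "tl (r + 1) \<le> tau r"
proof -
  have "tl (r + 1) = (\<integral>\<^sup>+s. tl (r + 1) * indicator {r<..r+1} s \<partial>lborel)"
    by (subst nn_integral_cmult_indicator) auto
  also have "\<dots> \<le> tau r" unfolding tau_def
    by (intro nn_integral_mono) (auto simp: indicator_def intro: tl_antimono)
  finally show ?thesis .
qed

lemma tau_reflect:
  "(\<integral>\<^sup>+r. tl (t - r) * indicator {..<t - R} r \<partial>lborel) = tau R"
proof -
  have "(\<integral>\<^sup>+r. tl (t - r) * indicator {..<t - R} r \<partial>lborel)
    = (\<integral>\<^sup>+r. tl (t - (t + (-1) * r)) * indicator {..<t - R} (t + (-1) * r) \<partial>lborel)"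
    by (subst nn_integral_real_affine[where c="-1" and t=t]) auto
  also have "\<dots> = tau R" unfolding tau_def
    by (intro nn_integral_cong) (auto simp: indicator_def)
  finally show ?thesis .
qed

text \<open>The mass of \<open>q\<close> is conserved and long flights are rare, hence half of it lands in a bounded time window
  before \<open>t - 1\<close>. The Doeblin condition spreads this half over all of the wall at time \<open>t\<close>.\<close>

lemma lower_bound:
  "\<exists>c l. 0 < c \<and> c \<le> 1 \<and> 0 < l \<and> (\<forall>\<kappa> s q t y. \<kappa> < \<infinity> \<longrightarrow> pm q \<longrightarrow> (\<forall>x. q x \<le> \<kappa> * tail s x) \<longrightarrow>
     ennreal c * I (upto (t - l) q) \<le> U q (t, y))"
proof -
  \<comment> \<open>Two losses have to be at most a quarter of the mass each: a long initial flight,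
    with probability at most e, and later long flights, which carry at most B e of the mass.\<close>
  define e where "e = min (1/4) (1 / (4 * B))"
  have e: "e > 0" "e \<le> 1/4" "B * e \<le> 1/4" using B_pos by (auto simp: e_def min_def field_simps)
  obtain r where r: "r > 0" "tau r \<le> ennreal e" using tau_small[OF e(1)] by auto
  have "1 < 1 + r" using r by simp
  from minor[OF this] obtain c where c: "c > 0" and
    cm: "\<And>w t y. pm w \<Longrightarrow> ennreal c * (\<integral>\<^sup>+x. w x * indicator {t - (1 + r)..t - 1} (fst x) \<partial>wallm) \<le> (\<integral>\<^sup>+n. w ((t, y) - n) \<partial>N)"
    by blast
  have main: "ennreal (c / 2) * I (upto (t - (r + 2)) q) \<le> U q (t, y)"
    if \<kappa>: "\<kappa> < \<infinity>" and q: "pm q" and qt: "\<And>x. q x \<le> \<kappa> * tail s x" for \<kappa> s q t y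
  proof -
    \<comment> \<open>A source time up to t - (r + 2) leaves room for a flight of length r + 1 that
      lands by t - 1.\<close>
    define p where "p = upto (t - (r + 2)) q"
    have p: "pm p" unfolding p_def using q by simp
    have pq: "p x \<le> q x" for x by (simp add: p_def upto_def)
    have pt: "p x \<le> \<kappa> * tail s x" for x using pq qt by (rule order_trans)
    define t1 where "t1 = t - 1"
    \<comment> \<open>The flux after at least one flight, which has the averaged bound B
      \<open>I p\<close> of \<open>bar_U_K_bound\<close>.\<close>
    define w where "w = U (K p)"
    have w: "pm w" unfolding w_def using p by simp
    have wK: "w x = K (U p) x" for x unfolding w_def by (rule U_K[OF p])
    have wU: "w x \<le> U p x" for x unfolding wK by (rule K_U_le[OF p])
    have "I (upto t1 w) \<le> I (upto t1 (U p))" by (rule I_mono) (simp add: upto_def wU)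
    then have fin: "I (upto t1 w) < \<infinity>" using I_upto_U_finite[OF pt \<kappa>] by (rule le_less_trans)
    have "I p \<le> I (upto (t - (r + 2)) (U p))"
      proof (rule I_mono)
      fix x show "p x \<le> upto (t - (r + 2)) (U p) x"
        using le_U[OF p, of x] by (auto simp: p_def upto_def split: if_splits)
    qed
    then have fin_p: "I p < \<infinity>" using I_upto_U_finite[OF pt \<kappa>] by (rule le_less_trans)
    \<comment> \<open>Either the initial flight lasts beyond \<open>t1\<close>, or it has ended; in
      the second case conservation with the source \<open>K p\<close> says that the mass is in
      flight at \<open>t1\<close> again.\<close>
    have "I p = I (upto t1 (K p)) + I (aft t1 (K p))"
      using p I_K[OF p] I_split[of "K p" t1] by simp
    also have "I (upto t1 (K p)) = I (aft t1 (K (upto t1 w)))"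
      unfolding w_def using conservation[of "K p" t1] p fin by (simp add: w_def)
    also have "I (aft t1 (K p)) \<le> ennreal (1/4) * I p"
    proof -
      have "I (aft t1 (K p)) \<le> (\<integral>\<^sup>+x. p x * tl (r + 1) \<partial>wallm)"
        unfolding I_aft_K[OF p]
      proof (intro nn_integral_mono)
        fix x show "p x * (\<integral>\<^sup>+n. indicator {t1<..} (fst x + fst n) \<partial>N) \<le> p x * tl (r + 1)"
        proof (cases "fst x \<le> t - (r + 2)")
          case True then show ?thesis
            by (intro mult_left_mono escape_le) (auto simp: t1_def)
        qed (simp add: p_def upto_def)
      qed
      also have "\<dots> = I p * tl (r + 1)" unfolding I_def
        by (rule nn_integral_multc) (use p in \<open>auto dest: pm_measurable\<close>)
      also have "\<dots> \<le> I p * ennreal (1/4)"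
        by (intro mult_left_mono order_trans[OF tl_le_tau] order_trans[OF r(2)] ennreal_leI e) auto
      finally show ?thesis by (simp add: mult.commute)
    qed
    \<comment> \<open>Mass in flight at \<open>t1\<close> left the wall in the last r units of time
      or before. The older part needs flights longer than r and is at most B \<open>I p\<close>
      times \<open>tau r\<close>.\<close>
    also have "I (aft t1 (K (upto t1 w))) \<le> (\<integral>\<^sup>+x. w x * indicator {t1 - r..t1} (fst x) \<partial>wallm) + ennreal (1/4) * I p"
    proof -
      have [measurable]: "w \<in> borel_measurable borel" using w by (rule pm_measurable)
      have "I (aft t1 (K (upto t1 w))) \<le> (\<integral>\<^sup>+x. w x * indicator {t1 - r..t1} (fst x) + w x * (tl (t1 - fst x) * indicator {..<t1 - r} (fst x)) \<partial>wallm)"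
        using w unfolding I_aft_K[OF pm_upto[OF w]]
      proof (intro nn_integral_mono)
        fix x :: pt
        have "(\<integral>\<^sup>+n. indicator {t1<..} (fst x + fst n) \<partial>N) \<le> tl (t1 - fst x)" by (rule escape_le) simp
        moreover have "w x * (\<integral>\<^sup>+n. indicator {t1<..} (fst x + fst n) \<partial>N) \<le> w x * 1"
          by (intro mult_left_mono escape_le_1) auto
        ultimately show "upto t1 w x * (\<integral>\<^sup>+n. indicator {t1<..} (fst x + fst n) \<partial>N)
          \<le> w x * indicator {t1 - r..t1} (fst x) + w x * (tl (t1 - fst x) * indicator {..<t1 - r} (fst x))"
          using r by (auto simp: upto_def indicator_def intro: mult_left_mono)
      qed
      also have "\<dots> = (\<integral>\<^sup>+x. w x * indicator {t1 - r..t1} (fst x) \<partial>wallm) + (\<integral>\<^sup>+x. w x * (tl (t1 - fst x) * indicator {..<t1 - r} (fst x)) \<partial>wallm)"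
        by (intro nn_integral_add) auto
      also have "(\<integral>\<^sup>+x. w x * (tl (t1 - fst x) * indicator {..<t1 - r} (fst x)) \<partial>wallm)
         = (\<integral>\<^sup>+a. (\<integral>\<^sup>+y. w (a, y) \<partial>cellm) * (tl (t1 - a) * indicator {..<t1 - r} a) \<partial>lborel)"
        by (rule I_bar_time[OF w, symmetric]) measurable
      also have "\<dots> \<le> (\<integral>\<^sup>+a. (ennreal B * I p) * (tl (t1 - a) * indicator {..<t1 - r} a) \<partial>lborel)"
        unfolding w_def by (intro nn_integral_mono mult_right_mono bar_U_K_bound[OF p]) auto
      also have "\<dots> = ennreal B * I p * tau r"
        by (subst nn_integral_cmult) (auto simp: tau_reflect)
      also have "\<dots> \<le> ennreal B * I p * ennreal e" by (intro mult_left_mono r) auto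
      also have "\<dots> = ennreal (B * e) * I p" using B_pos e by (simp add: ennreal_mult ac_simps)
      also have "\<dots> \<le> ennreal (1/4) * I p" using e by (intro mult_right_mono ennreal_leI) auto
      finally show ?thesis by (simp add: add_left_mono)
    qed
    finally have le: "I p \<le> (\<integral>\<^sup>+x. w x * indicator {t1 - r..t1} (fst x) \<partial>wallm) + ennreal (1/4) * I p + ennreal (1/4) * I p"
      by (simp add: add_right_mono add_left_mono)
    have "ennreal (1/2) * I p \<le> (\<integral>\<^sup>+x. w x * indicator {t1 - r..t1} (fst x) \<partial>wallm)"
    proof (cases "(\<integral>\<^sup>+x. w x * indicator {t1 - r..t1} (fst x) \<partial>wallm)")
      case (real b)
      obtain a where a: "I p = ennreal a" "a \<ge> 0" using fin_p by (cases "I p") auto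
      have e: "ennreal r * ennreal a = ennreal (r * a)" if "0 \<le> r" for r
        using that a by (simp add: ennreal_mult)
      have "ennreal (b + 1/4 * a + 1/4 * a) = ennreal b + ennreal (1/4 * a) + ennreal (1/4 * a)"
        using real a by (subst ennreal_plus, simp, simp, subst ennreal_plus) auto
      also have "\<dots> = ennreal b + ennreal (1/4) * ennreal a + ennreal (1/4) * ennreal a"
        using e[of "1/4"] by (simp only:)
      finally have "ennreal a \<le> ennreal (b + 1/4 * a + 1/4 * a)"
        using le unfolding real(2) a(1) by simp
      then have "a \<le> b + 1/4 * a + 1/4 * a" using real a by (subst (asm) ennreal_le_iff) auto
      then have "1/2 * a \<le> b" by simp
      then show ?thesis unfolding real(2) a(1) by (subst e) (auto intro: ennreal_leI)
    qed auto
    \<comment> \<open>At least half of the mass leaves the wall in the window of the Doeblin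
      condition, whose length r + 1 was chosen to end at \<open>t1\<close> = t - 1.\<close>
    then have "ennreal c * (ennreal (1/2) * I p) \<le> ennreal c * (\<integral>\<^sup>+x. w x * indicator {t1 - r..t1} (fst x) \<partial>wallm)"
      by (intro mult_left_mono) auto
    also have "\<dots> \<le> K w (t, y)"
      using cm[OF w, of t y] by (simp add: K_def t1_def algebra_simps)
    also have "\<dots> \<le> K (U p) (t, y)" by (rule K_mono) (rule wU)
    also have "\<dots> \<le> U p (t, y)" by (rule K_U_le[OF p])
    also have "\<dots> \<le> U q (t, y)" by (rule U_mono) (rule pq)
    finally show ?thesis using c by (simp add: p_def ennreal_mult[symmetric] mult.assoc[symmetric] del: ennreal_half)
  qed
  have "ennreal (min 1 (c / 2)) * I (upto (t - (r + 2)) q) \<le> U q (t, y)"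
    if "\<kappa> < \<infinity>" "pm q" "\<forall>x. q x \<le> \<kappa> * tail s x" for \<kappa> s q t y
  proof -
    have "ennreal (min 1 (c / 2)) * I (upto (t - (r + 2)) q) \<le> ennreal (c / 2) * I (upto (t - (r + 2)) q)"
      by (intro mult_right_mono ennreal_leI) auto
    then show ?thesis using main[OF that(1,2), of s t y] that(3) by (meson order_trans)
  qed
  moreover have "0 < min 1 (c / 2)" "min 1 (c/2) \<le> 1" "0 < r + 2" using c r by auto
  ultimately show ?thesis by blast
qed

section \<open>Coupling of two fluxes of equal mass\<close>

text \<open>After time \<open>s\<close> the two fluxes agree up to the parts generated by two sources of equal mass.\<close>

definition coupled :: "(pt \<Rightarrow> ennreal) \<Rightarrow> (pt \<Rightarrow> ennreal) \<Rightarrow> real \<Rightarrow> real \<Rightarrow> real \<Rightarrow> bool" where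
  "coupled w1 w2 \<kappa> s m \<longleftrightarrow> (\<exists>h r1 r2. pm r1 \<and> pm r2 \<and>
     (\<forall>x. aft s w1 x = h x + U r1 x) \<and> (\<forall>x. aft s w2 x = h x + U r2 x) \<and>
     (\<forall>x. r1 x \<le> ennreal \<kappa> * tail s x) \<and> (\<forall>x. r2 x \<le> ennreal \<kappa> * tail s x) \<and>
     I r1 = I r2 \<and> I r1 \<le> ennreal m)"

lemma coupledE:
  assumes "coupled w1 w2 \<kappa> s m"
  obtains r1 r2 h where "pm r1" "pm r2" "\<forall>x. aft s w1 x = h x + U r1 x" "\<forall>x. aft s w2 x = h x + U r2 x"
    "\<forall>x. r1 x \<le> ennreal \<kappa> * tail s x" "\<forall>x. r2 x \<le> ennreal \<kappa> * tail s x" "I r1 = I r2" "I r1 \<le> ennreal m"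
proof -
  from assms obtain h r1 r2 where *: "pm r1 \<and> pm r2 \<and>
     (\<forall>x. aft s w1 x = h x + U r1 x) \<and> (\<forall>x. aft s w2 x = h x + U r2 x) \<and>
     (\<forall>x. r1 x \<le> ennreal \<kappa> * tail s x) \<and> (\<forall>x. r2 x \<le> ennreal \<kappa> * tail s x) \<and>
     I r1 = I r2 \<and> I r1 \<le> ennreal m"
    unfolding coupled_def by blast
  show thesis by (rule that[of r1 r2 h]) (insert *, (elim conjE, assumption)+)
qed

lemma U_finite:
  assumes "\<And>x. q x \<le> ennreal \<kappa> * tail s x"
  shows "U q x < \<infinity>"
proof -
  have "U q x \<le> ennreal \<kappa> * indicator {s<..} (fst x)" by (rule U_dominated[OF assms])
  also have "\<dots> < \<infinity>" by (simp add: indicator_def)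
  finally show ?thesis .
qed

lemma aft_aft: "s \<le> s' \<Longrightarrow> aft s' (aft s w) x = aft s' w x"
  by (simp add: aft_def)

text \<open>The part of each source up to s + R causes a flux of at least c \<alpha> on the whole
  wall during the last unit of time before the new restart time s'. One further flight turns it into
  a piece that both restarted sources share, and this piece is moved into the common flux h. The
  parts of the sources after s + R make up the error term with \<open>tau R\<close>.\<close>

lemma coupled_step:
  "\<exists>\<theta> l. 0 < \<theta> \<and> \<theta> \<le> 1 \<and> 0 < l \<and> (\<forall>w1 w2 \<kappa> s m R. 0 \<le> \<kappa> \<longrightarrow> 0 \<le> m \<longrightarrow> 0 \<le> R \<longrightarrow> coupled w1 w2 \<kappa> s m \<longrightarrow>
     coupled w1 w2 \<kappa> (s + R + l) ((1 - \<theta>) * m + \<theta> * \<kappa> * enn2real (tau R)))"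
proof -
  obtain c l where c: "0 < c" "c \<le> 1" "0 < l" and
    lb: "\<And>\<kappa> s q t y. \<kappa> < \<infinity> \<Longrightarrow> pm q \<Longrightarrow> (\<And>x. q x \<le> \<kappa> * tail s x) \<Longrightarrow> ennreal c * I (upto (t - l) q) \<le> U q (t, y)"
    using lower_bound by metis
  \<comment> \<open>For a time in [s' + 1, s' + 2] the window of length 3 contains the whole slab
    (s' - 1, s'] on which the lower bound holds.\<close>
  obtain d0 where d0: "d0 > 0" and
    dm0: "\<And>w t y. pm w \<Longrightarrow> ennreal d0 * (\<integral>\<^sup>+x. w x * indicator {t - 3..t - 1} (fst x) \<partial>wallm) \<le> (\<integral>\<^sup>+n. w ((t, y) - n) \<partial>N)"
    using minor[of 3] by auto
  \<comment> \<open>Capped at 1, so that \<open>\<theta>\<close> = c d is a valid fraction.\<close>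
  define d where "d = min 1 d0"
  have d: "0 < d" "d \<le> 1" using d0 by (auto simp: d_def)
  have dm: "ennreal d * (\<integral>\<^sup>+x. w x * indicator {t - 3..t - 1} (fst x) \<partial>wallm) \<le> K w (t, y)" if "pm w" for w t y
  proof -
    have "ennreal d * (\<integral>\<^sup>+x. w x * indicator {t - 3..t - 1} (fst x) \<partial>wallm) \<le> ennreal d0 * (\<integral>\<^sup>+x. w x * indicator {t - 3..t - 1} (fst x) \<partial>wallm)"
      by (intro mult_right_mono ennreal_leI) (auto simp: d_def)
    then show ?thesis using dm0[OF that, of t y] by (simp add: K_def)
  qed
  define \<theta> where "\<theta> = c * d"
  have \<theta>: "0 < \<theta>" "\<theta> \<le> 1" using c d by (auto simp: \<theta>_def mult_le_one)
  have "coupled w1 w2 \<kappa> (s + R + (l + 1)) ((1 - \<theta>) * m + \<theta> * \<kappa> * enn2real (tau R))"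
    if \<kappa>: "0 \<le> \<kappa>" and m: "0 \<le> m" and R: "0 \<le> R" and cp: "coupled w1 w2 \<kappa> s m" for w1 w2 \<kappa> s m R
  proof -
    obtain r1 r2 h where pm: "pm r1" "pm r2" and eq: "\<forall>x. aft s w1 x = h x + U r1 x" "\<forall>x. aft s w2 x = h x + U r2 x"
      and dom: "\<forall>x. r1 x \<le> ennreal \<kappa> * tail s x" "\<forall>x. r2 x \<le> ennreal \<kappa> * tail s x"
      and I12: "I r1 = I r2" and Im: "I r1 \<le> ennreal m"
      using cp by (rule coupledE)
    note eq = eq[rule_format] and dom = dom[rule_format]
    \<comment> \<open>The additional unit makes room for the slab (s' - 1, s'], at each time t of
      which t - l still exceeds s + R.\<close>
    define s' where "s' = s + R + (l + 1)"
    have ss': "s \<le> s'" using R c by (simp add: s'_def)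
    have \<kappa>f: "ennreal \<kappa> < \<infinity>" by simp
    define \<alpha> where "\<alpha> = min (I (upto (s + R) r1)) (I (upto (s + R) r2))"
    \<comment> \<open>A slab of unit length in time over a torus of unit area, so that its mass is
      exactly \<open>\<theta> * \<alpha>\<close>. It depends on the two sources only through
      \<open>\<alpha>\<close>, hence fits below both restarted sources.\<close>
    define p :: "pt \<Rightarrow> ennreal" where "p x = ennreal \<theta> * \<alpha> * indicator {s'+1..s'+2} (fst x)" for x
    have pmp: "pm p" unfolding p_def[abs_def] by (rule pm_time[of "\<lambda>t. ennreal \<theta> * \<alpha> * indicator {s'+1..s'+2} t"]) measurable
    have Ip: "I p = ennreal \<theta> * \<alpha>"
      unfolding p_def[abs_def] by (subst I_time[of "\<lambda>t. ennreal \<theta> * \<alpha> * indicator {s'+1..s'+2} t"]) (auto simp: nn_integral_cmult_indicator)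
    have pA: "p x \<le> A s' r x"
      if r: "pm r" "\<And>x. r x \<le> ennreal \<kappa> * tail s x" and \<alpha>r: "\<alpha> \<le> I (upto (s + R) r)" for r x
    proof (cases "fst x \<in> {s'+1..s'+2}")
      case True
      define b where "b = ennreal c * I (upto (s + R) r)"
      have 1: "b * strip (s' - 1) s' z \<le> upto s' (U r) z" for z
      proof (cases "fst z \<in> {s'-1<..s'}")
        case True
        have "b \<le> ennreal c * I (upto (fst z - l) r)"
          unfolding b_def using True by (intro mult_left_mono I_mono) (auto simp: upto_def s'_def)
        also have "\<dots> \<le> U r z" using lb[OF \<kappa>f r(1) r(2), of "fst z" "snd z"] by simp
        finally show ?thesis using True by (simp add: strip_def upto_def)
      qed (simp add: strip_def)
      have "(\<integral>\<^sup>+z. strip (s' - 1) s' z * indicator {fst x - 3..fst x - 1} (fst z) \<partial>wallm) = I (strip (s' - 1) s')"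
        unfolding I_def using True by (intro nn_integral_cong) (auto simp: strip_def indicator_def)
      then have "ennreal d * 1 \<le> K (strip (s' - 1) s') x"
        using dm[of "strip (s' - 1) s'" "fst x" "snd x"] by (simp add: I_strip)
      then have "b * ennreal d \<le> b * K (strip (s' - 1) s') x" by (intro mult_left_mono) auto
      also have "\<dots> = K (\<lambda>z. b * strip (s' - 1) s' z) x" by (simp add: K_cmult)
      also have "\<dots> \<le> K (upto s' (U r)) x" by (rule K_mono) (rule 1)
      also have "\<dots> \<le> A s' r x" using True by (simp add: A_def aft_def)
      finally have "b * ennreal d \<le> A s' r x" .
      moreover have "p x \<le> b * ennreal d"
      proof -
        have "p x = ennreal c * \<alpha> * ennreal d"
          using True c d by (simp add: p_def \<theta>_def ennreal_mult ac_simps)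
        also have "\<dots> \<le> b * ennreal d"
          unfolding b_def by (intro mult_right_mono mult_left_mono \<alpha>r) auto
        finally show ?thesis .
      qed
      ultimately show ?thesis by simp
    qed (simp add: p_def)
    \<comment> \<open>Removing p keeps the bound by the tail at s', which the restarted source
      satisfies by \<open>A_dominated\<close>, and lowers the mass by exactly that of p.\<close>
    have step: "\<exists>r'. pm r' \<and> (\<forall>x. aft s' w x = (aft s' h x + U p x) + U r' x) \<and> (\<forall>x. r' x \<le> ennreal \<kappa> * tail s' x)
        \<and> I r = I p + I r'"
      if r: "pm r" "\<And>x. r x \<le> ennreal \<kappa> * tail s x" and \<alpha>r: "\<alpha> \<le> I (upto (s + R) r)" and eqr: "\<And>x. aft s w x = h x + U r x" for r w
    proof (intro exI conjI allI)
      define r' where "r' x = A s' r x - p x" for x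
      have pr: "A s' r = (\<lambda>x. p x + r' x)"
        unfolding r'_def using pA[OF r \<alpha>r] by (auto simp: fun_eq_iff add_diff_inverse_ennreal)
      show pr': "pm r'" unfolding r'_def[abs_def] using r pmp by simp
      show "r' x \<le> ennreal \<kappa> * tail s' x" for x
        unfolding r'_def using A_dominated[OF r(2) ss', of x] by (rule order_trans[OF diff_le_self_ennreal])
      show "I r = I p + I r'"
        using A_mass[OF r(1) I_upto_U_finite[OF r(2) \<kappa>f], of s'] pmp pr' by (simp add: pr I_add)
      show "aft s' w x = (aft s' h x + U p x) + U r' x" for x
      proof -
        have "aft s' w x = aft s' (aft s w) x" using ss' by (simp add: aft_aft)
        also have "\<dots> = aft s' h x + aft s' (U r) x" by (simp add: aft_def[of s'] eqr)
        also have "aft s' (U r) x = U (A s' r) x" by (rule aft_U[OF r(1) U_finite[OF r(2)]])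
        also have "\<dots> = U p x + U r' x" unfolding pr by (rule U_add[OF pmp pr'])
        finally show ?thesis by (simp add: ac_simps)
      qed
    qed
    obtain r1' where r1': "pm r1'" "\<And>x. aft s' w1 x = (aft s' h x + U p x) + U r1' x"
      "\<And>x. r1' x \<le> ennreal \<kappa> * tail s' x" "I r1 = I p + I r1'"
      using step[OF pm(1) dom(1) _ eq(1)] by (auto simp: \<alpha>_def)
    obtain r2' where r2': "pm r2'" "\<And>x. aft s' w2 x = (aft s' h x + U p x) + U r2' x"
      "\<And>x. r2' x \<le> ennreal \<kappa> * tail s' x" "I r2 = I p + I r2'"
      using step[OF pm(2) dom(2) _ eq(2)] by (auto simp: \<alpha>_def)
    have fin: "I r1 < \<infinity>" using Im by (auto intro: le_less_trans)
    have finp: "I p < \<infinity>" using fin r1'(4) by (metis ennreal_add_eq_top infinity_ennreal_def less_top)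
    have II: "I r1' = I r2'" using r1'(4) r2'(4) I12 finp by (metis ennreal_add_left_cancel infinity_ennreal_def less_irrefl)
    define T where "T = enn2real (tau R)"
    have T: "tau R = ennreal T" "0 \<le> T" using tau_finite'[OF R] by (auto simp: T_def)
    have near: "I r \<le> I (upto (s + R) r) + ennreal (\<kappa> * T)"
      if r: "pm r" "\<And>x. r x \<le> ennreal \<kappa> * tail s x" for r
    proof -
      have "I (aft (s + R) r) \<le> I (\<lambda>x. ennreal \<kappa> * aft (s + R) (tail s) x)"
        using r(2) by (intro I_mono) (auto simp: aft_def)
      also have "\<dots> = ennreal \<kappa> * tau R" by (subst I_cmult) (auto simp: I_aft_tail[OF R])
      also have "\<dots> = ennreal (\<kappa> * T)" using \<kappa> T by (simp add: ennreal_mult)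
      finally show ?thesis by (subst I_split[OF r(1), of "s + R"]) (rule add_left_mono)
    qed
    have \<alpha>le: "I r1 \<le> \<alpha> + ennreal (\<kappa> * T)"
      using near[OF pm(1) dom(1)] near[OF pm(2) dom(2)] I12 by (auto simp: \<alpha>_def min_def)
    have "\<alpha> \<le> I (upto (s + R) r1)" by (simp add: \<alpha>_def)
    also have "\<dots> \<le> I r1" by (rule I_mono) (simp add: upto_def)
    finally have \<alpha>fin: "\<alpha> < \<infinity>" using fin by (rule le_less_trans)
    obtain a where a: "\<alpha> = ennreal a" "0 \<le> a" using \<alpha>fin by (cases \<alpha>) auto
    obtain i where i: "I r1 = ennreal i" "0 \<le> i" using fin by (cases "I r1") auto
    have "I r1' < \<infinity>" using fin r1'(4) by (metis ennreal_add_eq_top infinity_ennreal_def less_top)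
    then obtain i' where i': "I r1' = ennreal i'" "0 \<le> i'" by (cases "I r1'") auto
    have "ennreal i = ennreal (\<theta> * a + i')"
      using r1'(4) \<theta> a i' by (simp add: Ip i ennreal_mult ennreal_plus)
    then have e1: "i = \<theta> * a + i'" using i i' a \<theta> by (subst (asm) ennreal_inj) auto
    have "ennreal i \<le> ennreal (a + \<kappa> * T)"
      using \<alpha>le a i \<kappa> T by (simp add: ennreal_plus)
    then have e2: "i \<le> a + \<kappa> * T" using a \<kappa> T by (subst (asm) ennreal_le_iff) auto
    have e3: "i \<le> m" using Im i m by simp
    \<comment> \<open>The new mass is i' = i - \<theta> a. The share \<theta> of i is estimated by a
      + \<kappa> T, the share 1 - \<theta> by the old bound m.\<close>
    have "\<theta> * i \<le> \<theta> * (a + \<kappa> * T)" using e2 \<theta> by simp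
    moreover have "(1 - \<theta>) * i \<le> (1 - \<theta>) * m" using e3 \<theta> by (intro mult_left_mono) auto
    ultimately have "i' \<le> (1 - \<theta>) * m + \<theta> * \<kappa> * T" using e1 by (simp add: algebra_simps)
    then have "I r1' \<le> ennreal ((1 - \<theta>) * m + \<theta> * \<kappa> * T)" unfolding i' by (rule ennreal_leI)
    then show ?thesis
      unfolding coupled_def s'_def[symmetric] T_def[symmetric]
      using r1' r2' II by (intro exI[of _ "\<lambda>x. aft s' h x + U p x"] exI[of _ r1'] exI[of _ r2']) auto
  qed
  then show ?thesis using \<theta> c by (intro exI[of _ \<theta>] exI[of _ "l + 1"]) auto
qed

text \<open>The recursion of \<open>coupled_step\<close> for the uncoupled mass has the fixed point
  \<kappa> \<open>tau R\<close>, and the distance to it shrinks by the factor 1 - \<theta> in each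
  window. The tail errors of all windows thus add up to a single \<open>tau R\<close>, whatever n
  is.\<close>

lemma coupled_iterate:
  "\<exists>\<theta> l. 0 < \<theta> \<and> \<theta> \<le> 1 \<and> 0 < l \<and> (\<forall>\<kappa> q1 q2 R n. 0 \<le> \<kappa> \<longrightarrow> 0 \<le> R \<longrightarrow> pm q1 \<longrightarrow> pm q2 \<longrightarrow>
     (\<forall>x. q1 x \<le> ennreal \<kappa> * tail 0 x) \<longrightarrow> (\<forall>x. q2 x \<le> ennreal \<kappa> * tail 0 x) \<longrightarrow> I q1 = I q2 \<longrightarrow>
     coupled (U q1) (U q2) \<kappa> (real n * (R + l)) (\<kappa> * ((1 - \<theta>) ^ n * enn2real (tau 0) + enn2real (tau R))))"
proof -
  obtain \<theta> l where \<theta>: "0 < \<theta>" "\<theta> \<le> 1" "0 < l" and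
    st: "\<And>w1 w2 \<kappa> s m R. 0 \<le> \<kappa> \<Longrightarrow> 0 \<le> m \<Longrightarrow> 0 \<le> R \<Longrightarrow> coupled w1 w2 \<kappa> s m \<Longrightarrow>
     coupled w1 w2 \<kappa> (s + R + l) ((1 - \<theta>) * m + \<theta> * \<kappa> * enn2real (tau R))"
    using coupled_step by metis
  have "coupled (U q1) (U q2) \<kappa> (real n * (R + l)) (\<kappa> * ((1 - \<theta>) ^ n * enn2real (tau 0) + enn2real (tau R)))"
    if \<kappa>: "0 \<le> \<kappa>" and R: "0 \<le> R" and pm: "pm q1" "pm q2"
     and dom: "\<And>x. q1 x \<le> ennreal \<kappa> * tail 0 x" "\<And>x. q2 x \<le> ennreal \<kappa> * tail 0 x" and II: "I q1 = I q2" for \<kappa> q1 q2 R n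
  proof (induction n)
    case 0
    have aU: "aft 0 (U q) x = U q x" if "\<And>x. q x \<le> ennreal \<kappa> * tail 0 x" for q x
      using U_dominated[OF that, of x] by (auto simp: aft_def indicator_def split: if_splits)
    have "I q1 \<le> I (\<lambda>x. ennreal \<kappa> * tail 0 x)" by (rule I_mono) (rule dom)
    also have "\<dots> = ennreal \<kappa> * ennreal (enn2real (tau 0))" using tau_finite by (simp add: I_cmult I_tail)
    also have "\<dots> \<le> ennreal (\<kappa> * (enn2real (tau 0) + enn2real (tau R)))"
      using \<kappa> by (simp add: ennreal_mult[symmetric] mult_left_mono)
    finally show ?case
      unfolding coupled_def using aU[OF dom(1)] aU[OF dom(2)] pm dom II
      by (intro exI[of _ "\<lambda>_. 0"] exI[of _ q1] exI[of _ q2]) auto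
  next
    case (Suc n)
    have "(1 - \<theta>) * (\<kappa> * ((1 - \<theta>) ^ n * enn2real (tau 0) + enn2real (tau R))) + \<theta> * \<kappa> * enn2real (tau R)
       = \<kappa> * ((1 - \<theta>) ^ Suc n * enn2real (tau 0) + enn2real (tau R))"
      by (simp add: algebra_simps)
    moreover have "real n * (R + l) + R + l = real (Suc n) * (R + l)" by (simp add: algebra_simps)
    ultimately show ?case using st[OF \<kappa> _ R Suc] \<kappa> \<theta> by simp
  qed
  then show ?thesis using \<theta> by blast
qed

lemma tau_reflect_le:
  "(\<integral>\<^sup>+r. tl (t - r) * indicator {..t - R} r \<partial>lborel) = tau R"
proof -
  have "(\<integral>\<^sup>+r. tl (t - r) * indicator {..t - R} r \<partial>lborel) = (\<integral>\<^sup>+r. tl (t - r) * indicator {..<t - R} r \<partial>lborel)"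
    using AE_lborel_singleton[of "t - R"] by (intro nn_integral_cong_AE) (auto simp: indicator_def)
  then show ?thesis by (simp add: tau_reflect)
qed

text \<open>The left side is the mass in flight at t of the discrepancy of the fluxes. Before the
  coupling time s = n (R + l) only the bound \<kappa> on the discrepancy is known, but its flights
  have to bridge [s, t], which costs \<open>tau (t - s)\<close>. After s the discrepancy is at most
  the sum of the two uncoupled fluxes, and each has in flight only what its source has fed
  in.\<close>

lemma difference_decay:
  "\<exists>\<theta> l. 0 < \<theta> \<and> \<theta> \<le> 1 \<and> 0 < l \<and> (\<forall>\<kappa> q1 q2 R n t. 0 \<le> \<kappa> \<longrightarrow> 0 \<le> R \<longrightarrow> pm q1 \<longrightarrow> pm q2 \<longrightarrow>
     (\<forall>x. q1 x \<le> ennreal \<kappa> * tail 0 x) \<longrightarrow> (\<forall>x. q2 x \<le> ennreal \<kappa> * tail 0 x) \<longrightarrow> I q1 = I q2 \<longrightarrow> real n * (R + l) \<le> t \<longrightarrow>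
     I (aft t (K (upto t (\<lambda>x. ennreal \<bar>enn2real (U q1 x) - enn2real (U q2 x)\<bar>))))
       \<le> ennreal \<kappa> * tau (t - real n * (R + l)) + ennreal (2 * \<kappa> * ((1 - \<theta>) ^ n * enn2real (tau 0) + enn2real (tau R))))"
proof -
  obtain \<theta> l where \<theta>: "0 < \<theta>" "\<theta> \<le> 1" "0 < l" and
    cp: "\<And>\<kappa> q1 q2 R n. 0 \<le> \<kappa> \<Longrightarrow> 0 \<le> R \<Longrightarrow> pm q1 \<Longrightarrow> pm q2 \<Longrightarrow>
     (\<And>x. q1 x \<le> ennreal \<kappa> * tail 0 x) \<Longrightarrow> (\<And>x. q2 x \<le> ennreal \<kappa> * tail 0 x) \<Longrightarrow> I q1 = I q2 \<Longrightarrow>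
     coupled (U q1) (U q2) \<kappa> (real n * (R + l)) (\<kappa> * ((1 - \<theta>) ^ n * enn2real (tau 0) + enn2real (tau R)))"
    using coupled_iterate by metis
  have "I (aft t (K (upto t (\<lambda>x. ennreal \<bar>enn2real (U q1 x) - enn2real (U q2 x)\<bar>))))
       \<le> ennreal \<kappa> * tau (t - s) + ennreal (2 * m)"
    if \<kappa>: "0 \<le> \<kappa>" and pm: "pm q1" "pm q2"
     and dom: "\<And>x. q1 x \<le> ennreal \<kappa> * tail 0 x" "\<And>x. q2 x \<le> ennreal \<kappa> * tail 0 x"
     and s: "s \<le> t" and m: "0 \<le> m" and co: "coupled (U q1) (U q2) \<kappa> s m" for \<kappa> q1 q2 s t m
  proof -
    define D where "D x = ennreal \<bar>enn2real (U q1 x) - enn2real (U q2 x)\<bar>" for x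
    have pmD: "pm D"
      using pm_U[OF pm(1)] pm_U[OF pm(2)] unfolding D_def[abs_def] pm_def periodic2_def by auto
    obtain r1 r2 h where r: "pm r1" "pm r2" and eq: "\<forall>x. aft s (U q1) x = h x + U r1 x" "\<forall>x. aft s (U q2) x = h x + U r2 x"
      and rdom: "\<forall>x. r1 x \<le> ennreal \<kappa> * tail s x" "\<forall>x. r2 x \<le> ennreal \<kappa> * tail s x"
      and I12: "I r1 = I r2" and Im: "I r1 \<le> ennreal m"
      using co by (rule coupledE)
    note eq = eq[rule_format] and rdom = rdom[rule_format]
    have U1: "U q1 x \<le> ennreal \<kappa>" "U q2 x \<le> ennreal \<kappa>" for x
      using U_dominated[OF dom(1), of x] U_dominated[OF dom(2), of x] by (auto split: split_indicator_asm intro: order_trans)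
    have D\<kappa>: "D x \<le> ennreal \<kappa>" for x
    proof -
      have "enn2real (U q1 x) \<le> \<kappa>" "enn2real (U q2 x) \<le> \<kappa>"
        using U1[of x] \<kappa> by (auto intro: enn2real_leI)
      then show ?thesis unfolding D_def
        using enn2real_nonneg[of "U q1 x"] enn2real_nonneg[of "U q2 x"] by (intro ennreal_leI) linarith    qed
    have Dr: "D x \<le> U r1 x + U r2 x" if "s < fst x" for x
    proof -
      have e: "U q1 x = h x + U r1 x" "U q2 x = h x + U r2 x" using eq[of x] that by (auto simp: aft_def)
      have f: "U q1 x < \<infinity>" "U q2 x < \<infinity>" using U_finite[OF dom(1)] U_finite[OF dom(2)] by auto
      then have "h x < \<infinity>" "U r1 x < \<infinity>" "U r2 x < \<infinity>" using e by auto
      then obtain a b c where "h x = ennreal a" "U r1 x = ennreal b" "U r2 x = ennreal c" "0 \<le> a" "0 \<le> b" "0 \<le> c"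
        by (metis ennreal_cases infinity_ennreal_def less_irrefl)
      then show ?thesis by (simp add: D_def e ennreal_plus[symmetric] del: ennreal_plus)
    qed
    \<comment> \<open>A time up to s is charged with the crude bound, a later one with the uncoupled
      fluxes.\<close>
    have "upto t D x \<le> ennreal \<kappa> * indicator {..s} (fst x) + (upto t (U r1) x + upto t (U r2) x)" for x
      proof (cases "fst x \<le> s")
      case True
      have "D x \<le> ennreal \<kappa> + (U r1 x + U r2 x)" using D\<kappa>[of x] by (rule add_increasing2[OF zero_le])
      then show ?thesis using True s by (simp add: upto_def)
    qed (use Dr[of x] in \<open>simp add: upto_def\<close>)
    then have "I (aft t (K (upto t D))) \<le> I (aft t (K (\<lambda>x. ennreal \<kappa> * indicator {..s} (fst x) + (upto t (U r1) x + upto t (U r2) x))))"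
      by (intro I_mono) (auto simp: aft_def intro!: K_mono)
    also have "aft t (K (\<lambda>x. ennreal \<kappa> * indicator {..s} (fst x) + (upto t (U r1) x + upto t (U r2) x)))
       = (\<lambda>x. aft t (K (\<lambda>x. ennreal \<kappa> * indicator {..s} (fst x))) x + (aft t (K (upto t (U r1))) x + aft t (K (upto t (U r2))) x))"
      using r by (auto simp: aft_def K_add pm_time[of "\<lambda>t. ennreal \<kappa> * indicator {..s} t"])
    also have "I \<dots> = I (aft t (K (\<lambda>x. ennreal \<kappa> * indicator {..s} (fst x)))) + (I (aft t (K (upto t (U r1)))) + I (aft t (K (upto t (U r2)))))"
      using r by (simp add: I_add pm_time[of "\<lambda>t. ennreal \<kappa> * indicator {..s} t"])
    also have "I (aft t (K (upto t (U r1)))) = I (upto t r1)"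
      by (rule conservation[OF r(1) I_upto_U_finite[OF rdom(1)]]) simp
    also have "I (aft t (K (upto t (U r2)))) = I (upto t r2)"
      by (rule conservation[OF r(2) I_upto_U_finite[OF rdom(2)]]) simp
    also have "I (upto t r1) \<le> ennreal m"
      by (rule order_trans[OF I_mono Im]) (simp add: upto_def)
    also have "I (upto t r2) \<le> ennreal m"
      by (rule order_trans[OF I_mono Im[unfolded I12]]) (simp add: upto_def)
    also have "ennreal m + ennreal m = ennreal (2 * m)" using m by (simp add: ennreal_plus[symmetric] del: ennreal_plus)
    also have "I (aft t (K (\<lambda>x. ennreal \<kappa> * indicator {..s} (fst x)))) \<le> ennreal \<kappa> * tau (t - s)"
    proof -
      have p: "pm (\<lambda>x. ennreal \<kappa> * indicator {..s} (fst x))" by (rule pm_time[of "\<lambda>t. ennreal \<kappa> * indicator {..s} t"]) simp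
      have "I (aft t (K (\<lambda>x. ennreal \<kappa> * indicator {..s} (fst x)))) \<le> I (\<lambda>x. (\<lambda>a. ennreal \<kappa> * (tl (t - a) * indicator {..s} a)) (fst x))"
        unfolding I_aft_K[OF p] unfolding I_def
        by (intro nn_integral_mono) (auto split: split_indicator intro!: mult_left_mono escape_le)
      also have "\<dots> = ennreal \<kappa> * (\<integral>\<^sup>+a. tl (t - a) * indicator {..s} a \<partial>lborel)"
        by (subst I_time) (auto simp: nn_integral_cmult)
      also have "(\<integral>\<^sup>+a. tl (t - a) * indicator {..s} a \<partial>lborel) = tau (t - s)"
        using tau_reflect_le[of t "t - s"] by simp
      finally show ?thesis .
    qed
    finally show ?thesis unfolding D_def[abs_def] by (simp add: add_mono)
  qed
  note main = this
  have "I (aft t (K (upto t (\<lambda>x. ennreal \<bar>enn2real (U q1 x) - enn2real (U q2 x)\<bar>))))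
       \<le> ennreal \<kappa> * tau (t - real n * (R + l)) + ennreal (2 * \<kappa> * ((1 - \<theta>) ^ n * enn2real (tau 0) + enn2real (tau R)))"
    if *: "0 \<le> \<kappa>" "0 \<le> R" "pm q1" "pm q2" "\<forall>x. q1 x \<le> ennreal \<kappa> * tail 0 x" "\<forall>x. q2 x \<le> ennreal \<kappa> * tail 0 x"
      "I q1 = I q2" "real n * (R + l) \<le> t" for \<kappa> q1 q2 R n t
  proof -
    have "0 \<le> \<kappa> * ((1 - \<theta>) ^ n * enn2real (tau 0) + enn2real (tau R))" using * \<theta> by simp
    from main[OF *(1,3,4) *(5)[rule_format] *(6)[rule_format] *(8) this cp[OF *(1-4) *(5)[rule_format] *(6)[rule_format] *(7)]]
    show ?thesis by (simp only: mult.assoc)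
  qed
  note fin = this
  show ?thesis
    by (rule exI[of _ \<theta>], rule exI[of _ l], intro conjI allI impI \<theta>) (rule fin; assumption)
qed

end

section \<open>Vertical motion in the logarithmic potential\<close>

text \<open>Substitution on compact intervals, exhausted from below: since g tends to infinity, the
  images of [a, a + n] fill the half-line that starts at g a.\<close>

lemma nn_integral_substitution_atLeast:
  fixes f :: "real \<Rightarrow> ennreal"
  assumes [measurable]: "f \<in> borel_measurable borel" "g \<in> borel_measurable borel" "g' \<in> borel_measurable borel"
    and deriv: "\<And>x. a \<le> x \<Longrightarrow> (g has_real_derivative g' x) (at x)"
    and cont: "continuous_on {a..} g'" and nonneg: "\<And>x. a \<le> x \<Longrightarrow> 0 \<le> g' x"
    and lim: "filterlim g at_top at_top"
  shows "(\<integral>\<^sup>+x. f x * indicator {g a..} x \<partial>lborel) = (\<integral>\<^sup>+x. f (g x) * ennreal (g' x) * indicator {a..} x \<partial>lborel)"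
proof -
  let ?M1 = "density lborel f" and ?M2 = "density lborel (\<lambda>x. f (g x) * ennreal (g' x))"
  have mono: "g x \<le> g y" if "a \<le> x" "x \<le> y" for x y
  proof (rule DERIV_nonneg_imp_nondecreasing[OF that(2)])
    fix z assume "x \<le> z"
    then have "a \<le> z" using that by simp
    then show "\<exists>y. (g has_real_derivative y) (at z) \<and> 0 \<le> y" using deriv nonneg by blast
  qed
  have eq: "emeasure ?M1 {g a..g (a + real (Suc n))} = emeasure ?M2 {a..a + real (Suc n)}" for n
  proof -
    have "emeasure ?M1 {g a..g (a + real (Suc n))} = (\<integral>\<^sup>+x. f x * indicator {g a..g (a + real (Suc n))} x \<partial>lborel)"
      by (subst emeasure_density) auto
    also have "\<dots> = (\<integral>\<^sup>+x. f (g x) * ennreal (g' x) * indicator {a..a + real (Suc n)} x \<partial>lborel)"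
      by (rule nn_integral_substitution_aux) (simp_all add: deriv nonneg continuous_on_subset[OF cont])
    also have "\<dots> = emeasure ?M2 {a..a + real (Suc n)}"
      by (subst emeasure_density) auto
    finally show ?thesis .
  qed
  have U1: "(\<Union>n. {g a..g (a + real (Suc n))}) = {g a..}"
  proof (intro equalityI subsetI)
    fix y assume y: "y \<in> {g a..}"
    have "eventually (\<lambda>x. y \<le> g x) at_top" using lim by (simp add: filterlim_at_top)
    then obtain N where N: "\<And>x. N \<le> x \<Longrightarrow> y \<le> g x" by (auto simp: eventually_at_top_linorder)
    obtain n :: nat where "N - a \<le> real n" using real_arch_simple by blast
    then have "y \<le> g (a + real (Suc n))" by (intro N) auto
    then show "y \<in> (\<Union>n. {g a..g (a + real (Suc n))})" using y by auto
  qed auto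
  have U2: "(\<Union>n. {a..a + real (Suc n)}) = {a..}"
  proof (intro equalityI subsetI)
    fix y assume y: "y \<in> {a..}"
    obtain n :: nat where "y - a \<le> real n" using real_arch_simple by blast
    then show "y \<in> (\<Union>n. {a..a + real (Suc n)})" using y by (auto intro!: exI[of _ n])
  qed auto
  have "emeasure ?M1 {g a..} = (SUP n. emeasure ?M1 {g a..g (a + real (Suc n))})"
    unfolding U1[symmetric]
  proof (rule SUP_emeasure_incseq[symmetric])
    show "incseq (\<lambda>n. {g a..g (a + real (Suc n))})"
    proof (rule incseq_SucI)
      fix n
      have "g (a + real (Suc n)) \<le> g (a + real (Suc (Suc n)))" by (rule mono) auto
      then show "{g a..g (a + real (Suc n))} \<subseteq> {g a..g (a + real (Suc (Suc n)))}" by auto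
    qed
  qed auto
  also have "\<dots> = (SUP n. emeasure ?M2 {a..a + real (Suc n)})" by (simp only: eq)
  also have "\<dots> = emeasure ?M2 {a..}"
    unfolding U2[symmetric] by (rule SUP_emeasure_incseq) (auto simp: incseq_def)
  finally show ?thesis by (simp add: emeasure_density)
qed

text \<open>Here b stands for 1 / ln a, so that the potential is b ln(1 + x) and the vertical
  acceleration is -b / (1 + x).\<close>

locale log_potential =
  fixes b :: real
  assumes b_pos: "0 < b"
begin

section \<open>A Gaussian integral as clock of the vertical motion\<close>

text \<open>An error function up to scale. On an orbit with emission speed v energy conservation
  gives 1 + x = exp((v^2 - u^2) / (2b)), hence dt = - exp((v^2 - u^2) / (2b)) du / b, and time is an
  affine function of \<open>gint u\<close>.\<close>

definition gint :: "real \<Rightarrow> real" where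
  "gint u = (LBINT s=0..u. exp (- (s\<^sup>2 / (2 * b))))"

lemma gint_deriv: "(gint has_real_derivative exp (- (u\<^sup>2 / (2 * b)))) (at u)"
proof -
  let ?f = "\<lambda>s::real. exp (- (s\<^sup>2 / (2 * b)))"
  \<comment> \<open>The fundamental theorem yields a derivative within a compact interval; this one
    contains u in its interior.\<close>
  have "((\<lambda>u. LBINT s=0..u. ?f s) has_vector_derivative ?f u) (at u within {- \<bar>u\<bar> - 1..\<bar>u\<bar> + 1})"
    by (rule interval_integral_FTC2[where c=0, simplified zero_ereal_def[symmetric]]) (use b_pos in \<open>auto intro!: continuous_intros\<close>)
  then have "(gint has_vector_derivative ?f u) (at u within {- \<bar>u\<bar> - 1..\<bar>u\<bar> + 1})"
    by (simp add: gint_def[abs_def] zero_ereal_def)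
  then have "(gint has_vector_derivative ?f u) (at u)"
    by (subst (asm) at_within_interior) (auto simp: interior_atLeastAtMost_real)
  then show ?thesis by (simp add: has_real_derivative_iff_has_vector_derivative)
qed

lemma gint_0 [simp]: "gint 0 = 0"
  by (simp add: gint_def zero_ereal_def[symmetric])

lemma gint_deriv_comp [derivative_intros]:
  "(f has_real_derivative f') (at x within S) \<Longrightarrow>
   ((\<lambda>x. gint (f x)) has_real_derivative exp (- ((f x)\<^sup>2 / (2 * b))) * f') (at x within S)"
  using DERIV_chain2[OF gint_deriv] by blast

lemma gint_minus: "gint (- u) = - gint u"
proof -
  have "((\<lambda>u. gint (- u) + gint u) has_real_derivative 0) (at x)" for x
    by (auto intro!: derivative_eq_intros)
  then have "gint (- u) + gint u = gint (- 0) + gint 0"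
    by (intro DERIV_isconst_all[of "\<lambda>u. gint (- u) + gint u"] allI)
  then show ?thesis by simp
qed

lemma gint_strict_mono: "u < v \<Longrightarrow> gint u < gint v"
  by (rule DERIV_pos_imp_increasing[where f=gint]) (use gint_deriv in \<open>auto intro: exp_gt_zero\<close>)

lemma gint_less_iff [simp]: "gint u < gint v \<longleftrightarrow> u < v"
  using gint_strict_mono[of u v] gint_strict_mono[of v u] by (cases rule: linorder_cases[of u v]) auto

lemma gint_eq_iff [simp]: "gint u = gint v \<longleftrightarrow> u = v"
  using gint_strict_mono[of u v] gint_strict_mono[of v u]
  by (cases rule: linorder_cases[of u v]) (auto simp del: gint_less_iff)

lemma gint_le_iff [simp]: "gint u \<le> gint v \<longleftrightarrow> u \<le> v"
  by (simp add: not_less[symmetric])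

lemma gint_cont: "continuous_on S gint"
  by (meson DERIV_isCont continuous_at_imp_continuous_on gint_deriv)

lemma gint_borel [measurable]: "gint \<in> borel_measurable borel"
  by (intro borel_measurable_continuous_onI gint_cont)

text \<open>The range of \<open>gint\<close> is bounded; the value 0 outside it makes the inverse a
  Borel function on the whole line.\<close>

definition ginv :: "real \<Rightarrow> real" where
  "ginv q = (if q \<in> range gint then inv gint q else 0)"

lemma inj_gint: "inj gint" by (simp add: inj_def)

lemma ginv_gint [simp]: "ginv (gint u) = u"
  by (simp add: ginv_def inv_f_f[OF inj_gint])

lemma open_range_gint: "open (range gint)"
  by (rule injective_into_1d_imp_open_map_UNIV[of UNIV UNIV]) (auto intro: gint_cont inj_gint)

lemma ginv_deriv: "(ginv has_real_derivative exp (u\<^sup>2 / (2 * b))) (at (gint u))"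
proof -
  have "isCont ginv (gint u)"
    by (rule isCont_inverse_function[where d=1]) (auto intro: DERIV_isCont[OF gint_deriv])
  then have "(ginv has_real_derivative inverse (exp (- (u\<^sup>2 / (2 * b))))) (at (gint u))"
    by (intro has_field_derivative_inverse_basic[where f=gint and t="range gint"])
       (auto simp: open_range_gint gint_deriv)
  then show ?thesis by (simp add: exp_minus)
qed

lemma ginv_borel [measurable]: "ginv \<in> borel_measurable borel"
proof -
  have "continuous_on (range gint) (inv gint)"
  proof (rule continuous_on_cong[THEN iffD1])
    show "continuous_on (range gint) ginv"
      by (auto intro!: continuous_at_imp_continuous_on DERIV_isCont[OF ginv_deriv])
  qed (auto simp: ginv_def)
  then show ?thesis unfolding ginv_def[abs_def]
    by (intro borel_measurable_continuous_on_if borel_open open_range_gint) auto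
qed

text \<open>Since exp(-y) \<le> 1 / (1 + y), the integrand lies below the derivative of c arctan(v /
  c) with c = sqrt(2b). The bound supplies the constant in the tail of the flight time.\<close>

lemma gint_bound: "0 \<le> v \<Longrightarrow> gint v \<le> sqrt (2 * b) * (pi / 2)"
proof -
  assume v: "0 \<le> v"
  define c where "c = sqrt (2 * b)"
  have c: "c > 0" "c\<^sup>2 = 2 * b" using b_pos by (auto simp: c_def)
  have d: "((\<lambda>v. c * arctan (v / c) - gint v) has_real_derivative 1 / (1 + (x / c)\<^sup>2) - exp (- (x\<^sup>2 / (2 * b)))) (at x)" for x
  proof -
    have "((\<lambda>v. c * arctan (v / c) - gint v) has_real_derivative c * (inverse (1 + (x / c)\<^sup>2) * (1 / c)) - exp (- (x\<^sup>2 / (2 * b)))) (at x)"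
      by (intro DERIV_diff DERIV_cmult gint_deriv DERIV_chain2[OF DERIV_arctan] DERIV_cdivide DERIV_ident)
    then show ?thesis using c by (simp add: inverse_eq_divide)
  qed
  have "c * arctan (0 / c) - gint 0 \<le> c * arctan (v / c) - gint v"
  proof (rule DERIV_nonneg_imp_nondecreasing[OF v])
    fix x
    have "exp (- (x\<^sup>2 / (2 * b))) = 1 / exp ((x / c)\<^sup>2)" using c by (simp add: exp_minus power_divide field_simps)
    also have "\<dots> \<le> 1 / (1 + (x / c)\<^sup>2)"
      by (intro divide_left_mono exp_ge_add_one_self mult_pos_pos exp_gt_zero) (auto intro: add_pos_nonneg)
    finally show "\<exists>y. ((\<lambda>v. c * arctan (v / c) - gint v) has_real_derivative y) (at x) \<and> 0 \<le> y"
      by (intro exI[of _ "1 / (1 + (x / c)\<^sup>2) - exp (- (x\<^sup>2 / (2 * b)))"] conjI d) simp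
  qed
  then have "gint v \<le> c * arctan (v / c)" by simp
  also have "\<dots> \<le> c * (pi / 2)" using arctan_ubound[of "v / c"] c by (intro mult_left_mono) auto
  finally show ?thesis by (simp add: c_def)
qed

section \<open>Flight time as a function of the emission speed\<close>

text \<open>The time in which the vertical velocity falls from v to -v: the clock above integrated
  over [-v, v], with \<open>gint\<close> odd.\<close>

definition flight :: "real \<Rightarrow> real" where
  "flight v = 2 / b * exp (v\<^sup>2 / (2 * b)) * gint v"

definition flight' :: "real \<Rightarrow> real" where
  "flight' v = 2 / b + v / b * flight v"

text \<open>In the product rule the Gaussian factors cancel in one term, and the other term
  reproduces \<open>flight\<close> itself. This form of the derivative makes monotonicity and the
  hazard estimate immediate.\<close>

lemma flight_deriv: "(flight has_real_derivative flight' v) (at v)"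
proof -
  have e: "exp (v\<^sup>2 / (2 * b)) * exp (- (v\<^sup>2 / (2 * b))) = 1" by (simp flip: exp_add)
  have "((\<lambda>v. v\<^sup>2 / (2 * b)) has_real_derivative v / b) (at v)"
    using b_pos by (auto intro!: derivative_eq_intros)
  then have "(flight has_real_derivative 2 / b * (exp (v\<^sup>2 / (2 * b)) * (v / b)) * gint v + exp (- (v\<^sup>2 / (2 * b))) * (2 / b * exp (v\<^sup>2 / (2 * b)))) (at v)"
    unfolding flight_def[abs_def] by (intro DERIV_mult DERIV_cmult DERIV_fun_exp gint_deriv)
  moreover have "2 / b * (exp (v\<^sup>2 / (2 * b)) * (v / b)) * gint v + exp (- (v\<^sup>2 / (2 * b))) * (2 / b * exp (v\<^sup>2 / (2 * b)))
     = 2 / b * (exp (v\<^sup>2 / (2 * b)) * exp (- (v\<^sup>2 / (2 * b)))) + v / b * (2 / b * exp (v\<^sup>2 / (2 * b)) * gint v)"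
    by (simp add: ac_simps)
  ultimately show ?thesis unfolding e by (simp add: flight'_def flight_def)
qed
lemma flight_0 [simp]: "flight 0 = 0" by (simp add: flight_def)

lemma gint_nonneg: "0 \<le> v \<Longrightarrow> 0 \<le> gint v" using gint_le_iff[of 0 v] by simp

lemma flight_nonneg: "0 \<le> v \<Longrightarrow> 0 \<le> flight v"
  using gint_nonneg b_pos by (simp add: flight_def)

lemma flight'_pos: "0 \<le> v \<Longrightarrow> 2 / b \<le> flight' v" "0 \<le> v \<Longrightarrow> 0 < flight' v"
  using flight_nonneg[of v] b_pos by (auto simp: flight'_def intro!: add_pos_nonneg)

lemma flight_strict_mono: "0 \<le> u \<Longrightarrow> u < v \<Longrightarrow> flight u < flight v"
proof (rule DERIV_pos_imp_increasing[where f=flight])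
  fix x assume "0 \<le> u" "u \<le> x"
  then show "\<exists>y. (flight has_real_derivative y) (at x) \<and> 0 < y"
    using flight_deriv[of x] flight'_pos(2)[of x] by (intro exI[of _ "flight' x"]) auto
qed

lemma flight_mono: "0 \<le> u \<Longrightarrow> u \<le> v \<Longrightarrow> flight u \<le> flight v"
  using flight_strict_mono[of u v] by (cases "u = v") auto

lemma flight_le_iff: "0 \<le> u \<Longrightarrow> 0 \<le> v \<Longrightarrow> flight u \<le> flight v \<longleftrightarrow> u \<le> v"
  using flight_strict_mono[of v u] flight_mono[of u v] by (cases "u \<le> v") auto

lemma flight_ge: "0 \<le> v \<Longrightarrow> 2 / b * v \<le> flight v"
proof -
  assume v: "0 \<le> v"
  have "flight 0 - 2 / b * 0 \<le> flight v - 2 / b * v"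
  proof (rule DERIV_nonneg_imp_nondecreasing[OF v])
    fix x :: real assume "0 \<le> x"
    then show "\<exists>y. ((\<lambda>v. flight v - 2 / b * v) has_real_derivative y) (at x) \<and> 0 \<le> y"
      using flight'_pos(1)[of x] DERIV_diff[OF flight_deriv[of x] DERIV_cmult_Id[of "2 / b" x]]
      by (intro exI[of _ "flight' x - 2 / b"] conjI) auto
  qed
  then show ?thesis by simp
qed

lemma flight_pos: "0 < v \<Longrightarrow> 0 < flight v"
  using flight_strict_mono[of 0 v] by simp

lemma flight_cont: "continuous_on S flight"
  by (meson DERIV_isCont continuous_at_imp_continuous_on flight_deriv)

lemma flight_borel [measurable]: "flight \<in> borel_measurable borel"
  by (intro borel_measurable_continuous_onI flight_cont)

lemma flight'_cont: "continuous_on S flight'"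
  unfolding flight'_def using b_pos by (auto intro!: continuous_intros flight_cont)

lemma flight'_borel [measurable]: "flight' \<in> borel_measurable borel"
  by (intro borel_measurable_continuous_onI flight'_cont)

lemma flight_at_top: "filterlim flight at_top at_top"
proof (rule filterlim_at_top_mono)
  show "filterlim (\<lambda>v. 2 / b * v) at_top at_top"
    using b_pos by (intro filterlim_tendsto_pos_mult_at_top[OF tendsto_const _ filterlim_ident]) simp
  show "\<forall>\<^sub>F x in at_top. 2 / b * x \<le> flight x"
    using eventually_ge_at_top[of 0] by eventually_elim (rule flight_ge)
qed

lemma flight_surj: "0 \<le> s \<Longrightarrow> \<exists>v\<ge>0. flight v = s"
proof -
  assume s: "0 \<le> s"
  have "\<exists>x\<ge>0. x \<le> b * s \<and> flight x = s"
  proof (rule IVT')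
    have "s \<le> 2 / b * (b * s)" using s b_pos by simp
    also have "\<dots> \<le> flight (b * s)" using s b_pos by (intro flight_ge) simp
    finally show "s \<le> flight (b * s)" .
  qed (use s b_pos flight_cont in auto)
  then show ?thesis by blast
qed

section \<open>Age and emission speed as coordinates\<close>

text \<open>In terms of \<open>gint\<close> of the vertical velocity, time is affine along an orbit. \<open>sage v u\<close> is the time since the
  emission at vertical speed \<open>v\<close> at which the vertical velocity is \<open>u\<close>, and \<open>age x u\<close> is the same time as a
  function of the present height and velocity.\<close>

definition sage :: "real \<Rightarrow> real \<Rightarrow> real" where
  "sage v u = exp (v\<^sup>2 / (2 * b)) / b * (gint v - gint u)"

text \<open>The vertical speed at the wall of the orbit through height x and velocity u, from
  conservation of u^2 / 2 + b ln(1 + x).\<close>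

definition speed :: "real \<Rightarrow> real \<Rightarrow> real" where
  "speed x u = sqrt (u\<^sup>2 + 2 * b * ln (1 + x))"

definition age :: "real \<Rightarrow> real \<Rightarrow> real" where
  "age x u = sage (speed x u) u"

text \<open>The equation \<open>sage v u = s\<close> solved for u; the height below then follows
  from energy conservation.\<close>

definition vel :: "real \<Rightarrow> real \<Rightarrow> real" where
  "vel s v = ginv (gint v - b * s * exp (- (v\<^sup>2 / (2 * b))))"

definition height :: "real \<Rightarrow> real \<Rightarrow> real" where
  "height s v = exp ((v\<^sup>2 - (vel s v)\<^sup>2) / (2 * b)) - 1"

lemma sage_flight: "sage v (- v) = flight v"
  by (simp add: sage_def flight_def gint_minus)

lemma vel_sage: "vel (sage v u) v = u"
proof -
  have "b * sage v u * exp (- (v\<^sup>2 / (2 * b))) = (exp (v\<^sup>2 / (2 * b)) * exp (- (v\<^sup>2 / (2 * b)))) * (gint v - gint u)"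
    using b_pos by (simp add: sage_def)
  also have "exp (v\<^sup>2 / (2 * b)) * exp (- (v\<^sup>2 / (2 * b))) = 1" by (simp flip: exp_add)
  finally show ?thesis by (simp add: vel_def)
qed

lemma sage_surj:
  assumes "0 \<le> v" "0 \<le> s" "s \<le> flight v"
  shows "\<exists>u. - v \<le> u \<and> u \<le> v \<and> sage v u = s"
proof -
  have c: "continuous_on S (sage v)" for S
    unfolding sage_def[abs_def] using b_pos by (auto intro!: continuous_intros gint_cont)
  have "\<exists>u\<ge>- v. u \<le> v \<and> sage v u = s"
    by (rule IVT2') (use assms c sage_flight[of v] in \<open>auto simp: sage_def[of v v]\<close>)
  then show ?thesis by blast
qed

text \<open>For s within the flight the argument of \<open>ginv\<close> lies in the range of
  \<open>gint\<close>, so the default value of \<open>ginv\<close> does not occur.\<close>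

lemma sage_vel:
  assumes "0 \<le> v" "0 \<le> s" "s \<le> flight v"
  shows "sage v (vel s v) = s" "\<bar>vel s v\<bar> \<le> v" "gint (vel s v) = gint v - b * s * exp (- (v\<^sup>2 / (2 * b)))"
proof -
  obtain u where u: "- v \<le> u" "u \<le> v" "sage v u = s" using sage_surj[OF assms] by blast
  then have "vel s v = u" using vel_sage[of v u] by simp
  then show 1: "sage v (vel s v) = s" "\<bar>vel s v\<bar> \<le> v" using u by auto
  have "b * s * exp (- (v\<^sup>2 / (2 * b))) = (exp (v\<^sup>2 / (2 * b)) * exp (- (v\<^sup>2 / (2 * b)))) * (gint v - gint (vel s v))"
    by (subst 1(1)[symmetric]) (use b_pos in \<open>simp add: sage_def\<close>)
  also have "exp (v\<^sup>2 / (2 * b)) * exp (- (v\<^sup>2 / (2 * b))) = 1" by (simp flip: exp_add)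
  finally show "gint (vel s v) = gint v - b * s * exp (- (v\<^sup>2 / (2 * b)))" by simp
qed

lemma sage_less_iff: "sage v u < sage v u' \<longleftrightarrow> u' < u"
proof -
  have "0 < exp (v\<^sup>2 / (2 * b)) / b" using b_pos by simp
  then show ?thesis unfolding sage_def by (subst mult_less_cancel_left_pos) auto
qed

lemma vel_strict:
  assumes "0 < s" "s < flight v" "0 < v"
  shows "\<bar>vel s v\<bar> < v"
proof -
  have *: "sage v (vel s v) = s" "\<bar>vel s v\<bar> \<le> v" using sage_vel[of v s] assms by auto
  have "vel s v \<noteq> v" using * assms by (auto simp: sage_def)
  moreover have "vel s v \<noteq> - v" using * assms by (metis less_irrefl sage_flight)
  ultimately show ?thesis using * by auto
qed

lemma height_nonneg:
  assumes "0 \<le> v" "0 \<le> s" "s \<le> flight v" shows "0 \<le> height s v"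
proof -
  have "(vel s v)\<^sup>2 \<le> v\<^sup>2" using sage_vel(2)[OF assms] by (metis abs_le_square_iff abs_of_nonneg assms(1))
  then show ?thesis using b_pos by (simp add: height_def)
qed

lemma height_pos:
  assumes "0 < s" "s < flight v" "0 < v" shows "0 < height s v"
proof -
  have "(vel s v)\<^sup>2 < v\<^sup>2" using vel_strict[OF assms] assms(3) by (metis abs_of_pos power2_abs power_strict_mono abs_ge_zero zero_less_numeral)
  then show ?thesis using b_pos by (simp add: height_def)
qed

lemma height_pos_iff:
  assumes "0 < v" "0 \<le> s" "s \<le> flight v" shows "0 < height s v \<longleftrightarrow> 0 < s \<and> s < flight v"
proof -
  have "height 0 v = 0" using vel_sage[of v v] by (simp add: height_def sage_def)
  moreover have "height (flight v) v = 0" using vel_sage[of v "- v"] by (simp add: height_def sage_flight)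
  ultimately show ?thesis using height_pos[of s v] assms by (cases "s = 0"; cases "s = flight v") auto
qed

lemma speed_coords:
  assumes "0 \<le> v" "0 \<le> s" "s \<le> flight v"
  shows "speed (height s v) (vel s v) = v" "age (height s v) (vel s v) = s"
proof -
  show "speed (height s v) (vel s v) = v" using b_pos assms by (simp add: speed_def height_def)
  then show "age (height s v) (vel s v) = s" using sage_vel(1)[OF assms] by (simp add: age_def)
qed

lemma speed_sq: "0 \<le> x \<Longrightarrow> (speed x u)\<^sup>2 = u\<^sup>2 + 2 * b * ln (1 + x)"
  using b_pos by (simp add: speed_def)

lemma speed_ge: "0 \<le> x \<Longrightarrow> \<bar>u\<bar> \<le> speed x u"
proof -
  assume "0 \<le> x"
  then have "sqrt (u\<^sup>2) \<le> speed x u" unfolding speed_def using b_pos by (intro real_sqrt_le_mono) simp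
  then show ?thesis by simp
qed

lemma speed_gt: "0 < x \<Longrightarrow> \<bar>u\<bar> < speed x u"
proof -
  assume "0 < x"
  then have "sqrt (u\<^sup>2) < speed x u" unfolding speed_def using b_pos by (intro real_sqrt_less_mono) simp
  then show ?thesis by simp
qed

lemma speed_nonneg: "0 \<le> x \<Longrightarrow> 0 \<le> speed x u"
  using speed_ge[of x u] by linarith

text \<open>Together with \<open>speed_coords\<close> this makes (age, speed) and (height, vel)
  mutually inverse, including the wall itself.\<close>

lemma coords_age:
  assumes "0 \<le> x"
  shows "vel (age x u) (speed x u) = u" "height (age x u) (speed x u) = x"
proof -
  show 1: "vel (age x u) (speed x u) = u" by (simp add: age_def vel_sage)
  show "height (age x u) (speed x u) = x" using assms b_pos by (simp add: height_def 1 speed_sq)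
qed

lemma age_bounds: "0 \<le> x \<Longrightarrow> 0 \<le> age x u \<and> age x u \<le> flight (speed x u)"
proof -
  assume x: "0 \<le> x"
  have "gint (- speed x u) \<le> gint u" "gint u \<le> gint (speed x u)"
    using speed_ge[OF x, of u] by (auto simp: abs_le_iff)
  then have "sage (speed x u) u \<le> sage (speed x u) (- speed x u)" "0 \<le> sage (speed x u) u"
    using b_pos by (auto simp: sage_def intro!: divide_right_mono mult_left_mono)
  then show ?thesis by (simp add: age_def sage_flight)
qed

lemma age_bounds_strict: "0 < x \<Longrightarrow> 0 < age x u \<and> age x u < flight (speed x u)"
  using age_bounds[of x u] coords_age[of x u] speed_gt[of x u] height_pos_iff[of "speed x u" "age x u"]
  by (auto simp: abs_less_iff)

lemma wall_coords: "speed 0 u = \<bar>u\<bar>" "0 \<le> u \<Longrightarrow> age 0 u = 0" "u \<le> 0 \<Longrightarrow> age 0 u = flight (- u)"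
  using sage_flight[of "-u"] by (auto simp: speed_def age_def) (simp add: sage_def)

section \<open>Equations of motion and their invariants\<close>

lemma vel_deriv:
  assumes "0 \<le> v" "0 \<le> s" "s \<le> flight v"
  shows "((\<lambda>s. vel s v) has_real_derivative - b / (1 + height s v)) (at s)"
proof -
  define e where "e = exp (- (v\<^sup>2 / (2 * b)))"
  have g: "((\<lambda>s. gint v - b * s * e) has_real_derivative - (b * e)) (at s)"
    by (auto intro!: derivative_eq_intros)
  have "(ginv has_real_derivative exp ((vel s v)\<^sup>2 / (2 * b))) (at (gint v - b * s * e))"
    using ginv_deriv[of "vel s v"] by (simp only: sage_vel(3)[OF assms] e_def)
  from DERIV_chain2[OF this g]
  have "((\<lambda>s. vel s v) has_real_derivative exp ((vel s v)\<^sup>2 / (2 * b)) * (- (b * e))) (at s)"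
    by (simp only: vel_def e_def)
  moreover have "1 + height s v = exp (v\<^sup>2 / (2 * b)) / exp ((vel s v)\<^sup>2 / (2 * b))"
    by (simp add: height_def diff_divide_distrib exp_diff)
  moreover have "r * (- (b * inverse p)) = - b / (p / r)" for r p :: real
    by (simp add: divide_inverse)
  ultimately show ?thesis
    by (simp only: e_def exp_minus)
qed
lemma height_deriv:
  assumes "0 \<le> v" "0 \<le> s" "s \<le> flight v"
  shows "((\<lambda>s. height s v) has_real_derivative vel s v) (at s)"
proof -
  define h where "h = height s v"
  have h: "exp ((v\<^sup>2 - (vel s v)\<^sup>2) / (2 * b)) = 1 + h" by (simp add: height_def h_def)
  have "((\<lambda>s. (v\<^sup>2 - (vel s v)\<^sup>2) / (2 * b)) has_real_derivative (0 - 2 * vel s v * (- b / (1 + h))) / (2 * b)) (at s)"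
    using DERIV_cdivide[OF DERIV_diff[OF DERIV_const[of "v\<^sup>2"] DERIV_power[OF vel_deriv[OF assms], of 2]], of "2 * b"]
    by (simp add: h_def ac_simps)
  then have "((\<lambda>s. height s v) has_real_derivative (1 + h) * ((0 - 2 * vel s v * (- b / (1 + h))) / (2 * b)) - 0) (at s)"
    unfolding height_def[of _ v, abs_def] h[symmetric]
    by (intro DERIV_diff DERIV_const DERIV_fun_exp)
  moreover have "1 + h > 0" using height_nonneg[OF assms] by (simp add: h_def)
  then have "(1 + h) * ((0 - 2 * vel s v * (- b / (1 + h))) / (2 * b)) - 0 = vel s v"
    using b_pos by simp
  ultimately show ?thesis by simp
qed
text \<open>The energy and the age minus time have derivative zero. Derivatives within the closed
  interval suffice, so orbits that begin or end on the wall are included. The lemma takes the place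
  of a uniqueness theorem for the equations of motion.\<close>

lemma flow_invariants:
  fixes X U :: "real \<Rightarrow> real"
  assumes st: "s \<le> t"
    and X: "\<And>\<tau>. \<tau> \<in> {s..t} \<Longrightarrow> (X has_real_derivative U \<tau>) (at \<tau> within {s..t})"
    and U: "\<And>\<tau>. \<tau> \<in> {s..t} \<Longrightarrow> (U has_real_derivative - b / (1 + X \<tau>)) (at \<tau> within {s..t})"
    and pos: "\<And>\<tau>. \<tau> \<in> {s..t} \<Longrightarrow> 0 \<le> X \<tau>"
  shows "speed (X t) (U t) = speed (X s) (U s)" "age (X t) (U t) = age (X s) (U s) + (t - s)"
proof -
  have dE: "((\<lambda>\<tau>. (U \<tau>)\<^sup>2 + 2 * b * ln (1 + X \<tau>)) has_real_derivative 0) (at \<tau> within {s..t})" if "\<tau> \<in> {s..t}" for \<tau>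
  proof -
    have p: "0 < 1 + X \<tau>" using pos[OF that] by simp
    have "((\<lambda>\<tau>. 1 + X \<tau>) has_real_derivative 0 + U \<tau>) (at \<tau> within {s..t})"
      by (intro DERIV_add DERIV_const X[OF that])
    from DERIV_chain2[OF DERIV_ln_divide[OF p] this]
    have "((\<lambda>\<tau>. ln (1 + X \<tau>)) has_real_derivative 1 / (1 + X \<tau>) * (0 + U \<tau>)) (at \<tau> within {s..t})" .
     moreover have "((\<lambda>\<tau>. (U \<tau>)\<^sup>2) has_real_derivative - b / (1 + X \<tau>) * U \<tau> + - b / (1 + X \<tau>) * U \<tau>) (at \<tau> within {s..t})"
      unfolding power2_eq_square by (rule DERIV_mult[OF U[OF that] U[OF that]])
    ultimately have "((\<lambda>\<tau>. (U \<tau>)\<^sup>2 + 2 * b * ln (1 + X \<tau>)) has_real_derivative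
        (- b / (1 + X \<tau>) * U \<tau> + - b / (1 + X \<tau>) * U \<tau>) + 2 * b * (1 / (1 + X \<tau>) * (0 + U \<tau>))) (at \<tau> within {s..t})"
      using DERIV_add DERIV_cmult by blast
    moreover have "(- b / (1 + X \<tau>) * U \<tau> + - b / (1 + X \<tau>) * U \<tau>) + 2 * b * (1 / (1 + X \<tau>) * (0 + U \<tau>)) = 0"
      by (simp add: algebra_simps)
    ultimately show ?thesis by (simp only:)
  qed
  have ss: "s \<in> {s..t}" and tt: "t \<in> {s..t}" using st by auto
  have cE: "(U \<tau>)\<^sup>2 + 2 * b * ln (1 + X \<tau>) = (U s)\<^sup>2 + 2 * b * ln (1 + X s)" if "\<tau> \<in> {s..t}" for \<tau>
  proof -
    obtain c where c: "\<forall>\<tau>\<in>{s..t}. (U \<tau>)\<^sup>2 + 2 * b * ln (1 + X \<tau>) = c"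
      using has_field_derivative_zero_constant[OF convex_real_interval(5) dE] by blast
    from c[rule_format, OF that] c[rule_format, OF ss] show ?thesis by (rule trans[OF _ sym])
  qed
  have sp: "speed (X \<tau>) (U \<tau>) = speed (X s) (U s)" if "\<tau> \<in> {s..t}" for \<tau>
    unfolding speed_def by (rule arg_cong[OF cE[OF that]])
  show "speed (X t) (U t) = speed (X s) (U s)" by (rule sp[OF tt])
  define v where "v = speed (X s) (U s)"
  have v2: "v\<^sup>2 = (U \<tau>)\<^sup>2 + 2 * b * ln (1 + X \<tau>)" if "\<tau> \<in> {s..t}" for \<tau>
    using speed_sq[OF pos[OF that], of "U \<tau>"] sp[OF that] by (simp add: v_def)
  have dA: "((\<lambda>\<tau>. sage v (U \<tau>) - \<tau>) has_real_derivative 0) (at \<tau> within {s..t})" if t: "\<tau> \<in> {s..t}" for \<tau>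
  proof -
    have p: "0 < 1 + X \<tau>" using pos[OF t] by simp
    have "v\<^sup>2 / (2 * b) = (U \<tau>)\<^sup>2 / (2 * b) + ln (1 + X \<tau>)"
      using b_pos by (simp add: v2[OF t] add_divide_distrib)
    then have e: "exp (v\<^sup>2 / (2 * b)) = exp ((U \<tau>)\<^sup>2 / (2 * b)) * (1 + X \<tau>)"
      using p by (simp add: exp_add)
    have "((\<lambda>\<tau>. sage v (U \<tau>) - \<tau>) has_real_derivative
       exp (v\<^sup>2 / (2 * b)) / b * (0 - exp (- ((U \<tau>)\<^sup>2 / (2 * b))) * (- b / (1 + X \<tau>))) - 1) (at \<tau> within {s..t})"
      unfolding sage_def
      by (intro DERIV_diff DERIV_cmult DERIV_const DERIV_ident DERIV_chain2[OF gint_deriv U[OF t]])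
    moreover have "exp (v\<^sup>2 / (2 * b)) / b * (0 - exp (- ((U \<tau>)\<^sup>2 / (2 * b))) * (- b / (1 + X \<tau>))) - 1 = 0"
      using p b_pos unfolding e by (simp add: exp_minus)
    ultimately show ?thesis by simp qed
  obtain c where c: "\<forall>\<tau>\<in>{s..t}. sage v (U \<tau>) - \<tau> = c"
    using has_field_derivative_zero_constant[OF convex_real_interval(5) dA] by blast
  from c[rule_format, OF tt] c[rule_format, OF ss] have "sage v (U t) - t = sage v (U s) - s" by (rule trans[OF _ sym])
  then show "age (X t) (U t) = age (X s) (U s) + (t - s)"
    unfolding age_def sp[OF tt] v_def[symmetric] by linarith
qed
end

section \<open>The law of a flight\<close>

lemma lborel2_measurable:
  "borel_measurable (lborel \<Otimes>\<^sub>M lborel) = (borel_measurable (borel :: ('a::euclidean_space \<times> 'b::euclidean_space) measure) :: (_ \<Rightarrow> ennreal) set)"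
  by (simp add: lborel_prod)

lemma lborel_Fubini:
  fixes H :: "'a::euclidean_space \<Rightarrow> 'b::euclidean_space \<Rightarrow> ennreal"
  assumes "(\<lambda>z. H (fst z) (snd z)) \<in> borel_measurable borel"
  shows "(\<integral>\<^sup>+y. (\<integral>\<^sup>+x. H x y \<partial>lborel) \<partial>lborel) = (\<integral>\<^sup>+x. (\<integral>\<^sup>+y. H x y \<partial>lborel) \<partial>lborel)"
  using assms by (intro lborel_pair.Fubini') (simp add: lborel2_measurable case_prod_beta')

lemma norm2_sq: "(norm (p :: real^2))\<^sup>2 = (p $ 1)\<^sup>2 + (p $ 2)\<^sup>2"
  unfolding power2_norm_eq_inner inner_vec_def sum_2 by (simp add: power2_eq_square)

section \<open>Gaussian integrals\<close>

lemma nn_integral_gauss2: "(\<integral>\<^sup>+p. ennreal (exp (- ((norm p)\<^sup>2 / 2))) \<partial>(lborel :: (real^2) measure)) = ennreal (2 * pi)"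
proof -
  have G: "(\<integral>\<^sup>+x. ennreal (exp (- (x\<^sup>2 / 2))) \<partial>lborel) = ennreal (sqrt (2 * pi))"
  proof -
    interpret prob_space "density lborel std_normal_density" by (rule prob_space_normal_density) simp
    have "(\<integral>\<^sup>+x. ennreal (std_normal_density x) \<partial>lborel) = 1"
      using emeasure_space_1 by (simp add: emeasure_density)
    moreover have "(\<integral>\<^sup>+x. ennreal (exp (- (x\<^sup>2 / 2))) \<partial>lborel) = (\<integral>\<^sup>+x. ennreal (sqrt (2 * pi)) * ennreal (std_normal_density x) \<partial>lborel)"
      by (intro nn_integral_cong) (simp add: std_normal_density_def ennreal_mult[symmetric])
    ultimately show ?thesis by (simp add: nn_integral_cmult)
  qed
  have n: "(norm (vec2 (a, c)))\<^sup>2 = a\<^sup>2 + c\<^sup>2" for a c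
    by (simp add: norm2_sq)
  have "(\<integral>\<^sup>+p. ennreal (exp (- ((norm p)\<^sup>2 / 2))) \<partial>(lborel :: (real^2) measure))
     = (\<integral>\<^sup>+a. (\<integral>\<^sup>+c. ennreal (exp (- (a\<^sup>2 / 2))) * ennreal (exp (- (c\<^sup>2 / 2))) \<partial>lborel) \<partial>lborel)"
    by (subst nn_integral_vec2, measurable, intro nn_integral_cong)
       (simp add: n ennreal_mult[symmetric] exp_add[symmetric] add_divide_distrib)
  also have "\<dots> = ennreal (sqrt (2 * pi)) * ennreal (sqrt (2 * pi))"
    by (simp add: nn_integral_cmult nn_integral_multc G)
  also have "\<dots> = ennreal (2 * pi)" by (simp add: ennreal_mult[symmetric])
  finally show ?thesis .
qed

lemma nn_integral_gauss_tail:
  assumes "0 \<le> a"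
  shows "(\<integral>\<^sup>+v. ennreal (v * exp (- (v\<^sup>2 / 2))) * indicator {a..} v \<partial>lborel) = ennreal (exp (- (a\<^sup>2 / 2)))"
proof -
  have "(\<integral>\<^sup>+v. ennreal (v * exp (- (v\<^sup>2 / 2))) * indicator {a..} v \<partial>lborel) = ennreal (0 - (- exp (- (a\<^sup>2 / 2))))"
  proof (rule nn_integral_FTC_atLeast[where F="\<lambda>v. - exp (- (v\<^sup>2 / 2))"])
    show "((\<lambda>v. - exp (- (v\<^sup>2 / 2))) has_real_derivative x * exp (- (x\<^sup>2 / 2))) (at x)" for x :: real
      by (auto intro!: derivative_eq_intros)
    show "((\<lambda>v::real. - exp (- (v\<^sup>2 / 2))) \<longlongrightarrow> 0) at_top" by real_asymp
  qed (use assms in auto)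
  then show ?thesis by simp
qed

context log_potential
begin

section \<open>Phase space volume in orbit coordinates\<close>

text \<open>The Jacobian v is the flux weight at the wall. It arises from two substitutions in one
  variable: for fixed u the height is replaced by the emission speed, with dx = (v / b) E dv, and
  for fixed v the velocity is replaced by the age, with ds = (E / b) du, where E = exp((v^2 - u^2) /
  (2b)).\<close>

lemma vertical_change_of_variables:
  assumes [measurable]: "h \<in> borel_measurable (borel :: (real \<times> real) measure)"
  shows "(\<integral>\<^sup>+x. (\<integral>\<^sup>+u. h (x, u) * indicator {0<..} x \<partial>lborel) \<partial>lborel)
   = (\<integral>\<^sup>+v. (\<integral>\<^sup>+s. h (height s v, vel s v) * ennreal v * indicator {0<..} v * indicator {0<..<flight v} s \<partial>lborel) \<partial>lborel)"
proof -
  \<comment> \<open>The height at which the orbit with emission speed v has velocity u, and its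
    derivative in v.\<close>
  define g where "g u v = exp ((v\<^sup>2 - u\<^sup>2) / (2 * b)) - 1" for u v :: real
  define g' where "g' u v = v / b * exp ((v\<^sup>2 - u\<^sup>2) / (2 * b))" for u v :: real
  have [measurable]: "(\<lambda>z. g (fst z) (snd z)) \<in> borel_measurable borel" "(\<lambda>z. g' (fst z) (snd z)) \<in> borel_measurable borel"
    unfolding g_def g'_def by measurable
  have gm: "g u \<in> borel_measurable borel" "g' u \<in> borel_measurable borel" for u
    unfolding g_def[abs_def] g'_def[abs_def] by measurable
  have lim: "filterlim (g u) at_top at_top" for u
    unfolding g_def using b_pos by real_asymp
  have 1: "(\<integral>\<^sup>+x. h (x, u) * indicator {0<..} x \<partial>lborel) = (\<integral>\<^sup>+v. h (g u v, u) * indicator {\<bar>u\<bar><..} v * ennreal (g' u v) \<partial>lborel)" for u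
  proof -
    have "(\<integral>\<^sup>+x. h (x, u) * indicator {0<..} x \<partial>lborel) = (\<integral>\<^sup>+x. (h (x, u) * indicator {0<..} x) * indicator {g u \<bar>u\<bar>..} x \<partial>lborel)"
      by (intro nn_integral_cong) (auto simp: g_def split: split_indicator)
    also have "\<dots> = (\<integral>\<^sup>+v. (h (g u v, u) * indicator {0<..} (g u v)) * ennreal (g' u v) * indicator {\<bar>u\<bar>..} v \<partial>lborel)"
    proof (rule nn_integral_substitution_atLeast[OF _ gm])
      show "(g u has_real_derivative g' u x) (at x)" for x
        unfolding g_def[abs_def] g'_def using b_pos by (auto intro!: derivative_eq_intros)
      show "continuous_on {\<bar>u\<bar>..} (g' u)" unfolding g'_def using b_pos by (intro continuous_intros) auto
      show "0 \<le> g' u x" if "\<bar>u\<bar> \<le> x" for x using that b_pos by (simp add: g'_def)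
    qed (use lim in auto)
    also have "\<dots> = (\<integral>\<^sup>+v. h (g u v, u) * indicator {\<bar>u\<bar><..} v * ennreal (g' u v) \<partial>lborel)"
    proof (intro nn_integral_cong)
      fix v
      have "0 < g u v \<longleftrightarrow> \<bar>u\<bar> < v" if "\<bar>u\<bar> \<le> v"
      proof -
        have "0 < g u v \<longleftrightarrow> u\<^sup>2 < v\<^sup>2" using b_pos by (simp add: g_def zero_less_divide_iff)
        also have "\<dots> \<longleftrightarrow> \<bar>u\<bar> < \<bar>v\<bar>" by (metis abs_le_square_iff not_le)
        finally show ?thesis using that by simp
      qed
      then show "(h (g u v, u) * indicator {0<..} (g u v)) * ennreal (g' u v) * indicator {\<bar>u\<bar>..} v
         = h (g u v, u) * indicator {\<bar>u\<bar><..} v * ennreal (g' u v)"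
        by (auto split: split_indicator)
    qed
    finally show ?thesis .
  qed
  have 2: "(\<integral>\<^sup>+u. h (g u v, u) * indicator {\<bar>u\<bar><..} v * ennreal (g' u v) \<partial>lborel)
     = (\<integral>\<^sup>+s. h (height s v, vel s v) * ennreal v * indicator {0<..} v * indicator {0<..<flight v} s \<partial>lborel)" for v
  proof (cases "0 < v")
    case True
    define f where "f s = h (height s v, vel s v) * indicator {0<..<flight v} s" for s
    have [measurable]: "f \<in> borel_measurable borel"
    proof -
      have "(\<lambda>s. height s v) \<in> borel_measurable borel" "(\<lambda>s. vel s v) \<in> borel_measurable borel"
        unfolding height_def vel_def by measurable
      then show ?thesis unfolding f_def[abs_def] by measurable
    qed
    define k where "k u = exp (v\<^sup>2 / (2 * b)) / b * exp (- (u\<^sup>2 / (2 * b)))" for u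
    \<comment> \<open>The substitution is carried out in -u, because the age increases as the
      velocity falls; the reflection is undone afterwards.\<close>
    have "(\<integral>\<^sup>+s. f s * indicator {0..flight v} s \<partial>lborel) = (\<integral>\<^sup>+s. f s * indicator {sage v (- (- v))..sage v (- v)} s \<partial>lborel)"
      by (simp add: sage_flight) (simp add: sage_def)
    also have "\<dots> = (\<integral>\<^sup>+u. f (sage v (- u)) * ennreal (k u) * indicator {- v..v} u \<partial>lborel)"
    proof (rule nn_integral_substitution_aux)
      show "((\<lambda>u. sage v (- u)) has_real_derivative k x) (at x)" for x
      proof -
        have "((\<lambda>u. gint (- u)) has_real_derivative exp (- ((- x)\<^sup>2 / (2 * b))) * - 1) (at x)"
          by (intro DERIV_chain2[OF gint_deriv]) (auto intro!: derivative_eq_intros)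
        then have "((\<lambda>u. sage v (- u)) has_real_derivative exp (v\<^sup>2 / (2 * b)) / b * (0 - exp (- ((- x)\<^sup>2 / (2 * b))) * - 1)) (at x)"
          unfolding sage_def by (intro DERIV_cmult DERIV_diff DERIV_const)
        then show ?thesis by (simp add: k_def)
      qed
      show "continuous_on {- v..v} k" unfolding k_def using b_pos by (intro continuous_intros) auto
    qed (use True b_pos in \<open>auto simp: k_def\<close>)
    also have "\<dots> = (\<integral>\<^sup>+u. f (sage v u) * ennreal (k u) * indicator {- v..v} u \<partial>lborel)"

    proof -
      have [measurable]: "(\<lambda>u. sage v u) \<in> borel_measurable borel" "k \<in> borel_measurable borel"
        unfolding sage_def k_def[abs_def] by measurable
      have "(\<integral>\<^sup>+u. f (sage v u) * ennreal (k u) * indicator {- v..v} u \<partial>lborel)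
        = (\<integral>\<^sup>+u. f (sage v (0 + -1 * u)) * ennreal (k (0 + -1 * u)) * indicator {- v..v} (0 + -1 * u) \<partial>lborel)"
        by (subst nn_integral_real_affine[where c="-1" and t=0]) auto
      also have "\<dots> = (\<integral>\<^sup>+u. f (sage v (- u)) * ennreal (k u) * indicator {- v..v} u \<partial>lborel)"
      proof (intro nn_integral_cong)
        fix u
        have "k (- u) = k u" by (simp add: k_def)
        moreover have "(indicator {- v..v} (- u) :: ennreal) = indicator {- v..v} u" by (auto simp: indicator_def)
        ultimately show "f (sage v (0 + -1 * u)) * ennreal (k (0 + -1 * u)) * indicator {- v..v} (0 + -1 * u)
          = f (sage v (- u)) * ennreal (k u) * indicator {- v..v} u" by simp
      qed
      finally show ?thesis by (rule sym)
    qed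
    also have "\<dots> = (\<integral>\<^sup>+u. h (g u v, u) * indicator {\<bar>u\<bar><..} v * ennreal (k u) \<partial>lborel)"
    proof (intro nn_integral_cong)
      fix u
      show "f (sage v u) * ennreal (k u) * indicator {- v..v} u = h (g u v, u) * indicator {\<bar>u\<bar><..} v * ennreal (k u)"
      proof (cases "\<bar>u\<bar> < v")
        case True
        then have "sage v v < sage v u" "sage v u < sage v (- v)" unfolding sage_less_iff by auto
        then have "0 < sage v u" "sage v u < flight v" by (auto simp: sage_flight) (simp add: sage_def)
        moreover have "u \<in> {- v..v}" using True by auto
        ultimately show ?thesis using True by (simp add: f_def vel_sage height_def g_def)
      next
        case False
        have "f (sage v u) = 0" if "u = v \<or> u = - v"
          using that by (auto simp: f_def sage_flight) (simp add: sage_def)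
        moreover have "u \<in> {- v..v} \<Longrightarrow> u = v \<or> u = - v" using False by auto
        ultimately show ?thesis using False by (cases "u \<in> {- v..v}") auto
      qed
    qed
    finally have 3: "(\<integral>\<^sup>+s. f s * indicator {0..flight v} s \<partial>lborel) = (\<integral>\<^sup>+u. h (g u v, u) * indicator {\<bar>u\<bar><..} v * ennreal (k u) \<partial>lborel)" .
    \<comment> \<open>The quotient of the two derivatives is v.\<close>
    have gk: "ennreal (g' u v) = ennreal v * ennreal (k u)" for u
      using True b_pos by (simp add: g'_def k_def ennreal_mult[symmetric] exp_add[symmetric] diff_divide_distrib)
    have "(\<integral>\<^sup>+u. h (g u v, u) * indicator {\<bar>u\<bar><..} v * ennreal (g' u v) \<partial>lborel)
       = (\<integral>\<^sup>+u. ennreal v * (h (g u v, u) * indicator {\<bar>u\<bar><..} v * ennreal (k u)) \<partial>lborel)"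
      by (intro nn_integral_cong) (simp add: gk ac_simps)
    also have "\<dots> = ennreal v * (\<integral>\<^sup>+s. f s * indicator {0..flight v} s \<partial>lborel)"
      unfolding 3 k_def by (intro nn_integral_cmult) (simp add: g_def indicator_def)
    also have "\<dots> = (\<integral>\<^sup>+s. ennreal v * (f s * indicator {0..flight v} s) \<partial>lborel)"
      by (intro nn_integral_cmult[symmetric]) simp
    also have "\<dots> = (\<integral>\<^sup>+s. h (height s v, vel s v) * ennreal v * indicator {0<..} v * indicator {0<..<flight v} s \<partial>lborel)"
      using True by (intro nn_integral_cong) (auto simp: f_def ac_simps split: split_indicator)
    finally show ?thesis .
  qed (auto split: split_indicator)
  have "(\<integral>\<^sup>+x. (\<integral>\<^sup>+u. h (x, u) * indicator {0<..} x \<partial>lborel) \<partial>lborel) = (\<integral>\<^sup>+u. (\<integral>\<^sup>+x. h (x, u) * indicator {0<..} x \<partial>lborel) \<partial>lborel)"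
    by (rule lborel_Fubini) measurable
  also have "\<dots> = (\<integral>\<^sup>+u. (\<integral>\<^sup>+v. h (g u v, u) * indicator {\<bar>u\<bar><..} v * ennreal (g' u v) \<partial>lborel) \<partial>lborel)"
    by (simp only: 1)
  also have "\<dots> = (\<integral>\<^sup>+v. (\<integral>\<^sup>+u. h (g u v, u) * indicator {\<bar>u\<bar><..} v * ennreal (g' u v) \<partial>lborel) \<partial>lborel)"
    by (rule lborel_Fubini[symmetric]) (simp add: g_def g'_def indicator_def)
  also have "\<dots> = (\<integral>\<^sup>+v. (\<integral>\<^sup>+s. h (height s v, vel s v) * ennreal v * indicator {0<..} v * indicator {0<..<flight v} s \<partial>lborel) \<partial>lborel)"
    by (simp only: 2)
  finally show ?thesis .
qed

section \<open>Law of the emission and law of a flight\<close>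

definition maxw :: "(real^2) \<times> real \<Rightarrow> real" where
  "maxw z = 1 / (2 * pi) * exp (- ((norm (fst z))\<^sup>2 + (snd z)\<^sup>2) / 2)"

text \<open>The Maxwellian flux of emitted velocities, and its image under a flight.\<close>

definition emission :: "((real^2) \<times> real) measure" where
  "emission = density lborel (\<lambda>z. ennreal (snd z * maxw z) * indicator {0<..} (snd z))"

definition jump :: "pt measure" where
  "jump = distr emission borel (\<lambda>z. (flight (snd z), flight (snd z) *\<^sub>R fst z))"

lemma maxw_borel [measurable]: "maxw \<in> borel_measurable borel"
  unfolding maxw_def by measurable

lemma maxw_pos: "0 < maxw z" by (simp add: maxw_def)

lemma sets_jump [simp]: "sets jump = sets borel" by (simp add: jump_def)

lemma nn_integral_emission:
  assumes [measurable]: "H \<in> borel_measurable borel"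
  shows "(\<integral>\<^sup>+z. H z \<partial>emission) = (\<integral>\<^sup>+v. (\<integral>\<^sup>+p. H (p, v) * ennreal (v * maxw (p, v)) * indicator {0<..} v \<partial>lborel) \<partial>lborel)"
proof -
  have "(\<integral>\<^sup>+z. H z \<partial>emission) = (\<integral>\<^sup>+z. (ennreal (snd z * maxw z) * indicator {0<..} (snd z)) * H z \<partial>lborel)"
    unfolding emission_def by (rule nn_integral_density) measurable
  also have "\<dots> = (\<integral>\<^sup>+p. (\<integral>\<^sup>+v. H (p, v) * ennreal (v * maxw (p, v)) * indicator {0<..} v \<partial>lborel) \<partial>lborel)"
    by (subst nn_integral_lborel_pair) (simp_all add: ac_simps)
  also have "\<dots> = (\<integral>\<^sup>+v. (\<integral>\<^sup>+p. H (p, v) * ennreal (v * maxw (p, v)) * indicator {0<..} v \<partial>lborel) \<partial>lborel)"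
    by (rule lborel_Fubini[symmetric]) measurable
  finally show ?thesis .
qed

lemma nn_integral_jump:
  assumes [measurable]: "H \<in> borel_measurable borel"
  shows "(\<integral>\<^sup>+n. H n \<partial>jump) = (\<integral>\<^sup>+v. (\<integral>\<^sup>+p. H (flight v, flight v *\<^sub>R p) * ennreal (v * maxw (p, v)) * indicator {0<..} v \<partial>lborel) \<partial>lborel)"
proof -
  have m: "(\<lambda>z. (flight (snd z), flight (snd z) *\<^sub>R fst z)) \<in> borel_measurable emission"
    unfolding emission_def by measurable
  have "(\<integral>\<^sup>+n. H n \<partial>jump) = (\<integral>\<^sup>+z. H (flight (snd z), flight (snd z) *\<^sub>R fst z) \<partial>emission)"
    unfolding jump_def by (subst nn_integral_distr[OF m]) auto
  also have "\<dots> = (\<integral>\<^sup>+v. (\<integral>\<^sup>+p. H (flight v, flight v *\<^sub>R p) * ennreal (v * maxw (p, v)) * indicator {0<..} v \<partial>lborel) \<partial>lborel)"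
    by (subst nn_integral_emission) auto
  finally show ?thesis .
qed

lemma maxw_split: "0 \<le> v \<Longrightarrow> ennreal (v * maxw (p, v)) = ennreal (v * exp (- (v\<^sup>2 / 2)) / (2 * pi)) * ennreal (exp (- ((norm p)\<^sup>2 / 2)))"
  by (simp add: maxw_def ennreal_mult[symmetric] add_divide_distrib exp_add[symmetric] diff_divide_distrib ac_simps)

lemma nn_integral_maxw_p:
  "(\<integral>\<^sup>+p. ennreal (v * maxw (p, v)) * indicator {0<..} v \<partial>lborel) = ennreal (v * exp (- (v\<^sup>2 / 2))) * indicator {0<..} v"
proof (cases "0 < v")
  case True
  then have "(\<integral>\<^sup>+p. ennreal (v * maxw (p, v)) * indicator {0<..} v \<partial>lborel)
     = ennreal (v * exp (- (v\<^sup>2 / 2)) / (2 * pi)) * ennreal (2 * pi)"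
    by (simp add: maxw_split nn_integral_cmult nn_integral_gauss2)
  also have "\<dots> = ennreal (v * exp (- (v\<^sup>2 / 2)))" using True by (subst ennreal_mult[symmetric]) auto
  finally show ?thesis using True by simp
qed simp

lemma nn_integral_jump_time:
  assumes [measurable]: "g \<in> borel_measurable borel"
  shows "(\<integral>\<^sup>+n. g (fst n) \<partial>jump) = (\<integral>\<^sup>+v. g (flight v) * (ennreal (v * exp (- (v\<^sup>2 / 2))) * indicator {0<..} v) \<partial>lborel)"
  by (subst nn_integral_jump, measurable, intro nn_integral_cong)
     (simp add: mult.assoc nn_integral_cmult nn_integral_maxw_p)

lemma jump_tail_int: "emeasure jump {n. s \<le> fst n} = (\<integral>\<^sup>+n. indicator {s..} (fst n) \<partial>jump)"
proof -
  have "{n :: pt. s \<le> fst n} \<in> sets borel" by simp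
  then have "emeasure jump {n. s \<le> fst n} = (\<integral>\<^sup>+n. indicator {n. s \<le> fst n} n \<partial>jump)"
    by (intro nn_integral_indicator[symmetric]) simp
  then show ?thesis by (simp add: indicator_def)
qed

text \<open>As \<open>flight\<close> is increasing, the event says that the emission speed is at
  least v, and the density v exp(-v^2 / 2) of that speed integrates exactly.\<close>

lemma jump_tail: "0 \<le> v \<Longrightarrow> emeasure jump {n. flight v \<le> fst n} = ennreal (exp (- (v\<^sup>2 / 2)))"
proof -
  assume v: "0 \<le> v"
  have "emeasure jump {n. flight v \<le> fst n} = (\<integral>\<^sup>+u. indicator {flight v..} (flight u) * (ennreal (u * exp (- (u\<^sup>2 / 2))) * indicator {0<..} u) \<partial>lborel)"
    unfolding jump_tail_int by (rule nn_integral_jump_time) simp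
  also have "\<dots> = (\<integral>\<^sup>+u. ennreal (u * exp (- (u\<^sup>2 / 2))) * indicator {v..} u \<partial>lborel)"
    using v by (intro nn_integral_cong) (auto simp: flight_le_iff split: split_indicator)
  also have "\<dots> = ennreal (exp (- (v\<^sup>2 / 2)))" by (rule nn_integral_gauss_tail[OF v])
  finally show ?thesis .
qed

lemma prob_jump: "prob_space jump"
proof (rule prob_spaceI)
  have "space jump = {n. flight 0 \<le> fst n} \<union> {n. fst n < 0}" by (auto simp: jump_def)
  have "emeasure jump (space jump) = (\<integral>\<^sup>+n. 1 \<partial>jump)" by simp
  also have "\<dots> = (\<integral>\<^sup>+u. 1 * (ennreal (u * exp (- (u\<^sup>2 / 2))) * indicator {0<..} u) \<partial>lborel)"
    by (rule nn_integral_jump_time) simp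
  also have "\<dots> = (\<integral>\<^sup>+u. ennreal (u * exp (- (u\<^sup>2 / 2))) * indicator {0..} u \<partial>lborel)"
    by (intro nn_integral_cong) (auto split: split_indicator)
  also have "\<dots> = 1" by (subst nn_integral_gauss_tail) auto
  finally show "emeasure jump (space jump) = 1" .
qed

lemma jump_pos: "AE n in jump. 0 < fst n"
proof -
  have "(\<integral>\<^sup>+n. indicator {..0} (fst n) \<partial>jump) = (\<integral>\<^sup>+u. indicator {..0} (flight u) * (ennreal (u * exp (- (u\<^sup>2 / 2))) * indicator {0<..} u) \<partial>lborel)"
    by (rule nn_integral_jump_time) simp
  also have "\<dots> = (\<integral>\<^sup>+u. 0 \<partial>(lborel::real measure))"
    using flight_pos by (intro nn_integral_cong) (auto simp: not_le[symmetric] split: split_indicator)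
  also have "\<dots> = 0" by simp
  finally have "AE n in jump. (indicator {..0} (fst n) :: ennreal) = 0"
    by (subst (asm) nn_integral_0_iff_AE) (auto simp: measurable_cong_sets[OF sets_jump refl])
  then show ?thesis by eventually_elim (auto simp: indicator_def split: if_splits)
qed

section \<open>Hazard rate, tail and Doeblin condition\<close>

lemma nn_integral_flight_substitution:
  assumes [measurable]: "f \<in> borel_measurable borel"
  shows "(\<integral>\<^sup>+s. f s * indicator {0<..} s \<partial>lborel) = (\<integral>\<^sup>+v. f (flight v) * ennreal (flight' v) * indicator {0..} v \<partial>lborel)"
proof -
  have "(\<integral>\<^sup>+s. f s * indicator {0<..} s \<partial>lborel) = (\<integral>\<^sup>+s. f s * indicator {flight 0..} s \<partial>lborel)"
    using AE_lborel_singleton[of "0::real"] by (intro nn_integral_cong_AE) (auto simp: indicator_def)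
  also have "\<dots> = (\<integral>\<^sup>+v. f (flight v) * ennreal (flight' v) * indicator {0..} v \<partial>lborel)"
    by (rule nn_integral_substitution_atLeast)
       (auto intro: flight_deriv flight'_cont flight_at_top less_imp_le[OF flight'_pos(2)])
  finally show ?thesis .
qed

lemma jump_tail_borel [measurable]: "(\<lambda>s. emeasure jump {n. s \<le> fst n}) \<in> borel_measurable borel"
proof -
  interpret prob_space jump by (rule prob_jump)
  show ?thesis unfolding jump_tail_int
    by (rule borel_measurable_nn_integral)
       (simp add: measurable_cong_sets[OF sets_pair_measure_cong[OF refl sets_jump] refl] borel_prod case_prod_beta' indicator_def)
qed

definition hz :: real where "hz = b / 2 + b\<^sup>2 / 2"

text \<open>The quotient v / \<open>flight' v\<close> is the hazard rate of the duration at
  \<open>flight v\<close>. Speeds up to 1 use \<open>flight' v\<close> \<ge> 2 / b, which accounts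
  for the first summand of \<open>hz\<close>; larger speeds use \<open>flight' v\<close> \<ge> (v /
  b) (2 / b) v, which accounts for the second.\<close>

lemma hazard_rate: "0 \<le> v \<Longrightarrow> v \<le> hz * flight' v"
proof -
  assume v: "0 \<le> v"
  show ?thesis
  proof (cases "v \<le> 1")
    case True
    have "v \<le> b / 2 * (2 / b)" using True b_pos by simp
    also have "\<dots> \<le> hz * flight' v"
      using flight'_pos(1)[OF v] b_pos by (intro mult_mono) (auto simp: hz_def)
    finally show ?thesis .
  next
    case False
    have "v * 1 \<le> v * v" using False by (intro mult_left_mono) auto
    then have "v \<le> b\<^sup>2 / 2 * (v / b * (2 / b * v))" using b_pos by (simp add: power2_eq_square)
    also have "\<dots> \<le> hz * flight' v"
    proof (rule mult_mono)
      have "v / b * (2 / b * v) \<le> v / b * flight v" using flight_ge[OF v] v b_pos by (intro mult_left_mono) auto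
      then show "v / b * (2 / b * v) \<le> flight' v" using b_pos by (simp add: flight'_def add_increasing)
    qed (use v b_pos in \<open>auto simp: hz_def\<close>)
    finally show ?thesis .
  qed
qed

lemma jump_hazard:
  assumes [measurable]: "g \<in> borel_measurable borel"
  shows "(\<integral>\<^sup>+n. g (fst n) \<partial>jump) \<le> ennreal hz * (\<integral>\<^sup>+s. g s * emeasure jump {n. s \<le> fst n} * indicator {0<..} s \<partial>lborel)"
proof -
  have hz: "0 \<le> hz" using b_pos by (simp add: hz_def)
  have "(\<integral>\<^sup>+n. g (fst n) \<partial>jump) = (\<integral>\<^sup>+v. g (flight v) * (ennreal (v * exp (- (v\<^sup>2 / 2))) * indicator {0<..} v) \<partial>lborel)"
    by (rule nn_integral_jump_time) simp
  also have "\<dots> \<le> (\<integral>\<^sup>+v. ennreal hz * ((g (flight v) * emeasure jump {n. flight v \<le> fst n}) * ennreal (flight' v) * indicator {0..} v) \<partial>lborel)"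
  proof (intro nn_integral_mono)
    fix v
    show "g (flight v) * (ennreal (v * exp (- (v\<^sup>2 / 2))) * indicator {0<..} v) \<le> ennreal hz * ((g (flight v) * emeasure jump {n. flight v \<le> fst n}) * ennreal (flight' v) * indicator {0..} v)"
    proof (cases "0 < v")
      case True
      have "ennreal (v * exp (- (v\<^sup>2 / 2))) \<le> ennreal (hz * flight' v * exp (- (v\<^sup>2 / 2)))"
        using hazard_rate[of v] True by (intro ennreal_leI mult_right_mono) auto
      also have "\<dots> = ennreal hz * ennreal (flight' v) * emeasure jump {n. flight v \<le> fst n}"
        using True hz flight'_pos(2)[of v] by (simp add: jump_tail ennreal_mult)
      finally have "g (flight v) * ennreal (v * exp (- (v\<^sup>2 / 2))) \<le> g (flight v) * (ennreal hz * ennreal (flight' v) * emeasure jump {n. flight v \<le> fst n})"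
        by (intro mult_left_mono) auto
      then show ?thesis using True by (simp add: ac_simps)
    qed (auto split: split_indicator)
  qed
  also have "\<dots> = ennreal hz * (\<integral>\<^sup>+v. (g (flight v) * emeasure jump {n. flight v \<le> fst n}) * ennreal (flight' v) * indicator {0..} v \<partial>lborel)"
  proof (rule nn_integral_cmult)
    have [measurable]: "(\<lambda>v. emeasure jump {n. flight v \<le> fst n}) \<in> borel_measurable borel"
      by (rule measurable_compose[OF flight_borel jump_tail_borel])
    show "(\<lambda>v. (g (flight v) * emeasure jump {n. flight v \<le> fst n}) * ennreal (flight' v) * indicator {0..} v) \<in> borel_measurable lborel"
      by measurable
  qed
  also have "(\<integral>\<^sup>+v. (g (flight v) * emeasure jump {n. flight v \<le> fst n}) * ennreal (flight' v) * indicator {0..} v \<partial>lborel)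
     = (\<integral>\<^sup>+s. g s * emeasure jump {n. s \<le> fst n} * indicator {0<..} s \<partial>lborel)"
    by (rule nn_integral_flight_substitution[symmetric]) measurable
  finally show ?thesis .
qed

definition tail_const :: real where "tail_const = (2 / b * (sqrt (2 * b) * (pi / 2))) powr b"

text \<open>Write s = \<open>flight v\<close>. Then s is at most k exp(v^2 / (2b)), where k comes
  from the bound on \<open>gint\<close>, and the tail exp(-v^2 / 2) is the power -b of that
  exponential.\<close>

lemma jump_tail_powr:
  assumes s: "0 < s"
  shows "emeasure jump {n. s \<le> fst n} \<le> ennreal (tail_const * s powr (- b))"
proof -
  obtain v where v: "0 \<le> v" "flight v = s" using flight_surj[of s] s by auto
  define k where "k = 2 / b * (sqrt (2 * b) * (pi / 2))"
  have k: "0 < k" using b_pos by (simp add: k_def)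
  have "s = exp (v\<^sup>2 / (2 * b)) * (2 / b * gint v)" unfolding v(2)[symmetric] flight_def by (simp only: ac_simps)
  also have "\<dots> \<le> exp (v\<^sup>2 / (2 * b)) * k"
    unfolding k_def using gint_bound[OF v(1)] b_pos by (intro mult_left_mono) auto
  finally have "s / k \<le> exp (v\<^sup>2 / (2 * b))" using k by (simp add: field_simps)
  then have "exp (v\<^sup>2 / (2 * b)) powr (- b) \<le> (s / k) powr (- b)"
    using s k b_pos by (intro powr_mono2') auto
  also have "exp (v\<^sup>2 / (2 * b)) powr (- b) = exp (- (v\<^sup>2 / 2))"
    using b_pos by (simp add: powr_def)
  also have "(s / k) powr (- b) = tail_const * s powr (- b)"
  proof -
    have "tail_const = k powr b" by (simp only: tail_const_def k_def)
    then show ?thesis using s k by (simp add: powr_divide powr_minus) (simp add: divide_inverse)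
  qed
  finally show ?thesis using jump_tail[OF v(1)] v(2) by (simp add: ennreal_leI)
qed

lemma jump_tau:
  assumes b1: "1 < b" and r: "0 < r"
  shows "(\<integral>\<^sup>+s. emeasure jump {n. s \<le> fst n} * indicator {r<..} s \<partial>lborel) \<le> ennreal (tail_const / (b - 1) * r powr (1 - b))"
proof -
  have tc: "0 \<le> tail_const" by (simp add: tail_const_def)
  have "(\<integral>\<^sup>+s. emeasure jump {n. s \<le> fst n} * indicator {r<..} s \<partial>lborel) \<le> (\<integral>\<^sup>+s. ennreal (tail_const * s powr (- b)) * indicator {r..} s \<partial>lborel)"
    using jump_tail_powr r by (intro nn_integral_mono) (auto split: split_indicator)
  also have "\<dots> = ennreal (0 - (tail_const * (r powr (1 - b) / (1 - b))))"
  proof (rule nn_integral_FTC_atLeast)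
    show "((\<lambda>s. tail_const * (s powr (1 - b) / (1 - b))) has_real_derivative tail_const * x powr (- b)) (at x)" if "r \<le> x" for x
    proof -
      have "((\<lambda>s. s powr (1 - b)) has_real_derivative (1 - b) * x powr (1 - b - 1)) (at x)"
        using that r by (intro has_real_derivative_powr) auto
      from DERIV_cmult[OF DERIV_cdivide[OF this, of "1 - b"], of tail_const]
      show ?thesis using b1 by simp
    qed
    have "((\<lambda>s. s powr (1 - b)) \<longlongrightarrow> 0) at_top"
      using b1 by (intro tendsto_neg_powr filterlim_ident) auto
    then have "((\<lambda>s. tail_const * (s powr (1 - b) / (1 - b))) \<longlongrightarrow> tail_const * (0 / (1 - b))) at_top"
      using b1 by (intro tendsto_mult tendsto_const tendsto_divide) auto
    then show "((\<lambda>s. tail_const * (s powr (1 - b) / (1 - b))) \<longlongrightarrow> 0) at_top" by simp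
  qed (use tc in auto)
  also have "0 - (tail_const * (r powr (1 - b) / (1 - b))) = tail_const / (b - 1) * r powr (1 - b)"
    using b1 by (simp add: field_simps)
  finally show ?thesis .
qed

text \<open>The duration has a density that is bounded below on [1, L]. Given the duration s, the
  displacement is a centred Gaussian of standard deviation s, whose density is bounded below on one
  fundamental cell; by periodicity one cell already sees the whole wall.\<close>

lemma jump_minor:
  assumes L: "1 < L"
  shows "\<exists>c>0. \<forall>w t y. pm w \<longrightarrow>
       ennreal c * (\<integral>\<^sup>+x. w x * indicator {t - L..t - 1} (fst x) \<partial>wallm) \<le> (\<integral>\<^sup>+n. w ((t, y) - n) \<partial>jump)"
proof -
  obtain v1 where v1: "0 \<le> v1" "flight v1 = 1" using flight_surj[of 1] by auto
  obtain v2 where v2: "0 \<le> v2" "flight v2 = L" using flight_surj[of L] L by auto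
  have "v1 \<noteq> 0" using v1 by auto
  then have v1p: "0 < v1" using v1 by simp
  have v12: "v1 \<le> v2" using v1 v2 L flight_le_iff[of v1 v2] by simp
  \<comment> \<open>The density of the duration at \<open>flight v\<close>, continuous and positive
    on the compact range of speeds that corresponds to [1, L].\<close>
  have "\<exists>m>0. \<forall>v\<in>{v1..v2}. m \<le> v * exp (- (v\<^sup>2 / 2)) / flight' v"
  proof -
    have nz: "flight' v \<noteq> 0" if "v \<in> {v1..v2}" for v using flight'_pos(2)[of v] that v1 by auto
    have "continuous_on {v1..v2} (\<lambda>v. v * exp (- (v\<^sup>2 / 2)) / flight' v)"
      using nz by (intro continuous_intros flight'_cont) auto
    then obtain v where v: "v \<in> {v1..v2}" "\<forall>u\<in>{v1..v2}. v * exp (- (v\<^sup>2 / 2)) / flight' v \<le> u * exp (- (u\<^sup>2 / 2)) / flight' u"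
      using continuous_attains_inf[of "{v1..v2}" "\<lambda>v. v * exp (- (v\<^sup>2 / 2)) / flight' v"] v12 by auto
    have "0 < v * exp (- (v\<^sup>2 / 2)) / flight' v" using v(1) v1p flight'_pos(2)[of v] by simp
    then show ?thesis using v(2) by blast
  qed
  then obtain m where m: "0 < m" "\<And>v. v \<in> {v1..v2} \<Longrightarrow> m \<le> v * exp (- (v\<^sup>2 / 2)) / flight' v" by blast
  \<comment> \<open>Normalisation of the Maxwellian, lower bound of the displacement density up to
    that normalisation, and lower bound of the duration density.\<close>
  define c where "c = 1 / (2 * pi) * (exp (- 1) / L\<^sup>2) * m"
  have c: "0 < c" using m L by (simp add: c_def)
  have "ennreal c * (\<integral>\<^sup>+x. w x * indicator {t - L..t - 1} (fst x) \<partial>wallm) \<le> (\<integral>\<^sup>+n. w ((t, y) - n) \<partial>jump)"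
    if w: "pm w" for w t y
  proof -
    have [measurable]: "w \<in> borel_measurable borel" using w by (rule pm_measurable)
    define W where "W r = (\<integral>\<^sup>+y. w (r, y) \<partial>cellm)" for r
    have [measurable]: "W \<in> borel_measurable borel"
    proof -
      interpret cellm: prob_space cellm by (rule prob_cellm)
      show ?thesis unfolding W_def[abs_def] by (intro cellm.borel_measurable_nn_integral) measurable
    qed
    have spread: "ennreal (exp (- 1) / L\<^sup>2) * W (t - s) \<le> (\<integral>\<^sup>+p. w (t - s, y - s *\<^sub>R p) * ennreal (exp (- ((norm p)\<^sup>2 / 2))) \<partial>lborel)"
      if s: "1 \<le> s" "s \<le> L" for s
    proof -
      define f where "f z = w (t - s, y - z) * ennreal (exp (- ((norm z)\<^sup>2 / (2 * s\<^sup>2))))" for z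
      have [measurable]: "f \<in> borel_measurable borel" unfolding f_def[abs_def] by measurable
      have s0: "s \<noteq> 0" using s by simp
      have "(\<integral>\<^sup>+z. f z \<partial>lborel) = (\<integral>\<^sup>+z. f z \<partial>density (distr lborel borel (\<lambda>x. 0 + s *\<^sub>R x)) (\<lambda>_. ennreal (\<bar>s\<bar> ^ DIM(real^2))))"
        by (subst lborel_affine[OF s0, of 0, symmetric]) simp
      also have "\<dots> = (\<integral>\<^sup>+p. ennreal (s\<^sup>2) * f (s *\<^sub>R p) \<partial>lborel)"
        by (simp add: nn_integral_density nn_integral_distr)
      also have "\<dots> = ennreal (s\<^sup>2) * (\<integral>\<^sup>+p. f (s *\<^sub>R p) \<partial>lborel)"
        by (rule nn_integral_cmult) measurable
      also have "(\<integral>\<^sup>+p. f (s *\<^sub>R p) \<partial>lborel) = (\<integral>\<^sup>+p. w (t - s, y - s *\<^sub>R p) * ennreal (exp (- ((norm p)\<^sup>2 / 2))) \<partial>lborel)"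
        using s0 by (intro nn_integral_cong) (simp add: f_def power_mult_distrib)
      finally have 1: "(\<integral>\<^sup>+z. f z \<partial>lborel) = ennreal (s\<^sup>2) * (\<integral>\<^sup>+p. w (t - s, y - s *\<^sub>R p) * ennreal (exp (- ((norm p)\<^sup>2 / 2))) \<partial>lborel)" .
      have "W (t - s) = (\<integral>\<^sup>+z. w (t - s, y - z) \<partial>cellm)"
        unfolding W_def using w by (intro nn_integral_cellm_reflect[symmetric]) (auto simp: pm_def)
      also have "\<dots> = (\<integral>\<^sup>+z. indicator torus_cell z * w (t - s, y - z) \<partial>lborel)"
        unfolding cellm_def by (rule nn_integral_density) measurable
      finally have "ennreal (exp (- 1)) * W (t - s) = (\<integral>\<^sup>+z. ennreal (exp (- 1)) * (indicator torus_cell z * w (t - s, y - z)) \<partial>lborel)"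
        by (simp add: nn_integral_cmult)
      also have "\<dots> \<le> (\<integral>\<^sup>+z. f z \<partial>lborel)"
      proof (intro nn_integral_mono)
        fix z :: "real^2"
        show "ennreal (exp (- 1)) * (indicator torus_cell z * w (t - s, y - z)) \<le> f z"
        proof (cases "z \<in> torus_cell")
          case True
          then have z: "0 \<le> z$1" "z$1 < 1" "0 \<le> z$2" "z$2 < 1" by (auto simp: torus_cell_def)
          \<comment> \<open>On the cell |z|^2 \<le> 2 \<le> 2 s^2 because s \<ge> 1, so the Gaussian
            exponent is at least -1.\<close>
          have "(norm z)\<^sup>2 = (z$1)\<^sup>2 + (z$2)\<^sup>2"
            by (rule norm2_sq)
          also have "\<dots> \<le> 1 + 1" using z by (intro add_mono) (auto simp: power_le_one)
          also have "\<dots> \<le> 2 * s\<^sup>2" using s by (simp add: one_le_power)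
          finally have "exp (- 1) \<le> exp (- ((norm z)\<^sup>2 / (2 * s\<^sup>2)))" using s by (simp add: field_simps)
          then have "w (t - s, y - z) * ennreal (exp (- 1)) \<le> f z"
            unfolding f_def by (intro mult_left_mono ennreal_leI) auto
          then show ?thesis using True by (simp add: mult.commute)
        qed simp
      qed
      finally have "ennreal (exp (- 1)) * W (t - s) \<le> ennreal (s\<^sup>2) * (\<integral>\<^sup>+p. w (t - s, y - s *\<^sub>R p) * ennreal (exp (- ((norm p)\<^sup>2 / 2))) \<partial>lborel)"
        unfolding 1 .
      also have "\<dots> \<le> ennreal (L\<^sup>2) * (\<integral>\<^sup>+p. w (t - s, y - s *\<^sub>R p) * ennreal (exp (- ((norm p)\<^sup>2 / 2))) \<partial>lborel)"
        using s by (intro mult_right_mono ennreal_leI power_mono) auto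
      finally have "ennreal (1 / L\<^sup>2) * (ennreal (exp (- 1)) * W (t - s)) \<le> ennreal (1 / L\<^sup>2) * (ennreal (L\<^sup>2) * (\<integral>\<^sup>+p. w (t - s, y - s *\<^sub>R p) * ennreal (exp (- ((norm p)\<^sup>2 / 2))) \<partial>lborel))"
        by (intro mult_left_mono) auto
      also have "ennreal (1 / L\<^sup>2) * (ennreal (L\<^sup>2) * (\<integral>\<^sup>+p. w (t - s, y - s *\<^sub>R p) * ennreal (exp (- ((norm p)\<^sup>2 / 2))) \<partial>lborel)) = (\<integral>\<^sup>+p. w (t - s, y - s *\<^sub>R p) * ennreal (exp (- ((norm p)\<^sup>2 / 2))) \<partial>lborel)"
        using L by (subst mult.assoc[symmetric], subst ennreal_mult[symmetric]) auto
      also have "ennreal (1 / L\<^sup>2) * (ennreal (exp (- 1)) * W (t - s)) = ennreal (exp (- 1) / L\<^sup>2) * W (t - s)"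
        by (subst mult.assoc[symmetric], subst ennreal_mult[symmetric]) auto
      finally show ?thesis .
    qed
    have "(\<integral>\<^sup>+x. w x * indicator {t - L..t - 1} (fst x) \<partial>wallm) = (\<integral>\<^sup>+r. W r * indicator {t - L..t - 1} r \<partial>lborel)"
      unfolding W_def by (subst nn_integral_wallm) (auto simp: nn_integral_multc)
    also have "\<dots> = (\<integral>\<^sup>+s. (W (t - s) * indicator {1..L} s) * indicator {0<..} s \<partial>lborel)"
      by (subst nn_integral_real_affine[where c="-1" and t=t]) (auto intro!: nn_integral_cong split: split_indicator)
    also have "\<dots> = (\<integral>\<^sup>+v. (W (t - flight v) * indicator {1..L} (flight v)) * ennreal (flight' v) * indicator {0..} v \<partial>lborel)"
      by (rule nn_integral_flight_substitution) measurable
    finally have "ennreal c * (\<integral>\<^sup>+x. w x * indicator {t - L..t - 1} (fst x) \<partial>wallm)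
       = (\<integral>\<^sup>+v. ennreal c * ((W (t - flight v) * indicator {1..L} (flight v)) * ennreal (flight' v) * indicator {0..} v) \<partial>lborel)"
      by (simp add: nn_integral_cmult)
    also have "\<dots> \<le> (\<integral>\<^sup>+v. (\<integral>\<^sup>+p. w ((t, y) - (flight v, flight v *\<^sub>R p)) * ennreal (v * maxw (p, v)) * indicator {0<..} v \<partial>lborel) \<partial>lborel)"
    proof (intro nn_integral_mono)
      fix v
      show "ennreal c * ((W (t - flight v) * indicator {1..L} (flight v)) * ennreal (flight' v) * indicator {0..} v)
         \<le> (\<integral>\<^sup>+p. w ((t, y) - (flight v, flight v *\<^sub>R p)) * ennreal (v * maxw (p, v)) * indicator {0<..} v \<partial>lborel)"
      proof (cases "0 \<le> v \<and> flight v \<in> {1..L}")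
        case True
        then have v: "v \<in> {v1..v2}" using flight_le_iff[of v1 v] flight_le_iff[of v v2] v1 v2 by auto
        then have vp: "0 < v" using v1p by simp
        have f': "0 < flight' v" using flight'_pos(2)[of v] vp by simp
        have "(\<integral>\<^sup>+p. w ((t, y) - (flight v, flight v *\<^sub>R p)) * ennreal (v * maxw (p, v)) * indicator {0<..} v \<partial>lborel)
          = (\<integral>\<^sup>+p. ennreal (v * exp (- (v\<^sup>2 / 2)) / (2 * pi)) * (w (t - flight v, y - flight v *\<^sub>R p) * ennreal (exp (- ((norm p)\<^sup>2 / 2)))) \<partial>lborel)"
          using vp by (intro nn_integral_cong) (simp add: maxw_split minus_prod_def ac_simps)
        also have "\<dots> = ennreal (v * exp (- (v\<^sup>2 / 2)) / (2 * pi)) * (\<integral>\<^sup>+p. w (t - flight v, y - flight v *\<^sub>R p) * ennreal (exp (- ((norm p)\<^sup>2 / 2))) \<partial>lborel)"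
          by (rule nn_integral_cmult) measurable
        also have "\<dots> \<ge> ennreal (1 / (2 * pi) * (m * flight' v)) * (ennreal (exp (- 1) / L\<^sup>2) * W (t - flight v))"
        proof (intro mult_mono spread ennreal_leI)
          have "m * flight' v \<le> v * exp (- (v\<^sup>2 / 2))" using m(2)[OF v] f' by (simp add: field_simps)
          then show "1 / (2 * pi) * (m * flight' v) \<le> v * exp (- (v\<^sup>2 / 2)) / (2 * pi)" by (simp add: divide_right_mono)
        qed (use True in auto)
        also have "ennreal (1 / (2 * pi) * (m * flight' v)) * (ennreal (exp (- 1) / L\<^sup>2) * W (t - flight v)) = ennreal c * (W (t - flight v) * ennreal (flight' v))"
        proof -
          have "ennreal (1 / (2 * pi) * (m * flight' v)) * ennreal (exp (- 1) / L\<^sup>2) = ennreal c * ennreal (flight' v)"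
            using m f' c by (simp add: c_def ennreal_mult[symmetric] ac_simps)
          then show ?thesis by (simp add: ac_simps)
        qed
        finally show ?thesis using True by simp
      qed (auto split: split_indicator)
    qed
    also have "\<dots> = (\<integral>\<^sup>+n. w ((t, y) - n) \<partial>jump)"
      by (rule nn_integral_jump[symmetric]) measurable
    finally show ?thesis .
  qed
  then show ?thesis using c by blast
qed

end

text \<open>For b > 1 the tail bound s^(-b) is integrable at infinity, which gives a finite mean
  flight time.\<close>

locale steep_log_potential = log_potential +
  assumes b_gt_1: "1 < b"
begin

sublocale renewal jump hz
proof (rule renewal.intro)
  show "prob_space jump" by (rule prob_jump)
  show "0 < hz" using b_pos by (simp add: hz_def add_pos_pos)
  show "(\<integral>\<^sup>+s. emeasure jump {n. s \<le> fst n} * indicator {0<..} s \<partial>lborel) < \<infinity>"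
  proof -
    interpret prob_space jump by (rule prob_jump)
    have "(\<integral>\<^sup>+s. emeasure jump {n. s \<le> fst n} * indicator {0<..} s \<partial>lborel)
       \<le> (\<integral>\<^sup>+s. indicator {0<..1} s + emeasure jump {n. s \<le> fst n} * indicator {1<..} s \<partial>lborel)"
      using emeasure_le_1 by (intro nn_integral_mono) (auto split: split_indicator)
    also have "\<dots> = (\<integral>\<^sup>+s. indicator {0<..1} s \<partial>(lborel::real measure)) + (\<integral>\<^sup>+s. emeasure jump {n. s \<le> fst n} * indicator {1<..} s \<partial>lborel)"
      by (intro nn_integral_add) auto
    also have "\<dots> \<le> 1 + ennreal (tail_const / (b - 1) * 1 powr (1 - b))"
      by (intro add_mono jump_tau b_gt_1) auto
    also have "\<dots> < \<infinity>" by simp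
    finally show ?thesis .
  qed
  show "\<exists>r>0. (\<integral>\<^sup>+s. emeasure jump {n. s \<le> fst n} * indicator {r<..} s \<partial>lborel) \<le> ennreal e" if "0 < e" for e
  proof -
    have "((\<lambda>r. tail_const / (b - 1) * r powr (1 - b)) \<longlongrightarrow> tail_const / (b - 1) * 0) at_top"
      using b_gt_1 by (intro tendsto_mult tendsto_const tendsto_neg_powr filterlim_ident) auto
    then have "\<forall>\<^sub>F r in at_top. tail_const / (b - 1) * r powr (1 - b) < e"
      using that by (intro order_tendstoD) auto
    moreover have "\<forall>\<^sub>F r in at_top. (0::real) < r" by (rule eventually_gt_at_top)
    ultimately have "\<forall>\<^sub>F r in at_top. tail_const / (b - 1) * r powr (1 - b) < e \<and> 0 < r" by eventually_elim simp
    then obtain r where r: "tail_const / (b - 1) * r powr (1 - b) < e" "0 < r"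
      by (auto simp: eventually_at_top_linorder)
    have "(\<integral>\<^sup>+s. emeasure jump {n. s \<le> fst n} * indicator {r<..} s \<partial>lborel) \<le> ennreal (tail_const / (b - 1) * r powr (1 - b))"
      by (rule jump_tau[OF b_gt_1 r(2)])
    also have "\<dots> \<le> ennreal e" using r(1) by (intro ennreal_leI) simp
    finally show ?thesis using r(2) by blast
  qed
qed (use jump_pos jump_hazard jump_minor in auto)

end

section \<open>Transport along the orbits\<close>

definition hor :: "real^3 \<Rightarrow> real^2" where
  "hor x = vector [x $ 1, x $ 2]"

lemma hor_nth [simp]: "hor x $ 1 = x $ 1" "hor x $ 2 = x $ 2"
  by (simp_all add: hor_def)

lemma hor_vec3 [simp]: "hor (vec3 z) = fst z"
  unfolding vec_eq_iff forall_2 by simp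

lemma vec3_hor [simp]: "vec3 (hor x, x $ 3) = x"
  unfolding vec_eq_iff forall_3 by simp

lemma hor_vec2: "hor x = vec2 (x $ 1, x $ 2)"
  by (simp add: hor_def vec2_def)

lemma hor_borel [measurable]: "hor \<in> borel_measurable borel"
  unfolding hor_vec2[abs_def] by measurable

lemma vec3_shift: "vec3 (y + axis 1 1, h) = vec3 (y, h) + axis 1 1" "vec3 (y + axis 2 1, h) = vec3 (y, h) + axis 2 1"
  unfolding vec_eq_iff forall_3 by (simp_all add: axis_def)

definition per3 :: "((real^3) \<times> (real^3) \<Rightarrow> 'a) \<Rightarrow> bool" where
  "per3 H \<longleftrightarrow> (\<forall>x v. H (x + axis 1 1, v) = H (x, v) \<and> H (x + axis 2 1, v) = H (x, v))"

lemma per3_periodic2: "per3 H \<Longrightarrow> periodic2 (\<lambda>y. H (vec3 (y, h), u))"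
  unfolding per3_def periodic2_def vec3_shift by blast

lemma per3_periodic2': "per3 H \<Longrightarrow> periodic2 (\<lambda>y. H (vec3 (y + c, h), u))"
proof -
  have *: "y + e + c = (y + c) + e" for y e :: "real^2" by (simp add: algebra_simps)
  show "per3 H \<Longrightarrow> periodic2 (\<lambda>y. H (vec3 (y + c, h), u))"
    unfolding per3_def periodic2_def *[of _ "axis 1 1"] *[of _ "axis 2 1"] vec3_shift by blast
qed

text \<open>The order of integration puts the torus innermost, where horizontal shifts can be
  removed, and keeps height and vertical velocity adjacent for the change of variables.\<close>

lemma nn_integral_phase_split:
  assumes [measurable]: "H \<in> borel_measurable borel"
  shows "(\<integral>\<^sup>+z. H z * indicator (Omega_cell \<times> UNIV) z \<partial>lborel)
    = (\<integral>\<^sup>+p. (\<integral>\<^sup>+h. (\<integral>\<^sup>+u. (\<integral>\<^sup>+y. H (vec3 (y, h), vec3 (p, u)) \<partial>cellm) * indicator {0<..} h \<partial>lborel) \<partial>lborel) \<partial>lborel)"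
proof -
  have [measurable]: "Omega_cell \<times> UNIV \<in> sets (borel :: ((real^3) \<times> (real^3)) measure)"
    unfolding Omega_cell_def Omega_def borel_prod[symmetric] by (intro pair_measureI) measurable
  have O: "indicator (Omega_cell \<times> UNIV) (vec3 (y, h), v) = (indicator torus_cell y * indicator {0<..} h :: ennreal)" for y h and v :: "real^3"
    by (auto simp: Omega_cell_def Omega_def torus_cell_def indicator_def)
  have "(\<integral>\<^sup>+z. H z * indicator (Omega_cell \<times> UNIV) z \<partial>lborel)
     = (\<integral>\<^sup>+x. (\<integral>\<^sup>+v. H (x, v) * indicator (Omega_cell \<times> UNIV) (x, v) \<partial>lborel) \<partial>lborel)"
    by (rule nn_integral_lborel_pair) measurable
  also have "\<dots> = (\<integral>\<^sup>+v. (\<integral>\<^sup>+x. H (x, v) * indicator (Omega_cell \<times> UNIV) (x, v) \<partial>lborel) \<partial>lborel)"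
    by (rule lborel_Fubini[symmetric]) measurable
  also have "\<dots> = (\<integral>\<^sup>+v. (\<integral>\<^sup>+y. (\<integral>\<^sup>+h. H (vec3 (y, h), v) * (indicator torus_cell y * indicator {0<..} h) \<partial>lborel) \<partial>lborel) \<partial>lborel)"
    by (subst nn_integral_vec3) (simp_all add: O)
  also have "\<dots> = (\<integral>\<^sup>+v. (\<integral>\<^sup>+h. (\<integral>\<^sup>+y. H (vec3 (y, h), v) * (indicator torus_cell y * indicator {0<..} h) \<partial>lborel) \<partial>lborel) \<partial>lborel)"
    by (intro nn_integral_cong, rule lborel_Fubini[symmetric]) measurable
  also have "\<dots> = (\<integral>\<^sup>+v. (\<integral>\<^sup>+h. (\<integral>\<^sup>+y. H (vec3 (y, h), v) \<partial>cellm) * indicator {0<..} h \<partial>lborel) \<partial>lborel)"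
  proof (intro nn_integral_cong)
    fix v :: "real^3" and h :: real
    have "(\<integral>\<^sup>+y. H (vec3 (y, h), v) * (indicator torus_cell y * indicator {0<..} h) \<partial>lborel)
      = (\<integral>\<^sup>+y. indicator torus_cell y * H (vec3 (y, h), v) * indicator {0<..} h \<partial>lborel)"
      by (intro nn_integral_cong) (simp add: ac_simps)
    also have "\<dots> = (\<integral>\<^sup>+y. indicator torus_cell y * H (vec3 (y, h), v) \<partial>lborel) * indicator {0<..} h"
      by (rule nn_integral_multc) measurable
    also have "(\<integral>\<^sup>+y. indicator torus_cell y * H (vec3 (y, h), v) \<partial>lborel) = (\<integral>\<^sup>+y. H (vec3 (y, h), v) \<partial>cellm)"
      unfolding cellm_def by (rule nn_integral_density[symmetric]) measurable
    finally show "(\<integral>\<^sup>+y. H (vec3 (y, h), v) * (indicator torus_cell y * indicator {0<..} h) \<partial>lborel) = (\<integral>\<^sup>+y. H (vec3 (y, h), v) \<partial>cellm) * indicator {0<..} h" .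
  qed
  also have "\<dots> = (\<integral>\<^sup>+p. (\<integral>\<^sup>+u. (\<integral>\<^sup>+h. (\<integral>\<^sup>+y. H (vec3 (y, h), vec3 (p, u)) \<partial>cellm) * indicator {0<..} h \<partial>lborel) \<partial>lborel) \<partial>lborel)"
  proof (rule nn_integral_vec3)
    have c: "borel_measurable (borel \<Otimes>\<^sub>M cellm) = (borel_measurable (borel \<Otimes>\<^sub>M borel) :: (((real^3) \<times> real) \<times> (real^2) \<Rightarrow> ennreal) set)"
      by (intro measurable_cong_sets sets_pair_measure_cong) auto
    have "(\<lambda>z::((real^3) \<times> real) \<times> (real^2). H (vec3 (snd z, snd (fst z)), fst (fst z))) \<in> borel_measurable (borel \<Otimes>\<^sub>M borel)"
      unfolding borel_prod by measurable
    then have [measurable]: "(\<lambda>z::(real^3) \<times> real. \<integral>\<^sup>+y. H (vec3 (y, snd z), fst z) \<partial>cellm) \<in> borel_measurable borel"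
      by (intro cellm.borel_measurable_nn_integral) (simp add: c case_prod_beta')
    have "(\<lambda>z::(real^3) \<times> real. (\<integral>\<^sup>+y. H (vec3 (y, snd z), fst z) \<partial>cellm) * indicator {0<..} (snd z)) \<in> borel_measurable (borel \<Otimes>\<^sub>M borel)"
      unfolding borel_prod by measurable
    then show "(\<lambda>v. \<integral>\<^sup>+h. (\<integral>\<^sup>+y. H (vec3 (y, h), v) \<partial>cellm) * indicator {0<..} h \<partial>lborel) \<in> borel_measurable borel"
      by (intro lborel.borel_measurable_nn_integral) (simp add: case_prod_beta' measurable_cong_sets[OF sets_pair_measure_cong[OF refl sets_lborel] refl])
  qed
  also have "\<dots> = (\<integral>\<^sup>+p. (\<integral>\<^sup>+h. (\<integral>\<^sup>+u. (\<integral>\<^sup>+y. H (vec3 (y, h), vec3 (p, u)) \<partial>cellm) * indicator {0<..} h \<partial>lborel) \<partial>lborel) \<partial>lborel)"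
  proof (rule nn_integral_cong, rule lborel_Fubini)
    fix p :: "real^2"
    have c: "borel_measurable (borel \<Otimes>\<^sub>M cellm) = (borel_measurable (borel \<Otimes>\<^sub>M borel) :: ((real \<times> real) \<times> (real^2) \<Rightarrow> ennreal) set)"
      by (intro measurable_cong_sets sets_pair_measure_cong) auto
    have "(\<lambda>z::(real \<times> real) \<times> (real^2). H (vec3 (snd z, fst (fst z)), vec3 (p, snd (fst z)))) \<in> borel_measurable (borel \<Otimes>\<^sub>M borel)"
      unfolding borel_prod by measurable
    then have [measurable]: "(\<lambda>z::real \<times> real. \<integral>\<^sup>+y. H (vec3 (y, fst z), vec3 (p, snd z)) \<partial>cellm) \<in> borel_measurable borel"
      by (intro cellm.borel_measurable_nn_integral) (simp add: c case_prod_beta')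
    show "(\<lambda>z. (\<integral>\<^sup>+y. H (vec3 (y, fst z), vec3 (p, snd z)) \<partial>cellm) * indicator {0<..} (fst z)) \<in> borel_measurable (borel :: (real \<times> real) measure)"
      by measurable
  qed
  finally show ?thesis .
qed

context steep_log_potential
begin

lemma coords_measurable [measurable (raw)]:
  assumes [measurable]: "f \<in> borel_measurable M" "h \<in> borel_measurable M"
  shows "(\<lambda>x. age (f x) (h x)) \<in> borel_measurable M" "(\<lambda>x. speed (f x) (h x)) \<in> borel_measurable M"
    "(\<lambda>x. vel (f x) (h x)) \<in> borel_measurable M" "(\<lambda>x. height (f x) (h x)) \<in> borel_measurable M"
  unfolding age_def sage_def speed_def vel_def height_def by measurable

text \<open>\<open>state s y p v\<close> is the phase point at time \<open>s\<close> after the emission at \<open>y\<close> with horizontal velocity \<open>p\<close> and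
  vertical velocity \<open>v\<close>; \<open>evol g w t\<close> is the density at time \<open>t\<close> for the initial density \<open>g\<close> and the wall flux \<open>w\<close>.\<close>

definition state :: "real \<Rightarrow> real^2 \<Rightarrow> real^2 \<Rightarrow> real \<Rightarrow> (real^3) \<times> (real^3)" where
  "state s y p v = (vec3 (y + s *\<^sub>R p, height s v), vec3 (p, vel s v))"

text \<open>The point of the wall from which the orbit through z was emitted, in the universal
  cover.\<close>

definition foot :: "(real^3) \<times> (real^3) \<Rightarrow> real^2" where
  "foot z = hor (fst z) - age (fst z $ 3) (snd z $ 3) *\<^sub>R hor (snd z)"

definition evol :: "((real^3) \<times> (real^3) \<Rightarrow> real) \<Rightarrow> (pt \<Rightarrow> real) \<Rightarrow> real \<Rightarrow> (real^3) \<times> (real^3) \<Rightarrow> real" where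
  "evol g w t z = (let s = age (fst z $ 3) (snd z $ 3); r = speed (fst z $ 3) (snd z $ 3); p = hor (snd z) in
     if s < t then maxw (p, r) * w (t - s, foot z) else g (state (s - t) (foot z) p r))"

lemma state_measurable [measurable (raw)]:
  assumes [measurable]: "s \<in> borel_measurable M" "y \<in> borel_measurable M" "p \<in> borel_measurable M" "v \<in> borel_measurable M"
  shows "(\<lambda>x. state (s x) (y x) (p x) (v x)) \<in> borel_measurable M"
  unfolding state_def by measurable

lemma foot_borel [measurable]: "foot \<in> borel_measurable borel"
  unfolding foot_def[abs_def] by measurable

lemma evol_measurable [measurable (raw)]:
  assumes [measurable]: "g \<in> borel_measurable borel" "w \<in> borel_measurable borel" "t \<in> borel_measurable M" "z \<in> borel_measurable M"
  shows "(\<lambda>x. evol g w (t x) (z x)) \<in> borel_measurable M"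
  unfolding evol_def Let_def by measurable

lemma state_inv:
  assumes "0 \<le> v" "0 \<le> s" "s \<le> flight v"
  shows "age (fst (state s y p v) $ 3) (snd (state s y p v) $ 3) = s"
    "speed (fst (state s y p v) $ 3) (snd (state s y p v) $ 3) = v"
    "foot (state s y p v) = y" "hor (snd (state s y p v)) = p"
  using speed_coords[OF assms] by (simp_all add: state_def foot_def)

lemma evol_state:
  assumes "0 \<le> v" "0 \<le> s" "s \<le> flight v"
  shows "evol g w t (state s y p v) = (if s < t then maxw (p, v) * w (t - s, y) else g (state (s - t) y p v))"
  unfolding evol_def Let_def state_inv[OF assms] ..

lemma state_of:
  assumes "0 \<le> fst z $ 3"
  shows "state (age (fst z $ 3) (snd z $ 3)) (foot z) (hor (snd z)) (speed (fst z $ 3) (snd z $ 3)) = z"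
  unfolding state_def coords_age[OF assms] foot_def by simp

text \<open>For fixed p, v and s the displacement s p is absorbed by shift invariance on the torus;
  what remains is \<open>vertical_change_of_variables\<close>.\<close>

lemma nn_integral_phase:
  assumes [measurable]: "H \<in> borel_measurable borel" and per: "per3 H"
  shows "(\<integral>\<^sup>+z. H z * indicator (Omega_cell \<times> UNIV) z \<partial>lborel)
    = (\<integral>\<^sup>+p. (\<integral>\<^sup>+v. (\<integral>\<^sup>+s. (\<integral>\<^sup>+y. H (state s y p v) \<partial>cellm) * ennreal v * indicator {0<..} v * indicator {0<..<flight v} s \<partial>lborel) \<partial>lborel) \<partial>lborel)"
  unfolding nn_integral_phase_split[OF assms(1)]
proof (rule nn_integral_cong)
  fix p :: "real^2"
  define G where "G z = (\<integral>\<^sup>+y. H (vec3 (y, fst z), vec3 (p, snd z)) \<partial>cellm)" for z :: "real \<times> real"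
  have c: "borel_measurable (borel \<Otimes>\<^sub>M cellm) = (borel_measurable (borel \<Otimes>\<^sub>M borel) :: ((real \<times> real) \<times> (real^2) \<Rightarrow> ennreal) set)"
    by (intro measurable_cong_sets sets_pair_measure_cong) auto
  have "(\<lambda>z::(real \<times> real) \<times> (real^2). H (vec3 (snd z, fst (fst z)), vec3 (p, snd (fst z)))) \<in> borel_measurable (borel \<Otimes>\<^sub>M borel)"
    unfolding borel_prod by measurable
  then have "G \<in> borel_measurable borel" unfolding G_def[abs_def]
    by (intro cellm.borel_measurable_nn_integral) (simp add: c case_prod_beta')
  from vertical_change_of_variables[OF this]
  have "(\<integral>\<^sup>+h. (\<integral>\<^sup>+u. G (h, u) * indicator {0<..} h \<partial>lborel) \<partial>lborel)
    = (\<integral>\<^sup>+v. (\<integral>\<^sup>+s. G (height s v, vel s v) * ennreal v * indicator {0<..} v * indicator {0<..<flight v} s \<partial>lborel) \<partial>lborel)" .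
  moreover have "G (height s v, vel s v) = (\<integral>\<^sup>+y. H (state s y p v) \<partial>cellm)" for s v
    using nn_integral_cellm_shift[of "\<lambda>y. H (vec3 (y, height s v), vec3 (p, vel s v))" "s *\<^sub>R p"] per3_periodic2[OF per]
    by (simp add: G_def state_def)
  ultimately show "(\<integral>\<^sup>+h. (\<integral>\<^sup>+u. (\<integral>\<^sup>+y. H (vec3 (y, h), vec3 (p, u)) \<partial>cellm) * indicator {0<..} h \<partial>lborel) \<partial>lborel)
    = (\<integral>\<^sup>+v. (\<integral>\<^sup>+s. (\<integral>\<^sup>+y. H (state s y p v) \<partial>cellm) * ennreal v * indicator {0<..} v * indicator {0<..<flight v} s \<partial>lborel) \<partial>lborel)"
    by (simp add: G_def)
qed

end

lemma nn_integral_lborel_borel: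
  fixes H :: "'a::{second_countable_topology} \<times> 'b::euclidean_space \<Rightarrow> ennreal"
  assumes "H \<in> borel_measurable borel"
  shows "(\<lambda>x. \<integral>\<^sup>+y. H (x, y) \<partial>lborel) \<in> borel_measurable borel"
  using assms by (intro lborel.borel_measurable_nn_integral)
    (simp add: case_prod_beta' measurable_cong_sets[OF sets_pair_measure_cong[OF refl sets_lborel] refl] borel_prod)

lemma nn_integral_cellm_borel:
  fixes H :: "'a::{second_countable_topology} \<times> (real^2) \<Rightarrow> ennreal"
  assumes "H \<in> borel_measurable borel"
  shows "(\<lambda>x. \<integral>\<^sup>+y. H (x, y) \<partial>cellm) \<in> borel_measurable borel"
proof -
  show ?thesis using assms by (intro cellm.borel_measurable_nn_integral)
    (simp add: case_prod_beta' measurable_cong_sets[OF sets_pair_measure_cong[OF refl sets_cellm] refl] borel_prod)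
qed

lemma cellm_Fubini:
  fixes H :: "'a::euclidean_space \<Rightarrow> real^2 \<Rightarrow> ennreal"
  assumes "(\<lambda>z. H (fst z) (snd z)) \<in> borel_measurable borel"
  shows "(\<integral>\<^sup>+y. (\<integral>\<^sup>+x. H x y \<partial>lborel) \<partial>cellm) = (\<integral>\<^sup>+x. (\<integral>\<^sup>+y. H x y \<partial>cellm) \<partial>lborel)"
proof -
  interpret pair_sigma_finite "lborel :: 'a measure" cellm ..
  have "sets ((lborel :: 'a measure) \<Otimes>\<^sub>M cellm) = sets (borel \<Otimes>\<^sub>M (borel :: (real^2) measure))"
    by (intro sets_pair_measure_cong) auto
  then show ?thesis using assms
    by (intro Fubini') (simp add: case_prod_beta' measurable_cong_sets[of _ "borel \<Otimes>\<^sub>M (borel :: (real^2) measure)"] borel_prod)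
qed

lemma lborel_rotate:
  fixes H :: "'a::euclidean_space \<Rightarrow> 'b::euclidean_space \<Rightarrow> 'c::euclidean_space \<Rightarrow> ennreal"
  assumes [measurable]: "(\<lambda>z. H (fst z) (fst (snd z)) (snd (snd z))) \<in> borel_measurable borel"
  shows "(\<integral>\<^sup>+x. (\<integral>\<^sup>+y. (\<integral>\<^sup>+z. H x y z \<partial>lborel) \<partial>lborel) \<partial>lborel) = (\<integral>\<^sup>+z. (\<integral>\<^sup>+x. (\<integral>\<^sup>+y. H x y z \<partial>lborel) \<partial>lborel) \<partial>lborel)"
proof -
   have "(\<integral>\<^sup>+x. (\<integral>\<^sup>+y. (\<integral>\<^sup>+z. H x y z \<partial>lborel) \<partial>lborel) \<partial>lborel) = (\<integral>\<^sup>+x. (\<integral>\<^sup>+z. (\<integral>\<^sup>+y. H x y z \<partial>lborel) \<partial>lborel) \<partial>lborel)"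
  proof (rule nn_integral_cong, rule lborel_Fubini)
    fix x :: 'a
    have "(\<lambda>u. (x, snd u, fst u)) \<in> borel_measurable (borel :: ('c \<times> 'b) measure)" by measurable
    from measurable_compose[OF this assms] show "(\<lambda>u. H x (snd u) (fst u)) \<in> borel_measurable (borel :: ('c \<times> 'b) measure)" by simp
  qed
  also have "\<dots> = (\<integral>\<^sup>+z. (\<integral>\<^sup>+x. (\<integral>\<^sup>+y. H x y z \<partial>lborel) \<partial>lborel) \<partial>lborel)"
  proof (rule lborel_Fubini)

    have "(\<lambda>u::('c \<times> 'a) \<times> 'b. (snd (fst u), snd u, fst (fst u))) \<in> borel_measurable borel" by measurable
    from measurable_compose[OF this assms]
    have "(\<lambda>u::('c \<times> 'a) \<times> 'b. H (snd (fst u)) (snd u) (fst (fst u))) \<in> borel_measurable borel" by simp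
    from nn_integral_lborel_borel[OF this]
    show "(\<lambda>u. \<integral>\<^sup>+y. H (snd u) y (fst u) \<partial>lborel) \<in> borel_measurable (borel :: ('c \<times> 'a) measure)" by simp
  qed
  finally show ?thesis .
qed

context steep_log_potential
begin

section \<open>Mass and outgoing flux of a transported density\<close>

text \<open>The flux through the wall of particles of density \<open>g\<close> that hit it for the first time.\<close>

definition src :: "((real^3) \<times> (real^3) \<Rightarrow> real) \<Rightarrow> pt \<Rightarrow> ennreal" where
  "src g x = (if 0 < fst x then (\<integral>\<^sup>+p. (\<integral>\<^sup>+v. ennreal (g (state (flight v - fst x) (snd x - flight v *\<^sub>R p) p v))
      * ennreal v * indicator {0<..} v * indicator {fst x..} (flight v) \<partial>lborel) \<partial>lborel) else 0)"

lemma per3_state: "per3 g \<Longrightarrow> periodic2 (\<lambda>y. g (state s (y + c) p v))"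
  using per3_periodic2'[of g "c + s *\<^sub>R p" "height s v" "vec3 (p, vel s v)"]
  by (simp add: state_def add.assoc)

lemma per3_state': "per3 g \<Longrightarrow> periodic2 (\<lambda>y. g (state s (y - c) p v))"
  using per3_state[of g s "- c"] by simp

lemma pm_src [simp]:
  assumes [measurable]: "g \<in> borel_measurable borel" and per: "per3 g"
  shows "pm (src g)"
  unfolding pm_def
proof (intro conjI allI)
  have "(\<lambda>z::(pt \<times> (real^2)) \<times> real. ennreal (g (state (flight (snd z) - fst (fst (fst z))) (snd (fst (fst z)) - flight (snd z) *\<^sub>R snd (fst z)) (snd (fst z)) (snd z)))
      * ennreal (snd z) * indicator {0<..} (snd z) * indicator {fst (fst (fst z))..} (flight (snd z))) \<in> borel_measurable borel"
    unfolding indicator_def atLeast_iff by measurable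
  from nn_integral_lborel_borel[OF nn_integral_lborel_borel[OF this]]
  have "(\<lambda>x::pt. \<integral>\<^sup>+p. (\<integral>\<^sup>+v. ennreal (g (state (flight v - fst x) (snd x - flight v *\<^sub>R p) p v))
      * ennreal v * indicator {0<..} v * indicator {fst x..} (flight v) \<partial>lborel) \<partial>lborel) \<in> borel_measurable borel" by simp
  then show "src g \<in> borel_measurable borel" unfolding src_def[abs_def] by measurable
  fix t
  have *: "g (state s (y + axis 1 1 - c) p v) = g (state s (y - c) p v)" "g (state s (y + axis 2 1 - c) p v) = g (state s (y - c) p v)" for s y c p v
    using per3_state'[OF per, of s c p v] by (auto simp: periodic2_def)
  show "periodic2 (\<lambda>y. src g (t, y))"
    unfolding periodic2_def src_def by (simp add: *)
qed

lemma per3_evol: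
  assumes g: "per3 g" and w: "\<And>t. periodic2 (\<lambda>y. w (t, y))"
  shows "per3 (evol g w t)"
proof -
  have f: "foot (x + axis 1 1, v) = foot (x, v) + axis 1 1" "foot (x + axis 2 1, v) = foot (x, v) + axis 2 1" for x v
    unfolding vec_eq_iff forall_2 foot_def by (simp_all add: axis_def)
  have a: "axis 1 (1::real) $ (3::3) = 0" "axis 2 (1::real) $ (3::3) = 0"
    by (simp_all add: axis_def)
  have gs: "g (state s (y + axis 1 1) p v) = g (state s y p v)" "g (state s (y + axis 2 1) p v) = g (state s y p v)" for s y p v
    using per3_state[OF g, of s 0 p v] by (auto simp: periodic2_def)
  have ws: "w (t, y + axis 1 1) = w (t, y)" "w (t, y + axis 2 1) = w (t, y)" for t y
    using w by (auto simp: periodic2_def)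
  show ?thesis unfolding per3_def evol_def Let_def by (simp add: f a gs ws)
qed

text \<open>The mass at time t is read off at the wall. A particle that has not yet hit the wall is
  counted by its future first visit after t; a particle of age s < t was emitted at t - s and is in
  a flight longer than s. The Jacobian v makes both counts exact.\<close>

lemma nn_integral_evol:
  assumes g [measurable]: "g \<in> borel_measurable borel" and gper: "per3 g"
    and w [measurable]: "w \<in> borel_measurable borel" and wper: "\<And>t. periodic2 (\<lambda>y. w (t, y))"
    and w0: "\<And>x. fst x \<le> 0 \<Longrightarrow> w x = 0" and t: "0 \<le> t"
  shows "(\<integral>\<^sup>+z. ennreal (evol g w t z) * indicator (Omega_cell \<times> UNIV) z \<partial>lborel)
    = I (aft t (src g)) + I (aft t (K (upto t (\<lambda>x. ennreal (w x)))))"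
proof -
  define W where "W r = (\<integral>\<^sup>+y. ennreal (w (r, y)) \<partial>cellm)" for r
  define G where "G u = (\<integral>\<^sup>+y. ennreal (g (state (fst u) y (fst (snd u)) (snd (snd u)))) \<partial>cellm)" for u :: "real \<times> (real^2) \<times> real"
  have [measurable]: "W \<in> borel_measurable borel"
    unfolding W_def[abs_def] by (rule nn_integral_cellm_borel) measurable
  have [measurable]: "G \<in> borel_measurable borel"
  proof -
    have "(\<lambda>z::(real \<times> (real^2) \<times> real) \<times> (real^2). ennreal (g (state (fst (fst z)) (snd z) (fst (snd (fst z))) (snd (snd (fst z)))))) \<in> borel_measurable borel"
      by measurable
    from nn_integral_cellm_borel[OF this] show ?thesis by (simp add: G_def[abs_def])
  qed
  have W0: "W r = 0" if "r \<le> 0" for r using that w0 by (simp add: W_def)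
  \<comment> \<open>Emitted particles. The condition s < t need not be written, because W vanishes
    at nonpositive times.\<close>
  define A where "A p v s = W (t - s) * (indicator {s<..} (flight v) * ennreal (v * maxw (p, v)) * indicator {0<..} v) * indicator {0..} s" for p v s
  define B where "B p v s = G (s - t, p, v) * ennreal v * indicator {0<..} v * indicator {t..<flight v} s" for p v s
  have mA: "(\<lambda>z. A (fst z) (fst (snd z)) (snd (snd z))) \<in> borel_measurable borel"
    unfolding A_def indicator_def greaterThan_iff by measurable
  have mB: "(\<lambda>z. B (fst z) (fst (snd z)) (snd (snd z))) \<in> borel_measurable borel"
    unfolding B_def indicator_def greaterThan_iff atLeastLessThan_iff by measurable
  have mA1: "(\<lambda>s. A p v s) \<in> borel_measurable borel" "(\<lambda>s. B p v s) \<in> borel_measurable borel" for p v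
    unfolding A_def B_def indicator_def greaterThan_iff atLeastLessThan_iff by measurable
  have mA2: "(\<lambda>v. \<integral>\<^sup>+s. A p v s \<partial>lborel) \<in> borel_measurable borel" "(\<lambda>v. \<integral>\<^sup>+s. B p v s \<partial>lborel) \<in> borel_measurable borel" for p
  proof -
    have "(\<lambda>z. A p (fst z) (snd z)) \<in> borel_measurable borel" "(\<lambda>z. B p (fst z) (snd z)) \<in> borel_measurable borel"
      unfolding A_def B_def indicator_def greaterThan_iff atLeastLessThan_iff by measurable
    from this[THEN nn_integral_lborel_borel] show "(\<lambda>v. \<integral>\<^sup>+s. A p v s \<partial>lborel) \<in> borel_measurable borel" "(\<lambda>v. \<integral>\<^sup>+s. B p v s \<partial>lborel) \<in> borel_measurable borel"
      by simp_all
  qed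
  have mA3: "(\<lambda>p. \<integral>\<^sup>+v. \<integral>\<^sup>+s. A p v s \<partial>lborel \<partial>lborel) \<in> borel_measurable borel" "(\<lambda>p. \<integral>\<^sup>+v. \<integral>\<^sup>+s. B p v s \<partial>lborel \<partial>lborel) \<in> borel_measurable borel"
  proof -
    have "(\<lambda>z::((real^2) \<times> real) \<times> real. A (fst (fst z)) (snd (fst z)) (snd z)) \<in> borel_measurable borel" "(\<lambda>z::((real^2) \<times> real) \<times> real. B (fst (fst z)) (snd (fst z)) (snd z)) \<in> borel_measurable borel"
      unfolding A_def B_def indicator_def greaterThan_iff atLeastLessThan_iff by measurable
    from this[THEN nn_integral_lborel_borel, THEN nn_integral_lborel_borel] show "(\<lambda>p. \<integral>\<^sup>+v. \<integral>\<^sup>+s. A p v s \<partial>lborel \<partial>lborel) \<in> borel_measurable borel" "(\<lambda>p. \<integral>\<^sup>+v. \<integral>\<^sup>+s. B p v s \<partial>lborel \<partial>lborel) \<in> borel_measurable borel"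
      by simp_all
  qed
  have "(\<integral>\<^sup>+z. ennreal (evol g w t z) * indicator (Omega_cell \<times> UNIV) z \<partial>lborel)
    = (\<integral>\<^sup>+p. (\<integral>\<^sup>+v. (\<integral>\<^sup>+s. (\<integral>\<^sup>+y. ennreal (evol g w t (state s y p v)) \<partial>cellm) * ennreal v * indicator {0<..} v * indicator {0<..<flight v} s \<partial>lborel) \<partial>lborel) \<partial>lborel)"
  proof (rule nn_integral_phase)
    show "per3 (\<lambda>z. ennreal (evol g w t z))" using per3_evol[OF gper wper, of t] by (simp add: per3_def)
  qed measurable
  also have "\<dots> = (\<integral>\<^sup>+p. (\<integral>\<^sup>+v. (\<integral>\<^sup>+s. A p v s + B p v s \<partial>lborel) \<partial>lborel) \<partial>lborel)"
  \<comment> \<open>Age zero is discarded: the indicators in \<open>A\<close> and \<open>B\<close>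
    include it, the phase space does not.\<close>
  proof (rule nn_integral_cong, rule nn_integral_cong, rule nn_integral_cong_AE)
    fix p v
    have "AE s in lborel. s \<noteq> (0::real)" by (rule AE_lborel_singleton)
    then show "AE s in lborel. (\<integral>\<^sup>+y. ennreal (evol g w t (state s y p v)) \<partial>cellm) * ennreal v * indicator {0<..} v * indicator {0<..<flight v} s = A p v s + B p v s"
    proof eventually_elim
      fix s :: real assume s: "s \<noteq> 0"
      show "(\<integral>\<^sup>+y. ennreal (evol g w t (state s y p v)) \<partial>cellm) * ennreal v * indicator {0<..} v * indicator {0<..<flight v} s = A p v s + B p v s"
      proof (cases "0 < v \<and> 0 < s \<and> s < flight v")
        case True
        then have e: "evol g w t (state s y p v) = (if s < t then maxw (p, v) * w (t - s, y) else g (state (s - t) y p v))" for y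
          by (intro evol_state) auto
        show ?thesis
        proof (cases "s < t")
          case st: True
          have "(\<integral>\<^sup>+y. ennreal (evol g w t (state s y p v)) \<partial>cellm) = (\<integral>\<^sup>+y. ennreal (maxw (p, v)) * ennreal (w (t - s, y)) \<partial>cellm)"
            using st maxw_pos[of "(p, v)"] by (intro nn_integral_cong) (simp add: e ennreal_mult')
          also have "\<dots> = ennreal (maxw (p, v)) * W (t - s)"
            unfolding W_def by (rule nn_integral_cmult) measurable
          finally show ?thesis using True st maxw_pos[of "(p, v)"]
            by (simp add: A_def B_def ennreal_mult ac_simps)
        next
          case False
          then show ?thesis using True by (simp add: e A_def B_def G_def W0)
        qed
      next
        case False
        then consider "v \<le> 0" | "s < 0" "0 < v" | "flight v \<le> s" "0 < v" using s by fastforce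
        then show ?thesis
        proof cases
          case 2 then show ?thesis using t by (simp add: A_def B_def)
        qed (simp_all add: A_def B_def)
      qed
    qed
  qed
  also have "\<dots> = (\<integral>\<^sup>+p. (\<integral>\<^sup>+v. (\<integral>\<^sup>+s. A p v s \<partial>lborel) \<partial>lborel) \<partial>lborel) + (\<integral>\<^sup>+p. (\<integral>\<^sup>+v. (\<integral>\<^sup>+s. B p v s \<partial>lborel) \<partial>lborel) \<partial>lborel)"
    by (simp add: nn_integral_add mA1 mA2 mA3)
  also have "(\<integral>\<^sup>+p. (\<integral>\<^sup>+v. (\<integral>\<^sup>+s. A p v s \<partial>lborel) \<partial>lborel) \<partial>lborel) = I (aft t (K (upto t (\<lambda>x. ennreal (w x)))))"
  proof -
    have pw: "pm (\<lambda>x. ennreal (w x))" using wper by (auto simp: pm_def periodic2_def)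
    have esc: "(\<integral>\<^sup>+n. indicator {s<..} (fst n) \<partial>jump) = (\<integral>\<^sup>+p. (\<integral>\<^sup>+v. indicator {s<..} (flight v) * ennreal (v * maxw (p, v)) * indicator {0<..} v \<partial>lborel) \<partial>lborel)" for s
    proof -
      have m: "(\<lambda>n::pt. indicator {s<..} (fst n) :: ennreal) \<in> borel_measurable borel" by measurable
      show ?thesis by (simp only: nn_integral_jump[OF m] fst_conv) (rule lborel_Fubini, measurable)
    qed
    have escm: "(\<lambda>s. \<integral>\<^sup>+n. indicator {s<..} (fst n) \<partial>jump) \<in> borel_measurable borel"
    proof -
      have "(\<lambda>z::(real \<times> (real^2)) \<times> real. indicator {fst (fst z)<..} (flight (snd z)) * ennreal (snd z * maxw (snd (fst z), snd z)) * indicator {0<..} (snd z) :: ennreal) \<in> borel_measurable borel"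
        unfolding indicator_def greaterThan_iff by measurable
      from this[THEN nn_integral_lborel_borel, THEN nn_integral_lborel_borel] show ?thesis unfolding esc by simp
    qed
    have "(\<integral>\<^sup>+p. (\<integral>\<^sup>+v. (\<integral>\<^sup>+s. A p v s \<partial>lborel) \<partial>lborel) \<partial>lborel) = (\<integral>\<^sup>+s. (\<integral>\<^sup>+p. (\<integral>\<^sup>+v. A p v s \<partial>lborel) \<partial>lborel) \<partial>lborel)"
      by (rule lborel_rotate[OF mA])
    also have "\<dots> = (\<integral>\<^sup>+s. W (t - s) * indicator {0..} s * (\<integral>\<^sup>+n. indicator {s<..} (fst n) \<partial>jump) \<partial>lborel)"
    proof (rule nn_integral_cong)
      fix s
      have m1: "(\<lambda>v. indicator {s<..} (flight v) * ennreal (v * maxw (p, v)) * indicator {0<..} v) \<in> borel_measurable lborel" for p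
        unfolding indicator_def greaterThan_iff by measurable
      have m2: "(\<lambda>p. \<integral>\<^sup>+v. indicator {s<..} (flight v) * ennreal (v * maxw (p, v)) * indicator {0<..} v \<partial>lborel) \<in> borel_measurable lborel"
      proof -
        have "(\<lambda>z::(real^2) \<times> real. indicator {s<..} (flight (snd z)) * ennreal (snd z * maxw (fst z, snd z)) * indicator {0<..} (snd z) :: ennreal) \<in> borel_measurable borel"
          unfolding indicator_def greaterThan_iff by measurable
        from nn_integral_lborel_borel[OF this] show ?thesis by simp
      qed
      have "(\<integral>\<^sup>+p. (\<integral>\<^sup>+v. A p v s \<partial>lborel) \<partial>lborel) = (\<integral>\<^sup>+p. (\<integral>\<^sup>+v. (W (t - s) * indicator {0..} s) * (indicator {s<..} (flight v) * ennreal (v * maxw (p, v)) * indicator {0<..} v) \<partial>lborel) \<partial>lborel)"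
        by (intro nn_integral_cong) (simp add: A_def ac_simps)
      also have "\<dots> = (W (t - s) * indicator {0..} s) * (\<integral>\<^sup>+p. (\<integral>\<^sup>+v. indicator {s<..} (flight v) * ennreal (v * maxw (p, v)) * indicator {0<..} v \<partial>lborel) \<partial>lborel)"
        by (simp only: nn_integral_cmult[OF m1] nn_integral_cmult[OF m2])
      finally show "(\<integral>\<^sup>+p. (\<integral>\<^sup>+v. A p v s \<partial>lborel) \<partial>lborel) = W (t - s) * indicator {0..} s * (\<integral>\<^sup>+n. indicator {s<..} (fst n) \<partial>jump)"
        by (simp add: esc)
    qed
    also have "\<dots> = (\<integral>\<^sup>+r. W (t - (t + -1 * r)) * indicator {0..} (t + -1 * r) * (\<integral>\<^sup>+n. indicator {t + -1 * r<..} (fst n) \<partial>jump) \<partial>lborel)"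
      by (subst nn_integral_real_affine[where c="-1" and t=t]) (use escm in auto)
    also have "\<dots> = (\<integral>\<^sup>+r. (\<integral>\<^sup>+y. upto t (\<lambda>x. ennreal (w x)) (r, y) \<partial>cellm) * (\<integral>\<^sup>+n. indicator {t<..} (r + fst n) \<partial>jump) \<partial>lborel)"
    proof (intro nn_integral_cong)
      fix r
      have "(\<integral>\<^sup>+n. indicator {t + -1 * r<..} (fst n) \<partial>jump) = (\<integral>\<^sup>+n. (indicator {t<..} (r + fst n) :: ennreal) \<partial>jump)"
        by (intro nn_integral_cong) (auto simp: indicator_def)
      then show "W (t - (t + -1 * r)) * indicator {0..} (t + -1 * r) * (\<integral>\<^sup>+n. indicator {t + -1 * r<..} (fst n) \<partial>jump)
        = (\<integral>\<^sup>+y. upto t (\<lambda>x. ennreal (w x)) (r, y) \<partial>cellm) * (\<integral>\<^sup>+n. indicator {t<..} (r + fst n) \<partial>jump)"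
        by (auto simp: upto_def W_def indicator_def)
    qed
    also have "\<dots> = (\<integral>\<^sup>+x. upto t (\<lambda>x. ennreal (w x)) x * (\<integral>\<^sup>+n. indicator {t<..} (fst x + fst n) \<partial>jump) \<partial>wallm)"
    proof (rule I_bar_time[OF pm_upto[OF pw]])
      have "(\<integral>\<^sup>+n. indicator {t<..} (r + fst n) \<partial>jump) = (\<integral>\<^sup>+n. (indicator {t - r<..} (fst n) :: ennreal) \<partial>jump)" for r
        by (intro nn_integral_cong) (auto simp: indicator_def)
      then show "(\<lambda>r. \<integral>\<^sup>+n. indicator {t<..} (r + fst n) \<partial>jump) \<in> borel_measurable borel"
        using measurable_compose[OF _ escm, of "\<lambda>r. t - r" borel] by simp
    qed
    also have "\<dots> = I (aft t (K (upto t (\<lambda>x. ennreal (w x)))))"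
      by (rule I_aft_K[OF pm_upto[OF pw], symmetric])
    finally show ?thesis .
  qed
  also have "(\<integral>\<^sup>+p. (\<integral>\<^sup>+v. (\<integral>\<^sup>+s. B p v s \<partial>lborel) \<partial>lborel) \<partial>lborel) = I (aft t (src g))"
  proof -
    \<comment> \<open>The age s at time t is replaced by the time r = \<open>flight v\<close> + t -
      s of the next visit to the wall.\<close>
    define C where "C p v r = G (flight v - r, p, v) * ennreal v * indicator {0<..} v * indicator {t<..flight v} r" for p v r
    have mC: "(\<lambda>z. C (fst z) (fst (snd z)) (snd (snd z))) \<in> borel_measurable borel"
      unfolding C_def indicator_def greaterThan_iff greaterThanAtMost_iff by measurable
    have "(\<integral>\<^sup>+p. (\<integral>\<^sup>+v. (\<integral>\<^sup>+s. B p v s \<partial>lborel) \<partial>lborel) \<partial>lborel) = (\<integral>\<^sup>+p. (\<integral>\<^sup>+v. (\<integral>\<^sup>+r. C p v r \<partial>lborel) \<partial>lborel) \<partial>lborel)"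
    proof (rule nn_integral_cong, rule nn_integral_cong)
      fix p v
      have "(\<integral>\<^sup>+s. B p v s \<partial>lborel) = (\<integral>\<^sup>+r. B p v (flight v + t + -1 * r) \<partial>lborel)"
        using nn_integral_real_affine[OF mA1(2)[of p v], of "-1" "flight v + t"] by simp
      also have "\<dots> = (\<integral>\<^sup>+r. C p v r \<partial>lborel)"
        by (intro nn_integral_cong) (auto simp: B_def C_def indicator_def)
      finally show "(\<integral>\<^sup>+s. B p v s \<partial>lborel) = (\<integral>\<^sup>+r. C p v r \<partial>lborel)" .
    qed
    also have "\<dots> = (\<integral>\<^sup>+r. (\<integral>\<^sup>+p. (\<integral>\<^sup>+v. C p v r \<partial>lborel) \<partial>lborel) \<partial>lborel)"
      by (rule lborel_rotate[OF mC])
    also have "\<dots> = (\<integral>\<^sup>+r. (\<integral>\<^sup>+y. aft t (src g) (r, y) \<partial>cellm) \<partial>lborel)"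
    proof (rule nn_integral_cong)
      fix r
      define F where "F p v y = ennreal (g (state (flight v - r) (y - flight v *\<^sub>R p) p v)) * ennreal v * indicator {0<..} v * indicator {r..} (flight v)" for p v y
      show "(\<integral>\<^sup>+p. (\<integral>\<^sup>+v. C p v r \<partial>lborel) \<partial>lborel) = (\<integral>\<^sup>+y. aft t (src g) (r, y) \<partial>cellm)"
      proof (cases "t < r")
        case True
        have "(\<integral>\<^sup>+y. aft t (src g) (r, y) \<partial>cellm) = (\<integral>\<^sup>+y. (\<integral>\<^sup>+p. (\<integral>\<^sup>+v. F p v y \<partial>lborel) \<partial>lborel) \<partial>cellm)"
          using True t by (simp add: aft_def src_def F_def)
        also have "\<dots> = (\<integral>\<^sup>+p. (\<integral>\<^sup>+y. (\<integral>\<^sup>+v. F p v y \<partial>lborel) \<partial>cellm) \<partial>lborel)"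
        proof (rule cellm_Fubini)
          have "(\<lambda>z::((real^2) \<times> (real^2)) \<times> real. F (fst (fst z)) (snd z) (snd (fst z))) \<in> borel_measurable borel"
            unfolding F_def by measurable
          from nn_integral_lborel_borel[OF this]
          show "(\<lambda>z. \<integral>\<^sup>+v. F (fst z) v (snd z) \<partial>lborel) \<in> borel_measurable (borel :: ((real^2) \<times> (real^2)) measure)" by simp
        qed
        also have "\<dots> = (\<integral>\<^sup>+p. (\<integral>\<^sup>+v. (\<integral>\<^sup>+y. F p v y \<partial>cellm) \<partial>lborel) \<partial>lborel)"
        proof (rule nn_integral_cong, rule cellm_Fubini)
          fix p show "(\<lambda>z. F p (fst z) (snd z)) \<in> borel_measurable borel" unfolding F_def by measurable
        qed
        also have "\<dots> = (\<integral>\<^sup>+p. (\<integral>\<^sup>+v. C p v r \<partial>lborel) \<partial>lborel)"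
        proof (intro nn_integral_cong)
          fix p v
          have "(\<integral>\<^sup>+y. F p v y \<partial>cellm) = (\<integral>\<^sup>+y. ennreal (g (state (flight v - r) (y - flight v *\<^sub>R p) p v)) * (ennreal v * indicator {0<..} v * indicator {r..} (flight v)) \<partial>cellm)"
            by (simp add: F_def mult.assoc)
          also have "\<dots> = (\<integral>\<^sup>+y. ennreal (g (state (flight v - r) (y - flight v *\<^sub>R p) p v)) \<partial>cellm) * (ennreal v * indicator {0<..} v * indicator {r..} (flight v))"
            by (rule nn_integral_multc) measurable
          also have "(\<integral>\<^sup>+y. ennreal (g (state (flight v - r) (y - flight v *\<^sub>R p) p v)) \<partial>cellm) = G (flight v - r, p, v)"
            using nn_integral_cellm_shift[of "\<lambda>y. ennreal (g (state (flight v - r) y p v))" "- flight v *\<^sub>R p"] per3_state[OF gper, of "flight v - r" 0 p v]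
            by (simp add: G_def periodic2_def)
          finally show "(\<integral>\<^sup>+y. F p v y \<partial>cellm) = C p v r"
            using True by (simp add: C_def mult.assoc indicator_def)
        qed
        finally show ?thesis by simp
      qed (simp add: C_def aft_def)
    qed
    also have "\<dots> = I (aft t (src g))"
      unfolding I_def by (rule nn_integral_wallm[symmetric]) (use pm_aft[OF pm_src[OF g gper]] in \<open>simp add: pm_def\<close>)
    finally show ?thesis .
  qed
  finally show ?thesis by (simp add: add.commute)
qed

text \<open>On the half-space this is exp(-(|v|^2 / 2 + \<Phi>)) / (2 pi). Written through the
  emission speed it is visibly constant along orbits.\<close>

definition Mx :: "(real^3) \<times> (real^3) \<Rightarrow> real" where
  "Mx z = maxw (hor (snd z), speed (fst z $ 3) (snd z $ 3))"

lemma Mx_borel [measurable]: "Mx \<in> borel_measurable borel"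
  unfolding Mx_def[abs_def] by measurable

lemma Mx_pos: "0 < Mx z" by (simp add: Mx_def maxw_pos)

lemma Mx_state: "0 \<le> v \<Longrightarrow> 0 \<le> s \<Longrightarrow> s \<le> flight v \<Longrightarrow> Mx (state s y p v) = maxw (p, v)"
  by (simp add: Mx_def state_inv)

text \<open>The Maxwellian is constant along orbits, so its first hitting flux at time t is the
  emission flux restricted to flights of duration at least t. A weighted bound on the datum thus
  becomes the domination by \<open>tail 0\<close>.\<close>

lemma src_Mx:
  assumes c: "0 \<le> c"
  shows "src (\<lambda>z. c * Mx z) x = ennreal c * tail 0 x"
proof (cases "0 < fst x")
  case True
  let ?F = "\<lambda>p v. indicator {fst x..} (flight v) * ennreal (v * maxw (p, v)) * indicator {0<..} v :: ennreal"
  have m2: "(\<lambda>z::(real^2) \<times> real. ?F (fst z) (snd z)) \<in> borel_measurable borel" by measurable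
  have "src (\<lambda>z. c * Mx z) x = (\<integral>\<^sup>+p. (\<integral>\<^sup>+v. ennreal c * ?F p v \<partial>lborel) \<partial>lborel)"
    unfolding src_def using True
  proof (simp, intro nn_integral_cong)
    fix p v
    show "ennreal (c * Mx (state (flight v - fst x) (snd x - flight v *\<^sub>R p) p v)) * ennreal v * indicator {0<..} v * indicator {fst x..} (flight v) = ennreal c * ?F p v"
    proof (cases "0 < v \<and> fst x \<le> flight v")
      case v: True
      then have "Mx (state (flight v - fst x) (snd x - flight v *\<^sub>R p) p v) = maxw (p, v)"
        using True by (intro Mx_state) auto
      moreover have "ennreal (c * maxw (p, v)) * ennreal v = ennreal c * ennreal (v * maxw (p, v))"
        using c v maxw_pos[of "(p, v)"] by (simp add: ennreal_mult[symmetric] mult.commute)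
      ultimately show ?thesis using v by simp
    qed (auto split: split_indicator)
  qed
  also have "\<dots> = ennreal c * (\<integral>\<^sup>+p. (\<integral>\<^sup>+v. ?F p v \<partial>lborel) \<partial>lborel)"
  proof -
    have "(\<lambda>v. ?F p v) \<in> borel_measurable lborel" for p by measurable
    moreover have "(\<lambda>p. \<integral>\<^sup>+v. ?F p v \<partial>lborel) \<in> borel_measurable lborel"
      using nn_integral_lborel_borel[OF m2] by simp
    ultimately show ?thesis by (simp add: nn_integral_cmult)
  qed
  also have "(\<integral>\<^sup>+p. (\<integral>\<^sup>+v. ?F p v \<partial>lborel) \<partial>lborel) = (\<integral>\<^sup>+v. (\<integral>\<^sup>+p. ?F p v \<partial>lborel) \<partial>lborel)"
    using m2 by (rule lborel_Fubini[symmetric])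
  also have "\<dots> = tl (fst x)"
  proof -
    have m: "(\<lambda>n::pt. indicator {fst x..} (fst n) :: ennreal) \<in> borel_measurable borel" by measurable
    show ?thesis unfolding tl_alt nn_integral_jump[OF m] fst_conv ..
  qed
  finally show ?thesis using True by (simp add: tail_def)
qed (simp add: src_def tail_def)

lemma src_dominated:
  assumes \<kappa>: "0 \<le> \<kappa>" and dom: "\<And>z. g z \<le> \<kappa> * Mx z"
  shows "src g x \<le> ennreal \<kappa> * tail 0 x"
  unfolding src_Mx[OF \<kappa>, symmetric] src_def
  by (auto intro!: nn_integral_mono mult_right_mono ennreal_leI dom)

text \<open>A particle that arrives with velocity (p, -v) has age \<open>flight v\<close>: it was
  emitted after time zero if this age is less than t, and stems from the datum otherwise. The
  renewal equation is therefore the diffuse boundary condition for \<open>evol\<close>.\<close>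

lemma wall_outflux:
  assumes g [measurable]: "g \<in> borel_measurable borel"
    and w [measurable]: "w \<in> borel_measurable borel"
    and w0: "\<And>x. fst x \<le> 0 \<Longrightarrow> w x = 0" and t: "0 < t"
  shows "(\<integral>\<^sup>+p. (\<integral>\<^sup>+v. ennreal (evol g w t (vec3 (y, 0), vec3 (p, - v))) * ennreal v * indicator {0<..} v \<partial>lborel) \<partial>lborel)
     = K (\<lambda>x. ennreal (w x)) (t, y) + src g (t, y)"
proof -
  let ?A = "\<lambda>p v. ennreal (w ((t, y) - (flight v, flight v *\<^sub>R p))) * ennreal (v * maxw (p, v)) * indicator {0<..} v"
  let ?B = "\<lambda>p v. ennreal (g (state (flight v - t) (y - flight v *\<^sub>R p) p v)) * ennreal v * indicator {0<..} v * indicator {t..} (flight v)"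
  have mA: "(\<lambda>z::(real^2) \<times> real. ?A (fst z) (snd z)) \<in> borel_measurable borel" by measurable
  have mB: "(\<lambda>z::(real^2) \<times> real. ?B (fst z) (snd z)) \<in> borel_measurable borel" by measurable
  have mm: "(\<lambda>v. ?A p v) \<in> borel_measurable lborel" "(\<lambda>v. ?B p v) \<in> borel_measurable lborel" for p by measurable
  have mm2: "(\<lambda>p. \<integral>\<^sup>+v. ?A p v \<partial>lborel) \<in> borel_measurable lborel" "(\<lambda>p. \<integral>\<^sup>+v. ?B p v \<partial>lborel) \<in> borel_measurable lborel"
    using nn_integral_lborel_borel[OF mA] nn_integral_lborel_borel[OF mB] by simp_all
  have "(\<integral>\<^sup>+p. (\<integral>\<^sup>+v. ennreal (evol g w t (vec3 (y, 0), vec3 (p, - v))) * ennreal v * indicator {0<..} v \<partial>lborel) \<partial>lborel)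
     = (\<integral>\<^sup>+p. (\<integral>\<^sup>+v. ?A p v + ?B p v \<partial>lborel) \<partial>lborel)"
  proof (intro nn_integral_cong)
    fix p v
    show "ennreal (evol g w t (vec3 (y, 0), vec3 (p, - v))) * ennreal v * indicator {0<..} v = ?A p v + ?B p v"
    proof (cases "0 < v")
      case True
      then have c: "age 0 (- v) = flight v" "speed 0 (- v) = v" using wall_coords[of "- v"] by auto
      have e: "evol g w t (vec3 (y, 0), vec3 (p, - v)) = (if flight v < t then maxw (p, v) * w (t - flight v, y - flight v *\<^sub>R p) else g (state (flight v - t) (y - flight v *\<^sub>R p) p v))"
        by (simp add: evol_def foot_def c Let_def)
      show ?thesis
      proof (cases "flight v < t")
        case lt: True
        then show ?thesis using True maxw_pos[of "(p, v)"]
          by (simp add: e ennreal_mult' ennreal_mult ac_simps)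
      next
        case False
        then have "w (t - flight v, y - flight v *\<^sub>R p) = 0" by (intro w0) simp
        then show ?thesis using True False by (simp add: e)
      qed
    qed simp
  qed
  also have "\<dots> = (\<integral>\<^sup>+p. (\<integral>\<^sup>+v. ?A p v \<partial>lborel) \<partial>lborel) + (\<integral>\<^sup>+p. (\<integral>\<^sup>+v. ?B p v \<partial>lborel) \<partial>lborel)"
    by (simp only: nn_integral_add[OF mm] nn_integral_add[OF mm2])
  also have "(\<integral>\<^sup>+p. (\<integral>\<^sup>+v. ?B p v \<partial>lborel) \<partial>lborel) = src g (t, y)"
    using t by (simp add: src_def)
  also have "(\<integral>\<^sup>+p. (\<integral>\<^sup>+v. ?A p v \<partial>lborel) \<partial>lborel) = (\<integral>\<^sup>+v. (\<integral>\<^sup>+p. ?A p v \<partial>lborel) \<partial>lborel)"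
    by (rule lborel_Fubini[OF mA, symmetric])
  also have "\<dots> = K (\<lambda>x. ennreal (w x)) (t, y)"
    unfolding K_def by (rule nn_integral_jump[symmetric]) measurable
  finally show ?thesis .
qed

section \<open>Comparison of fluxes\<close>

lemma escape_pos: "0 < (\<integral>\<^sup>+n. indicator {t<..} (a + fst n) \<partial>jump)"
proof -
  obtain v where v: "0 \<le> v" "flight v = max 0 (t - a + 1)" using flight_surj[of "max 0 (t - a + 1)"] by auto
  have "0 < emeasure jump {n. flight v \<le> fst n}" using jump_tail[OF v(1)] by simp
  also have "\<dots> = (\<integral>\<^sup>+n. indicator {flight v..} (fst n) \<partial>jump)" by (rule jump_tail_int)
  also have "\<dots> \<le> (\<integral>\<^sup>+n. indicator {t<..} (a + fst n) \<partial>jump)"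
    using v(2) by (intro nn_integral_mono) (auto simp: indicator_def)
  finally show ?thesis .
qed

text \<open>Up to time t the mass of D is at most that of its returns, yet \<open>K\<close>
  preserves mass, so no mass of D is in flight at t. Every emission has a positive chance to be in
  flight at t, hence there is none. Finite mass on bounded time intervals allows the
  cancellation.\<close>

lemma homogeneous_zero:
  assumes D: "pm D" and le: "AE x in wallm. D x \<le> K D x" and D0: "\<And>x. fst x \<le> 0 \<Longrightarrow> D x = 0"
    and fin: "\<And>t. I (upto t D) < \<infinity>"
  shows "AE x in wallm. D x = 0"
proof -
  have "AE x in wallm. upto t D x = 0" for t
  proof -
    let ?d = "upto t D"
    have Kd: "K D x = K ?d x" if "fst x \<le> t" for x
    proof -
      have "K (aft t D) x = 0" using that by (subst K_aft) (simp add: aft_def[of _ "K _"])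
      then show ?thesis using K_split[OF D, of x t] by simp
    qed
    have "I ?d \<le> I (upto t (K ?d))"
      unfolding I_def
    proof (rule nn_integral_mono_AE)
      show "AE x in wallm. ?d x \<le> upto t (K ?d) x"
        using le by eventually_elim (auto simp: upto_def[of t D] upto_def[of t "K _"] Kd)
    qed
    moreover have "I ?d = I (upto t (K ?d)) + I (aft t (K ?d))"
      using D I_K[of ?d] I_split[of "K ?d" t] by simp
    moreover have "I (upto t (K ?d)) < \<infinity>" using fin[of t] calculation(2)
      by (metis ennreal_add_eq_top infinity_ennreal_def less_top)
    ultimately have "I (aft t (K ?d)) = 0"
      by (cases "I (upto t (K ?d))"; cases "I (aft t (K ?d))")
         (auto simp: ennreal_plus[symmetric] top_unique simp del: ennreal_plus)
    then have "(\<integral>\<^sup>+x. ?d x * (\<integral>\<^sup>+n. indicator {t<..} (fst x + fst n) \<partial>jump) \<partial>wallm) = 0"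
      using I_aft_K[of ?d t] D by simp
    moreover have "(\<lambda>x. ?d x * (\<integral>\<^sup>+n. indicator {t<..} (fst x + fst n) \<partial>jump)) \<in> borel_measurable wallm"
    proof -
      have [measurable]: "?d \<in> borel_measurable borel" using D by (intro pm_measurable) simp
      have "(\<lambda>x::pt. \<integral>\<^sup>+n. indicator {t<..} (fst x + fst n) \<partial>jump) \<in> borel_measurable borel"
        by (rule borel_measurable_nn_integral)
           (simp add: measurable_cong_sets[OF sets_pair_measure_cong[OF refl sets_jump] refl] borel_prod case_prod_beta' indicator_def)
      then show ?thesis by measurable
    qed
    ultimately have "AE x in wallm. ?d x * (\<integral>\<^sup>+n. indicator {t<..} (fst x + fst n) \<partial>jump) = 0"
      by (subst (asm) nn_integral_0_iff_AE) auto
    then show ?thesis by eventually_elim (metis escape_pos mult_eq_0_iff less_irrefl)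
  qed
  then have "AE x in wallm. \<forall>k::nat. upto (real k) D x = 0" by (simp add: AE_all_countable)
  then show ?thesis
  proof eventually_elim
    fix x assume *: "\<forall>k::nat. upto (real k) D x = 0"
    obtain k :: nat where "fst x \<le> real k" using real_arch_simple by blast
    then show "D x = 0" using *[rule_format, of k] by (simp add: upto_def)
  qed
qed

text \<open>Truncated subtraction is the positive part of the difference, and this part satisfies
  the homogeneous inequality of \<open>homogeneous_zero\<close>.\<close>

lemma solution_le:
  assumes pm: "pm a" "pm c" "pm Q" and a: "AE x in wallm. a x \<le> Q x + K a x" and c: "AE x in wallm. Q x + K c x \<le> c x"
    and a0: "\<And>x. fst x \<le> 0 \<Longrightarrow> a x = 0" and fin: "\<And>t. I (upto t a) < \<infinity>" and cfin: "\<And>x. c x < \<infinity>"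
  shows "AE x in wallm. a x \<le> c x"
proof -
  define D where "D x = a x - c x" for x
  have D: "pm D" unfolding D_def[abs_def] using pm by simp
  have "AE x in wallm. D x \<le> K D x"
    using a c
  proof eventually_elim
    fix x assume 1: "a x \<le> Q x + K a x" and 2: "Q x + K c x \<le> c x"
    have "K a x \<le> K (\<lambda>x. c x + D x) x"
    proof (rule K_mono)
      fix z show "a z \<le> c z + D z"
        by (cases "a z \<le> c z") (auto simp: D_def add_increasing2 add_diff_inverse_ennreal)
    qed
    also have "\<dots> = K c x + K D x" using pm D by (simp add: K_add)
    finally have "Q x + K a x \<le> Q x + (K c x + K D x)" by (rule add_left_mono)
    also have "\<dots> \<le> c x + K D x" using add_right_mono[OF 2, of "K D x"] by (simp add: add.assoc)
    finally have "a x \<le> c x + K D x" using 1 by simp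
    then show "D x \<le> K D x" using cfin[of x] by (auto simp: D_def ennreal_minus_le_iff)
  qed
  then have "AE x in wallm. D x = 0"
  proof (rule homogeneous_zero[OF D])
    show "D x = 0" if "fst x \<le> 0" for x using a0[OF that] by (simp add: D_def)
    fix t
    have "I (upto t D) \<le> I (upto t a)"
      by (rule I_mono) (auto simp: upto_def D_def diff_le_self_ennreal)
    then show "I (upto t D) < \<infinity>" using fin[of t] by (rule le_less_trans)
  qed
  then show ?thesis by eventually_elim (simp add: D_def diff_eq_0_iff_ennreal)
qed

end

section \<open>Construction of the solution\<close>

lemma AE_lebesgue_on:
  fixes S :: "'a::euclidean_space set"
  assumes "S \<in> sets borel"
  shows "(AE x in lebesgue_on S. P x) \<longleftrightarrow> (AE x in lborel. x \<in> S \<longrightarrow> P x)"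
  using assms by (subst AE_restrict_space_iff) (auto simp: AE_completion_iff)

lemma nn_integral_lebesgue_on:
  fixes S :: "'a::euclidean_space set"
  assumes "S \<in> sets borel"
  shows "(\<integral>\<^sup>+x. f x \<partial>lebesgue_on S) = (\<integral>\<^sup>+x. f x * indicator S x \<partial>lborel)"
  using assms by (subst nn_integral_restrict_space) (auto simp: nn_integral_completion)

lemma borel_lebesgue_on:
  fixes S :: "'a::euclidean_space set"
  shows "f \<in> borel_measurable borel \<Longrightarrow> f \<in> borel_measurable (lebesgue_on S)"
  by (intro measurable_restrict_space1 measurable_completion) simp

text \<open>Traces and data are only Lebesgue measurable, whereas composition with the orbit maps
  needs Borel functions.\<close>

lemma lebesgue_on_borel_representative:
  fixes S :: "'a::euclidean_space set" and f :: "'a \<Rightarrow> real"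
  assumes S: "S \<in> sets borel" and f: "f \<in> borel_measurable (lebesgue_on S)"
  obtains g where "g \<in> borel_measurable borel" "AE x in lebesgue_on S. f x = g x"
proof -
  have "(\<lambda>x. if x \<in> S then f x else 0) \<in> borel_measurable lebesgue"
    using f S by (subst (asm) measurable_restrict_space_iff[where c=0]) auto
  then obtain g where g: "g \<in> borel_measurable lborel" "AE x in lborel. (if x \<in> S then f x else 0) = g x"
    using completion_ex_borel_measurable_real by blast
  have "AE x in lebesgue_on S. f x = g x"
    unfolding AE_lebesgue_on[OF S] using g(2) by eventually_elim auto
  then show ?thesis using g(1) by (intro that) simp_all
qed

lemma Omega_cell_borel [measurable]: "Omega_cell \<times> UNIV \<in> sets (borel :: ((real^3) \<times> (real^3)) measure)"
  unfolding Omega_cell_def Omega_def borel_prod[symmetric] by (intro pair_measureI) measurable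

lemma nn_integral_phase_measure:
  "(\<integral>\<^sup>+z. f z \<partial>phase_measure) = (\<integral>\<^sup>+z. f z * indicator (Omega_cell \<times> UNIV) z \<partial>lborel)"
  unfolding phase_measure_def by (rule nn_integral_lebesgue_on) measurable

lemma AE_phase_measure:
  "(AE z in phase_measure. P z) \<longleftrightarrow> (AE z in lborel. z \<in> Omega_cell \<times> UNIV \<longrightarrow> P z)"
  unfolding phase_measure_def by (rule AE_lebesgue_on) measurable

lemma AE_phase_measure_Omega: "AE z in phase_measure. fst z \<in> Omega_cell"
  unfolding AE_phase_measure by auto

lemma borel_phase_measure: "f \<in> borel_measurable borel \<Longrightarrow> f \<in> borel_measurable phase_measure"
  unfolding phase_measure_def by (rule borel_lebesgue_on)

lemma closure_Omega: "closure Omega = {x. 0 \<le> x $ 3}"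
proof -
  have "Omega = {x. axis 3 1 \<bullet> x > 0}" by (auto simp: Omega_def inner_axis inner_commute)
  moreover have "axis 3 (1::real) \<noteq> (0 :: real^3)" by (metis axis_eq_0_iff zero_neq_one)
  ultimately show ?thesis using closure_halfspace_gt[of "axis 3 1 :: real^3" 0] by (simp add: inner_axis inner_commute)
qed

lemma frontier_Omega: "frontier Omega = {x. x $ 3 = 0}"
proof -
  have "open Omega" unfolding Omega_def by (intro open_Collect_less continuous_intros)
  then show ?thesis unfolding frontier_def closure_Omega by (auto simp: interior_open Omega_def)
qed

lemma wall_eq: "wall y = vec3 (y, 0)"
  by (simp add: wall_def vec3_def)

lemma normal_inner: "normal x \<bullet> v = - v $ 3"
  by (simp add: normal_def inner_vec_def sum_3)

lemma gamma_minus_wall: "(wall y, v) \<in> gamma_minus \<longleftrightarrow> 0 < v $ 3"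
  by (simp add: gamma_minus_def frontier_Omega normal_inner wall_eq)

lemma nn_integral_outgoing:
  fixes H :: "real^3 \<Rightarrow> real"
  assumes [measurable]: "H \<in> borel_measurable borel"
  shows "(\<integral>\<^sup>+v. ennreal (H v * (normal x \<bullet> v)) \<partial>lebesgue_on {v. normal x \<bullet> v > 0})
    = (\<integral>\<^sup>+p. (\<integral>\<^sup>+v. ennreal (H (vec3 (p, - v))) * ennreal v * indicator {0<..} v \<partial>lborel) \<partial>lborel)"
proof -
  have S: "{v :: real^3. normal x \<bullet> v > 0} = {v. 0 < - v $ 3}" by (simp add: normal_inner)
  have "(\<integral>\<^sup>+v. ennreal (H v * (normal x \<bullet> v)) \<partial>lebesgue_on {v. normal x \<bullet> v > 0})
     = (\<integral>\<^sup>+v. ennreal (H v * (- v $ 3)) * indicator {v. 0 < - v $ 3} v \<partial>lborel)"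
    unfolding S by (subst nn_integral_lebesgue_on) (simp_all add: normal_inner)
  also have "\<dots> = (\<integral>\<^sup>+p. (\<integral>\<^sup>+u. ennreal (H (vec3 (p, u)) * (- u)) * indicator {..<0} u \<partial>lborel) \<partial>lborel)"
    by (subst nn_integral_vec3, measurable) (simp add: indicator_def)
  also have "\<dots> = (\<integral>\<^sup>+p. (\<integral>\<^sup>+v. ennreal (H (vec3 (p, - v))) * ennreal v * indicator {0<..} v \<partial>lborel) \<partial>lborel)"
  proof (rule nn_integral_cong)
    fix p
    have "(\<integral>\<^sup>+u. ennreal (H (vec3 (p, u)) * (- u)) * indicator {..<0} u \<partial>lborel)
      = (\<integral>\<^sup>+u. ennreal (H (vec3 (p, 0 + -1 * u)) * (- (0 + -1 * u))) * indicator {..<0} (0 + -1 * u) \<partial>lborel)"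
      by (subst nn_integral_real_affine[where c="-1" and t=0]) auto
    also have "\<dots> = (\<integral>\<^sup>+v. ennreal (H (vec3 (p, - v))) * ennreal v * indicator {0<..} v \<partial>lborel)"
      by (intro nn_integral_cong) (auto simp: ennreal_mult'' split: split_indicator)
    finally show "(\<integral>\<^sup>+u. ennreal (H (vec3 (p, u)) * (- u)) * indicator {..<0} u \<partial>lborel)
      = (\<integral>\<^sup>+v. ennreal (H (vec3 (p, - v))) * ennreal v * indicator {0<..} v \<partial>lborel)" .
  qed
  finally show ?thesis .
qed

context steep_log_potential
begin

section \<open>Choice of the windows\<close>

lemma tau_powr:
  assumes "0 < r" shows "enn2real (tau r) \<le> tail_const / (b - 1) * r powr (1 - b)"
proof -
  have "tau r \<le> ennreal (tail_const / (b - 1) * r powr (1 - b))"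
    using jump_tau[OF b_gt_1 assms] by (simp add: tau_def tl_def)
  then show ?thesis using b_gt_1 by (intro enn2real_leI) (auto simp: tail_const_def)
qed

text \<open>The window \<open>R\<close> is a power of \<open>t\<close> and the number \<open>n\<close> of coupling steps is a multiple of \<open>ln t\<close>: the contraction
  factor then contributes \<open>t powr - m\<close>, and so does the tail at \<open>R\<close>.\<close>

lemma decay_rate:
  assumes \<theta>: "0 < \<theta>" "\<theta> \<le> 1" and l: "0 < l" and m: "0 < m" "m + 5 \<le> b - 1"
  shows "\<exists>C>0. \<forall>t\<ge>0. \<exists>n R. 0 \<le> R \<and> real n * (R + l) \<le> t \<and>
     enn2real (tau t) + enn2real (tau (t - real n * (R + l))) + 2 * ((1 - \<theta>) ^ n * enn2real (tau 0) + enn2real (tau R))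
       \<le> C * (exp 1 + t) powr (- m)"
proof -
  define C1 where "C1 = tail_const / (b - 1)"
  define T0 where "T0 = enn2real (tau 0)"
  \<comment> \<open>Then \<rho> (m + 5) = m, hence \<rho> (b - 1) \<ge> m and the tail at R =
    t^\<rho> is at most of order t^(-m).\<close>
  define \<rho> where "\<rho> = m / (m + 5)"
  \<comment> \<open>With n \<ge> k ln t windows, (1 - \<theta>)^n \<le> exp(-\<theta> n) \<le>
    t^(-m).\<close>
  define k where "k = m / \<theta>"
  have C1: "0 \<le> C1" using b_gt_1 by (simp add: C1_def tail_const_def)
  have T0: "0 \<le> T0" by (simp add: T0_def)
  have \<rho>: "0 < \<rho>" "\<rho> < 1" using m by (auto simp: \<rho>_def)
  have k: "0 < k" using m \<theta> by (simp add: k_def)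
  \<comment> \<open>All windows together take about t^\<rho> ln t, which is o(t) because \<rho> < 1;
    half of the time is left for the last flight.\<close>
  have "eventually (\<lambda>t. (k * ln t + 1) * (t powr \<rho> + l) \<le> t / 2) at_top"
    using \<rho> k l by real_asymp
  moreover have "eventually (\<lambda>t::real. 1 < t) at_top" by (rule eventually_gt_at_top)
  ultimately have "eventually (\<lambda>t. (k * ln t + 1) * (t powr \<rho> + l) \<le> t / 2 \<and> 1 < t) at_top"
    by eventually_elim simp
  then obtain t1 where t1: "\<And>t. t1 \<le> t \<Longrightarrow> (k * ln t + 1) * (t powr \<rho> + l) \<le> t / 2 \<and> 1 < t"
    by (auto simp: eventually_at_top_linorder)
  define C2 where "C2 = C1 * (1 + 2 powr (b - 1)) + 2 * (T0 + C1)"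
  \<comment> \<open>For t \<ge> \<open>t1\<close> the factor 4^m comes from e + t \<le> 4t. For
    smaller t the sum is at most 6 times the mean flight time, and the power of e + |t1| compensates
    the decay.\<close>
  define C where "C = C2 * 4 powr m + 6 * T0 * (exp 1 + \<bar>t1\<bar>) powr m + 1"
  have C2: "0 \<le> C2" using C1 T0 by (simp add: C2_def)
  have C: "0 < C" using C2 T0 by (simp add: C_def add_nonneg_pos)
  have "\<exists>n R. 0 \<le> R \<and> real n * (R + l) \<le> t \<and>
     enn2real (tau t) + enn2real (tau (t - real n * (R + l))) + 2 * ((1 - \<theta>) ^ n * T0 + enn2real (tau R))
       \<le> C * (exp 1 + t) powr (- m)" if t: "0 \<le> t" for t
  proof (cases "t1 \<le> t")
    case True
    then have t2: "(k * ln t + 1) * (t powr \<rho> + l) \<le> t / 2" and tp: "1 < t" using t1 by auto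
    have lt: "0 < ln t" using tp by simp
    define n where "n = nat \<lceil>k * ln t\<rceil>"
    define R where "R = t powr \<rho>"
    have n: "k * ln t \<le> real n" "real n \<le> k * ln t + 1"
    proof -
      have "0 \<le> k * ln t" using k lt by simp
      then have "0 \<le> \<lceil>k * ln t\<rceil>" by linarith
      then have "real n = of_int \<lceil>k * ln t\<rceil>" by (simp add: n_def)
      then show "k * ln t \<le> real n" "real n \<le> k * ln t + 1" by linarith+
    qed
    have R: "0 < R" using tp by (simp add: R_def)
    have s: "real n * (R + l) \<le> t / 2"
    proof -
      have "real n * (R + l) \<le> (k * ln t + 1) * (R + l)" using n R l by (intro mult_right_mono) auto
      then show ?thesis using t2 by (simp add: R_def)
    qed
    have e0: "t powr (1 - b) \<le> t powr (- m)" using tp m by (intro powr_mono) auto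
    have e1: "enn2real (tau t) \<le> C1 * t powr (- m)"
      using tau_powr[of t] tp e0 C1 unfolding C1_def[symmetric] by (meson mult_left_mono order_trans less_trans zero_less_one)
    have e2: "enn2real (tau (t - real n * (R + l))) \<le> C1 * 2 powr (b - 1) * t powr (- m)"
    proof -
      have p: "0 < t - real n * (R + l)" "t / 2 \<le> t - real n * (R + l)" using s tp by auto
      have "enn2real (tau (t - real n * (R + l))) \<le> C1 * (t - real n * (R + l)) powr (1 - b)"
        unfolding C1_def by (rule tau_powr[OF p(1)])
      also have "\<dots> \<le> C1 * (t / 2) powr (1 - b)"
        using p tp b_gt_1 C1 by (intro mult_left_mono powr_mono2') auto
      also have "(t / 2) powr (1 - b) = 2 powr (b - 1) * t powr (1 - b)"
      proof -
        have "(t / 2) powr (1 - b) = t powr (1 - b) / 2 powr (1 - b)" using tp by (simp add: powr_divide)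
        also have "2 powr (1 - b) = 1 / (2 powr (b - 1) :: real)" using powr_minus_divide[of 2 "b - 1"] by simp
        finally show ?thesis by simp
      qed
      also have "C1 * (2 powr (b - 1) * t powr (1 - b)) \<le> C1 * (2 powr (b - 1) * t powr (- m))"
        using C1 e0 by (intro mult_left_mono) auto
      finally show ?thesis by (simp add: mult.assoc)
    qed
    have e3: "(1 - \<theta>) ^ n \<le> t powr (- m)"
    proof -
      have "(1 - \<theta>) ^ n \<le> exp (- \<theta>) ^ n" using \<theta> exp_ge_add_one_self[of "- \<theta>"] by (intro power_mono) auto
      also have "\<dots> = exp (- \<theta> * real n)" by (simp add: exp_of_nat_mult[symmetric] mult.commute)
      also have "\<dots> \<le> exp (- (m * ln t))"
      proof -
        have "\<theta> * (k * ln t) \<le> \<theta> * real n" using n \<theta> by (intro mult_left_mono) auto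
        then show ?thesis using \<theta> by (simp add: k_def)
      qed
      also have "\<dots> = t powr (- m)" using tp by (simp add: powr_def)
      finally show ?thesis .
    qed
    have e4: "enn2real (tau R) \<le> C1 * t powr (- m)"
    proof -
      have "enn2real (tau R) \<le> C1 * R powr (1 - b)" unfolding C1_def by (rule tau_powr[OF R])
      also have "R powr (1 - b) = t powr (\<rho> * (1 - b))" by (simp add: R_def powr_powr)
      also have "t powr (\<rho> * (1 - b)) \<le> t powr (- m)"
      proof (intro powr_mono)
        have "\<rho> * (m + 5) \<le> \<rho> * (b - 1)" using m \<rho> by (intro mult_left_mono) auto
        moreover have "\<rho> * (m + 5) = m" using m by (simp add: \<rho>_def)
        ultimately show "\<rho> * (1 - b) \<le> - m" by (simp add: algebra_simps)
      qed (use tp in simp)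
      finally show ?thesis using C1 by (simp add: mult_left_mono)
    qed
    have e5: "t powr (- m) \<le> 4 powr m * (exp 1 + t) powr (- m)"
    proof -
      have "exp 1 + t \<le> 4 * t" using exp_le tp by linarith
      then have "t powr (- m) \<le> ((exp 1 + t) / 4) powr (- m)"
        using tp m by (intro powr_mono2') (auto intro: add_pos_pos)
      also have "\<dots> = 4 powr m * (exp 1 + t) powr (- m)"
        using tp by (simp add: powr_divide powr_minus_divide add_nonneg_nonneg)
      finally show ?thesis .
    qed
    have "enn2real (tau t) + enn2real (tau (t - real n * (R + l))) + 2 * ((1 - \<theta>) ^ n * T0 + enn2real (tau R))
      \<le> C1 * t powr (- m) + C1 * 2 powr (b - 1) * t powr (- m) + 2 * (t powr (- m) * T0 + C1 * t powr (- m))"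
      by (intro add_mono mult_left_mono e1 e2 e4 mult_right_mono[OF e3 T0]) auto
    also have "\<dots> = C2 * t powr (- m)" by (simp add: C2_def algebra_simps)
    also have "\<dots> \<le> C2 * (4 powr m * (exp 1 + t) powr (- m))" using e5 C2 by (rule mult_left_mono)
    also have "\<dots> \<le> C * (exp 1 + t) powr (- m)"
      unfolding C_def using T0 by (simp add: algebra_simps)
    finally show ?thesis using R s tp by (intro exI[of _ n] exI[of _ R]) auto
  next
    case False
    \<comment> \<open>Without any window, n = 0 and R = 0, every term of the sum is bounded by the
      mean flight time.\<close>
    have "enn2real (tau t) \<le> T0"
      unfolding T0_def using t tau_finite by (intro enn2real_mono tau_antimono) (auto simp: less_top)
    moreover have "1 \<le> (exp 1 + \<bar>t1\<bar>) powr m * (exp 1 + t) powr (- m)"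
    proof -
      have "(exp 1 + \<bar>t1\<bar>) powr (- m) \<le> (exp 1 + t) powr (- m)"
        using False t m by (intro powr_mono2') (auto intro: add_pos_nonneg)
      then have "(exp 1 + \<bar>t1\<bar>) powr m * (exp 1 + \<bar>t1\<bar>) powr (- m) \<le> (exp 1 + \<bar>t1\<bar>) powr m * (exp 1 + t) powr (- m)"
        by (intro mult_left_mono) auto
      moreover have "0 < exp 1 + \<bar>t1\<bar>" by (intro add_pos_nonneg) auto
      ultimately show ?thesis by (simp add: powr_add[symmetric])
    qed
    then have "6 * T0 * 1 \<le> 6 * T0 * ((exp 1 + \<bar>t1\<bar>) powr m * (exp 1 + t) powr (- m))"
      using T0 by (intro mult_left_mono) auto
    then have "6 * T0 \<le> C * (exp 1 + t) powr (- m)"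
      unfolding C_def using C2 by (simp add: algebra_simps add_increasing)
    ultimately show ?thesis using t T0
      by (intro exI[of _ "0::nat"] exI[of _ "0::real"]) (auto simp: T0_def[symmetric])
  qed
  then show ?thesis using C unfolding T0_def by blast
qed

end

section \<open>The solution for a bounded datum\<close>

locale log_problem = steep_log_potential +
  fixes a :: real
  assumes a_gt_1: "1 < a" and b_eq: "b = 1 / ln a"
begin

lemma Phi_eq: "Phi a x = b * ln (1 + x $ 3)"
  by (simp add: Phi_def log_def b_eq)

lemma norm3_sq: "(norm (v :: real^3))\<^sup>2 = (norm (hor v))\<^sup>2 + (v $ 3)\<^sup>2"
  unfolding power2_norm_eq_inner inner_vec_def sum_2 sum_3 by (simp add: power2_eq_square)

lemma maxw_energy: "0 \<le> x $ 3 \<Longrightarrow> maxw (hor v, speed (x $ 3) (v $ 3)) = 1 / (2 * pi) * exp (- ((norm v)\<^sup>2 / 2 + Phi a x))"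
  by (simp add: maxw_def speed_sq norm3_sq Phi_eq add_divide_distrib)

lemma stationary_eq: "0 \<le> x $ 3 \<Longrightarrow> stationary a c x v = c * maxw (hor v, speed (x $ 3) (v $ 3))"
  by (simp add: stationary_def maxw_energy)

text \<open>The value of \<open>evol\<close> depends only on emission speed, horizontal velocity,
  foot, and age minus time, and all of these are constant along a characteristic.\<close>

lemma evol_characteristic:
  assumes ch: "characteristic a s t X V"
  shows "evol g w t (X t, V t) = evol g w s (X s, V s)"
proof -
  have st: "s < t" and dX: "\<And>\<tau>. \<tau> \<in> {s..t} \<Longrightarrow> (X has_vector_derivative V \<tau>) (at \<tau> within {s..t})"
    and dV: "\<And>\<tau>. \<tau> \<in> {s..t} \<Longrightarrow> (V has_vector_derivative - grad (Phi a) (X \<tau>)) (at \<tau> within {s..t})"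
    and int: "\<And>\<tau>. \<tau> \<in> {s<..<t} \<Longrightarrow> X \<tau> \<in> Omega"
    using ch by (auto simp: characteristic_def)
  have dXi: "((\<lambda>\<tau>. X \<tau> $ i) has_real_derivative V \<tau> $ i) (at \<tau> within {s..t})" if "\<tau> \<in> {s..t}" for \<tau> i
    using bounded_linear.has_vector_derivative[OF bounded_linear_vec_nth dX[OF that]]
    by (simp add: has_real_derivative_iff_has_vector_derivative)
  \<comment> \<open>Interior times lie in the open domain; continuity extends the sign to the end
    points, which may lie on the wall.\<close>
  have pos: "0 \<le> X \<tau> $ 3" if "\<tau> \<in> {s..t}" for \<tau>
   proof -
    have c: "continuous_on {s..t} (\<lambda>\<tau>. X \<tau> $ 3)"
      unfolding continuous_on_eq_continuous_within using DERIV_continuous[OF dXi[of _ 3]] by blast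
    have cl: "closure {s<..<t} = {s..t}" using st by simp
    show ?thesis
    proof (rule continuous_ge_on_closure[of "{s<..<t}" "\<lambda>\<tau>. X \<tau> $ 3" \<tau> 0])
      show "0 \<le> X x $ 3" if "x \<in> {s<..<t}" for x using int[OF that] by (simp add: Omega_def)
    qed (use c cl that in simp_all)
  qed
  have g: "grad (Phi a) (X \<tau>) = axis 3 (b / (1 + X \<tau> $ 3))" if "\<tau> \<in> {s..t}" for \<tau>
    using grad_Phi[OF a_gt_1, of "X \<tau>"] pos[OF that] by (simp add: closure_Omega b_eq mult.commute)
  have dVi: "((\<lambda>\<tau>. V \<tau> $ i) has_real_derivative - (axis 3 (b / (1 + X \<tau> $ 3)) $ i)) (at \<tau> within {s..t})" if "\<tau> \<in> {s..t}" for \<tau> i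
    using bounded_linear.has_vector_derivative[OF bounded_linear_vec_nth dV[OF that]] g[OF that]
    by (simp add: has_real_derivative_iff_has_vector_derivative)
  have V3: "((\<lambda>\<tau>. V \<tau> $ 3) has_real_derivative - b / (1 + X \<tau> $ 3)) (at \<tau> within {s..t})" if "\<tau> \<in> {s..t}" for \<tau>
    using dVi[OF that, of 3] by (simp add: axis_def)
  have inv: "speed (X t $ 3) (V t $ 3) = speed (X s $ 3) (V s $ 3)" "age (X t $ 3) (V t $ 3) = age (X s $ 3) (V s $ 3) + (t - s)"
    using flow_invariants[of s t "\<lambda>\<tau>. X \<tau> $ 3" "\<lambda>\<tau>. V \<tau> $ 3"] st dXi[of _ 3] V3 pos by auto
  have Vi: "V \<tau> $ i = V s $ i" if i: "i \<noteq> 3" and \<tau>: "\<tau> \<in> {s..t}" for i \<tau>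
  proof -
    have "((\<lambda>\<tau>. V \<tau> $ i) has_real_derivative 0) (at \<tau> within {s..t})" if "\<tau> \<in> {s..t}" for \<tau>
      using dVi[OF that, of i] i by (simp add: axis_def)
    then obtain c where c: "\<forall>\<tau>\<in>{s..t}. V \<tau> $ i = c"
      using has_field_derivative_zero_constant[OF convex_real_interval(5)] by blast
    have ss: "s \<in> {s..t}" using st by simp
    from c[rule_format, OF \<tau>] c[rule_format, OF ss] show ?thesis by (rule trans[OF _ sym])
  qed
  have Xi: "X t $ i = X s $ i + (t - s) * V s $ i" if i: "i \<noteq> 3" for i
  proof -
    have "((\<lambda>\<tau>. X \<tau> $ i - \<tau> * V s $ i) has_real_derivative 0) (at \<tau> within {s..t})" if \<tau>: "\<tau> \<in> {s..t}" for \<tau>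
    proof -
      have "((\<lambda>\<tau>. X \<tau> $ i - \<tau> * V s $ i) has_real_derivative V \<tau> $ i - (1 * V s $ i)) (at \<tau> within {s..t})"
        by (intro DERIV_diff dXi[OF \<tau>] DERIV_cmult_right DERIV_ident)
      then show ?thesis using Vi[OF i \<tau>] by simp
    qed
    then obtain c where c: "\<forall>\<tau>\<in>{s..t}. X \<tau> $ i - \<tau> * V s $ i = c"
      using has_field_derivative_zero_constant[OF convex_real_interval(5)] by blast
    have ss: "s \<in> {s..t}" "t \<in> {s..t}" using st by auto
    from c[rule_format, OF ss(1)] c[rule_format, OF ss(2)] show ?thesis by (simp add: algebra_simps)
  qed
  have n3: "(1::3) \<noteq> 3" "(2::3) \<noteq> 3" by simp_all
  have tt: "t \<in> {s..t}" using st by simp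
  have h: "hor (V t) = hor (V s)"
    unfolding vec_eq_iff forall_2 using Vi[OF n3(1) tt] Vi[OF n3(2) tt] by simp
  have f: "foot (X t, V t) = foot (X s, V s)"
    unfolding vec_eq_iff forall_2 foot_def fst_conv snd_conv inv(2) h
    using Xi[OF n3(1)] Xi[OF n3(2)] by (simp add: algebra_simps)
  show ?thesis unfolding evol_def Let_def fst_conv snd_conv inv h f by (simp add: algebra_simps)
qed

definition wsol :: "((real^3) \<times> (real^3) \<Rightarrow> real) \<Rightarrow> pt \<Rightarrow> real" where
  "wsol g x = enn2real (U (src g) x)"

definition sol :: "((real^3) \<times> (real^3) \<Rightarrow> real) \<Rightarrow> real \<Rightarrow> real^3 \<Rightarrow> real^3 \<Rightarrow> real" where
  "sol g t x v = evol g (wsol g) t (x, v)"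

text \<open>All conditions hold at every point and not just almost everywhere, because the datum is
  evaluated along single orbits.\<close>

definition datum :: "real \<Rightarrow> ((real^3) \<times> (real^3) \<Rightarrow> real) \<Rightarrow> bool" where
  "datum \<kappa> g \<longleftrightarrow> 0 \<le> \<kappa> \<and> g \<in> borel_measurable borel \<and> per3 g \<and> (\<forall>z. 0 \<le> g z) \<and> (\<forall>z. g z \<le> \<kappa> * Mx z)"

lemma datumD:
  assumes "datum \<kappa> g"
  shows "0 \<le> \<kappa>" "g \<in> borel_measurable borel" "per3 g" "\<And>z. 0 \<le> g z" "\<And>z. g z \<le> \<kappa> * Mx z"
    "pm (src g)" "\<And>x. src g x \<le> ennreal \<kappa> * tail 0 x" "\<And>x. U (src g) x < \<infinity>" "\<And>x. fst x \<le> 0 \<Longrightarrow> wsol g x = 0"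
    "\<And>x. ennreal (wsol g x) = U (src g) x" "wsol g \<in> borel_measurable borel" "\<And>t. periodic2 (\<lambda>y. wsol g (t, y))"
    "\<And>x. 0 \<le> wsol g x" "\<And>x. wsol g x \<le> \<kappa>"
proof -
  show 1: "0 \<le> \<kappa>" "g \<in> borel_measurable borel" "per3 g" "\<And>z. 0 \<le> g z" "\<And>z. g z \<le> \<kappa> * Mx z"
    using assms by (auto simp: datum_def)
  show 2: "pm (src g)" using 1 by simp
  show 3: "\<And>x. src g x \<le> ennreal \<kappa> * tail 0 x"
    by (intro src_dominated 1)
  show 4: "\<And>x. U (src g) x < \<infinity>" by (rule U_finite[OF 3])
  show "fst x \<le> 0 \<Longrightarrow> wsol g x = 0" for x using U_dominated[OF 3, of x] by (simp add: wsol_def)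
  show 5: "\<And>x. ennreal (wsol g x) = U (src g) x" using 4 by (simp add: wsol_def less_top)
  show "wsol g \<in> borel_measurable borel"
    unfolding wsol_def[abs_def] using pm_measurable[OF pm_U[OF 2]] by measurable
  show "\<And>t. periodic2 (\<lambda>y. wsol g (t, y))" using pm_U[OF 2] by (simp add: pm_def periodic2_def wsol_def)
  show "\<And>x. 0 \<le> wsol g x" by (simp add: wsol_def)
  show "wsol g x \<le> \<kappa>" for x
  proof -
    have "U (src g) x \<le> ennreal \<kappa> * indicator {0<..} (fst x)" by (rule U_dominated[OF 3])
    also have "\<dots> \<le> ennreal \<kappa>" by (simp add: indicator_def)
    finally show ?thesis unfolding wsol_def by (rule enn2real_leI[OF 1(1)])
  qed
qed

lemma sol_nonneg: "datum \<kappa> g \<Longrightarrow> 0 \<le> sol g t x v"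
  using datumD(4)[of \<kappa> g] datumD(13)[of \<kappa> g] maxw_pos unfolding sol_def evol_def Let_def
  by (auto intro!: mult_nonneg_nonneg simp: less_imp_le)

text \<open>The two terms of \<open>nn_integral_evol\<close> are the mass of the source restarted at
  t, which \<open>A_mass\<close> shows to be constant in t.\<close>

lemma sol_mass:
  assumes d: "datum \<kappa> g" and t: "0 \<le> t"
  shows "(\<integral>\<^sup>+z. ennreal (sol g t (fst z) (snd z)) \<partial>phase_measure) = I (src g)"
proof -
  note d = datumD[OF d]
  have "(\<integral>\<^sup>+z. ennreal (sol g t (fst z) (snd z)) \<partial>phase_measure) = I (aft t (src g)) + I (aft t (K (upto t (U (src g)))))"
    unfolding nn_integral_phase_measure sol_def using nn_integral_evol[OF d(2,3,11,12,9) t] by (simp add: d(10))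
  also have "\<dots> = I (A t (src g))"
  proof -
    have "A t (src g) = (\<lambda>x. aft t (src g) x + aft t (K (upto t (U (src g)))) x)"
      by (auto simp: A_def aft_def)
    then show ?thesis using d(6) by (simp add: I_add)
  qed
  also have "\<dots> = I (src g)"
    by (rule A_mass[OF d(6) I_upto_U_finite[OF d(7)]]) simp
  finally show ?thesis .
qed

lemma sol_0: "0 \<le> x $ 3 \<Longrightarrow> sol g 0 x v = g (x, v)"
  using age_bounds[of "x $ 3" "v $ 3"] state_of[of "(x, v)"] by (simp add: sol_def evol_def)

lemma Omega_cellD: "x \<in> Omega_cell \<Longrightarrow> 0 < x $ 3"
  by (simp add: Omega_cell_def Omega_def)

text \<open>Conservation of mass, read at time zero.\<close>

lemma src_mass: "datum \<kappa> g \<Longrightarrow> (\<integral>\<^sup>+z. ennreal (g z) \<partial>phase_measure) = I (src g)"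
proof -
  assume d: "datum \<kappa> g"
  have "(\<integral>\<^sup>+z. ennreal (g z) \<partial>phase_measure) = (\<integral>\<^sup>+z. ennreal (sol g 0 (fst z) (snd z)) \<partial>phase_measure)"
  proof (rule nn_integral_cong_AE)
    show "AE z in phase_measure. ennreal (g z) = ennreal (sol g 0 (fst z) (snd z))"
      using AE_phase_measure_Omega by eventually_elim (auto simp: sol_0 less_imp_le[OF Omega_cellD])
  qed
  then show ?thesis using sol_mass[OF d, of 0] by simp
qed

lemma I_src_finite: "datum \<kappa> g \<Longrightarrow> I (src g) < \<infinity>"
proof -
  assume d: "datum \<kappa> g"
  have "I (src g) \<le> I (\<lambda>x. ennreal \<kappa> * tail 0 x)" by (rule I_mono) (rule datumD(7)[OF d])
  also have "\<dots> < \<infinity>" using tau_finite by (simp add: I_cmult I_tail ennreal_mult_less_top)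
  finally show ?thesis .
qed

lemma sol_borel:
  assumes d: "datum \<kappa> g" and [measurable]: "t \<in> borel_measurable M" "x \<in> borel_measurable M" "v \<in> borel_measurable M"
  shows "(\<lambda>z. sol g (t z) (x z) (v z)) \<in> borel_measurable M"
  unfolding sol_def by (intro evol_measurable datumD(2,11)[OF d]) measurable

lemma sol_integrable:
  assumes d: "datum \<kappa> g" and t: "0 \<le> t"
  shows "integrable phase_measure (\<lambda>z. sol g t (fst z) (snd z))"
proof (rule integrableI_nonneg)
  show "(\<lambda>z. sol g t (fst z) (snd z)) \<in> borel_measurable phase_measure"
    by (intro borel_phase_measure sol_borel[OF d]) measurable
  show "(\<integral>\<^sup>+z. ennreal (sol g t (fst z) (snd z)) \<partial>phase_measure) < \<infinity>"
    using sol_mass[OF d t] I_src_finite[OF d] by simp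
qed (use sol_nonneg[OF d] in auto)

text \<open>\<open>wall_outflux\<close> gives the outgoing flux as returns plus first visits, and
  the renewal equation says that this sum is the emission flux.\<close>

lemma sol_outflux:
  assumes d: "datum \<kappa> g" and t: "0 < t"
  shows "integrable (lebesgue_on {v. normal (wall y) \<bullet> v > 0}) (\<lambda>v. sol g t (wall y) v * (normal (wall y) \<bullet> v))"
    "outflux (sol g) t (wall y) = wsol g (t, y)"
proof -
  note D = datumD[OF d]
  have m: "(\<lambda>v. sol g t (wall y) v) \<in> borel_measurable borel" by (intro sol_borel[OF d]) measurable
  have "(\<integral>\<^sup>+v. ennreal (sol g t (wall y) v * (normal (wall y) \<bullet> v)) \<partial>lebesgue_on {v. normal (wall y) \<bullet> v > 0})
     = K (\<lambda>x. ennreal (wsol g x)) (t, y) + src g (t, y)"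
    unfolding nn_integral_outgoing[OF m] unfolding sol_def wall_eq
    by (rule wall_outflux[OF D(2,11,9) t])
  also have "\<dots> = U (src g) (t, y)"
    using U_eq[OF D(6), of "(t, y)"] by (simp add: D(10) add.commute)
  finally have nn: "(\<integral>\<^sup>+v. ennreal (sol g t (wall y) v * (normal (wall y) \<bullet> v)) \<partial>lebesgue_on {v. normal (wall y) \<bullet> v > 0}) = U (src g) (t, y)" .
  have mm: "(\<lambda>v. sol g t (wall y) v * (normal (wall y) \<bullet> v)) \<in> borel_measurable (lebesgue_on {v. normal (wall y) \<bullet> v > 0})"
    by (intro borel_lebesgue_on borel_measurable_times m) measurable
  have S: "{v :: real^3. normal (wall y) \<bullet> v > 0} \<in> sets borel" by (simp add: normal_inner)
  have nonneg: "AE v in lebesgue_on {v. normal (wall y) \<bullet> v > 0}. 0 \<le> sol g t (wall y) v * (normal (wall y) \<bullet> v)"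
    unfolding AE_lebesgue_on[OF S] using sol_nonneg[OF d] by auto
  show "integrable (lebesgue_on {v. normal (wall y) \<bullet> v > 0}) (\<lambda>v. sol g t (wall y) v * (normal (wall y) \<bullet> v))"
    by (rule integrableI_nonneg[OF mm nonneg]) (use nn D(8) in simp)
  show "outflux (sol g) t (wall y) = wsol g (t, y)"
    unfolding outflux_def wsol_def by (subst integral_eq_nn_integral[OF mm nonneg]) (simp add: nn)
qed

lemma wall_maxwellian_eq: "0 \<le> v $ 3 \<Longrightarrow> wall_maxwellian x v = maxw (hor v, v $ 3)"
  by (simp add: wall_maxwellian_def maxw_def norm3_sq)

lemma sol_wall_in:
  assumes "0 < t" "0 < v $ 3"
  shows "sol g t (wall y) v = wall_maxwellian (wall y) v * wsol g (t, y)"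
proof -
  have "hor (wall y) = y" by (simp add: wall_eq)
  moreover have "wall y $ 3 = 0" by (simp add: wall_eq)
  ultimately show ?thesis using assms wall_coords[of "v $ 3"]
    by (simp add: sol_def evol_def foot_def wall_maxwellian_eq Let_def)
qed

lemma L1_solution_sol:
  assumes d: "datum \<kappa> g" and F0: "AE z in phase_measure. F0 (fst z) (snd z) = g z"
  shows "L1_solution a F0 (sol g)"
proof -
  note D = datumD[OF d]
  have S1: "({0<..} \<times> torus_cell \<times> UNIV :: (real \<times> (real^2) \<times> (real^3)) set) \<in> sets borel"
    unfolding borel_prod[symmetric] by (intro pair_measureI) auto
  have S2: "({0<..} \<times> torus_cell :: (real \<times> (real^2)) set) \<in> sets borel"
    unfolding borel_prod[symmetric] by (intro pair_measureI) auto
  show ?thesis unfolding L1_solution_def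
  proof (intro conjI allI impI)
    show "torus_periodic (sol g t)" for t
      using per3_evol[OF D(3,12), of t] by (simp add: torus_periodic_def per3_def sol_def)
    show "integrable phase_measure (\<lambda>z. sol g t (fst z) (snd z))" if "0 \<le> t" for t
      by (rule sol_integrable[OF d that])
    show "sol g t (X t) (V t) = sol g s (X s) (V s)" if "characteristic a s t X V" for s t X V
      unfolding sol_def by (rule evol_characteristic[OF that])
    have "(\<lambda>z::real \<times> (real^2) \<times> (real^3). sol g (fst z) (wall (fst (snd z))) (snd (snd z))) \<in> borel_measurable borel"
      unfolding wall_eq by (intro sol_borel[OF d]) measurable
    then show "(\<lambda>(t, y, v). sol g t (wall y) v) \<in> borel_measurable (lebesgue_on ({0<..} \<times> torus_cell \<times> UNIV))"
      by (intro borel_lebesgue_on) (simp add: case_prod_beta')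
    show "AE (t, y) in lebesgue_on ({0<..} \<times> torus_cell). integrable (lebesgue_on {v. normal (wall y) \<bullet> v > 0}) (\<lambda>v. sol g t (wall y) v * (normal (wall y) \<bullet> v))"
      unfolding AE_lebesgue_on[OF S2] using sol_outflux(1)[OF d] by auto
    show "AE (t, y, v) in lebesgue_on ({0<..} \<times> torus_cell \<times> UNIV). (wall y, v) \<in> gamma_minus \<longrightarrow> sol g t (wall y) v = wall_maxwellian (wall y) v * outflux (sol g) t (wall y)"
      unfolding AE_lebesgue_on[OF S1] using sol_outflux(2)[OF d] sol_wall_in by (auto simp: gamma_minus_wall)
    show "AE z in phase_measure. sol g 0 (fst z) (snd z) = F0 (fst z) (snd z)"
      using F0 AE_phase_measure_Omega by eventually_elim (auto simp: sol_0 less_imp_le[OF Omega_cellD])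
  qed
qed

end

section \<open>Uniqueness\<close>

text \<open>Reduction modulo the lattice. Composition with it turns a function or a null set on one
  cell into a periodic one on the cover.\<close>

definition wrap2 :: "real^2 \<Rightarrow> real^2" where
  "wrap2 y = vec2 (frac (y $ 1), frac (y $ 2))"

definition wrap3 :: "real^3 \<Rightarrow> real^3" where
  "wrap3 x = vec3 (wrap2 (hor x), x $ 3)"

lemma frac_borel [measurable]: "(frac :: real \<Rightarrow> real) \<in> borel_measurable borel"
  unfolding frac_def[abs_def] by measurable

lemma wrap2_borel [measurable]: "wrap2 \<in> borel_measurable borel"
  unfolding wrap2_def[abs_def] by measurable

lemma wrap3_borel [measurable]: "wrap3 \<in> borel_measurable borel"
  unfolding wrap3_def[abs_def] by measurable

lemma frac_Suc: "frac (x + 1 :: real) = frac x"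
  by (simp add: frac_def)

lemma wrap2_periodic: "wrap2 (y + axis 1 1) = wrap2 y" "wrap2 (y + axis 2 1) = wrap2 y"
  by (simp_all add: wrap2_def axis_def frac_Suc)

lemma wrap2_cell: "wrap2 y \<in> torus_cell"
  by (simp add: wrap2_def torus_cell_def frac_lt_1)

lemma wrap2_id: "y \<in> torus_cell \<Longrightarrow> wrap2 y = y"
  unfolding vec_eq_iff forall_2 by (simp add: wrap2_def torus_cell_def frac_eq)

lemma periodic2_wrap2:
  assumes "periodic2 f" shows "f (wrap2 y) = f y"
proof -
  have 1: "f (vec2 (s + 1, r)) = f (vec2 (s, r))" and 2: "f (vec2 (s, r + 1)) = f (vec2 (s, r))" for s r
    using assms by (auto simp: periodic2_def vec2_shift)
  have "f (vec2 (frac (y $ 1), frac (y $ 2))) = f (vec2 (frac (y $ 1) + of_int \<lfloor>y $ 1\<rfloor>, frac (y $ 2)))"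
    by (rule periodic_int[of "\<lambda>s. f (vec2 (s, frac (y $ 2)))", symmetric]) (rule 1)
  also have "\<dots> = f (vec2 (frac (y $ 1) + of_int \<lfloor>y $ 1\<rfloor>, frac (y $ 2) + of_int \<lfloor>y $ 2\<rfloor>))"
    by (rule periodic_int[of "\<lambda>r. f (vec2 (_, r))", symmetric]) (rule 2)
  also have "vec2 (frac (y $ 1) + of_int \<lfloor>y $ 1\<rfloor>, frac (y $ 2) + of_int \<lfloor>y $ 2\<rfloor>) = y"
    unfolding vec_eq_iff forall_2 by (simp add: frac_def)
  finally show ?thesis by (simp add: wrap2_def)
qed

lemma per3_wrap3:
  assumes "per3 H" shows "H (wrap3 x, v) = H (x, v)"
  using periodic2_wrap2[OF per3_periodic2[OF assms, of "x $ 3" v], of "hor x"] by (simp add: wrap3_def)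

lemma wrap3_periodic: "wrap3 (x + axis 1 1) = wrap3 x" "wrap3 (x + axis 2 1) = wrap3 x"
proof -
  have "hor (x + axis 1 1) = hor x + axis 1 1" "hor (x + axis 2 1) = hor x + axis 2 1"
    unfolding vec_eq_iff forall_2 by (simp_all add: axis_def)
  moreover have e: "axis 1 (1::real) $ (3::3) = 0" "axis 2 (1::real) $ (3::3) = 0" by (simp_all add: axis_def)
  ultimately show "wrap3 (x + axis 1 1) = wrap3 x" "wrap3 (x + axis 2 1) = wrap3 x"
    by (simp_all add: wrap3_def wrap2_periodic e)
qed

lemma wrap3_cell: "0 < x $ 3 \<Longrightarrow> wrap3 x \<in> Omega_cell"
  using wrap2_cell[of "hor x"] by (simp add: Omega_cell_def Omega_def wrap3_def torus_cell_def)

lemma wrap3_id: "x \<in> Omega_cell \<Longrightarrow> wrap3 x = x"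
  unfolding wrap3_def by (subst wrap2_id) (auto simp: torus_cell_def Omega_cell_def)

lemma bounded_linear_vec3: "bounded_linear vec3"
proof -
  have "linear vec3"
    by (rule linearI) (simp_all add: vec_eq_iff forall_3)
  then show ?thesis by (simp add: linear_linear)
qed

text \<open>An exceptional set becomes a Borel set, whose indicator can serve as a density and be
  transported.\<close>

lemma AE_null_cover:
  assumes "AE x in lborel. P x"
  obtains N where "N \<in> sets borel" "\<And>x. x \<notin> N \<Longrightarrow> P x" "(\<integral>\<^sup>+x. indicator N x \<partial>lborel) = 0"
proof -
  from AE_E[OF assms] obtain N where "{x \<in> space lborel. \<not> P x} \<subseteq> N" "emeasure lborel N = 0" "N \<in> sets lborel" by blast
  then show ?thesis by (intro that[of N]) auto
qed

lemma nn_integral_wall_velocity: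
  assumes [measurable]: "H \<in> borel_measurable (borel :: (real \<times> (real^2) \<times> (real^3)) measure)"
  shows "(\<integral>\<^sup>+u. H u \<partial>lborel) = (\<integral>\<^sup>+x. (\<integral>\<^sup>+v. H (fst x, snd x, v) \<partial>lborel) \<partial>(lborel :: pt measure))"
proof -
  have "(\<integral>\<^sup>+u. H u \<partial>lborel) = (\<integral>\<^sup>+t. (\<integral>\<^sup>+z. H (t, z) \<partial>lborel) \<partial>lborel)"
    by (rule nn_integral_lborel_pair) measurable
  also have "\<dots> = (\<integral>\<^sup>+t. (\<integral>\<^sup>+y. (\<integral>\<^sup>+v. H (t, y, v) \<partial>lborel) \<partial>lborel) \<partial>lborel)"
    by (intro nn_integral_cong nn_integral_lborel_pair) measurable
  also have "\<dots> = (\<integral>\<^sup>+x. (\<integral>\<^sup>+v. H (fst x, snd x, v) \<partial>lborel) \<partial>(lborel :: pt measure))"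
  proof -
    have "(\<lambda>z::pt \<times> (real^3). H (fst (fst z), snd (fst z), snd z)) \<in> borel_measurable borel" by measurable
    from nn_integral_lborel_borel[OF this] show ?thesis
      by (subst nn_integral_lborel_pair) simp_all
  qed
  finally show ?thesis .
qed

lemma AE_wall_velocity:
  assumes "AE u in lborel. P (fst u) (fst (snd u)) (snd (snd u))"
  shows "AE x in (lborel :: pt measure). AE v in (lborel :: (real^3) measure). P (fst x) (snd x) v"
proof -
  obtain N where N: "N \<in> sets borel" "\<And>u. u \<notin> N \<Longrightarrow> P (fst u) (fst (snd u)) (snd (snd u))" "(\<integral>\<^sup>+u. indicator N u \<partial>lborel) = 0"
    by (rule AE_null_cover[OF assms]) (rule that)
  note [measurable] = N(1)
  have "(\<lambda>z::pt \<times> (real^3). indicator N (fst (fst z), snd (fst z), snd z) :: ennreal) \<in> borel_measurable borel" by measurable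
  from nn_integral_lborel_borel[OF this]
  have m: "(\<lambda>x::pt. \<integral>\<^sup>+v. indicator N (fst x, snd x, v) \<partial>(lborel :: (real^3) measure)) \<in> borel_measurable borel" by simp
  have "(\<integral>\<^sup>+x. (\<integral>\<^sup>+v. indicator N (fst x, snd x, v) \<partial>lborel) \<partial>(lborel :: pt measure)) = 0"
    using N(3) by (subst (asm) nn_integral_wall_velocity) simp_all
  then have "AE x in (lborel :: pt measure). (\<integral>\<^sup>+v. indicator N (fst x, snd x, v) \<partial>lborel) = 0"
    using m by (subst (asm) nn_integral_0_iff_AE) auto
  then show ?thesis
  proof eventually_elim
    fix x :: pt assume "(\<integral>\<^sup>+v. indicator N (fst x, snd x, v) \<partial>lborel) = 0"
    then have "AE v in lborel. (indicator N (fst x, snd x, v) :: ennreal) = 0"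
      by (subst (asm) nn_integral_0_iff_AE) auto
    then show "AE v in lborel. P (fst x) (snd x) v"
      by eventually_elim (use N(2)[of "(fst x, snd x, _)"] in \<open>auto simp: indicator_def split: if_splits\<close>)
  qed
qed

lemma AE_wall_lift:
  assumes "AE x in (lborel :: pt measure). P x"
  shows "AE u in (lborel :: (real \<times> (real^2) \<times> (real^3)) measure). P (fst u, fst (snd u))"
proof -
  obtain N where N: "N \<in> sets borel" "\<And>u. u \<notin> N \<Longrightarrow> P u" "(\<integral>\<^sup>+u. indicator N u \<partial>lborel) = 0"
    by (rule AE_null_cover[OF assms]) (rule that)
  note [measurable] = N(1)
  have "(\<integral>\<^sup>+u. indicator N (fst u, fst (snd u)) \<partial>(lborel :: (real \<times> (real^2) \<times> (real^3)) measure))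
     = (\<integral>\<^sup>+x. (\<integral>\<^sup>+v. indicator N x \<partial>(lborel :: (real^3) measure)) \<partial>(lborel :: pt measure))"
    by (subst nn_integral_wall_velocity) simp_all
  also have "\<dots> = (\<integral>\<^sup>+x. indicator N x * \<infinity> \<partial>(lborel :: pt measure))"
    by simp
  also have "\<dots> = 0" using N(3) by (subst nn_integral_multc) auto
  finally have "AE u in (lborel :: (real \<times> (real^2) \<times> (real^3)) measure). (indicator N (fst u, fst (snd u)) :: ennreal) = 0"
    by (subst (asm) nn_integral_0_iff_AE) auto
  then show ?thesis
    by eventually_elim (use N(2) in \<open>auto simp: indicator_def split: if_splits\<close>)
qed

lemma AE_wallm:
  assumes "AE x in (lborel :: pt measure). snd x \<in> torus_cell \<longrightarrow> P x"
  shows "AE x in wallm. snd x \<in> torus_cell \<and> P x"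
proof -
  obtain N where N: "N \<in> sets borel" "\<And>x. x \<notin> N \<Longrightarrow> (snd x \<in> torus_cell \<longrightarrow> P x)" "(\<integral>\<^sup>+x. indicator N x \<partial>(lborel :: pt measure)) = 0"
    by (rule AE_null_cover[OF assms]) (rule that)
  note [measurable] = N(1)
  have c: "(\<integral>\<^sup>+y. H y \<partial>cellm) = (\<integral>\<^sup>+y. indicator torus_cell y * H y \<partial>lborel)" if "H \<in> borel_measurable borel" for H
    unfolding cellm_def using that by (subst nn_integral_density) auto
  define H :: "pt \<Rightarrow> ennreal" where "H x = indicator N x + indicator (- torus_cell) (snd x)" for x
  have [measurable]: "H \<in> borel_measurable borel" unfolding H_def[abs_def] by measurable
  have "(\<integral>\<^sup>+x. H x \<partial>wallm) = (\<integral>\<^sup>+t. (\<integral>\<^sup>+y. indicator torus_cell y * H (t, y) \<partial>lborel) \<partial>lborel)"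
    by (subst nn_integral_wallm) (simp_all add: c)
  also have "\<dots> \<le> (\<integral>\<^sup>+t. (\<integral>\<^sup>+y. indicator N (t, y) \<partial>lborel) \<partial>lborel)"
    by (intro nn_integral_mono) (auto simp: H_def indicator_def)
  also have "\<dots> = 0" using N(3) by (subst (asm) nn_integral_lborel_pair) simp_all
  finally have "(\<integral>\<^sup>+x. H x \<partial>wallm) = 0" by simp
  then have "AE x in wallm. H x = 0" by (subst (asm) nn_integral_0_iff_AE) auto
  then show ?thesis
    by eventually_elim (use N(2) in \<open>auto simp: H_def indicator_def split: if_splits\<close>)
qed

lemma nn_integral_wall_transfer:
  assumes [measurable]: "H \<in> borel_measurable (borel :: (real \<times> (real^2) \<times> (real^3)) measure)"
  shows "(\<integral>\<^sup>+p. (\<integral>\<^sup>+v. (\<integral>\<^sup>+s. (\<integral>\<^sup>+y. H (s, y, vec3 (p, v)) \<partial>cellm) \<partial>lborel) \<partial>lborel) \<partial>lborel)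
    = (\<integral>\<^sup>+u. H u * indicator torus_cell (fst (snd u)) \<partial>lborel)"
proof -
  have c: "(\<integral>\<^sup>+y. H (s, y, w) \<partial>cellm) = (\<integral>\<^sup>+y. H (s, y, w) * indicator torus_cell y \<partial>lborel)" for s w
    unfolding cellm_def by (subst nn_integral_density) (auto simp: mult.commute)
  define J where "J z = (\<integral>\<^sup>+y. H (fst z, y, snd z) \<partial>cellm)" for z :: "real \<times> (real^3)"
  have J [measurable]: "J \<in> borel_measurable borel"
  proof -
    have "(\<lambda>z::(real \<times> (real^3)) \<times> (real^2). H (fst (fst z), snd z, snd (fst z))) \<in> borel_measurable borel" by measurable
    from nn_integral_cellm_borel[OF this] show ?thesis by (simp add: J_def[abs_def])
  qed
  have "(\<integral>\<^sup>+p. (\<integral>\<^sup>+v. (\<integral>\<^sup>+s. (\<integral>\<^sup>+y. H (s, y, vec3 (p, v)) \<partial>cellm) \<partial>lborel) \<partial>lborel) \<partial>lborel)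
     = (\<integral>\<^sup>+p. (\<integral>\<^sup>+v. (\<integral>\<^sup>+s. J (s, vec3 (p, v)) \<partial>lborel) \<partial>lborel) \<partial>lborel)"
    by (simp add: J_def)
  also have "\<dots> = (\<integral>\<^sup>+s. (\<integral>\<^sup>+p. (\<integral>\<^sup>+v. J (s, vec3 (p, v)) \<partial>lborel) \<partial>lborel) \<partial>lborel)"
    by (rule lborel_rotate) measurable
  also have "\<dots> = (\<integral>\<^sup>+s. (\<integral>\<^sup>+w. J (s, w) \<partial>lborel) \<partial>lborel)"
    by (subst nn_integral_vec3[of "\<lambda>w. J (_, w)"]) simp_all
  also have "\<dots> = (\<integral>\<^sup>+s. (\<integral>\<^sup>+w. (\<integral>\<^sup>+y. H (s, y, w) * indicator torus_cell y \<partial>lborel) \<partial>lborel) \<partial>lborel)"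
    by (simp add: J_def c)
  also have "\<dots> = (\<integral>\<^sup>+s. (\<integral>\<^sup>+y. (\<integral>\<^sup>+w. H (s, y, w) * indicator torus_cell y \<partial>lborel) \<partial>lborel) \<partial>lborel)"
    by (intro nn_integral_cong, rule lborel_Fubini) measurable
  also have "\<dots> = (\<integral>\<^sup>+s. (\<integral>\<^sup>+z. H (s, z) * indicator torus_cell (fst z) \<partial>lborel) \<partial>lborel)"
    by (subst nn_integral_lborel_pair[of "\<lambda>z. H (_, z) * indicator torus_cell (fst z)"]) simp_all
  also have "\<dots> = (\<integral>\<^sup>+u. H u * indicator torus_cell (fst (snd u)) \<partial>lborel)"
    by (subst nn_integral_lborel_pair[of "\<lambda>u. H u * indicator torus_cell (fst (snd u))"]) simp_all
  finally show ?thesis .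
qed

context log_problem
begin

section \<open>Tracing solutions and null sets along orbits\<close>

text \<open>The converse of \<open>evol_characteristic\<close>: the explicit orbits are
  characteristics up to and including the wall, so any solution is constant along them.\<close>

lemma state_characteristic:
  assumes v: "0 < v" and s: "0 \<le> s1" "s1 < s2" "s2 \<le> flight v"
  shows "characteristic a \<tau> (\<tau> + (s2 - s1)) (\<lambda>r. fst (state (r - \<tau> + s1) y p v)) (\<lambda>r. snd (state (r - \<tau> + s1) y p v))"
  unfolding characteristic_def
proof (intro conjI ballI)
  show "\<tau> < \<tau> + (s2 - s1)" using s by simp
next
  fix r assume r: "r \<in> {\<tau>..\<tau> + (s2 - s1)}"
  define q where "q = r - \<tau> + s1"
  have q: "0 \<le> v" "0 \<le> q" "q \<le> flight v" using r s v by (auto simp: q_def)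
  have hp: "0 \<le> height q v" by (rule height_nonneg[OF q])
  have dq: "((\<lambda>r. r - \<tau> + s1) has_real_derivative 1) (at r)" by (auto intro!: derivative_eq_intros)
  have dh: "((\<lambda>r. height (r - \<tau> + s1) v) has_vector_derivative vel q v) (at r)"
    using DERIV_chain2[OF height_deriv[OF q, unfolded q_def] dq]
    by (simp add: has_real_derivative_iff_has_vector_derivative q_def)
  have dv: "((\<lambda>r. vel (r - \<tau> + s1) v) has_vector_derivative - b / (1 + height q v)) (at r)"
    using DERIV_chain2[OF vel_deriv[OF q, unfolded q_def] dq]
    by (simp add: has_real_derivative_iff_has_vector_derivative q_def)
  have dy: "((\<lambda>r. y + (r - \<tau> + s1) *\<^sub>R p) has_vector_derivative p) (at r)"
    by (auto intro!: derivative_eq_intros simp: has_vector_derivative_def)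
  have "((\<lambda>r. vec3 (y + (r - \<tau> + s1) *\<^sub>R p, height (r - \<tau> + s1) v)) has_vector_derivative vec3 (p, vel q v)) (at r)"
    by (intro bounded_linear.has_vector_derivative[OF bounded_linear_vec3] has_vector_derivative_Pair dy dh)
  then show "((\<lambda>r. fst (state (r - \<tau> + s1) y p v)) has_vector_derivative snd (state (r - \<tau> + s1) y p v)) (at r within {\<tau>..\<tau> + (s2 - s1)})"
    by (auto simp: state_def q_def intro: has_vector_derivative_at_within)
  have "((\<lambda>r. vec3 (p, vel (r - \<tau> + s1) v)) has_vector_derivative vec3 (0, - b / (1 + height q v))) (at r)"
    by (intro bounded_linear.has_vector_derivative[OF bounded_linear_vec3] has_vector_derivative_Pair has_vector_derivative_const dv)
  moreover have "vec3 (0, - b / (1 + height q v)) = - grad (Phi a) (vec3 (y + q *\<^sub>R p, height q v))"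
    using grad_Phi[OF a_gt_1, of "vec3 (y + q *\<^sub>R p, height q v)"] hp
    by (simp add: closure_Omega vec_eq_iff forall_3 axis_def b_eq mult.commute)
  ultimately show "((\<lambda>r. snd (state (r - \<tau> + s1) y p v)) has_vector_derivative - grad (Phi a) (fst (state (r - \<tau> + s1) y p v))) (at r within {\<tau>..\<tau> + (s2 - s1)})"
    by (auto simp: state_def q_def intro: has_vector_derivative_at_within)
next
  fix r assume r: "r \<in> {\<tau><..<\<tau> + (s2 - s1)}"
  then have "0 < height (r - \<tau> + s1) v" using s v by (intro height_pos) auto
  then show "fst (state (r - \<tau> + s1) y p v) \<in> Omega" by (simp add: state_def Omega_def)
qed

lemma L1_solution_transport:
  assumes G: "L1_solution a F0 G" and \<tau>: "0 \<le> \<tau>" and v: "0 < v" and s: "0 \<le> s1" "s1 \<le> s2" "s2 \<le> flight v"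
  shows "G (\<tau> + (s2 - s1)) (fst (state s2 y p v)) (snd (state s2 y p v)) = G \<tau> (fst (state s1 y p v)) (snd (state s1 y p v))"
proof (cases "s1 = s2")
  case False
  then have "s1 < s2" using s by simp
  from state_characteristic[OF v s(1) this s(3), of \<tau> y p]
  have "G (\<tau> + (s2 - s1)) (fst (state (\<tau> + (s2 - s1) - \<tau> + s1) y p v)) (snd (state (\<tau> + (s2 - s1) - \<tau> + s1) y p v))
     = G \<tau> (fst (state (\<tau> - \<tau> + s1) y p v)) (snd (state (\<tau> - \<tau> + s1) y p v))"
    using G \<tau> unfolding L1_solution_def by blast
  then show ?thesis by simp
qed simp

lemma state_0: "state 0 y p v = (wall y, vec3 (p, v))"
  using vel_sage[of v v] by (simp add: state_def wall_eq height_def sage_def)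

lemma state_flight: "state (flight v) (y - flight v *\<^sub>R p) p v = (wall y, vec3 (p, - v))"
  using vel_sage[of v "- v"] by (simp add: state_def wall_eq height_def sage_flight)

lemma L1_solution_wrap:
  assumes G: "L1_solution a F0 G" and "0 \<le> t" "0 \<le> x $ 3"
  shows "G t (wrap3 x) v = G t x v"
proof -
  have "periodic2 (\<lambda>y. G t (vec3 (y, x $ 3)) v)"
    using assms unfolding periodic2_def L1_solution_def torus_periodic_def closure_Omega
    by (simp add: vec3_shift)
  from periodic2_wrap2[OF this, of "hor x"] show ?thesis by (simp add: wrap3_def)
qed

text \<open>The orbit is traced back to its emission if s < t and to time zero if t < s. In the
  second case both solutions carry the same datum, so only the discrepancy of the wall fluxes is
  transported. What holds merely almost everywhere enters as the last two hypotheses.\<close>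

lemma difference_along_state:
  assumes d: "datum \<kappa> g" and G: "L1_solution a F0 G" and t: "0 < t" and v: "0 < v" and s: "0 \<le> s" "s \<le> flight v" "s \<noteq> t"
    and wallG: "s < t \<Longrightarrow> G (t - s) (wall (wrap2 y)) (vec3 (p, v)) = maxw (p, v) * om (t - s, y)"
    and initG: "t < s \<Longrightarrow> G 0 (wrap3 (fst (state (s - t) y p v))) (snd (state (s - t) y p v)) = g (wrap3 (fst (state (s - t) y p v)), snd (state (s - t) y p v))"
  shows "\<bar>G t (fst (state s y p v)) (snd (state s y p v)) - sol g t (fst (state s y p v)) (snd (state s y p v))\<bar>
     = evol (\<lambda>_. 0) (\<lambda>x. \<bar>om x - wsol g x\<bar>) t (state s y p v)"
proof -
  have v0: "0 \<le> v" using v by simp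
  have e: "evol h w t (state s y p v) = (if s < t then maxw (p, v) * w (t - s, y) else h (state (s - t) y p v))" for h w
    by (rule evol_state[OF v0 s(1,2)])
  show ?thesis
  proof (cases "s < t")
    case True
    have "G t (fst (state s y p v)) (snd (state s y p v)) = G (t - s) (fst (state 0 y p v)) (snd (state 0 y p v))"
      using L1_solution_transport[OF G, of "t - s" v 0 s y p] True v s by simp
    also have "\<dots> = G (t - s) (wall y) (vec3 (p, v))" by (simp add: state_0)
    also have "\<dots> = G (t - s) (wrap3 (wall y)) (vec3 (p, v))"
      using True by (intro L1_solution_wrap[OF G, symmetric]) (auto simp: wall_eq)
    also have "wrap3 (wall y) = wall (wrap2 y)" by (simp add: wrap3_def wall_eq)
    finally have "G t (fst (state s y p v)) (snd (state s y p v)) = maxw (p, v) * om (t - s, y)" using wallG[OF True] by simp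
    moreover have "sol g t (fst (state s y p v)) (snd (state s y p v)) = maxw (p, v) * wsol g (t - s, y)"
      using True by (simp add: sol_def e)
    ultimately show ?thesis using True maxw_pos[of "(p, v)"]
      by (simp add: e right_diff_distrib[symmetric] abs_mult)
  next
    case False
    then have ts: "t < s" using s by simp
    have "0 \<le> height (s - t) v" using ts t s v by (intro height_nonneg) auto
    then have h: "0 \<le> fst (state (s - t) y p v) $ 3" by (simp add: state_def)
    have "G t (fst (state s y p v)) (snd (state s y p v)) = G 0 (fst (state (s - t) y p v)) (snd (state (s - t) y p v))"
      using L1_solution_transport[OF G, of 0 v "s - t" s y p] ts t v s by simp
    also have "\<dots> = g (state (s - t) y p v)"
      using initG[OF ts] L1_solution_wrap[OF G _ h, of 0] per3_wrap3[OF datumD(3)[OF d]] by simp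
    finally show ?thesis using False by (simp add: e sol_def)
  qed
qed

lemma src_zero: "src (\<lambda>_. 0) = (\<lambda>_. 0)"
  by (auto simp: src_def fun_eq_iff)

lemma evol_0: "0 \<le> fst z $ 3 \<Longrightarrow> evol g w 0 z = g z"
  using age_bounds[of "fst z $ 3" "snd z $ 3"] state_of[of z] by (simp add: evol_def Let_def)

lemma aft_K_upto_zero: "aft t (K (upto t (\<lambda>_. 0))) = (\<lambda>_. 0)"
  by (simp add: fun_eq_iff aft_def upto_def[abs_def] K_def)

text \<open>The mass identity at time zero without wall flux: a null set of initial points has first
  visits of mass zero.\<close>

lemma src_null:
  assumes e [measurable]: "e \<in> borel_measurable borel" and per: "per3 e"
    and null: "(\<integral>\<^sup>+z. ennreal (e z) \<partial>phase_measure) = 0"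
  shows "I (src e) = 0"
proof -
  have "(\<integral>\<^sup>+z. ennreal (evol e (\<lambda>_. 0) 0 z) * indicator (Omega_cell \<times> UNIV) z \<partial>lborel) = I (aft 0 (src e)) + I (aft 0 (K (upto 0 (\<lambda>x. ennreal 0))))"
    by (rule nn_integral_evol[OF e per]) (simp_all add: periodic2_def)
  moreover have "aft 0 (src e) = src e" by (auto simp: aft_def src_def fun_eq_iff)
  moreover have "(\<integral>\<^sup>+z. ennreal (evol e (\<lambda>_. 0) 0 z) * indicator (Omega_cell \<times> UNIV) z \<partial>lborel) = (\<integral>\<^sup>+z. ennreal (e z) \<partial>phase_measure)"
    unfolding nn_integral_phase_measure
    by (rule nn_integral_cong) (auto simp: indicator_def evol_0 less_imp_le[OF Omega_cellD])
  ultimately show ?thesis using null by (simp add: aft_K_upto_zero I_def)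
qed

text \<open>The indicator of a null set is transported like a density. Its mass at time t is that of
  the first visits after t, hence zero.\<close>

lemma evol_null:
  assumes e [measurable]: "e \<in> borel_measurable borel" and per: "per3 e" and src: "I (src e) = 0" and t: "0 \<le> t"
  shows "AE z in phase_measure. evol e (\<lambda>_. 0) t z \<le> 0"
proof -
  have "(\<integral>\<^sup>+z. ennreal (evol e (\<lambda>_. 0) t z) * indicator (Omega_cell \<times> UNIV) z \<partial>lborel) = I (aft t (src e)) + I (aft t (K (upto t (\<lambda>x. ennreal 0))))"
    by (rule nn_integral_evol[OF e per]) (simp_all add: periodic2_def t)
  moreover have "I (aft t (src e)) \<le> I (src e)" by (rule I_mono) (simp add: aft_def)
  ultimately have "(\<integral>\<^sup>+z. ennreal (evol e (\<lambda>_. 0) t z) * indicator (Omega_cell \<times> UNIV) z \<partial>lborel) = 0"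
    using src by (simp add: aft_K_upto_zero I_def)
  then have "(\<integral>\<^sup>+z. ennreal (evol e (\<lambda>_. 0) t z) \<partial>phase_measure) = 0"
    by (simp add: nn_integral_phase_measure)
  moreover have "(\<lambda>z. ennreal (evol e (\<lambda>_. 0) t z)) \<in> borel_measurable phase_measure"
    by (rule borel_phase_measure) measurable
  ultimately have "AE z in phase_measure. ennreal (evol e (\<lambda>_. 0) t z) = 0"
    by (subst (asm) nn_integral_0_iff_AE) auto
  then show ?thesis by eventually_elim (simp add: ennreal_eq_0_iff)
qed

text \<open>Transport into phase space of a set of emission events, given by time, place and
  velocity, without the Maxwellian weight. Emission at time zero is included through s \<le> t,
  since that instant has to count as exceptional.\<close>

definition emit :: "(real \<times> (real^2) \<times> (real^3) \<Rightarrow> real) \<Rightarrow> real \<Rightarrow> (real^3) \<times> (real^3) \<Rightarrow> real" where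
  "emit e t z = (let s = age (fst z $ 3) (snd z $ 3) in
     if s \<le> t then e (t - s, foot z, vec3 (hor (snd z), speed (fst z $ 3) (snd z $ 3))) else 0)"

lemma emit_measurable [measurable (raw)]:
  assumes [measurable]: "e \<in> borel_measurable borel" "t \<in> borel_measurable M" "z \<in> borel_measurable M"
  shows "(\<lambda>x. emit e (t x) (z x)) \<in> borel_measurable M"
  unfolding emit_def Let_def by measurable

lemma emit_state:
  assumes "0 \<le> v" "0 \<le> s" "s \<le> flight v"
  shows "emit e t (state s y p v) = (if s \<le> t then e (t - s, y, vec3 (p, v)) else 0)"
  unfolding emit_def Let_def state_inv[OF assms] ..

lemma per3_emit:
  assumes "\<And>t v. periodic2 (\<lambda>y. e (t, y, v))"
  shows "per3 (emit e t)"
proof -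
  have f: "foot (x + axis 1 1, v) = foot (x, v) + axis 1 1" "foot (x + axis 2 1, v) = foot (x, v) + axis 2 1" for x v
    unfolding vec_eq_iff forall_2 foot_def by (simp_all add: axis_def)
  have a: "axis 1 (1::real) $ (3::3) = 0" "axis 2 (1::real) $ (3::3) = 0"
    by (simp_all add: axis_def)
  have es: "e (t, y + axis 1 1, v) = e (t, y, v)" "e (t, y + axis 2 1, v) = e (t, y, v)" for t y v
    using assms by (auto simp: periodic2_def)
  show ?thesis unfolding per3_def emit_def Let_def by (simp add: f a es)
qed

text \<open>In orbit coordinates the transported set is the original one, up to the Jacobian v. The
  unbounded factor v is absorbed by the weight \<infinity>, which does no harm on a null
  set.\<close>

lemma emit_null_phase:
  assumes e [measurable]: "e \<in> borel_measurable borel" and per: "\<And>t v. periodic2 (\<lambda>y. e (t, y, v))"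
    and null: "(\<integral>\<^sup>+u. \<infinity> * ennreal (e u) * indicator torus_cell (fst (snd u)) \<partial>lborel) = 0"
  shows "AE z in phase_measure. emit e t z \<le> 0"
proof -
  let ?H = "\<lambda>u. \<infinity> * ennreal (e u)"
  have "(\<integral>\<^sup>+z. ennreal (emit e t z) * indicator (Omega_cell \<times> UNIV) z \<partial>lborel)
    = (\<integral>\<^sup>+p. (\<integral>\<^sup>+v. (\<integral>\<^sup>+s. (\<integral>\<^sup>+y. ennreal (emit e t (state s y p v)) \<partial>cellm) * ennreal v * indicator {0<..} v * indicator {0<..<flight v} s \<partial>lborel) \<partial>lborel) \<partial>lborel)"
    by (rule nn_integral_phase) (use per3_emit[OF per, of t] in \<open>simp_all add: per3_def\<close>)
  also have "\<dots> \<le> (\<integral>\<^sup>+p. (\<integral>\<^sup>+v. (\<integral>\<^sup>+s. (\<integral>\<^sup>+y. ?H (t - s, y, vec3 (p, v)) \<partial>cellm) \<partial>lborel) \<partial>lborel) \<partial>lborel)"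
  proof (intro nn_integral_mono)
    fix p v s
    show "(\<integral>\<^sup>+y. ennreal (emit e t (state s y p v)) \<partial>cellm) * ennreal v * indicator {0<..} v * indicator {0<..<flight v} s \<le> (\<integral>\<^sup>+y. ?H (t - s, y, vec3 (p, v)) \<partial>cellm)"
    proof (cases "0 < v \<and> 0 < s \<and> s < flight v")
      case True
      then have "(\<integral>\<^sup>+y. ennreal (emit e t (state s y p v)) \<partial>cellm) \<le> (\<integral>\<^sup>+y. ennreal (e (t - s, y, vec3 (p, v))) \<partial>cellm)"
        by (intro nn_integral_mono) (simp add: emit_state)
      then have "(\<integral>\<^sup>+y. ennreal (emit e t (state s y p v)) \<partial>cellm) * ennreal v \<le> (\<integral>\<^sup>+y. ennreal (e (t - s, y, vec3 (p, v))) \<partial>cellm) * \<infinity>"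
        by (intro mult_mono) auto
      also have "\<dots> = (\<integral>\<^sup>+y. ?H (t - s, y, vec3 (p, v)) \<partial>cellm)"
        by (subst nn_integral_cmult) (simp_all add: mult.commute)
      finally show ?thesis using True by simp
    qed (auto split: split_indicator)
  qed
  also have "\<dots> = (\<integral>\<^sup>+p. (\<integral>\<^sup>+v. (\<integral>\<^sup>+s. (\<integral>\<^sup>+y. ?H (s, y, vec3 (p, v)) \<partial>cellm) \<partial>lborel) \<partial>lborel) \<partial>lborel)"
  proof (rule nn_integral_cong, rule nn_integral_cong)
    fix p v
    have "(\<lambda>z::real \<times> (real^2). ?H (fst z, snd z, vec3 (p, v))) \<in> borel_measurable borel" by measurable
    from nn_integral_cellm_borel[OF this]
    have "(\<lambda>s::real. \<integral>\<^sup>+y. ?H (s, y, vec3 (p, v)) \<partial>cellm) \<in> borel_measurable borel" by simp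
    from nn_integral_real_affine[OF this, of "-1" t]
    show "(\<integral>\<^sup>+s. (\<integral>\<^sup>+y. ?H (t - s, y, vec3 (p, v)) \<partial>cellm) \<partial>lborel) = (\<integral>\<^sup>+s. (\<integral>\<^sup>+y. ?H (s, y, vec3 (p, v)) \<partial>cellm) \<partial>lborel)"
      by simp
  qed
  also have "\<dots> = (\<integral>\<^sup>+u. ?H u * indicator torus_cell (fst (snd u)) \<partial>lborel)"
    by (rule nn_integral_wall_transfer) measurable
  finally have "(\<integral>\<^sup>+z. ennreal (emit e t z) \<partial>phase_measure) = 0"
    using null by (simp add: nn_integral_phase_measure)
  moreover have "(\<lambda>z. ennreal (emit e t z)) \<in> borel_measurable phase_measure"
    by (rule borel_phase_measure) measurable
  ultimately have "AE z in phase_measure. ennreal (emit e t z) = 0"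
    by (subst (asm) nn_integral_0_iff_AE) auto
  then show ?thesis by eventually_elim (simp add: ennreal_eq_0_iff)
qed

text \<open>The same for the outgoing trace: for fixed velocity the map from emission to arrival is
  a translation of time and place, which preserves null sets.\<close>

lemma emit_null_wall:
  assumes e [measurable]: "e \<in> borel_measurable borel" and per: "\<And>t v. periodic2 (\<lambda>y. e (t, y, v))"
    and null: "(\<integral>\<^sup>+u. \<infinity> * ennreal (e u) * indicator torus_cell (fst (snd u)) \<partial>lborel) = 0"
  shows "AE x in wallm. (\<integral>\<^sup>+p. (\<integral>\<^sup>+v. ennreal (emit e (fst x) (vec3 (snd x, 0), vec3 (p, - v))) * ennreal v * indicator {0<..} v \<partial>lborel) \<partial>lborel) = 0"
proof -
  let ?H = "\<lambda>u. \<infinity> * ennreal (e u)"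
  let ?E = "\<lambda>x p v. ennreal (emit e (fst x) (vec3 (snd x, 0), vec3 (p, - v))) * ennreal v * indicator {0<..} v"
  define J where "J t p v = (\<integral>\<^sup>+y. ?H (t, y, vec3 (p, v)) \<partial>cellm)" for t p v
  have J: "(\<lambda>z. J (f z) (g z) (h z)) \<in> borel_measurable borel"
    if [measurable]: "f \<in> borel_measurable borel" "g \<in> borel_measurable borel" "h \<in> borel_measurable borel" for f g h
  proof -
    have "(\<lambda>z::(real \<times> (real^2) \<times> real) \<times> (real^2). ?H (fst (fst z), snd z, vec3 (fst (snd (fst z)), snd (snd (fst z))))) \<in> borel_measurable borel" by measurable
    from nn_integral_cellm_borel[OF this] have "(\<lambda>u. J (fst u) (fst (snd u)) (snd (snd u))) \<in> borel_measurable borel" by (simp add: J_def)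
    from measurable_compose[OF _ this, of "\<lambda>z. (f z, g z, h z)" borel] show ?thesis by simp
  qed
  have E: "?E x p v \<le> ?H (fst x - flight v, snd x - flight v *\<^sub>R p, vec3 (p, v))" for x p v
  proof (cases "0 < v")
    case True
    then have "age 0 (- v) = flight v" "speed 0 (- v) = v" using wall_coords[of "- v"] by auto
    then have "emit e (fst x) (vec3 (snd x, 0), vec3 (p, - v)) = (if flight v \<le> fst x then e (fst x - flight v, snd x - flight v *\<^sub>R p, vec3 (p, v)) else 0)"
      by (simp add: emit_def foot_def Let_def)
    then have "?E x p v \<le> ennreal (e (fst x - flight v, snd x - flight v *\<^sub>R p, vec3 (p, v))) * \<infinity>"
      using True by (auto intro!: mult_left_mono)
    then show ?thesis by (simp add: mult.commute)
  qed simp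
  have m: "(\<lambda>x. \<integral>\<^sup>+p. (\<integral>\<^sup>+v. ?E x p v \<partial>lborel) \<partial>lborel) \<in> borel_measurable borel"
  proof -
    have "(\<lambda>z::(pt \<times> (real^2)) \<times> real. ?E (fst (fst z)) (snd (fst z)) (snd z)) \<in> borel_measurable borel" by measurable
    from nn_integral_lborel_borel[OF this] have "(\<lambda>z::pt \<times> (real^2). \<integral>\<^sup>+v. ?E (fst z) (snd z) v \<partial>lborel) \<in> borel_measurable borel" by simp
    from nn_integral_lborel_borel[OF this] show ?thesis by simp
  qed
  have "(\<integral>\<^sup>+x. (\<integral>\<^sup>+p. (\<integral>\<^sup>+v. ?E x p v \<partial>lborel) \<partial>lborel) \<partial>wallm)
    = (\<integral>\<^sup>+t. (\<integral>\<^sup>+y. (\<integral>\<^sup>+p. (\<integral>\<^sup>+v. ?E (t, y) p v \<partial>lborel) \<partial>lborel) \<partial>cellm) \<partial>lborel)"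
    by (rule nn_integral_wallm[OF m])
  also have "\<dots> \<le> (\<integral>\<^sup>+t. (\<integral>\<^sup>+y. (\<integral>\<^sup>+p. (\<integral>\<^sup>+v. ?H (t - flight v, y - flight v *\<^sub>R p, vec3 (p, v)) \<partial>lborel) \<partial>lborel) \<partial>cellm) \<partial>lborel)"
    by (intro nn_integral_mono) (use E[of "(_, _)"] in simp)
  also have "\<dots> = (\<integral>\<^sup>+t. (\<integral>\<^sup>+p. (\<integral>\<^sup>+v. J (t - flight v) p v \<partial>lborel) \<partial>lborel) \<partial>lborel)"
  proof (rule nn_integral_cong)
    fix t
    let ?F = "\<lambda>p v y. ?H (t - flight v, y - flight v *\<^sub>R p, vec3 (p, v))"
    have "(\<integral>\<^sup>+y. (\<integral>\<^sup>+p. (\<integral>\<^sup>+v. ?F p v y \<partial>lborel) \<partial>lborel) \<partial>cellm) = (\<integral>\<^sup>+p. (\<integral>\<^sup>+y. (\<integral>\<^sup>+v. ?F p v y \<partial>lborel) \<partial>cellm) \<partial>lborel)"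
    proof (rule cellm_Fubini)
      have "(\<lambda>z::((real^2) \<times> (real^2)) \<times> real. ?F (fst (fst z)) (snd z) (snd (fst z))) \<in> borel_measurable borel" by measurable
      from nn_integral_lborel_borel[OF this]
      show "(\<lambda>z. \<integral>\<^sup>+v. ?F (fst z) v (snd z) \<partial>lborel) \<in> borel_measurable (borel :: ((real^2) \<times> (real^2)) measure)" by simp
    qed
    also have "\<dots> = (\<integral>\<^sup>+p. (\<integral>\<^sup>+v. (\<integral>\<^sup>+y. ?F p v y \<partial>cellm) \<partial>lborel) \<partial>lborel)"
    proof (rule nn_integral_cong, rule cellm_Fubini)
      fix p show "(\<lambda>z. ?F p (fst z) (snd z)) \<in> borel_measurable borel" by measurable
    qed
    also have "\<dots> = (\<integral>\<^sup>+p. (\<integral>\<^sup>+v. J (t - flight v) p v \<partial>lborel) \<partial>lborel)"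
    proof (rule nn_integral_cong, rule nn_integral_cong)
      fix p v
      have "(\<lambda>y. ?H (t - flight v, y, vec3 (p, v))) \<in> borel_measurable borel" by measurable
      moreover have "periodic2 (\<lambda>y. ?H (t - flight v, y, vec3 (p, v)))" using per[of "t - flight v" "vec3 (p, v)"] by (simp add: periodic2_def)
      ultimately show "(\<integral>\<^sup>+y. ?F p v y \<partial>cellm) = J (t - flight v) p v"
        using nn_integral_cellm_shift[of "\<lambda>y. ?H (t - flight v, y, vec3 (p, v))" "- (flight v *\<^sub>R p)"] by (simp add: J_def)
    qed
    finally show "(\<integral>\<^sup>+y. (\<integral>\<^sup>+p. (\<integral>\<^sup>+v. ?F p v y \<partial>lborel) \<partial>lborel) \<partial>cellm) = (\<integral>\<^sup>+p. (\<integral>\<^sup>+v. J (t - flight v) p v \<partial>lborel) \<partial>lborel)" .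
  qed
  also have "\<dots> = (\<integral>\<^sup>+p. (\<integral>\<^sup>+v. (\<integral>\<^sup>+t. J (t - flight v) p v \<partial>lborel) \<partial>lborel) \<partial>lborel)"
    by (rule lborel_rotate[symmetric], rule J) measurable
  also have "\<dots> = (\<integral>\<^sup>+p. (\<integral>\<^sup>+v. (\<integral>\<^sup>+t. J t p v \<partial>lborel) \<partial>lborel) \<partial>lborel)"
  proof (rule nn_integral_cong, rule nn_integral_cong)
    fix p v
    have "(\<lambda>t. J t p v) \<in> borel_measurable borel" by (rule J) measurable
    from nn_integral_real_affine[OF this, of 1 "- flight v"]
    show "(\<integral>\<^sup>+t. J (t - flight v) p v \<partial>lborel) = (\<integral>\<^sup>+t. J t p v \<partial>lborel)" by simp
  qed
  also have "\<dots> = (\<integral>\<^sup>+u. ?H u * indicator torus_cell (fst (snd u)) \<partial>lborel)"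
    unfolding J_def by (rule nn_integral_wall_transfer) measurable
  also have "\<dots> = 0" by (rule null)
  finally have "(\<integral>\<^sup>+x. (\<integral>\<^sup>+p. (\<integral>\<^sup>+v. ?E x p v \<partial>lborel) \<partial>lborel) \<partial>wallm) = 0" by simp
  then show ?thesis using m by (subst (asm) nn_integral_0_iff_AE) auto
qed

lemma outgoing_null:
  fixes H :: "real^3 \<Rightarrow> real"
  assumes H [measurable]: "H \<in> borel_measurable borel"
    and null: "(\<integral>\<^sup>+p. (\<integral>\<^sup>+v. ennreal (H (vec3 (p, - v))) * ennreal v * indicator {0<..} v \<partial>lborel) \<partial>lborel) = 0"
  shows "AE w in lebesgue_on {v. v $ 3 < 0}. H w \<le> 0"
proof -
  have S: "{v :: real^3. 0 < - v $ 3} = {v. v $ 3 < 0}" by simp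
  have hs: "{v :: real^3. v $ 3 < 0} \<in> sets borel" by measurable
  have "(\<integral>\<^sup>+v. ennreal (H v * (- (v $ 3))) \<partial>lebesgue_on {v. v $ 3 < 0}) = 0"
    using nn_integral_outgoing[OF H, of 0] null unfolding normal_inner S by simp
  then have "AE v in lebesgue_on {v. v $ 3 < 0}. ennreal (H v * (- (v $ 3))) = 0"
    by (subst (asm) nn_integral_0_iff_AE) (auto intro!: borel_lebesgue_on)
  moreover have "AE v in lebesgue_on {v :: real^3. v $ 3 < 0}. v $ 3 < 0"
    unfolding AE_lebesgue_on[OF hs] by simp
  ultimately show ?thesis
  proof eventually_elim
    fix v :: "real^3" assume "ennreal (H v * (- (v $ 3))) = 0" "v $ 3 < 0"
    then have "H v * (- (v $ 3)) \<le> 0" "0 < - (v $ 3)" by (simp_all add: ennreal_eq_0_iff)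
    then show "H v \<le> 0" using mult_pos_pos[of "H v" "- (v $ 3)"] by linarith
  qed
qed

section \<open>Uniqueness among all solutions\<close>

text \<open>The trace, the boundary condition and the initial condition of G hold only almost
  everywhere, while the comparison runs along single orbits. The exceptional sets are covered by
  Borel null sets, made periodic and transported, so that almost every phase point and almost every
  outgoing wall point lies on an orbit that avoids them.\<close>

lemma L1_solution_unique:
  assumes d: "datum \<kappa> g" and F0: "AE z in phase_measure. F0 (fst z) (snd z) = g z" and G: "L1_solution a F0 G" and t0: "0 \<le> t"
  shows "AE z in phase_measure. G t (fst z) (snd z) = sol g t (fst z) (snd z)"
proof -
  note D = datumD[OF d]
  define SB :: "(real \<times> (real^2) \<times> (real^3)) set" where "SB = {0<..} \<times> torus_cell \<times> UNIV"
  define SC :: "pt set" where "SC = {0<..} \<times> torus_cell"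
  have SB [measurable]: "SB \<in> sets borel"
    unfolding SB_def borel_prod[symmetric] by (intro pair_measureI) auto
  have SC [measurable]: "SC \<in> sets borel"
    unfolding SC_def borel_prod[symmetric] by (intro pair_measureI) auto
  have Gm: "(\<lambda>u. G (fst u) (wall (fst (snd u))) (snd (snd u))) \<in> borel_measurable (lebesgue_on SB)"
    using G unfolding L1_solution_def SB_def by (simp add: case_prod_beta')
  obtain Gh where Gh [measurable]: "Gh \<in> borel_measurable borel"
    and GGh: "AE u in lebesgue_on SB. G (fst u) (wall (fst (snd u))) (snd (snd u)) = Gh u"
    using lebesgue_on_borel_representative[OF SB Gm] by blast
  \<comment> \<open>The outgoing flux of the Borel representative of the trace. Unlike the flux of G
    it is a Borel function of time and place, and it agrees with it almost everywhere.\<close>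
  define omega where "omega x = (\<integral>v. Gh (fst x, snd x, v) * (- (v $ 3)) * indicator {v. v $ 3 < 0} v \<partial>lborel)" for x :: pt
  have [measurable]: "omega \<in> borel_measurable borel"
  proof -
    have "(\<lambda>(x::pt, v::real^3). Gh (fst x, snd x, v) * (- (v $ 3)) * indicator {v. v $ 3 < 0} v) \<in> borel_measurable (borel \<Otimes>\<^sub>M lborel)"
      unfolding case_prod_beta' by (simp only: measurable_cong_sets[OF sets_pair_measure_cong[OF refl sets_lborel] refl] borel_prod) measurable
    from lborel.borel_measurable_lebesgue_integral[OF this]
    show ?thesis by (simp add: omega_def[abs_def])
  qed
  have trace: "AE x in (lborel :: pt measure). x \<in> SC \<longrightarrow> (AE v in lborel. G (fst x) (wall (snd x)) v = Gh (fst x, snd x, v))"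
  proof -
    have "AE u in lborel. (fst u, fst (snd u), snd (snd u)) \<in> SB \<longrightarrow> G (fst u) (wall (fst (snd u))) (snd (snd u)) = Gh (fst u, fst (snd u), snd (snd u))"
      using GGh unfolding AE_lebesgue_on[OF SB] by simp
    from AE_wall_velocity[OF this] show ?thesis
      by eventually_elim (auto simp: SB_def SC_def)
  qed
  have S: "{v :: real^3. 0 < - v $ 3} = {v. v $ 3 < 0}" by simp
  have hs: "{v :: real^3. v $ 3 < 0} \<in> sets borel" by measurable
  have flux: "AE x in (lborel :: pt measure). x \<in> SC \<longrightarrow> outflux G (fst x) (wall (snd x)) = omega x
      \<and> integrable (lebesgue_on {v. v $ 3 < 0}) (\<lambda>v. G (fst x) (wall (snd x)) v * (- (v $ 3)))"
  proof -
    have "AE x in lebesgue_on SC. integrable (lebesgue_on {v. v $ 3 < 0}) (\<lambda>v. G (fst x) (wall (snd x)) v * (- (v $ 3)))"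
      using G unfolding L1_solution_def SC_def normal_inner S by (simp add: case_prod_beta')
    then have "AE x in lborel. x \<in> SC \<longrightarrow> integrable (lebesgue_on {v. v $ 3 < 0}) (\<lambda>v. G (fst x) (wall (snd x)) v * (- (v $ 3)))"
      unfolding AE_lebesgue_on[OF SC] .
    then show ?thesis using trace
    proof eventually_elim
      fix x :: pt
      assume i: "x \<in> SC \<longrightarrow> integrable (lebesgue_on {v. v $ 3 < 0}) (\<lambda>v. G (fst x) (wall (snd x)) v * (- (v $ 3)))"
        and ae: "x \<in> SC \<longrightarrow> (AE v in lborel. G (fst x) (wall (snd x)) v = Gh (fst x, snd x, v))"
      show "x \<in> SC \<longrightarrow> outflux G (fst x) (wall (snd x)) = omega x \<and> integrable (lebesgue_on {v. v $ 3 < 0}) (\<lambda>v. G (fst x) (wall (snd x)) v * (- (v $ 3)))"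
      proof
        assume x: "x \<in> SC"
        have m: "(\<lambda>v. Gh (fst x, snd x, v) * (- (v $ 3))) \<in> borel_measurable borel" by measurable
        note m' = borel_lebesgue_on[OF m, of "{v. v $ 3 < 0}"]
        have i: "integrable (lebesgue_on {v. v $ 3 < 0}) (\<lambda>v. G (fst x) (wall (snd x)) v * (- (v $ 3)))" using i x by blast
        have e: "AE v in lebesgue_on {v. v $ 3 < 0}. G (fst x) (wall (snd x)) v * (- (v $ 3)) = Gh (fst x, snd x, v) * (- (v $ 3))"
          unfolding AE_lebesgue_on[OF hs] using mp[OF ae x] by eventually_elim simp
have "outflux G (fst x) (wall (snd x)) = (\<integral>v. Gh (fst x, snd x, v) * (- (v $ 3)) \<partial>lebesgue_on {v. v $ 3 < 0})"
          unfolding outflux_def normal_inner S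
          by (rule integral_cong_AE[OF borel_measurable_integrable[OF i] m' e])
        moreover have "\<dots> = omega x"
        proof -
          have "(\<integral>v. Gh (fst x, snd x, v) * (- (v $ 3)) \<partial>lebesgue_on {v. v $ 3 < 0}) = (\<integral>v. indicator {v. v $ 3 < 0} v *\<^sub>R (Gh (fst x, snd x, v) * (- (v $ 3))) \<partial>lebesgue)"
            by (rule integral_restrict_space) (use hs in simp)
          also have "\<dots> = (\<integral>v. indicator {v. v $ 3 < 0} v *\<^sub>R (Gh (fst x, snd x, v) * (- (v $ 3))) \<partial>lborel)"
            by (rule integral_completion) measurable
          finally show ?thesis by (simp add: omega_def mult.commute)
        qed
        ultimately show "outflux G (fst x) (wall (snd x)) = omega x \<and> integrable (lebesgue_on {v. v $ 3 < 0}) (\<lambda>v. G (fst x) (wall (snd x)) v * (- (v $ 3)))" using i by simp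
      qed
    qed
  qed
  \<comment> \<open>Time zero is put into the exceptional set as well: an orbit that leaves the wall
    at that instant is covered neither by the boundary condition nor by the initial one.\<close>
  have incoming: "AE u in lborel. fst u \<noteq> 0 \<and> (u \<in> SB \<longrightarrow> 0 < snd (snd u) $ 3 \<longrightarrow>
      G (fst u) (wall (fst (snd u))) (snd (snd u)) = wall_maxwellian (wall (fst (snd u))) (snd (snd u)) * omega (fst u, fst (snd u)))"
  proof -
    have "AE u in lebesgue_on SB. 0 < snd (snd u) $ 3 \<longrightarrow>
      G (fst u) (wall (fst (snd u))) (snd (snd u)) = wall_maxwellian (wall (fst (snd u))) (snd (snd u)) * outflux G (fst u) (wall (fst (snd u)))"
      using G unfolding L1_solution_def SB_def by (simp add: case_prod_beta' gamma_minus_wall)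
    then have "AE u in lborel. u \<in> SB \<longrightarrow> 0 < snd (snd u) $ 3 \<longrightarrow>
      G (fst u) (wall (fst (snd u))) (snd (snd u)) = wall_maxwellian (wall (fst (snd u))) (snd (snd u)) * outflux G (fst u) (wall (fst (snd u)))"
      unfolding AE_lebesgue_on[OF SB] .
    moreover note AE_wall_lift[OF flux]
    moreover have "AE u in (lborel :: (real \<times> (real^2) \<times> (real^3)) measure). fst u \<noteq> 0"
    proof -
      have "AE x in (lborel :: pt measure). fst x \<noteq> 0"
      proof -
        have "(\<integral>\<^sup>+x. indicator {0} (fst x) \<partial>(lborel :: pt measure)) = (\<integral>\<^sup>+r. (\<integral>\<^sup>+y. indicator {0} r \<partial>(lborel :: (real^2) measure)) \<partial>(lborel :: real measure))"
          by (subst nn_integral_lborel_pair) simp_all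
        also have "\<dots> = (\<integral>\<^sup>+r. indicator {0} r * \<infinity> \<partial>(lborel :: real measure))" by simp
        also have "\<dots> = 0" by (subst nn_integral_multc) simp_all
        finally have "AE x in (lborel :: pt measure). (indicator {0} (fst x) :: ennreal) = 0"
          by (subst (asm) nn_integral_0_iff_AE) auto
        then show ?thesis by eventually_elim (auto simp: indicator_def split: if_splits)
      qed
      from AE_wall_lift[OF this] show ?thesis by simp
    qed
    ultimately show ?thesis by eventually_elim (auto simp: SB_def SC_def)
  qed
  obtain N0 where N0 [measurable]: "N0 \<in> sets borel"
    and N0c: "\<And>u. u \<notin> N0 \<Longrightarrow> fst u \<noteq> 0 \<and> (u \<in> SB \<longrightarrow> 0 < snd (snd u) $ 3 \<longrightarrow>
      G (fst u) (wall (fst (snd u))) (snd (snd u)) = wall_maxwellian (wall (fst (snd u))) (snd (snd u)) * omega (fst u, fst (snd u)))"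
    and N0z: "(\<integral>\<^sup>+u. indicator N0 u \<partial>lborel) = 0"
    by (rule AE_null_cover[OF incoming]) (rule that)
  have "AE z in phase_measure. G 0 (fst z) (snd z) = F0 (fst z) (snd z)"
    using G unfolding L1_solution_def by (elim conjE)
  then have "AE z in phase_measure. G 0 (fst z) (snd z) = g z" using F0 by eventually_elim simp
  then have start: "AE z in lborel. z \<in> Omega_cell \<times> UNIV \<longrightarrow> G 0 (fst z) (snd z) = g z"
    unfolding AE_phase_measure .
  obtain N2 where N2 [measurable]: "N2 \<in> sets borel"
    and N2c: "\<And>z. z \<notin> N2 \<Longrightarrow> z \<in> Omega_cell \<times> UNIV \<longrightarrow> G 0 (fst z) (snd z) = g z"
    and N2z: "(\<integral>\<^sup>+z. indicator N2 z \<partial>lborel) = 0"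
    by (rule AE_null_cover[OF start]) (rule that)
  note [measurable] = D(11)
  \<comment> \<open>The flux of G on one cell is extended periodically in space and by zero to
    nonpositive times, as the renewal lemmas require.\<close>
  define om where "om x = (if 0 < fst x then omega (fst x, wrap2 (snd x)) else 0)" for x :: pt
  define Dd where "Dd x = \<bar>om x - wsol g x\<bar>" for x
  \<comment> \<open>Periodic indicators of the two exceptional sets: bad emission events and bad
    initial points.\<close>
  define e0 :: "real \<times> (real^2) \<times> (real^3) \<Rightarrow> real" where "e0 u = indicator N0 (fst u, wrap2 (fst (snd u)), snd (snd u))" for u
  define e2 :: "(real^3) \<times> (real^3) \<Rightarrow> real" where "e2 z = indicator N2 (wrap3 (fst z), snd z)" for z
  have [measurable]: "om \<in> borel_measurable borel" unfolding om_def[abs_def] by measurable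
  have Dm [measurable]: "Dd \<in> borel_measurable borel" unfolding Dd_def[abs_def] by measurable
  have e0 [measurable]: "e0 \<in> borel_measurable borel" unfolding e0_def[abs_def] by measurable
  have e2 [measurable]: "e2 \<in> borel_measurable borel" unfolding e2_def[abs_def] by measurable
  have e0p: "periodic2 (\<lambda>y. e0 (t, y, v))" for t v by (simp add: periodic2_def e0_def wrap2_periodic)
  have e2p: "per3 e2" by (simp add: per3_def e2_def wrap3_periodic)
  have Dp: "periodic2 (\<lambda>y. Dd (t, y))" for t
    using D(12)[of t] by (simp add: periodic2_def Dd_def om_def wrap2_periodic)
  have D0: "Dd x = 0" if "fst x \<le> 0" for x using that D(9) by (simp add: Dd_def om_def)
  have Dpm: "pm (\<lambda>x. ennreal (Dd x))" using Dp by (simp add: pm_def periodic2_def)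
  have e0n: "(\<integral>\<^sup>+u. \<infinity> * ennreal (e0 u) * indicator torus_cell (fst (snd u)) \<partial>lborel) = 0"
  proof -
    have "(\<integral>\<^sup>+u. \<infinity> * ennreal (e0 u) * indicator torus_cell (fst (snd u)) \<partial>lborel) \<le> (\<integral>\<^sup>+u. \<infinity> * indicator N0 u \<partial>lborel)"
      by (rule nn_integral_mono) (auto simp: e0_def wrap2_id indicator_def)
    also have "\<dots> = 0" using N0z by (subst nn_integral_cmult) simp_all
    finally show ?thesis by simp
  qed
  have e2n: "I (src e2) = 0"
  proof (rule src_null[OF e2 e2p])
    have "(\<integral>\<^sup>+z. ennreal (e2 z) \<partial>phase_measure) \<le> (\<integral>\<^sup>+z. indicator N2 z \<partial>lborel)"
      unfolding nn_integral_phase_measure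
      by (rule nn_integral_mono) (auto simp: e2_def wrap3_id indicator_def)
    then show "(\<integral>\<^sup>+z. ennreal (e2 z) \<partial>phase_measure) = 0" using N2z by simp
  qed
  have along: "\<bar>G t (fst (state s y p v)) (snd (state s y p v)) - sol g t (fst (state s y p v)) (snd (state s y p v))\<bar> = evol (\<lambda>_. 0) Dd t (state s y p v)"
    if t: "0 < t" and v: "0 < v" and s: "0 \<le> s" "s \<le> flight v" and good: "emit e0 t (state s y p v) \<le> 0" "evol e2 (\<lambda>_. 0) t (state s y p v) \<le> 0" for t s y p v
  proof -
    have v0: "0 \<le> v" using v by simp
    have n0: "(t - s, wrap2 y, vec3 (p, v)) \<notin> N0" if "s \<le> t"
      using good(1) that unfolding emit_state[OF v0 s] by (auto simp: e0_def)
    have ne: "s \<noteq> t" using n0 N0c[of "(t - s, wrap2 y, vec3 (p, v))"] by auto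
    have n2: "(wrap3 (fst (state (s - t) y p v)), snd (state (s - t) y p v)) \<notin> N2" if "t < s"
      using good(2) that unfolding evol_state[OF v0 s] by (auto simp: e2_def)
    have "\<bar>G t (fst (state s y p v)) (snd (state s y p v)) - sol g t (fst (state s y p v)) (snd (state s y p v))\<bar>
       = evol (\<lambda>_. 0) (\<lambda>x. \<bar>om x - wsol g x\<bar>) t (state s y p v)"
    proof (rule difference_along_state[OF d G t v s ne])
      assume st: "s < t"
      then have "(t - s, wrap2 y, vec3 (p, v)) \<in> SB" using wrap2_cell by (simp add: SB_def)
      then show "G (t - s) (wall (wrap2 y)) (vec3 (p, v)) = maxw (p, v) * om (t - s, y)"
        using N0c[OF n0] st v by (simp add: om_def wall_maxwellian_eq)
    next
      assume st: "t < s"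
      then have "0 < height (s - t) v" using t v s by (intro height_pos) auto
      then have "wrap3 (fst (state (s - t) y p v)) \<in> Omega_cell" by (intro wrap3_cell) (simp add: state_def)
      then show "G 0 (wrap3 (fst (state (s - t) y p v))) (snd (state (s - t) y p v)) = g (wrap3 (fst (state (s - t) y p v)), snd (state (s - t) y p v))"
        using N2c[of "(wrap3 (fst (state (s - t) y p v)), snd (state (s - t) y p v))"] n2[OF st] by auto
    qed
    then show ?thesis by (simp add: Dd_def[abs_def])
  qed
  have inside: "AE z in phase_measure. \<bar>G t (fst z) (snd z) - sol g t (fst z) (snd z)\<bar> = evol (\<lambda>_. 0) Dd t z" if t: "0 < t" for t
    using emit_null_phase[OF e0 e0p e0n, of t] evol_null[OF e2 e2p e2n less_imp_le[OF t]] AE_phase_measure_Omega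
  proof eventually_elim
    fix z assume g1: "emit e0 t z \<le> 0" and g2: "evol e2 (\<lambda>_. 0) t z \<le> 0" and "fst z \<in> Omega_cell"
    then have z: "0 < fst z $ 3" by (intro Omega_cellD)
    define v where "v = speed (fst z $ 3) (snd z $ 3)"
    define s where "s = age (fst z $ 3) (snd z $ 3)"
    have st: "state s (foot z) (hor (snd z)) v = z" unfolding s_def v_def by (rule state_of) (use z in simp)
    have s: "0 < s" "s < flight v" using age_bounds_strict[OF z] by (auto simp: s_def v_def)
    have "0 \<le> v" unfolding v_def by (rule speed_nonneg) (use z in simp)
    moreover have "v \<noteq> 0" using s by auto
    ultimately have "0 < v" by simp
    from along[OF t this, of s "foot z" "hor (snd z)", unfolded st] s g1 g2
    show "\<bar>G t (fst z) (snd z) - sol g t (fst z) (snd z)\<bar> = evol (\<lambda>_. 0) Dd t z" by simp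
  qed
  have src0: "AE x in wallm. src e2 x = 0"
    using e2n pm_measurable[OF pm_src[OF e2 e2p]] unfolding I_def by (subst (asm) nn_integral_0_iff_AE) auto
  have at_wall: "AE x in wallm. 0 < fst x \<longrightarrow> (AE w in lebesgue_on {v. v $ 3 < 0}.
      \<bar>G (fst x) (wall (snd x)) w - sol g (fst x) (wall (snd x)) w\<bar> = evol (\<lambda>_. 0) Dd (fst x) (wall (snd x), w))"
    using emit_null_wall[OF e0 e0p e0n] src0
  proof eventually_elim
    fix x :: pt
    assume g1: "(\<integral>\<^sup>+p. (\<integral>\<^sup>+v. ennreal (emit e0 (fst x) (vec3 (snd x, 0), vec3 (p, - v))) * ennreal v * indicator {0<..} v \<partial>lborel) \<partial>lborel) = 0"
      and g2: "src e2 x = 0"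
    show "0 < fst x \<longrightarrow> (AE w in lebesgue_on {v. v $ 3 < 0}.
      \<bar>G (fst x) (wall (snd x)) w - sol g (fst x) (wall (snd x)) w\<bar> = evol (\<lambda>_. 0) Dd (fst x) (wall (snd x), w))"
    proof
      assume t: "0 < fst x"
      \<comment> \<open>With zero wall flux the outgoing flux of the bad initial points is their
        first hitting flux, which vanishes here.\<close>
      have "(\<integral>\<^sup>+p. (\<integral>\<^sup>+v. ennreal (evol e2 (\<lambda>_. 0) (fst x) (vec3 (snd x, 0), vec3 (p, - v))) * ennreal v * indicator {0<..} v \<partial>lborel) \<partial>lborel) = 0"
        using wall_outflux[OF e2 _ _ t, of "\<lambda>_. 0" "snd x"] g2 by (simp add: K_def)
      then have "AE w in lebesgue_on {v. v $ 3 < 0}. evol e2 (\<lambda>_. 0) (fst x) (wall (snd x), w) \<le> 0"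
        unfolding wall_eq by (intro outgoing_null) simp_all
      moreover have "AE w in lebesgue_on {v. v $ 3 < 0}. emit e0 (fst x) (wall (snd x), w) \<le> 0"
        using g1 unfolding wall_eq by (intro outgoing_null) simp_all
      moreover have "AE w in lebesgue_on {v :: real^3. v $ 3 < 0}. w $ 3 < 0"
        unfolding AE_lebesgue_on[OF hs] by simp
      ultimately show "AE w in lebesgue_on {v. v $ 3 < 0}.
        \<bar>G (fst x) (wall (snd x)) w - sol g (fst x) (wall (snd x)) w\<bar> = evol (\<lambda>_. 0) Dd (fst x) (wall (snd x), w)"
      proof eventually_elim
        fix w :: "real^3" assume g: "evol e2 (\<lambda>_. 0) (fst x) (wall (snd x), w) \<le> 0" "emit e0 (fst x) (wall (snd x), w) \<le> 0" and w: "w $ 3 < 0"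
        have e: "state (flight (- w $ 3)) (snd x - flight (- w $ 3) *\<^sub>R hor w) (hor w) (- w $ 3) = (wall (snd x), w)"
          using state_flight[of "- w $ 3" "snd x" "hor w"] by simp
        show "\<bar>G (fst x) (wall (snd x)) w - sol g (fst x) (wall (snd x)) w\<bar> = evol (\<lambda>_. 0) Dd (fst x) (wall (snd x), w)"
          using along[OF t, of "- w $ 3" "flight (- w $ 3)" "snd x - flight (- w $ 3) *\<^sub>R hor w" "hor w", unfolded e] w g
          by (simp add: flight_nonneg)
      qed
    qed
  qed
  \<comment> \<open>The two outgoing fluxes differ by the integral of the difference of the traces.
    The triangle inequality bounds it by the outgoing flux of the transported discrepancy, which is
    \<open>K\<close> of that discrepancy because the datum part cancels.\<close>
  have balance: "AE x in wallm. ennreal (Dd x) \<le> K (\<lambda>x. ennreal (Dd x)) x"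
  proof -
    have "AE x in wallm. snd x \<in> torus_cell \<and> (0 < fst x \<longrightarrow> outflux G (fst x) (wall (snd x)) = omega x
      \<and> integrable (lebesgue_on {v. v $ 3 < 0}) (\<lambda>v. G (fst x) (wall (snd x)) v * (- (v $ 3))))"
      by (rule AE_wallm) (use flux in eventually_elim, auto simp: SC_def)
    then show ?thesis using at_wall
    proof eventually_elim
      fix x :: pt
      assume f: "snd x \<in> torus_cell \<and> (0 < fst x \<longrightarrow> outflux G (fst x) (wall (snd x)) = omega x
      \<and> integrable (lebesgue_on {v. v $ 3 < 0}) (\<lambda>v. G (fst x) (wall (snd x)) v * (- (v $ 3))))"
        and w: "0 < fst x \<longrightarrow> (AE w in lebesgue_on {v. v $ 3 < 0}.
      \<bar>G (fst x) (wall (snd x)) w - sol g (fst x) (wall (snd x)) w\<bar> = evol (\<lambda>_. 0) Dd (fst x) (wall (snd x), w))"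
      show "ennreal (Dd x) \<le> K (\<lambda>x. ennreal (Dd x)) x"
      proof (cases "0 < fst x")
        case t: True
        let ?M = "lebesgue_on {v :: real^3. v $ 3 < 0}"
        let ?g = "\<lambda>v. G (fst x) (wall (snd x)) v * (- (v $ 3))" and ?s = "\<lambda>v. sol g (fst x) (wall (snd x)) v * (- (v $ 3))"
        have ig: "integrable ?M ?g" using f t by blast
        have isol: "integrable ?M ?s" using sol_outflux(1)[OF d t, of "snd x"] unfolding normal_inner S .
        have og: "(\<integral>v. ?g v \<partial>?M) = omega x" using f t unfolding outflux_def normal_inner S by simp
        have os: "(\<integral>v. ?s v \<partial>?M) = wsol g x" using sol_outflux(2)[OF d t, of "snd x"] unfolding outflux_def normal_inner S by simp
        have "om x = omega x" using f t by (simp add: om_def wrap2_id)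
        then have "ennreal (Dd x) = ennreal (norm (\<integral>v. ?g v - ?s v \<partial>?M))"
          unfolding Bochner_Integration.integral_diff[OF ig isol] og os by (simp add: Dd_def)
        also have "\<dots> \<le> (\<integral>\<^sup>+v. ennreal (norm (?g v - ?s v)) \<partial>?M)"
          by (rule integral_norm_bound_ennreal) (intro Bochner_Integration.integrable_diff ig isol)
        also have "\<dots> = (\<integral>\<^sup>+v. ennreal (evol (\<lambda>_. 0) Dd (fst x) (wall (snd x), v) * (- (v $ 3))) \<partial>?M)"
        proof (rule nn_integral_cong_AE)
          have "AE v in ?M. v $ 3 < 0" unfolding AE_lebesgue_on[OF hs] by simp
          with mp[OF w t] show "AE v in ?M. ennreal (norm (?g v - ?s v)) = ennreal (evol (\<lambda>_. 0) Dd (fst x) (wall (snd x), v) * (- (v $ 3)))"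
          proof eventually_elim
            fix v :: "real^3" assume e: "\<bar>G (fst x) (wall (snd x)) v - sol g (fst x) (wall (snd x)) v\<bar> = evol (\<lambda>_. 0) Dd (fst x) (wall (snd x), v)" and v: "v $ 3 < 0"
            have "norm (?g v - ?s v) = \<bar>G (fst x) (wall (snd x)) v - sol g (fst x) (wall (snd x)) v\<bar> * \<bar>- (v $ 3)\<bar>"
              unfolding real_norm_def abs_mult[symmetric] left_diff_distrib ..
            then show "ennreal (norm (?g v - ?s v)) = ennreal (evol (\<lambda>_. 0) Dd (fst x) (wall (snd x), v) * (- (v $ 3)))"
              using e v by simp
          qed
        qed
        also have "\<dots> = (\<integral>\<^sup>+p. (\<integral>\<^sup>+v. ennreal (evol (\<lambda>_. 0) Dd (fst x) (wall (snd x), vec3 (p, - v))) * ennreal v * indicator {0<..} v \<partial>lborel) \<partial>lborel)"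
        proof -
          have "(\<lambda>v. evol (\<lambda>_. 0) Dd (fst x) (wall (snd x), v)) \<in> borel_measurable borel" by measurable
          from nn_integral_outgoing[OF this, of "wall (snd x)"] show ?thesis unfolding normal_inner S .
        qed
        also have "\<dots> = K (\<lambda>x. ennreal (Dd x)) (fst x, snd x) + src (\<lambda>_. 0) (fst x, snd x)"
          unfolding wall_eq by (rule wall_outflux) (use Dm D0 t in auto)
        finally show ?thesis by (simp add: src_zero)
      qed (simp add: D0)
    qed
  qed
  have mass: "(\<integral>\<^sup>+z. ennreal \<bar>G t (fst z) (snd z) - sol g t (fst z) (snd z)\<bar> \<partial>phase_measure) = I (aft t (K (upto t (\<lambda>x. ennreal (Dd x)))))" if t: "0 < t" for t
  proof -
    have "(\<integral>\<^sup>+z. ennreal \<bar>G t (fst z) (snd z) - sol g t (fst z) (snd z)\<bar> \<partial>phase_measure) = (\<integral>\<^sup>+z. ennreal (evol (\<lambda>_. 0) Dd t z) \<partial>phase_measure)"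
      by (rule nn_integral_cong_AE) (use inside[OF t] in eventually_elim, simp)
    also have "\<dots> = I (aft t (src (\<lambda>_. 0))) + I (aft t (K (upto t (\<lambda>x. ennreal (Dd x)))))"
      unfolding nn_integral_phase_measure by (rule nn_integral_evol) (use Dm Dp D0 t in \<open>auto simp: per3_def\<close>)
    also have "I (aft t (src (\<lambda>_. 0))) = 0" by (simp add: src_zero aft_def I_def)
    finally show ?thesis by simp
  qed
  \<comment> \<open>The boundary condition gives no a priori bound on the flux of G. Integrability
    of G at time r does: each emission in (0, r] is in flight at r with probability at least c = P(T
    > r) > 0, and the mass in flight of the discrepancy is an L1 distance at time r.\<close>
  have fin: "I (upto t (\<lambda>x. ennreal (Dd x))) < \<infinity>" for t
  proof -
    define r where "r = max t 1"
    have r: "0 < r" "t \<le> r" by (auto simp: r_def)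
    let ?q = "upto r (\<lambda>x. ennreal (Dd x))"
    define c where "c = (\<integral>\<^sup>+n. indicator {r<..} (fst n) \<partial>jump)"
    have c: "0 < c" using escape_pos[of r 0] by (simp add: c_def)
    have "(\<integral>\<^sup>+z. ennreal \<bar>G r (fst z) (snd z) - sol g r (fst z) (snd z)\<bar> \<partial>phase_measure) < \<infinity>"
    proof -
      have "integrable phase_measure (\<lambda>z. G r (fst z) (snd z))" using G r unfolding L1_solution_def by simp
      from Bochner_Integration.integrable_diff[OF this sol_integrable[OF d, of r]] r
      have "integrable phase_measure (\<lambda>z. G r (fst z) (snd z) - sol g r (fst z) (snd z))" by simp
      then show ?thesis unfolding integrable_iff_bounded by simp
    qed
    then have f: "I (aft r (K ?q)) < \<infinity>" unfolding mass[OF r(1)] .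
    have "c * I ?q = I (\<lambda>x. c * ?q x)" by (rule I_cmult[symmetric]) (simp add: Dpm)
    also have "\<dots> \<le> (\<integral>\<^sup>+x. ?q x * (\<integral>\<^sup>+n. indicator {r<..} (fst x + fst n) \<partial>jump) \<partial>wallm)"
      unfolding I_def
    proof (rule nn_integral_mono)
      fix x
      show "c * ?q x \<le> ?q x * (\<integral>\<^sup>+n. indicator {r<..} (fst x + fst n) \<partial>jump)"
      proof (cases "0 < fst x")
        case True
        then have "c \<le> (\<integral>\<^sup>+n. indicator {r<..} (fst x + fst n) \<partial>jump)"
          unfolding c_def by (intro nn_integral_mono) (auto simp: indicator_def)
        then show ?thesis by (simp add: mult.commute[of c] mult_left_mono)
      qed (simp add: upto_def D0)
    qed
    also have "\<dots> = (\<integral>\<^sup>+x. indicator {r<..} (fst x) * K ?q x \<partial>wallm)"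
      by (rule K_weight[symmetric]) (simp_all add: Dpm)
    also have "\<dots> = I (aft r (K ?q))"
      unfolding I_def by (rule nn_integral_cong) (simp add: aft_def indicator_def)
    finally have "c * I ?q < \<infinity>" using f by (rule le_less_trans)
    then have "I ?q < \<infinity>" using c by (auto simp: ennreal_mult_less_top)
    moreover have "I (upto t (\<lambda>x. ennreal (Dd x))) \<le> I ?q"
      using r by (intro I_mono) (simp add: upto_def)
    ultimately show ?thesis by (rule le_less_trans[rotated])
  qed
  have zero: "AE x in wallm. ennreal (Dd x) = 0"
    by (rule homogeneous_zero[OF Dpm balance _ fin]) (simp add: D0)
  show ?thesis
  proof (cases "t = 0")
    case True
    have "AE z in phase_measure. G 0 (fst z) (snd z) = g z"
      using start unfolding AE_phase_measure .
    then show ?thesis using AE_phase_measure_Omega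
      unfolding True by eventually_elim (auto simp: sol_0 less_imp_le[OF Omega_cellD])
  next
    case False
    then have t: "0 < t" using t0 by simp
    have "I (aft t (K (upto t (\<lambda>x. ennreal (Dd x))))) \<le> I (K (upto t (\<lambda>x. ennreal (Dd x))))"
      by (rule I_mono) (simp add: aft_def)
    also have "\<dots> = I (upto t (\<lambda>x. ennreal (Dd x)))" by (rule I_K) (simp add: Dpm)
    also have "\<dots> \<le> I (\<lambda>x. ennreal (Dd x))" by (rule I_mono) (simp add: upto_def)
    also have "\<dots> = 0" unfolding I_def
      using zero by (subst nn_integral_0_iff_AE) simp_all
    finally have "(\<integral>\<^sup>+z. ennreal \<bar>G t (fst z) (snd z) - sol g t (fst z) (snd z)\<bar> \<partial>phase_measure) = 0"
      using mass[OF t] by simp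
    moreover have "(\<lambda>z. G t (fst z) (snd z)) \<in> borel_measurable phase_measure"
      using G t unfolding L1_solution_def by (simp add: borel_measurable_integrable)
    moreover have "(\<lambda>z. sol g t (fst z) (snd z)) \<in> borel_measurable phase_measure"
      using sol_integrable[OF d t0] by (rule borel_measurable_integrable)
    ultimately have "AE z in phase_measure. ennreal \<bar>G t (fst z) (snd z) - sol g t (fst z) (snd z)\<bar> = 0"
      by (subst (asm) nn_integral_0_iff_AE) auto
    then show ?thesis by eventually_elim simp
  qed
qed

end

section \<open>Decay\<close>

context log_problem
begin

section \<open>Equilibrium and perturbation\<close>

lemma src_add:
  assumes [measurable]: "g \<in> borel_measurable borel" "h \<in> borel_measurable borel" and nonneg: "\<And>z. 0 \<le> g z" "\<And>z. 0 \<le> h z"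
  shows "src (\<lambda>z. g z + h z) x = src g x + src h x"
proof (cases "0 < fst x")
  case True
  let ?S = "\<lambda>g p v. ennreal (g (state (flight v - fst x) (snd x - flight v *\<^sub>R p) p v)) * ennreal v * indicator {0<..} v * indicator {fst x..} (flight v)"
  have m1: "(\<lambda>v. ?S f p v) \<in> borel_measurable lborel" if [measurable]: "f \<in> borel_measurable borel" for f p
    by measurable
  have m2: "(\<lambda>p. \<integral>\<^sup>+v. ?S f p v \<partial>lborel) \<in> borel_measurable lborel" if [measurable]: "f \<in> borel_measurable borel" for f
  proof -
    have "(\<lambda>z. ?S f (fst z) (snd z)) \<in> borel_measurable borel" by measurable
    from nn_integral_lborel_borel[OF this] show ?thesis by simp
  qed
  have "src (\<lambda>z. g z + h z) x = (\<integral>\<^sup>+p. (\<integral>\<^sup>+v. ?S g p v + ?S h p v \<partial>lborel) \<partial>lborel)"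
    using True by (simp add: src_def ennreal_plus[OF nonneg] distrib_right del: ennreal_plus)
  also have "\<dots> = (\<integral>\<^sup>+p. (\<integral>\<^sup>+v. ?S g p v \<partial>lborel) + (\<integral>\<^sup>+v. ?S h p v \<partial>lborel) \<partial>lborel)"
    by (intro nn_integral_cong nn_integral_add m1) measurable
  also have "\<dots> = (\<integral>\<^sup>+p. (\<integral>\<^sup>+v. ?S g p v \<partial>lborel) \<partial>lborel) + (\<integral>\<^sup>+p. (\<integral>\<^sup>+v. ?S h p v \<partial>lborel) \<partial>lborel)"
    by (intro nn_integral_add m2) measurable
  finally show ?thesis using True by (simp add: src_def)
qed (simp add: src_def)

text \<open>The constant c after time zero solves the renewal equation, by
  \<open>tail_after\<close>, and dominates the least solution. Its mass up to any time is finite, so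
  \<open>solution_le\<close> forces equality almost everywhere.\<close>

lemma stationary_flux:
  assumes c: "0 \<le> c"
  shows "AE x in wallm. U (\<lambda>x. ennreal c * tail 0 x) x = ennreal c * indicator {0<..} (fst x)"
proof -
  let ?q = "\<lambda>x. ennreal c * tail 0 x" and ?a = "\<lambda>x. ennreal c * indicator {0<..} (fst x) :: ennreal"
  have pq: "pm ?q" by simp
  have pa: "pm ?a" by (rule pm_cmult[OF pm_time]) measurable
  have bound: "U ?q x \<le> ?a x" for x by (rule U_dominated) simp
  have "AE x in wallm. ?a x \<le> U ?q x"
  proof (rule solution_le[OF pa _ pq])
    show "pm (U ?q)" using pq by simp
    show "AE x in wallm. ?a x \<le> ?q x + K ?a x"
    proof (rule AE_I2)
      fix x
      show "?a x \<le> ?q x + K ?a x"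
      proof (cases "0 < fst x")
        case True
        have "K ?a x = ennreal c * K (\<lambda>x. indicator {0<..} (fst x)) x" by (rule K_cmult, rule pm_time) measurable
        then have "?q x + K ?a x = ennreal c * (tail 0 x + K (\<lambda>x. indicator {0<..} (fst x)) x)" by (simp add: distrib_left)
        also have "\<dots> = ennreal c" by (simp add: tail_after[OF True])
        finally show ?thesis using True by simp
      qed simp
    qed
    show "AE x in wallm. ?q x + K (U ?q) x \<le> U ?q x" using U_eq[OF pq] by simp
    show "I (upto t ?a) < \<infinity>" for t
    proof -
      have "upto t ?a = (\<lambda>x. ennreal c * strip 0 t x)" by (auto simp: fun_eq_iff upto_def strip_def indicator_def)
      then show ?thesis by (simp add: I_cmult I_strip ennreal_mult_less_top)
    qed
    show "U ?q x < \<infinity>" for x using bound[of x] by (rule le_less_trans) (simp add: ennreal_mult_less_top indicator_def)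
  qed simp
  then show ?thesis by eventually_elim (use bound in \<open>auto intro: antisym\<close>)
qed

text \<open>The equilibrium is itself transported, with flux c and datum c \<open>Mx\<close>. At
  each point only one branch of \<open>evol\<close> is active, so the absolute value of the
  difference passes to flux and datum.\<close>

lemma stationary_evol:
  assumes x: "0 < fst z $ 3" and t: "0 \<le> t"
  shows "\<bar>evol h w t z - c * Mx z\<bar> = evol (\<lambda>z. \<bar>h z - c * Mx z\<bar>) (\<lambda>x. \<bar>w x - c\<bar>) t z"
proof -
  define v where "v = speed (fst z $ 3) (snd z $ 3)"
  define s where "s = age (fst z $ 3) (snd z $ 3)"
  have st: "state s (foot z) (hor (snd z)) v = z" unfolding s_def v_def by (rule state_of) (use x in simp)
  have s: "0 \<le> s" "s \<le> flight v" using age_bounds_strict[OF x, of "snd z $ 3"] by (simp_all add: s_def v_def)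
  have v: "0 \<le> v" unfolding v_def by (rule speed_nonneg) (use x in simp)
  have Mz: "Mx z = maxw (hor (snd z), v)" by (simp add: Mx_def v_def)
  have "Mx (state (s - t) (foot z) (hor (snd z)) v) = maxw (hor (snd z), v)" if "t \<le> s"
    using that s v t by (intro Mx_state) auto
  moreover have "\<bar>m * w x - c * m\<bar> = m * \<bar>w x - c\<bar>" if "0 < m" for m x
  proof -
    have "m * w x - c * m = m * (w x - c)" by (simp add: algebra_simps)
    then show ?thesis using that by (simp add: abs_mult)
  qed
  ultimately show ?thesis using maxw_pos
    unfolding evol_def Let_def s_def[symmetric] v_def[symmetric] Mz by auto
qed

lemma I_aft_K_cong_AE:
  assumes "pm p" "pm q" and eq: "AE x in wallm. p x = q x"
  shows "I (aft t (K p)) = I (aft t (K q))"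
proof -
  show ?thesis unfolding I_aft_K[OF assms(1)] I_aft_K[OF assms(2)]
    by (rule nn_integral_cong_AE) (use eq in eventually_elim, simp)
qed

lemma datum_integrable:
  assumes "datum \<kappa> g"
  shows "integrable phase_measure g" "(\<integral>z. g z \<partial>phase_measure) = enn2real (I (src g))"
proof -
  note D = datumD[OF assms]
  have m: "g \<in> borel_measurable phase_measure" by (rule borel_phase_measure[OF D(2)])
  show "integrable phase_measure g"
    by (rule integrableI_nonneg[OF m]) (use D(4) I_src_finite[OF assms] in \<open>simp_all add: src_mass[OF assms]\<close>)
  show "(\<integral>z. g z \<partial>phase_measure) = enn2real (I (src g))"
    by (subst integral_eq_nn_integral[OF m]) (use D(4) in \<open>simp_all add: src_mass[OF assms]\<close>)
qed

lemma datum_Mx: "0 \<le> c \<Longrightarrow> datum c (\<lambda>z. c * Mx z)"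
  unfolding datum_def
proof (intro conjI allI)
  have "axis 1 (1::real) $ (3::3) = 0" "axis 2 (1::real) $ (3::3) = 0" by (simp_all add: axis_def)
  then show "per3 (\<lambda>z. c * Mx z)" by (simp add: per3_def Mx_def)
  show "0 \<le> c \<Longrightarrow> 0 \<le> c * Mx z" for z using Mx_pos[of z] by simp
qed (simp_all, measurable)

definition perturbation :: "real \<Rightarrow> real \<Rightarrow> ((real^3) \<times> (real^3) \<Rightarrow> real) \<Rightarrow> bool" where
  "perturbation \<kappa> c f \<longleftrightarrow> 0 \<le> \<kappa> \<and> 0 \<le> c \<and> f \<in> borel_measurable borel \<and> per3 f \<and>
     (\<forall>z. \<bar>f z\<bar> \<le> \<kappa> * Mx z) \<and> (\<forall>z. - c * Mx z \<le> f z) \<and> (\<integral>z. f z \<partial>phase_measure) = 0"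

lemma perturbationD:
  assumes "perturbation \<kappa> c f"
  shows "datum \<kappa> (\<lambda>z. max 0 (f z))" "datum \<kappa> (\<lambda>z. max 0 (- f z))" "datum (c + \<kappa>) (\<lambda>z. c * Mx z + f z)"
    "I (src (\<lambda>z. max 0 (f z))) = I (src (\<lambda>z. max 0 (- f z)))"
proof -
  have p: "0 \<le> \<kappa>" "0 \<le> c" "f \<in> borel_measurable borel" "per3 f" "\<And>z. \<bar>f z\<bar> \<le> \<kappa> * Mx z" "\<And>z. - c * Mx z \<le> f z" "(\<integral>z. f z \<partial>phase_measure) = 0"
    using assms by (auto simp: perturbation_def)
  note [measurable] = p(3)
  have per: "f (x + axis 1 1, v) = f (x, v)" "f (x + axis 2 1, v) = f (x, v)" for x v
    using p(4) by (auto simp: per3_def)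
  have M0: "0 \<le> \<kappa> * Mx z" for z using p(1) Mx_pos[of z] by simp
  have fb: "f z \<le> \<kappa> * Mx z" "- f z \<le> \<kappa> * Mx z" for z using p(5)[of z] by auto
  show 1: "datum \<kappa> (\<lambda>z. max 0 (f z))"
    unfolding datum_def using p(1) M0 fb by (auto simp: per3_def per)
  show 2: "datum \<kappa> (\<lambda>z. max 0 (- f z))"
    unfolding datum_def using p(1) M0 fb by (auto simp: per3_def per)
  have perM: "per3 Mx" using datumD(3)[OF datum_Mx[of 1]] by simp
  show "datum (c + \<kappa>) (\<lambda>z. c * Mx z + f z)"
    unfolding datum_def
  proof (intro conjI allI)
    show "0 \<le> c + \<kappa>" using p by simp
    show "per3 (\<lambda>z. c * Mx z + f z)" using perM by (simp add: per3_def per)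
    show "0 \<le> c * Mx z + f z" for z using p(6)[of z] by simp
    show "c * Mx z + f z \<le> (c + \<kappa>) * Mx z" for z using fb[of z] by (simp add: distrib_right)
  qed measurable
  have "(\<integral>z. f z \<partial>phase_measure) = (\<integral>z. max 0 (f z) - max 0 (- f z) \<partial>phase_measure)"
    by (rule Bochner_Integration.integral_cong) auto
  also have "\<dots> = enn2real (I (src (\<lambda>z. max 0 (f z)))) - enn2real (I (src (\<lambda>z. max 0 (- f z))))"
    using datum_integrable[OF 1] datum_integrable[OF 2] by simp
  finally have "enn2real (I (src (\<lambda>z. max 0 (f z)))) = enn2real (I (src (\<lambda>z. max 0 (- f z))))" using p(7) by simp
  note e = this
  have a: "I (src (\<lambda>z. max 0 (f z))) = ennreal (enn2real (I (src (\<lambda>z. max 0 (f z)))))"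
    and b: "I (src (\<lambda>z. max 0 (- f z))) = ennreal (enn2real (I (src (\<lambda>z. max 0 (- f z)))))"
    using I_src_finite[OF 1] I_src_finite[OF 2] by (simp_all add: less_top)
  show "I (src (\<lambda>z. max 0 (f z))) = I (src (\<lambda>z. max 0 (- f z)))"
    by (rule trans[OF a]) (simp only: e b[symmetric])
qed

text \<open>The identity c \<open>Mx\<close> + f + f^- = c \<open>Mx\<close> + f^+ holds between
  nonnegative functions, where \<open>src\<close> and \<open>U\<close> are additive. The equilibrium
  flux is the constant c, and subtraction takes place only among finite real fluxes.\<close>

lemma flux_difference:
  assumes p: "perturbation \<kappa> c f"
  shows "AE x in wallm. 0 < fst x \<longrightarrow> wsol (\<lambda>z. c * Mx z + f z) x - c = wsol (\<lambda>z. max 0 (f z)) x - wsol (\<lambda>z. max 0 (- f z)) x"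
proof -
  note d = perturbationD[OF p]
  let ?h = "\<lambda>z. c * Mx z + f z" and ?fp = "\<lambda>z. max 0 (f z)" and ?fm = "\<lambda>z. max 0 (- f z)"
  have c: "0 \<le> c" using p by (simp add: perturbation_def)
  note dh = datumD[OF d(3)] and dp = datumD[OF d(1)] and dm = datumD[OF d(2)] and dM = datumD[OF datum_Mx[OF c]]
  have src: "(\<lambda>x. src ?h x + src ?fm x) = (\<lambda>x. ennreal c * tail 0 x + src ?fp x)"
  proof
    fix x
    have "src ?h x + src ?fm x = src (\<lambda>z. ?h z + ?fm z) x" by (rule src_add[symmetric, OF dh(2) dm(2) dh(4) dm(4)])
    also have "(\<lambda>z. ?h z + ?fm z) = (\<lambda>z. c * Mx z + ?fp z)" by (auto simp: fun_eq_iff max_def)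
    also have "src \<dots> x = src (\<lambda>z. c * Mx z) x + src ?fp x" by (rule src_add[OF dM(2) dp(2) dM(4) dp(4)])
    finally show "src ?h x + src ?fm x = ennreal c * tail 0 x + src ?fp x" by (simp add: src_Mx[OF c])
  qed
  have U: "U (src ?h) x + U (src ?fm) x = U (\<lambda>x. ennreal c * tail 0 x) x + U (src ?fp) x" for x
    unfolding U_add[OF dh(6) dm(6), symmetric] src by (rule U_add) (simp_all add: dp(6))
  show ?thesis using stationary_flux[OF c]
  proof eventually_elim
    fix x assume e: "U (\<lambda>x. ennreal c * tail 0 x) x = ennreal c * indicator {0<..} (fst x)"
    show "0 < fst x \<longrightarrow> wsol ?h x - c = wsol ?fp x - wsol ?fm x"
    proof
      assume "0 < fst x"
      then have "ennreal (wsol ?h x) + ennreal (wsol ?fm x) = ennreal c + ennreal (wsol ?fp x)"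
        using U[of x] unfolding e dh(10) dp(10) dm(10) by simp
      then have "ennreal (wsol ?h x + wsol ?fm x) = ennreal (c + wsol ?fp x)"
        using dh(13) dm(13) dp(13) c by (simp add: ennreal_plus)
      then have "wsol ?h x + wsol ?fm x = c + wsol ?fp x"
        using dh(13)[of x] dm(13)[of x] dp(13)[of x] c by (subst (asm) ennreal_inj) auto
      then show "wsol ?h x - c = wsol ?fp x - wsol ?fm x" by simp
    qed
  qed
qed

text \<open>The distance to the equilibrium splits into initial particles that have not reached the
  wall, at most \<kappa> \<open>tau t\<close>, and the flux discrepancy, to which
  \<open>difference_decay\<close> applies with the positive and the negative part of f. The
  equilibrium cancels, so C does not depend on c.\<close>

lemma perturbation_mass_decay:
  assumes m: "0 < m" "m + 5 \<le> b - 1"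
  shows "\<exists>C>0. \<forall>\<kappa> c f t. perturbation \<kappa> c f \<longrightarrow> 0 \<le> t \<longrightarrow>
    (\<integral>\<^sup>+z. ennreal \<bar>sol (\<lambda>z. c * Mx z + f z) t (fst z) (snd z) - c * Mx z\<bar> \<partial>phase_measure) \<le> ennreal (C * \<kappa> * (exp 1 + t) powr (- m))"
proof -
  from difference_decay obtain \<theta> l where \<theta>: "0 < \<theta>" "\<theta> \<le> 1" "0 < l" and dd: "\<forall>\<kappa> q1 q2 R n t. 0 \<le> \<kappa> \<longrightarrow> 0 \<le> R \<longrightarrow> pm q1 \<longrightarrow> pm q2 \<longrightarrow>
     (\<forall>x. q1 x \<le> ennreal \<kappa> * tail 0 x) \<longrightarrow> (\<forall>x. q2 x \<le> ennreal \<kappa> * tail 0 x) \<longrightarrow> I q1 = I q2 \<longrightarrow> real n * (R + l) \<le> t \<longrightarrow>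
     I (aft t (K (upto t (\<lambda>x. ennreal \<bar>enn2real (U q1 x) - enn2real (U q2 x)\<bar>))))
       \<le> ennreal \<kappa> * tau (t - real n * (R + l)) + ennreal (2 * \<kappa> * ((1 - \<theta>) ^ n * enn2real (tau 0) + enn2real (tau R)))"
    by (elim exE conjE) (rule that)
  obtain C where C: "0 < C" and rate: "\<And>t. 0 \<le> t \<Longrightarrow> \<exists>n R. 0 \<le> R \<and> real n * (R + l) \<le> t \<and>
     enn2real (tau t) + enn2real (tau (t - real n * (R + l))) + 2 * ((1 - \<theta>) ^ n * enn2real (tau 0) + enn2real (tau R))
       \<le> C * (exp 1 + t) powr (- m)"
    using decay_rate[OF \<theta> m] by blast
  have "(\<integral>\<^sup>+z. ennreal \<bar>sol (\<lambda>z. c * Mx z + f z) t (fst z) (snd z) - c * Mx z\<bar> \<partial>phase_measure) \<le> ennreal (C * \<kappa> * (exp 1 + t) powr (- m))"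
    if p: "perturbation \<kappa> c f" and t: "0 \<le> t" for \<kappa> c f t
  proof -
    note d = perturbationD[OF p]
    let ?h = "\<lambda>z. c * Mx z + f z" and ?fp = "\<lambda>z. max 0 (f z)" and ?fm = "\<lambda>z. max 0 (- f z)"
    have k: "0 \<le> \<kappa>" and c: "0 \<le> c" and [measurable]: "f \<in> borel_measurable borel" and per: "per3 f" and fb: "\<And>z. \<bar>f z\<bar> \<le> \<kappa> * Mx z"
      using p by (auto simp: perturbation_def)
    note dh = datumD[OF d(3)] and dp = datumD[OF d(1)] and dm = datumD[OF d(2)]
    note [measurable] = dh(11) dp(11) dm(11)
    \<comment> \<open>Set to zero at nonpositive times, where the constructed flux vanishes but the
      constant c does not; \<open>evol\<close> does not look at these times.\<close>
    define D where "D x = (if 0 < fst x then \<bar>wsol ?h x - c\<bar> else 0)" for x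
    have Dm [measurable]: "D \<in> borel_measurable borel" unfolding D_def[abs_def] by measurable
    have Dp: "periodic2 (\<lambda>y. D (t, y))" for t using dh(12)[of t] by (simp add: periodic2_def D_def)
    have am: "(\<lambda>z. \<bar>f z\<bar>) \<in> borel_measurable borel" by measurable
    have aper: "per3 (\<lambda>z. \<bar>f z\<bar>)" using per by (simp add: per3_def)
    have "(\<integral>\<^sup>+z. ennreal \<bar>sol ?h t (fst z) (snd z) - c * Mx z\<bar> \<partial>phase_measure) = (\<integral>\<^sup>+z. ennreal (evol (\<lambda>z. \<bar>f z\<bar>) D t z) \<partial>phase_measure)"
    proof (rule nn_integral_cong_AE)
      show "AE z in phase_measure. ennreal \<bar>sol ?h t (fst z) (snd z) - c * Mx z\<bar> = ennreal (evol (\<lambda>z. \<bar>f z\<bar>) D t z)"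
        using AE_phase_measure_Omega
      proof eventually_elim
        fix z :: "(real^3) \<times> (real^3)" assume "fst z \<in> Omega_cell"
        from stationary_evol[OF Omega_cellD[OF this] t, of ?h "wsol ?h" c]
        have "\<bar>sol ?h t (fst z) (snd z) - c * Mx z\<bar> = evol (\<lambda>z. \<bar>f z\<bar>) (\<lambda>x. \<bar>wsol ?h x - c\<bar>) t z"
          by (simp add: sol_def)
        also have "\<dots> = evol (\<lambda>z. \<bar>f z\<bar>) D t z" by (simp add: evol_def D_def Let_def)
        finally show "ennreal \<bar>sol ?h t (fst z) (snd z) - c * Mx z\<bar> = ennreal (evol (\<lambda>z. \<bar>f z\<bar>) D t z)" by simp
      qed
    qed
    also have "\<dots> = I (aft t (src (\<lambda>z. \<bar>f z\<bar>))) + I (aft t (K (upto t (\<lambda>x. ennreal (D x)))))"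
      unfolding nn_integral_phase_measure by (rule nn_integral_evol[OF am aper Dm Dp _ t]) (simp add: D_def)
    also have "I (aft t (src (\<lambda>z. \<bar>f z\<bar>))) \<le> ennreal \<kappa> * tau t"
    proof -
      have "src (\<lambda>z. \<bar>f z\<bar>) x \<le> ennreal \<kappa> * tail 0 x" for x
        by (intro src_dominated k fb)
      then have "I (aft t (src (\<lambda>z. \<bar>f z\<bar>))) \<le> I (\<lambda>x. ennreal \<kappa> * aft t (tail 0) x)"
        by (intro I_mono) (simp add: aft_def)
      also have "\<dots> = ennreal \<kappa> * tau t" using I_aft_tail[OF t, of 0] by (simp add: I_cmult)
      finally show ?thesis .
    qed
    also have "I (aft t (K (upto t (\<lambda>x. ennreal (D x))))) = I (aft t (K (upto t (\<lambda>x. ennreal \<bar>wsol ?fp x - wsol ?fm x\<bar>))))"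
    proof (rule I_aft_K_cong_AE)
      show "pm (upto t (\<lambda>x. ennreal (D x)))" using Dp by (intro pm_upto) (simp add: pm_def periodic2_def)
      show "pm (upto t (\<lambda>x. ennreal \<bar>wsol ?fp x - wsol ?fm x\<bar>))" using dp(12) dm(12) by (intro pm_upto) (simp add: pm_def periodic2_def)
      show "AE x in wallm. upto t (\<lambda>x. ennreal (D x)) x = upto t (\<lambda>x. ennreal \<bar>wsol ?fp x - wsol ?fm x\<bar>) x"
        using flux_difference[OF p]
      proof eventually_elim
        fix x assume "0 < fst x \<longrightarrow> wsol ?h x - c = wsol ?fp x - wsol ?fm x"
        then have "D x = \<bar>wsol ?fp x - wsol ?fm x\<bar>" using dp(9)[of x] dm(9)[of x] by (simp add: D_def)
        then show "upto t (\<lambda>x. ennreal (D x)) x = upto t (\<lambda>x. ennreal \<bar>wsol ?fp x - wsol ?fm x\<bar>) x" by (simp add: upto_def)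
      qed
    qed
    finally have le: "(\<integral>\<^sup>+z. ennreal \<bar>sol ?h t (fst z) (snd z) - c * Mx z\<bar> \<partial>phase_measure)
      \<le> ennreal \<kappa> * tau t + I (aft t (K (upto t (\<lambda>x. ennreal \<bar>wsol ?fp x - wsol ?fm x\<bar>))))" by (simp add: add_right_mono)
    obtain n R where R: "0 \<le> R" "real n * (R + l) \<le> t" and
      r: "enn2real (tau t) + enn2real (tau (t - real n * (R + l))) + 2 * ((1 - \<theta>) ^ n * enn2real (tau 0) + enn2real (tau R)) \<le> C * (exp 1 + t) powr (- m)"
      using rate[OF t] by blast
    define s where "s = t - real n * (R + l)"
    have s: "0 \<le> s" using R by (simp add: s_def)
    have tf: "tau r = ennreal (enn2real (tau r))" if "0 \<le> r" for r using tau_finite'[OF that] by (simp add: less_top)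
    have "I (aft t (K (upto t (\<lambda>x. ennreal \<bar>wsol ?fp x - wsol ?fm x\<bar>))))
      \<le> ennreal \<kappa> * tau s + ennreal (2 * \<kappa> * ((1 - \<theta>) ^ n * enn2real (tau 0) + enn2real (tau R)))"
      unfolding s_def wsol_def by (rule dd[rule_format, OF k R(1) dp(6) dm(6) _ _ d(4) R(2)]) (rule dp(7) dm(7))+
    then have "(\<integral>\<^sup>+z. ennreal \<bar>sol ?h t (fst z) (snd z) - c * Mx z\<bar> \<partial>phase_measure)
      \<le> ennreal \<kappa> * tau t + (ennreal \<kappa> * tau s + ennreal (2 * \<kappa> * ((1 - \<theta>) ^ n * enn2real (tau 0) + enn2real (tau R))))"
      by (intro order_trans[OF le] add_left_mono)
    also have "\<dots> = ennreal (\<kappa> * (enn2real (tau t) + enn2real (tau s) + 2 * ((1 - \<theta>) ^ n * enn2real (tau 0) + enn2real (tau R))))"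
    proof -
      have nn: "0 \<le> (1 - \<theta>) ^ n * enn2real (tau 0) + enn2real (tau R)" using \<theta> by simp
      have "ennreal \<kappa> * tau t = ennreal (\<kappa> * enn2real (tau t))" "ennreal \<kappa> * tau s = ennreal (\<kappa> * enn2real (tau s))"
        using tf[OF t] tf[OF s] k by (metis ennreal_mult enn2real_nonneg)+
      moreover have "ennreal (\<kappa> * x) + (ennreal (\<kappa> * y) + ennreal (2 * \<kappa> * z)) = ennreal (\<kappa> * (x + y + 2 * z))"
        if "0 \<le> x" "0 \<le> y" "0 \<le> z" for x y z
      proof -
        have "\<kappa> * (x + y + 2 * z) = \<kappa> * x + (\<kappa> * y + 2 * \<kappa> * z)" by (simp add: algebra_simps)
        then show ?thesis using that k by (simp only: ennreal_plus mult_nonneg_nonneg add_nonneg_nonneg zero_le_numeral)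
      qed
      ultimately show ?thesis using nn by simp
    qed
    also have "\<dots> \<le> ennreal (C * \<kappa> * (exp 1 + t) powr (- m))"
    proof (rule ennreal_leI)
      have "\<kappa> * (enn2real (tau t) + enn2real (tau s) + 2 * ((1 - \<theta>) ^ n * enn2real (tau 0) + enn2real (tau R))) \<le> \<kappa> * (C * (exp 1 + t) powr (- m))"
        using r k unfolding s_def by (intro mult_left_mono)
      then show "\<kappa> * (enn2real (tau t) + enn2real (tau s) + 2 * ((1 - \<theta>) ^ n * enn2real (tau 0) + enn2real (tau R))) \<le> C * \<kappa> * (exp 1 + t) powr (- m)"
        by (simp add: mult.assoc mult.left_commute)
    qed
    finally show ?thesis .
  qed
  then show ?thesis using C by blast
qed

lemma stationary_Mx: "fst z \<in> Omega_cell \<Longrightarrow> stationary a c (fst z) (snd z) = c * Mx z"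
  using stationary_eq[of "fst z" c "snd z"] Omega_cellD[of "fst z"] by (simp add: Mx_def)

lemma perturbation_solution:
  assumes p: "perturbation \<kappa> c f" and F0: "AE z in phase_measure. F0 (fst z) (snd z) = c * Mx z + f z"
  shows "admissible_solution a c F0 (sol (\<lambda>z. c * Mx z + f z))"
    "\<And>G t. admissible_solution a c F0 G \<Longrightarrow> 0 \<le> t \<Longrightarrow>
       AE z in phase_measure. G t (fst z) (snd z) = sol (\<lambda>z. c * Mx z + f z) t (fst z) (snd z)"
    "\<And>t. 0 \<le> t \<Longrightarrow> ennreal (L1_norm (\<lambda>x v. sol (\<lambda>z. c * Mx z + f z) t x v - stationary a c x v))
       = (\<integral>\<^sup>+z. ennreal \<bar>sol (\<lambda>z. c * Mx z + f z) t (fst z) (snd z) - c * Mx z\<bar> \<partial>phase_measure)"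
proof -
  let ?h = "\<lambda>z. c * Mx z + f z"
  note d = perturbationD(3)[OF p]
  have c: "0 \<le> c" and f0: "(\<integral>z. f z \<partial>phase_measure) = 0" and f: "f \<in> borel_measurable borel"
    using p by (auto simp: perturbation_def)
  have st: "AE z in phase_measure. stationary a c (fst z) (snd z) = c * Mx z"
    using AE_phase_measure_Omega by eventually_elim (rule stationary_Mx)
  have iM: "integrable phase_measure (\<lambda>z. c * Mx z)" by (rule datum_integrable(1)[OF datum_Mx[OF c]])
  have ih: "integrable phase_measure ?h" by (rule datum_integrable(1)[OF d])
  have "integrable phase_measure (\<lambda>z. ?h z - c * Mx z)" by (rule Bochner_Integration.integrable_diff[OF ih iM])
  then have if1: "integrable phase_measure f" by simp
  have "(\<lambda>z. stationary a c (fst z) (snd z)) \<in> borel_measurable phase_measure"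
    unfolding stationary_def Phi_eq by (rule borel_phase_measure) measurable
  note sm = this
  have ist: "integrable phase_measure (\<lambda>z. stationary a c (fst z) (snd z))"
    by (rule integrable_cong_AE_imp[OF iM sm]) (use st in eventually_elim, simp)
  have stI: "(\<integral>z. stationary a c (fst z) (snd z) \<partial>phase_measure) = (\<integral>z. c * Mx z \<partial>phase_measure)"
    by (rule integral_cong_AE[OF sm borel_measurable_integrable[OF iM] st])
  have solI: "(\<integral>z. sol ?h t (fst z) (snd z) \<partial>phase_measure) = enn2real (I (src ?h))" if "0 \<le> t" for t
    by (subst integral_eq_nn_integral[OF borel_measurable_integrable[OF sol_integrable[OF d that]]])
       (simp_all add: sol_nonneg[OF d] sol_mass[OF d that])
  have L1: "L1_solution a F0 (sol ?h)" using d F0 by (rule L1_solution_sol)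
  show "admissible_solution a c F0 (sol ?h)"
    unfolding admissible_solution_def
  proof (intro conjI allI impI)
    show "L1_solution a F0 (sol ?h)" by (rule L1)
    show "AE z in phase_measure. 0 \<le> sol ?h t (fst z) (snd z)" for t by (simp add: sol_nonneg[OF d])
    fix t :: real assume t: "0 \<le> t"
    have "phase_integral (\<lambda>x v. sol ?h t x v - stationary a c x v) = (\<integral>z. ?h z \<partial>phase_measure) - (\<integral>z. c * Mx z \<partial>phase_measure)"
      unfolding phase_integral_def
      by (simp add: Bochner_Integration.integral_diff[OF sol_integrable[OF d t] ist] stI solI[OF t] datum_integrable(2)[OF d])
    also have "\<dots> = 0" using f0 by (simp add: Bochner_Integration.integral_add[OF iM if1])
    finally show "phase_integral (\<lambda>x v. sol ?h t x v - stationary a c x v) = 0" .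
  qed
  show "AE z in phase_measure. G t (fst z) (snd z) = sol ?h t (fst z) (snd z)" if "admissible_solution a c F0 G" "0 \<le> t" for G t
    using that by (intro L1_solution_unique[OF d F0]) (simp_all add: admissible_solution_def)
  fix t :: real assume t: "0 \<le> t"
  have i: "integrable phase_measure (\<lambda>z. sol ?h t (fst z) (snd z) - stationary a c (fst z) (snd z))"
    by (rule Bochner_Integration.integrable_diff[OF sol_integrable[OF d t] ist])
  have "ennreal (L1_norm (\<lambda>x v. sol ?h t x v - stationary a c x v))
    = (\<integral>\<^sup>+z. ennreal \<bar>sol ?h t (fst z) (snd z) - stationary a c (fst z) (snd z)\<bar> \<partial>phase_measure)"
    unfolding L1_norm_def phase_integral_def by (rule nn_integral_eq_integral[symmetric]) (use i in simp_all)
  also have "\<dots> = (\<integral>\<^sup>+z. ennreal \<bar>sol ?h t (fst z) (snd z) - c * Mx z\<bar> \<partial>phase_measure)"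
    by (rule nn_integral_cong_AE) (use st in eventually_elim, simp)
  finally show "ennreal (L1_norm (\<lambda>x v. sol ?h t x v - stationary a c x v)) = \<dots>" .
qed

text \<open>The datum is only known almost everywhere on one cell. Clamping between the Maxwellian
  bounds enforces them at every point and \<open>wrap3\<close> enforces periodicity; neither changes
  the datum beyond a null set. The factor 2 pi undoes the normalisation of
  \<open>Mx\<close>.\<close>

lemma perturbation_representative:
  assumes c: "0 < c" and m: "0 < phase_integral (stationary a c)"
    and fm: "(\<lambda>z. f\<^sub>0 (fst z) (snd z)) \<in> borel_measurable phase_measure"
    and pos: "AE z in phase_measure. stationary a c (fst z) (snd z) + f\<^sub>0 (fst z) (snd z) \<ge> 0"
    and mass: "phase_integral f\<^sub>0 = 0"
    and L: "Linf_norm (\<lambda>x v. exp ((norm v)\<^sup>2 / 2 + Phi a x) * f\<^sub>0 x v) < \<infinity>"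
  obtains k f where "Linf_norm (\<lambda>x v. exp ((norm v)\<^sup>2 / 2 + Phi a x) * f\<^sub>0 x v) = ereal k" "perturbation (2 * pi * k) c f"
    "AE z in phase_measure. f\<^sub>0 (fst z) (snd z) = f z"
proof -
  let ?L = "Linf_norm (\<lambda>x v. exp ((norm v)\<^sup>2 / 2 + Phi a x) * f\<^sub>0 x v)"
  let ?w = "\<lambda>z. \<bar>exp ((norm (snd z))\<^sup>2 / 2 + Phi a (fst z)) * f\<^sub>0 (fst z) (snd z)\<bar>"
  have Lb: "AE z in phase_measure. ereal (?w z) \<le> ?L"
    unfolding Linf_norm_def by (rule esssup_AE)
  \<comment> \<open>An essential supremum of a nonnegative function is negative only for the zero
    measure. The positive mass of the stationary state excludes this case.\<close>
  have L0: "0 \<le> ?L"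
  proof (rule ccontr)
    assume "\<not> 0 \<le> ?L"
    have "AE z in phase_measure. stationary a c (fst z) (snd z) = 0"
      using Lb
    proof eventually_elim
      fix z assume "ereal (?w z) \<le> ?L"
      moreover have "0 \<le> ereal (?w z)" by simp
      ultimately have "0 \<le> ?L" by (rule order_trans[rotated])
      with \<open>\<not> 0 \<le> ?L\<close> show "stationary a c (fst z) (snd z) = 0" by simp
    qed
    then have "phase_integral (stationary a c) = 0"
      unfolding phase_integral_def by (rule integral_eq_zero_AE)
    then show False using m by simp
  qed
  then obtain k where k: "?L = ereal k" "0 \<le> k" using L by (cases ?L) auto
  define \<kappa> where "\<kappa> = 2 * pi * k"
  have \<kappa>: "0 \<le> \<kappa>" using k by (simp add: \<kappa>_def)
  obtain fB where [measurable]: "fB \<in> borel_measurable borel" and fB: "AE z in phase_measure. f\<^sub>0 (fst z) (snd z) = fB z"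
    using lebesgue_on_borel_representative[OF Omega_cell_borel fm[unfolded phase_measure_def]] unfolding phase_measure_def by blast
  define f where "f z = max (- c * Mx z) (max (- \<kappa> * Mx z) (min (\<kappa> * Mx z) (fB (wrap3 (fst z), snd z))))" for z
  have fm': "f \<in> borel_measurable borel" unfolding f_def[abs_def] by measurable
  have eq: "AE z in phase_measure. f\<^sub>0 (fst z) (snd z) = f z"
    using Lb fB pos AE_phase_measure_Omega
  proof eventually_elim
    fix z assume b: "ereal (?w z) \<le> ?L" and e: "f\<^sub>0 (fst z) (snd z) = fB z" and ps: "0 \<le> stationary a c (fst z) (snd z) + f\<^sub>0 (fst z) (snd z)"
      and z: "fst z \<in> Omega_cell"
    have M: "Mx z = 1 / (2 * pi) * exp (- ((norm (snd z))\<^sup>2 / 2 + Phi a (fst z)))"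
      unfolding Mx_def by (rule maxw_energy) (use Omega_cellD[OF z] in simp)
    define E where "E = exp ((norm (snd z))\<^sup>2 / 2 + Phi a (fst z))"
    have E: "0 < E" by (simp add: E_def)
    have M': "\<kappa> * Mx z = k / E" unfolding M \<kappa>_def exp_minus E_def by (simp add: field_simps)
    have "E * \<bar>f\<^sub>0 (fst z) (snd z)\<bar> \<le> k" using b unfolding k(1) by (simp add: abs_mult E_def)
    then have "\<bar>f\<^sub>0 (fst z) (snd z)\<bar> \<le> \<kappa> * Mx z" unfolding M' using E by (simp add: field_simps)
    moreover have "- c * Mx z \<le> f\<^sub>0 (fst z) (snd z)" using ps stationary_Mx[OF z, of c] by simp
    moreover have "fB (wrap3 (fst z), snd z) = f\<^sub>0 (fst z) (snd z)" using e wrap3_id[OF z] by simp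
    ultimately show "f\<^sub>0 (fst z) (snd z) = f z" by (simp add: f_def)
  qed
  have "perturbation \<kappa> c f"
    unfolding perturbation_def
  proof (intro conjI allI)
    show "0 \<le> \<kappa>" "0 \<le> c" "f \<in> borel_measurable borel" using \<kappa> c fm' by auto
    have "per3 Mx" using datumD(3)[OF datum_Mx[of 1]] by simp
    then show "per3 f" by (simp add: per3_def f_def wrap3_periodic)
    show "- c * Mx z \<le> f z" for z by (simp add: f_def)
    show "\<bar>f z\<bar> \<le> \<kappa> * Mx z" for z
    proof -
      have "0 \<le> \<kappa> * Mx z" "0 \<le> c * Mx z" using \<kappa> c Mx_pos[of z] by auto
      then show ?thesis by (auto simp: f_def)
    qed
    have "(\<integral>z. f z \<partial>phase_measure) = phase_integral f\<^sub>0"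
      unfolding phase_integral_def
      by (rule integral_cong_AE[OF borel_phase_measure[OF fm'] fm]) (use eq in eventually_elim, simp)
    then show "(\<integral>z. f z \<partial>phase_measure) = 0" using mass by simp
  qed
  then show ?thesis using that k(1) eq unfolding \<kappa>_def by blast
qed

end

theorem theorem1:
  fixes a \<delta> :: real and \<A> :: int
  assumes "a > 1" and "\<A> = \<lfloor>1 / ln a\<rfloor>" and "\<A> \<ge> 8" and "0 < \<delta>" and "\<delta> < 1"
  shows "\<exists>C>0. \<forall>(m::real) c (f\<^sub>0 :: real^3 \<Rightarrow> real^3 \<Rightarrow> real).
    m > 0 \<longrightarrow> c > 0 \<longrightarrow> phase_integral (stationary a c) = m \<longrightarrow>
    torus_periodic f\<^sub>0 \<longrightarrow>
    (\<lambda>z. f\<^sub>0 (fst z) (snd z)) \<in> borel_measurable phase_measure \<longrightarrow>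
    (AE z in phase_measure. stationary a c (fst z) (snd z) + f\<^sub>0 (fst z) (snd z) \<ge> 0) \<longrightarrow>
    phase_integral f\<^sub>0 = 0 \<longrightarrow>
    Linf_norm (\<lambda>x v. exp ((norm v)\<^sup>2 / 2 + Phi a x) * f\<^sub>0 x v) < \<infinity> \<longrightarrow>
    (\<exists>F. admissible_solution a c (\<lambda>x v. stationary a c x v + f\<^sub>0 x v) F \<and>
         (\<forall>G. admissible_solution a c (\<lambda>x v. stationary a c x v + f\<^sub>0 x v) G \<longrightarrow>
              (\<forall>t\<ge>0. AE z in phase_measure. G t (fst z) (snd z) = F t (fst z) (snd z))) \<and>
         (\<forall>t\<ge>0. ereal (L1_norm (\<lambda>x v. F t x v - stationary a c x v))
            \<le> ereal (C * ln (japanese t) powr (\<A> - 6 - \<delta> / 2) * japanese t powr (- (\<A> - 6)))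
              * Linf_norm (\<lambda>x v. exp ((norm v)\<^sup>2 / 2 + Phi a x) * f\<^sub>0 x v)))"
proof -
  define m where "m = real_of_int \<A> - 6"
  have b: "real_of_int \<A> \<le> 1 / ln a" "8 \<le> real_of_int \<A>" using assms by auto
  have b': "0 < 1 / ln a" "1 < 1 / ln a" using b by linarith+
  interpret log_problem "1 / ln a" a by unfold_locales (rule b' assms(1) refl)+
  \<comment> \<open>Here \<A> \<ge> 8 gives m \<ge> 2, and m + 5 = \<A> - 1 \<le> 1 / ln a -
    1.\<close>
  have m: "0 < m" "m + 5 \<le> 1 / ln a - 1" using b by (auto simp: m_def)
  obtain C where C: "0 < C" and decay: "\<And>\<kappa> c f t. perturbation \<kappa> c f \<Longrightarrow> 0 \<le> t \<Longrightarrow>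
    (\<integral>\<^sup>+z. ennreal \<bar>sol (\<lambda>z. c * Mx z + f z) t (fst z) (snd z) - c * Mx z\<bar> \<partial>phase_measure) \<le> ennreal (C * \<kappa> * (exp 1 + t) powr (- m))"
    using perturbation_mass_decay[OF m] by blast
  show ?thesis
  proof (intro exI[of _ "2 * pi * C"] conjI allI impI)
    show "0 < 2 * pi * C" using C by simp
    fix M c :: real and f\<^sub>0 :: "real^3 \<Rightarrow> real^3 \<Rightarrow> real"
    let ?L = "Linf_norm (\<lambda>x v. exp ((norm v)\<^sup>2 / 2 + Phi a x) * f\<^sub>0 x v)"
    assume h: "0 < M" "0 < c" "phase_integral (stationary a c) = M" "torus_periodic f\<^sub>0"
      "(\<lambda>z. f\<^sub>0 (fst z) (snd z)) \<in> borel_measurable phase_measure"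
      "AE z in phase_measure. 0 \<le> stationary a c (fst z) (snd z) + f\<^sub>0 (fst z) (snd z)"
      "phase_integral f\<^sub>0 = 0" "?L < \<infinity>"
    have pM: "0 < phase_integral (stationary a c)" using h by simp
    obtain k f where k: "?L = ereal k" and p: "perturbation (2 * pi * k) c f" and f: "AE z in phase_measure. f\<^sub>0 (fst z) (snd z) = f z"
      by (rule perturbation_representative[OF h(2) pM h(5-8)])
    let ?F = "sol (\<lambda>z. c * Mx z + f z)"
    have "0 \<le> 2 * pi * k" using p unfolding perturbation_def by (elim conjE)
    then have k0: "0 \<le> k" using pi_gt_zero by (simp add: zero_le_mult_iff)
    have F0: "AE z in phase_measure. stationary a c (fst z) (snd z) + f\<^sub>0 (fst z) (snd z) = c * Mx z + f z"
      using f AE_phase_measure_Omega by eventually_elim (simp add: stationary_Mx)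
    note ps = perturbation_solution[OF p F0]
    have "ereal (L1_norm (\<lambda>x v. ?F t x v - stationary a c x v))
      \<le> ereal (2 * pi * C * ln (japanese t) powr (\<A> - 6 - \<delta> / 2) * japanese t powr (- (\<A> - 6))) * ?L" if t: "0 \<le> t" for t
    proof -
      let ?N = "L1_norm (\<lambda>x v. ?F t x v - stationary a c x v)"
      have j: "japanese t = exp 1 + t" by (simp add: japanese_def)
      have "ennreal ?N \<le> ennreal (C * (2 * pi * k) * (exp 1 + t) powr (- m))"
        unfolding ps(3)[OF t] by (rule decay[OF p t])
      then have "?N \<le> C * (2 * pi * k) * (exp 1 + t) powr (- m)"
        using C k0 by (subst (asm) ennreal_le_iff) auto
      also have "\<dots> = 2 * pi * C * 1 * japanese t powr (- m) * k" by (simp add: j)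
      \<comment> \<open>The logarithmic factor is at least 1: its base is at least ln e = 1, and its
        exponent is nonnegative since \<A> \<ge> 8 and \<delta> < 1.\<close>
      also have "\<dots> \<le> 2 * pi * C * ln (japanese t) powr (\<A> - 6 - \<delta> / 2) * japanese t powr (- m) * k"
      proof (intro mult_right_mono mult_left_mono)
        have "ln (exp 1) \<le> ln (japanese t)" using t by (intro ln_mono) (auto simp: j)
        then have "1 \<le> ln (japanese t)" by simp
        moreover have "0 \<le> \<A> - 6 - \<delta> / 2"
          unfolding of_int_diff of_int_numeral using b(2) assms(5) by linarith
        ultimately show "1 \<le> ln (japanese t) powr (\<A> - 6 - \<delta> / 2)" by (rule ge_one_powr_ge_zero)
      qed (use C k0 in auto)
      finally show ?thesis by (simp add: k m_def)
    qed
    then show "\<exists>F. admissible_solution a c (\<lambda>x v. stationary a c x v + f\<^sub>0 x v) F \<and>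
         (\<forall>G. admissible_solution a c (\<lambda>x v. stationary a c x v + f\<^sub>0 x v) G \<longrightarrow>
              (\<forall>t\<ge>0. AE z in phase_measure. G t (fst z) (snd z) = F t (fst z) (snd z))) \<and>
         (\<forall>t\<ge>0. ereal (L1_norm (\<lambda>x v. F t x v - stationary a c x v))
            \<le> ereal (2 * pi * C * ln (japanese t) powr (\<A> - 6 - \<delta> / 2) * japanese t powr (- (\<A> - 6))) * ?L)"
      using ps(1,2) by (intro exI[of _ ?F] conjI allI impI) auto
  qed
qed

end
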